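(* Let $n,m$ be positive integers, let $f\in \mathscr{S}_n$ be an $n$-symbol and $g\in\mathscr{S}_m$ be an $m$-symbol. The noncommutative domain algebras $\mathscr{A}_f$ and $\mathscr{A}_g$ are completely isometrically isomorphic if and only if $n=m$ and $f$ and $g$ are scale-permutation equivalent, i.e. there exist a permutation $\sigma$ of $\{1,\ldots,n\}$ and real scalars $\lambda_1,\ldots,\lambda_n$ such that $f(X_1,\ldots,X_n)=g(\lambda_1X_{\sigma(1)},\ldots,\lambda_nX_{\sigma(n)})$.
   Context: Let $\mathds{F}_+^n$ be the free semigroup on $\{1,\ldots,n\}$ with neutral element $\emptyset$, and $|\alpha|$ the word length of $\alpha\in\mathds{F}_+^n$. Let $\mathscr{P}_n=\mathds{C}[X_1,\ldots,X_n]$ be the algebra of polynomials in $n$ noncommuting indeterminates, whose elements are $\sum_{\alpha}a_\alpha X_\alpha$ with $(a_\alpha)$ finitely supported, where $X_\alpha=X_{i_1}\cdots X_{i_k}$ for $\alpha=i_1\cdots i_k$ and $X_\emptyset=1$. The set of $n$-symbols is $\mathscr{S}_n=\{f=\sum_\alpha a_\alpha X_\alpha\in\mathscr{P}_n : a_\emptyset=0,\ a_\alpha\ge 0 \text{ for all }\alpha,\ a_\alpha>0 \text{ whenever } |\alpha|=1\}$. Let $\mathscr{F}(\mathds{C}^n)=\bigoplus_{k\ge0}(\mathds{C}^n)^{\otimes k}$ be the full Fock space with orthonormal basis $(e_\alpha)_{\alpha\in\mathds{F}_+^n}$, where $e_\alpha=e_{i_1}\otimes\cdots\otimes e_{i_k}$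 for the canonical basis $e_1,\dots,e_n$ of $\mathds{C}^n$ and $e_\emptyset=1\in\mathds{C}$. For $f=\sum_\alpha a_\alpha X_\alpha\in\mathscr{S}_n$ define $b_\emptyset=1$ and, for $\alpha\neq\emptyset$, $b_\alpha=\sum_{k=1}^{|\alpha|}\sum_{\gamma_1\cdots\gamma_k=\alpha,\ |\gamma_i|\ge1}a_{\gamma_1}\cdots a_{\gamma_k}$, and define weighted shifts $W_j^f$ ($j=1,\ldots,n$) on $\mathscr{F}(\mathds{C}^n)$ by $W_j^f e_\alpha=\sqrt{b_\alpha/b_{j\alpha}}\, e_j\otimes e_\alpha$. The noncommutative domain algebra $\mathscr{A}_f$ is the norm-closed (non-selfadjoint) algebra generated by $W_1^f,\ldots,W_n^f$ on $\mathscr{F}(\mathds{C}^n)$, viewed as an operator algebra. *)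

theory Defs
  imports "HOL-Analysis.Analysis"
begin

text \<open>Letters of the alphabet are 0,...,n-1; words of the free semigroup are nat lists
  over that alphabet; the empty list is the neutral element.\<close>

type_synonym vec = "nat list \<Rightarrow> complex"
type_synonym op = "vec \<Rightarrow> vec"

text \<open>n-symbols: coefficient function on words (coefficients are nonnegative, hence real).\<close>
definition symbol :: "nat \<Rightarrow> (nat list \<Rightarrow> real) \<Rightarrow> bool" where
  "symbol n a \<longleftrightarrow> finite {\<alpha>. a \<alpha> \<noteq> 0}
     \<and> (\<forall>\<alpha>. a \<alpha> \<noteq> 0 \<longrightarrow> set \<alpha> \<subseteq> {..<n})
     \<and> a [] = 0 \<and> (\<forall>\<alpha>. a \<alpha> \<ge> 0) \<and> (\<forall>i<n. a [i] > 0)"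

text \<open>b_alpha = sum over decompositions alpha = gamma_1 ... gamma_k into nonempty words.
  For alpha = [] the only decomposition is the empty one, giving 1.\<close>
definition bcoef :: "(nat list \<Rightarrow> real) \<Rightarrow> nat list \<Rightarrow> real" where
  "bcoef a \<alpha> = (\<Sum>\<gamma>s \<in> {\<gamma>s. concat \<gamma>s = \<alpha> \<and> (\<forall>\<gamma>\<in>set \<gamma>s. \<gamma> \<noteq> [])}. prod_list (map a \<gamma>s))"

definition Fock :: "nat \<Rightarrow> vec set" where
  "Fock n = {x. (\<forall>\<alpha>. x \<alpha> \<noteq> 0 \<longrightarrow> set \<alpha> \<subseteq> {..<n}) \<and> (\<lambda>\<alpha>. (cmod (x \<alpha>))\<^sup>2) summable_on UNIV}"

definition fnorm :: "vec \<Rightarrow> real" where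
  "fnorm x = sqrt (infsum (\<lambda>\<alpha>. (cmod (x \<alpha>))\<^sup>2) UNIV)"

text \<open>Operators on Fock n are represented by functions that vanish outside Fock n.\<close>
definition bounded_op :: "nat \<Rightarrow> op \<Rightarrow> bool" where
  "bounded_op n T \<longleftrightarrow> (\<forall>x\<in>Fock n. T x \<in> Fock n)
     \<and> (\<forall>x\<in>Fock n. \<forall>y\<in>Fock n. T (\<lambda>\<beta>. x \<beta> + y \<beta>) = (\<lambda>\<beta>. T x \<beta> + T y \<beta>))
     \<and> (\<forall>c. \<forall>x\<in>Fock n. T (\<lambda>\<beta>. c * x \<beta>) = (\<lambda>\<beta>. c * T x \<beta>))
     \<and> (\<exists>K. \<forall>x\<in>Fock n. fnorm (T x) \<le> K * fnorm x)
     \<and> (\<forall>x. x \<notin> Fock n \<longrightarrow> T x = (\<lambda>_. 0))"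

definition opnorm :: "nat \<Rightarrow> op \<Rightarrow> real" where
  "opnorm n T = Sup {fnorm (T x) | x. x \<in> Fock n \<and> fnorm x \<le> 1}"

definition idop :: "nat \<Rightarrow> op" where
  "idop n x = (if x \<in> Fock n then x else (\<lambda>_. 0))"

text \<open>Weighted shift W_j^f: W_j e_alpha = sqrt(b_alpha / b_{j alpha}) e_{j alpha}.\<close>
definition wshift :: "nat \<Rightarrow> (nat list \<Rightarrow> real) \<Rightarrow> nat \<Rightarrow> op" where
  "wshift n a j x = (if x \<in> Fock n then
      (\<lambda>\<beta>. case \<beta> of [] \<Rightarrow> 0
                | i # \<alpha> \<Rightarrow> (if i = j then complex_of_real (sqrt (bcoef a \<alpha> / bcoef a \<beta>)) * x \<alpha> else 0))
    else (\<lambda>_. 0))"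

definition wword :: "nat \<Rightarrow> (nat list \<Rightarrow> real) \<Rightarrow> nat list \<Rightarrow> op" where
  "wword n a \<alpha> = foldr (\<lambda>i T. wshift n a i \<circ> T) \<alpha> (idop n)"

definition polyops :: "nat \<Rightarrow> (nat list \<Rightarrow> real) \<Rightarrow> op set" where
  "polyops n a = {T. \<exists>F c. finite F \<and> (\<forall>\<alpha>\<in>F. set \<alpha> \<subseteq> {..<n})
       \<and> (\<forall>x. T x = (\<lambda>\<beta>. \<Sum>\<alpha>\<in>F. c \<alpha> * wword n a \<alpha> x \<beta>))}"

definition domalg :: "nat \<Rightarrow> (nat list \<Rightarrow> real) \<Rightarrow> op set" where
  "domalg n a = {T. bounded_op n T \<and>
      (\<forall>\<epsilon>>0. \<exists>P\<in>polyops n a. opnorm n (\<lambda>x \<beta>. T x \<beta> - P x \<beta>) < \<epsilon>)}"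

definition mnorm :: "nat \<Rightarrow> nat \<Rightarrow> (nat \<Rightarrow> nat \<Rightarrow> op) \<Rightarrow> real" where
  "mnorm n k M = Sup {sqrt (\<Sum>i<k. (fnorm (\<lambda>\<beta>. \<Sum>j<k. M i j (x j) \<beta>))\<^sup>2) | x.
       (\<forall>j<k. x j \<in> Fock n) \<and> (\<Sum>j<k. (fnorm (x j))\<^sup>2) \<le> 1}"

definition ci_isomorphic :: "nat \<Rightarrow> (nat list \<Rightarrow> real) \<Rightarrow> nat \<Rightarrow> (nat list \<Rightarrow> real) \<Rightarrow> bool" where
  "ci_isomorphic n a m b \<longleftrightarrow> (\<exists>\<Phi>. bij_betw \<Phi> (domalg n a) (domalg m b)
     \<and> (\<forall>S\<in>domalg n a. \<forall>T\<in>domalg n a.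
          \<Phi> (\<lambda>x \<beta>. S x \<beta> + T x \<beta>) = (\<lambda>x \<beta>. \<Phi> S x \<beta> + \<Phi> T x \<beta>))
     \<and> (\<forall>c. \<forall>S\<in>domalg n a. \<Phi> (\<lambda>x \<beta>. c * S x \<beta>) = (\<lambda>x \<beta>. c * \<Phi> S x \<beta>))
     \<and> (\<forall>S\<in>domalg n a. \<forall>T\<in>domalg n a. \<Phi> (S \<circ> T) = \<Phi> S \<circ> \<Phi> T)
     \<and> (\<forall>k>0. \<forall>M. (\<forall>i<k. \<forall>j<k. M i j \<in> domalg n a) \<longrightarrow>
          mnorm m k (\<lambda>i j. \<Phi> (M i j)) = mnorm n k M))"

text \<open>f(X_1..X_n) = g(lam_1 X_sigma(1), ..., lam_n X_sigma(n)), compared coefficientwise: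
  the coefficient of X_(sigma beta) on the right is g_beta * prod lam_(beta_k).\<close>
definition scale_perm_equiv :: "nat \<Rightarrow> (nat list \<Rightarrow> real) \<Rightarrow> (nat list \<Rightarrow> real) \<Rightarrow> bool" where
  "scale_perm_equiv n a b \<longleftrightarrow> (\<exists>\<sigma> (lam :: nat \<Rightarrow> real). bij_betw \<sigma> {..<n} {..<n}
     \<and> (\<forall>\<beta>. set \<beta> \<subseteq> {..<n} \<longrightarrow> a (map \<sigma> \<beta>) = b \<beta> * (\<Prod>i\<leftarrow>\<beta>. lam i)))"

end

theory Submission
  imports Defs "HOL-Complex_Analysis.Complex_Analysis" "Jordan_Normal_Form.Determinant"
begin

text \<open>
  For a point \<open>z\<close> of the domain \<open>g(z, z\<^sup>*) < 1\<close> the algebra of \<open>g\<close> has the character of evaluation at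
  \<open>z\<close>, and a completely isometric isomorphism \<open>\<Phi>\<close> from the algebra of \<open>f\<close> to that of \<open>g\<close> induces
  a bijection \<open>\<phi>\<close> from the domain of \<open>g\<close> to the domain of \<open>f\<close>. The operators
  \<open>\<surd>a\<^sub>\<alpha> W\<^sub>\<alpha>\<close> form a row contraction, and \<open>\<Phi>\<close> and its inverse preserve row contractions, so
  \<open>(1 - f(\<phi> z, \<phi> w)) / (1 - g(z, w))\<close> and its reciprocal are both positive definite kernels;
  such a kernel has rank one.

  If \<open>\<phi> 0 \<noteq> 0\<close>, differentiate this identity along the circle action: one obtains a
  vector field on the domain of \<open>f\<close> that does not vanish at \<open>0\<close>. Comparing coefficients
  shows that it is quadratic and, since all coefficients of \<open>f\<close> are nonnegative, that \<open>f\<close> has degree 1.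
  By symmetry so does \<open>g\<close>, and symbols of degree 1 in the same number of variables are equivalent.

  If \<open>\<phi> 0 = 0\<close>, the row contraction applied to the vacuum, for \<open>\<Phi>\<close> and for its inverse, shows that
  the image of each generator is a linear combination of generators, with coefficient matrix \<open>u\<close>.
  Induction on the degree \<open>k\<close> then shows that the \<open>k\<close>-th tensor power of \<open>u\<close> intertwines the diagonal
  forms given by the coefficients of \<open>f\<close> and \<open>g\<close> of degree \<open>k\<close>. Hence these coefficients agree up to
  scaling along every permutation with a nonzero term in the determinant of \<open>u\<close>.
\<close>

subsection \<open>The Fock space\<close>

text \<open>Point evaluations see only the commutative image of a symbol and cannot tell apart two
  words with the same letters in a different order. They serve to locate \<open>\<phi> 0\<close>. If
  that point is not the origin, nothing is lost: the coefficients are nonnegative, so words with the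
  same commutative image cannot cancel, and the absence of higher words is visible to characters. If
  the origin is fixed, the argument passes from characters to Fourier coefficients on the Fock
  space, where the linear part \<open>u\<close> acts on words by tensor powers.

  Complete isometry enters through operator norms and through one finite row for each direction. A
  single row yields inequalities only; the row of the inverse supplies the reverse ones, and each
  rigid conclusion (rank one, linearity of the images of the generators, intertwining) is a case of
  equality.

  The induction on the degree is forced by the weights: the row inequality in degree
  \<open>k\<close> involves the coefficients of all shorter words, and isolates those of length
  \<open>k\<close> only once the shorter ones are known to balance.\<close>

definition ip :: "(nat list \<Rightarrow> complex) \<Rightarrow> (nat list \<Rightarrow> complex) \<Rightarrow> complex" where
  "ip x y = (\<Sum>\<^sub>\<infinity>\<alpha>. x \<alpha> * cnj (y \<alpha>))"

lemma Fock_summable: "x \<in> Fock n \<Longrightarrow> (\<lambda>\<alpha>. (cmod (x \<alpha>))\<^sup>2) summable_on UNIV"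
  by (simp add: Fock_def)

lemma Fock_letters: "x \<in> Fock n \<Longrightarrow> x \<alpha> \<noteq> 0 \<Longrightarrow> set \<alpha> \<subseteq> {..<n}"
  by (simp add: Fock_def)

lemma Fock_eq_0: "x \<in> Fock n \<Longrightarrow> \<not> set \<alpha> \<subseteq> {..<n} \<Longrightarrow> x \<alpha> = 0"
  using Fock_letters by blast

lemma ip_abs_summable:
  assumes "x \<in> Fock n" "y \<in> Fock m"
  shows "(\<lambda>\<alpha>. cmod (x \<alpha> * cnj (y \<alpha>))) summable_on UNIV"
proof (rule abs_summable_product)
  show "(\<lambda>\<alpha>. cmod (x \<alpha> * x \<alpha>)) summable_on UNIV"
    using Fock_summable[OF assms(1)] by (simp add: norm_mult power2_eq_square)
  show "(\<lambda>\<alpha>. cmod (cnj (y \<alpha>) * cnj (y \<alpha>))) summable_on UNIV"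
    using Fock_summable[OF assms(2)] by (simp add: norm_mult power2_eq_square)
qed

lemma ip_summable:
  assumes "x \<in> Fock n" "y \<in> Fock m"
  shows "(\<lambda>\<alpha>. x \<alpha> * cnj (y \<alpha>)) summable_on UNIV"
  using ip_abs_summable[OF assms] by (rule abs_summable_summable)

lemma Fock_zero: "(\<lambda>_. 0) \<in> Fock n"
  by (simp add: Fock_def)

lemma Fock_add:
  assumes "x \<in> Fock n" "y \<in> Fock n"
  shows "(\<lambda>\<beta>. x \<beta> + y \<beta>) \<in> Fock n"
proof -
  have "(\<lambda>\<alpha>. 2 * (cmod (x \<alpha>))\<^sup>2 + 2 * (cmod (y \<alpha>))\<^sup>2) summable_on UNIV"
    by (intro summable_on_add summable_on_cmult_right Fock_summable[OF assms(1)] Fock_summable[OF assms(2)])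
  moreover have "(cmod (x \<alpha> + y \<alpha>))\<^sup>2 \<le> 2 * (cmod (x \<alpha>))\<^sup>2 + 2 * (cmod (y \<alpha>))\<^sup>2" for \<alpha>
  proof -
    have "(cmod (x \<alpha> + y \<alpha>))\<^sup>2 \<le> (cmod (x \<alpha>) + cmod (y \<alpha>))\<^sup>2"
      by (intro power_mono norm_triangle_ineq) simp
    also have "\<dots> \<le> 2 * (cmod (x \<alpha>))\<^sup>2 + 2 * (cmod (y \<alpha>))\<^sup>2"
      using sum_squares_bound[of "cmod (x \<alpha>)" "cmod (y \<alpha>)"] by (simp add: power2_sum)
    finally show ?thesis .
  qed
  ultimately have "(\<lambda>\<alpha>. (cmod (x \<alpha> + y \<alpha>))\<^sup>2) summable_on UNIV"
    by (rule summable_on_comparison_test) auto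
  moreover have "set \<alpha> \<subseteq> {..<n}" if "x \<alpha> + y \<alpha> \<noteq> 0" for \<alpha>
    using that Fock_eq_0[OF assms(1)] Fock_eq_0[OF assms(2)] by fastforce
  ultimately show ?thesis unfolding Fock_def by blast
qed

lemma Fock_scale:
  assumes "x \<in> Fock n"
  shows "(\<lambda>\<beta>. c * x \<beta>) \<in> Fock n"
  using assms unfolding Fock_def
  by (auto simp: norm_mult power_mult_distrib intro!: summable_on_cmult_right)

lemma Fock_sum:
  assumes "\<And>i. i \<in> I \<Longrightarrow> x i \<in> Fock n"
  shows "(\<lambda>\<beta>. \<Sum>i\<in>I. x i \<beta>) \<in> Fock n"
  using assms
  by (induction I rule: infinite_finite_induct) (auto simp: Fock_zero intro!: Fock_add)

lemma Fock_finite_support: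
  assumes "finite F" "\<And>\<alpha>. x \<alpha> \<noteq> 0 \<Longrightarrow> \<alpha> \<in> F \<and> set \<alpha> \<subseteq> {..<n}"
  shows "x \<in> Fock n"
proof -
  have "(\<lambda>\<alpha>. (cmod (x \<alpha>))\<^sup>2) summable_on F" using assms(1) by simp
  then have "(\<lambda>\<alpha>. (cmod (x \<alpha>))\<^sup>2) summable_on UNIV"
    by (subst summable_on_cong_neutral[where T = F and g = "\<lambda>\<alpha>. (cmod (x \<alpha>))\<^sup>2"])
       (use assms(2) in auto)
  then show ?thesis using assms(2) by (auto simp: Fock_def)
qed

lemma ip_add_left:
  assumes "x \<in> Fock n" "y \<in> Fock n" "w \<in> Fock m"
  shows "ip (\<lambda>\<beta>. x \<beta> + y \<beta>) w = ip x w + ip y w"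
  unfolding ip_def
  by (subst infsum_add[symmetric]) (auto intro: ip_summable assms simp: algebra_simps)

lemma ip_scale_left: "ip (\<lambda>\<beta>. c * x \<beta>) w = c * ip x w"
  unfolding ip_def by (subst infsum_cmult_right'[symmetric]) (simp add: mult.assoc)

lemma ip_cnj: "ip y x = cnj (ip x y)"
  unfolding ip_def by (subst infsum_cnj[symmetric]) (simp add: mult.commute)

lemma ip_diff_left:
  assumes "x \<in> Fock n" "y \<in> Fock n" "w \<in> Fock m"
  shows "ip (\<lambda>\<beta>. x \<beta> - y \<beta>) w = ip x w - ip y w"
  using ip_add_left[OF assms(1) Fock_scale[OF assms(2), of "-1"] assms(3)] ip_scale_left[of "-1" y w]
  by simp

lemma ip_sum_left:
  assumes "\<And>i. i \<in> I \<Longrightarrow> x i \<in> Fock n" "w \<in> Fock m"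
  shows "ip (\<lambda>\<beta>. \<Sum>i\<in>I. x i \<beta>) w = (\<Sum>i\<in>I. ip (x i) w)"
  using assms(1)
proof (induction I rule: infinite_finite_induct)
  case (insert i I)
  then show ?case
    using ip_add_left[OF _ Fock_sum[of I x n] assms(2), of "x i"] by simp
qed (simp_all add: ip_def)

lemma ip_sum_right:
  assumes "\<And>i. i \<in> I \<Longrightarrow> x i \<in> Fock n" "w \<in> Fock m"
  shows "ip w (\<lambda>\<beta>. \<Sum>i\<in>I. x i \<beta>) = (\<Sum>i\<in>I. ip w (x i))"
  unfolding ip_cnj[of w] using ip_sum_left[of I x n w m] assms by simp

lemma ip_scale_right: "ip w (\<lambda>\<beta>. c * x \<beta>) = cnj c * ip w x"
  using ip_scale_left[of c x w] by (subst (1 2) ip_cnj) simp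

lemma fnorm_nonneg [simp]: "fnorm x \<ge> 0"
  by (simp add: fnorm_def infsum_nonneg)

lemma fnorm_sq: "(fnorm x)\<^sup>2 = (\<Sum>\<^sub>\<infinity>\<alpha>. (cmod (x \<alpha>))\<^sup>2)"
  unfolding fnorm_def by (simp add: infsum_nonneg)

lemma fnorm_zero [simp]: "fnorm (\<lambda>_. 0) = 0"
  by (simp add: fnorm_def)

lemma ip_self:
  assumes "x \<in> Fock n"
  shows "ip x x = complex_of_real ((fnorm x)\<^sup>2)"
proof -
  have "ip x x = (\<Sum>\<^sub>\<infinity>\<alpha>. complex_of_real ((cmod (x \<alpha>))\<^sup>2))"
    unfolding ip_def by (simp only: complex_norm_square)
  also have "\<dots> = complex_of_real ((fnorm x)\<^sup>2)"
    unfolding fnorm_sq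
    by (rule infsumI) (intro has_sum_of_real has_sum_infsum Fock_summable[OF assms])
  finally show ?thesis .
qed

lemma fnorm_scale: "fnorm (\<lambda>\<beta>. c * x \<beta>) = cmod c * fnorm x"
proof -
  have "(fnorm (\<lambda>\<beta>. c * x \<beta>))\<^sup>2 = (cmod c)\<^sup>2 * (fnorm x)\<^sup>2"
    unfolding fnorm_sq by (simp add: norm_mult power_mult_distrib infsum_cmult_right')
  then have "(fnorm (\<lambda>\<beta>. c * x \<beta>))\<^sup>2 = (cmod c * fnorm x)\<^sup>2"
    by (simp add: power_mult_distrib)
  then show ?thesis by (rule power2_eq_imp_eq) auto
qed

lemma fnorm_sum_le:
  assumes "x \<in> Fock n" "finite F"
  shows "(\<Sum>\<alpha>\<in>F. (cmod (x \<alpha>))\<^sup>2) \<le> (fnorm x)\<^sup>2"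
  unfolding fnorm_sq by (rule finite_sum_le_infsum[OF Fock_summable[OF assms(1)] assms(2)]) auto

lemma fnorm_coord_le:
  assumes "x \<in> Fock n"
  shows "cmod (x \<alpha>) \<le> fnorm x"
proof (rule power2_le_imp_le)
  show "(cmod (x \<alpha>))\<^sup>2 \<le> (fnorm x)\<^sup>2" using fnorm_sum_le[OF assms, of "{\<alpha>}"] by simp
qed simp

lemma fnorm_eq_0:
  assumes "x \<in> Fock n" "fnorm x = 0"
  shows "x = (\<lambda>_. 0)"
proof
  fix \<alpha> show "x \<alpha> = 0" using fnorm_coord_le[OF assms(1), of \<alpha>] assms(2) by simp
qed

lemma ip_Cauchy_Schwarz:
  assumes "x \<in> Fock n" "y \<in> Fock m"
  shows "cmod (ip x y) \<le> fnorm x * fnorm y"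
proof (cases "fnorm x = 0 \<or> fnorm y = 0")
  case True
  then have "ip x y = 0"
    using fnorm_eq_0[OF assms(1)] fnorm_eq_0[OF assms(2)] by (auto simp: ip_def)
  then show ?thesis by simp
next
  case False
  then have pos: "fnorm x > 0" "fnorm y > 0" using fnorm_nonneg less_eq_real_def by metis+
  \<comment> \<open>This weight balances the pointwise arithmetic-geometric inequality: the two
    halves of the bound then sum to the same value, together
    \<open>fnorm x * fnorm y\<close>.\<close>
  define s where "s = fnorm y / fnorm x"
  have s: "s > 0" using pos by (simp add: s_def)
  have sx: "(\<lambda>\<alpha>. (s / 2) * (cmod (x \<alpha>))\<^sup>2 + (1 / (2 * s)) * (cmod (y \<alpha>))\<^sup>2) summable_on UNIV"
    by (intro summable_on_add summable_on_cmult_right Fock_summable[OF assms(1)] Fock_summable[OF assms(2)])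
  have "cmod (ip x y) \<le> (\<Sum>\<^sub>\<infinity>\<alpha>. cmod (x \<alpha> * cnj (y \<alpha>)))"
    unfolding ip_def by (rule norm_infsum_bound[OF ip_abs_summable[OF assms]])
  also have "\<dots> \<le> (\<Sum>\<^sub>\<infinity>\<alpha>. (s / 2) * (cmod (x \<alpha>))\<^sup>2 + (1 / (2 * s)) * (cmod (y \<alpha>))\<^sup>2)"
  proof (rule infsum_mono[OF ip_abs_summable[OF assms] sx])
    fix \<alpha>
    have "0 \<le> (s * cmod (x \<alpha>) - cmod (y \<alpha>))\<^sup>2 / (2 * s)" using s by simp
    then show "cmod (x \<alpha> * cnj (y \<alpha>)) \<le> (s / 2) * (cmod (x \<alpha>))\<^sup>2 + (1 / (2 * s)) * (cmod (y \<alpha>))\<^sup>2"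
      using s by (simp add: norm_mult field_simps power2_eq_square)
  qed
  also have "\<dots> = (s / 2) * (fnorm x)\<^sup>2 + (1 / (2 * s)) * (fnorm y)\<^sup>2"
    unfolding fnorm_sq infsum_cmult_right'[symmetric]
    by (intro infsum_add summable_on_cmult_right Fock_summable[OF assms(1)] Fock_summable[OF assms(2)])
  also have "\<dots> = fnorm x * fnorm y"
    using pos by (simp add: s_def field_simps power2_eq_square)
  finally show ?thesis .
qed

lemma fnorm_triangle:
  assumes "x \<in> Fock n" "y \<in> Fock n"
  shows "fnorm (\<lambda>\<beta>. x \<beta> + y \<beta>) \<le> fnorm x + fnorm y"
proof -
  let ?s = "\<lambda>\<beta>. x \<beta> + y \<beta>"
  have s: "?s \<in> Fock n" by (rule Fock_add[OF assms])
  have "(fnorm ?s)\<^sup>2 = cmod (ip ?s ?s)" unfolding ip_self[OF s] by (simp del: of_real_power)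
  also have "\<dots> = cmod (ip x ?s + ip y ?s)" using ip_add_left[OF assms s] by simp
  also have "\<dots> \<le> fnorm x * fnorm ?s + fnorm y * fnorm ?s"
    by (intro norm_triangle_le add_mono ip_Cauchy_Schwarz[OF assms(1) s] ip_Cauchy_Schwarz[OF assms(2) s])
  finally have "fnorm ?s * fnorm ?s \<le> (fnorm x + fnorm y) * fnorm ?s"
    by (simp add: power2_eq_square algebra_simps)
  then show ?thesis
    by (metis add_nonneg_nonneg fnorm_nonneg less_eq_real_def mult_le_cancel_right)
qed

lemma fnorm_sum_triangle:
  assumes "\<And>i. i \<in> I \<Longrightarrow> x i \<in> Fock n"
  shows "fnorm (\<lambda>\<beta>. \<Sum>i\<in>I. x i \<beta>) \<le> (\<Sum>i\<in>I. fnorm (x i))"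
  using assms
proof (induction I rule: infinite_finite_induct)
  case (insert i I)
  have "fnorm (\<lambda>\<beta>. x i \<beta> + (\<Sum>i\<in>I. x i \<beta>)) \<le> fnorm (x i) + fnorm (\<lambda>\<beta>. \<Sum>i\<in>I. x i \<beta>)"
    by (rule fnorm_triangle) (use insert in \<open>auto intro: Fock_sum\<close>)
  then show ?case using insert by force
qed auto

subsection \<open>Bounded operators\<close>

lemma bounded_opD:
  assumes "bounded_op n T"
  shows "x \<in> Fock n \<Longrightarrow> T x \<in> Fock n"
    and "x \<in> Fock n \<Longrightarrow> y \<in> Fock n \<Longrightarrow> T (\<lambda>\<beta>. x \<beta> + y \<beta>) = (\<lambda>\<beta>. T x \<beta> + T y \<beta>)"
    and "x \<in> Fock n \<Longrightarrow> T (\<lambda>\<beta>. c * x \<beta>) = (\<lambda>\<beta>. c * T x \<beta>)"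
    and "x \<notin> Fock n \<Longrightarrow> T x = (\<lambda>_. 0)"
  using assms unfolding bounded_op_def by blast+

lemma bounded_op_bound:
  assumes "bounded_op n T"
  obtains K where "K \<ge> 0" "\<And>x. x \<in> Fock n \<Longrightarrow> fnorm (T x) \<le> K * fnorm x"
proof -
  obtain K where K: "\<forall>x\<in>Fock n. fnorm (T x) \<le> K * fnorm x" using assms unfolding bounded_op_def by blast
  have "fnorm (T x) \<le> \<bar>K\<bar> * fnorm x" if "x \<in> Fock n" for x
    using K that by (meson abs_ge_self fnorm_nonneg mult_right_mono order_trans)
  then show ?thesis using that[of "\<bar>K\<bar>"] by auto
qed

lemma bounded_op_zero_vec:
  assumes "bounded_op n T"
  shows "T (\<lambda>_. 0) = (\<lambda>_. 0)"
  using bounded_opD(3)[OF assms Fock_zero, of 0] by simp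

lemma bounded_op_sum_vec:
  assumes "bounded_op n T" "\<And>i. i \<in> I \<Longrightarrow> x i \<in> Fock n"
  shows "T (\<lambda>\<beta>. \<Sum>i\<in>I. x i \<beta>) = (\<lambda>\<beta>. \<Sum>i\<in>I. T (x i) \<beta>)"
  using assms(2)
proof (induction I rule: infinite_finite_induct)
  case (insert i I)
  then show ?case
    using bounded_opD(2)[OF assms(1) _ Fock_sum[of I x n], of "x i"] by simp
qed (simp_all add: bounded_op_zero_vec[OF assms(1)])

lemma bounded_opI:
  assumes "\<And>x. x \<in> Fock n \<Longrightarrow> T x \<in> Fock n"
    and "\<And>x y. x \<in> Fock n \<Longrightarrow> y \<in> Fock n \<Longrightarrow> T (\<lambda>\<beta>. x \<beta> + y \<beta>) = (\<lambda>\<beta>. T x \<beta> + T y \<beta>)"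
    and "\<And>c x. x \<in> Fock n \<Longrightarrow> T (\<lambda>\<beta>. c * x \<beta>) = (\<lambda>\<beta>. c * T x \<beta>)"
    and "\<And>x. x \<in> Fock n \<Longrightarrow> fnorm (T x) \<le> K * fnorm x"
    and "\<And>x. x \<notin> Fock n \<Longrightarrow> T x = (\<lambda>_. 0)"
  shows "bounded_op n T"
  using assms unfolding bounded_op_def by blast

lemma bounded_op_zero: "bounded_op n (\<lambda>x \<beta>. 0)"
  by (rule bounded_opI[where K = 0]) (auto simp: Fock_zero)

lemma bounded_op_add:
  assumes S: "bounded_op n S" and T: "bounded_op n T"
  shows "bounded_op n (\<lambda>x \<beta>. S x \<beta> + T x \<beta>)"
proof -
  obtain K where K: "\<And>x. x \<in> Fock n \<Longrightarrow> fnorm (S x) \<le> K * fnorm x" using bounded_op_bound[OF S] by blast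
  obtain L where L: "\<And>x. x \<in> Fock n \<Longrightarrow> fnorm (T x) \<le> L * fnorm x" using bounded_op_bound[OF T] by blast
  show ?thesis
  proof (rule bounded_opI[where K = "K + L"])
    fix x assume x: "x \<in> Fock n"
    show "(\<lambda>\<beta>. S x \<beta> + T x \<beta>) \<in> Fock n" by (intro Fock_add bounded_opD(1)[OF S] bounded_opD(1)[OF T] x)
    show "fnorm (\<lambda>\<beta>. S x \<beta> + T x \<beta>) \<le> (K + L) * fnorm x"
      using fnorm_triangle[OF bounded_opD(1)[OF S x] bounded_opD(1)[OF T x]] K[OF x] L[OF x]
      by (simp add: algebra_simps)
  qed (auto simp: bounded_opD[OF S] bounded_opD[OF T] algebra_simps)
qed

lemma bounded_op_scale:
  assumes S: "bounded_op n S"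
  shows "bounded_op n (\<lambda>x \<beta>. c * S x \<beta>)"
proof -
  obtain K where K: "\<And>x. x \<in> Fock n \<Longrightarrow> fnorm (S x) \<le> K * fnorm x" using bounded_op_bound[OF S] by blast
  show ?thesis
  proof (rule bounded_opI[where K = "cmod c * K"])
    fix x assume x: "x \<in> Fock n"
    show "(\<lambda>\<beta>. c * S x \<beta>) \<in> Fock n" by (intro Fock_scale bounded_opD(1)[OF S] x)
    show "fnorm (\<lambda>\<beta>. c * S x \<beta>) \<le> cmod c * K * fnorm x"
      using K[OF x] by (simp add: fnorm_scale mult.assoc mult_left_mono)
  qed (auto simp: bounded_opD[OF S] algebra_simps)
qed

lemma bounded_op_diff:
  assumes S: "bounded_op n S" and T: "bounded_op n T"
  shows "bounded_op n (\<lambda>x \<beta>. S x \<beta> - T x \<beta>)"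
  using bounded_op_add[OF S bounded_op_scale[OF T, of "-1"]] by simp

lemma bounded_op_sum:
  assumes "\<And>i. i \<in> I \<Longrightarrow> bounded_op n (T i)"
  shows "bounded_op n (\<lambda>x \<beta>. \<Sum>i\<in>I. T i x \<beta>)"
  using assms
  by (induction I rule: infinite_finite_induct) (auto simp: bounded_op_zero intro!: bounded_op_add)

lemma bounded_op_comp:
  assumes S: "bounded_op n S" and T: "bounded_op n T"
  shows "bounded_op n (S \<circ> T)"
proof -
  obtain K where K: "K \<ge> 0" "\<And>x. x \<in> Fock n \<Longrightarrow> fnorm (S x) \<le> K * fnorm x" using bounded_op_bound[OF S] by blast
  obtain L where L: "\<And>x. x \<in> Fock n \<Longrightarrow> fnorm (T x) \<le> L * fnorm x" using bounded_op_bound[OF T] by blast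
  show ?thesis
  proof (rule bounded_opI[where K = "K * L"])
    fix x assume x: "x \<in> Fock n"
    show "fnorm ((S \<circ> T) x) \<le> K * L * fnorm x"
      using K(2)[OF bounded_opD(1)[OF T x]] mult_left_mono[OF L[OF x] K(1)] by (simp add: mult.assoc)
  qed (auto simp: bounded_opD[OF S] bounded_opD[OF T] bounded_op_zero_vec[OF S])
qed

lemma bounded_op_idop: "bounded_op n (idop n)"
  by (rule bounded_opI[where K = 1]) (auto simp: idop_def Fock_add Fock_scale)

lemma opnorm_bdd:
  assumes "bounded_op n T"
  shows "bdd_above {fnorm (T x) | x. x \<in> Fock n \<and> fnorm x \<le> 1}"
proof -
  obtain K where K: "K \<ge> 0" "\<And>x. x \<in> Fock n \<Longrightarrow> fnorm (T x) \<le> K * fnorm x"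
    using bounded_op_bound[OF assms] by blast
  have "fnorm (T x) \<le> K" if "x \<in> Fock n" "fnorm x \<le> 1" for x
    using K(2)[OF that(1)] mult_left_mono[OF that(2) K(1)] by simp
  then show ?thesis by (intro bdd_aboveI[where M = K]) auto
qed

lemma opnorm_bound:
  assumes T: "bounded_op n T" and x: "x \<in> Fock n"
  shows "fnorm (T x) \<le> opnorm n T * fnorm x"
proof (cases "fnorm x = 0")
  case True
  then show ?thesis using fnorm_eq_0[OF x] bounded_op_zero_vec[OF T] by simp
next
  case False
  define c where "c = complex_of_real (1 / fnorm x)"
  have c: "cmod c = 1 / fnorm x" unfolding c_def norm_of_real using fnorm_nonneg[of x] by simp
  have "fnorm (T (\<lambda>\<beta>. c * x \<beta>)) \<le> opnorm n T"
    unfolding opnorm_def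
    by (rule cSup_upper[OF _ opnorm_bdd[OF T]])
       (use False in \<open>auto intro!: exI[of _ "\<lambda>\<beta>. c * x \<beta>"] Fock_scale x simp: fnorm_scale c\<close>)
  then have "fnorm (T x) / fnorm x \<le> opnorm n T"
    by (simp add: bounded_opD(3)[OF T x] fnorm_scale c)
  then show ?thesis using False fnorm_nonneg[of x] by (simp add: divide_le_eq)
qed

lemma opnorm_nonneg:
  assumes "bounded_op n T"
  shows "opnorm n T \<ge> 0"
  unfolding opnorm_def
  by (rule cSup_upper2[OF _ _ opnorm_bdd[OF assms], of "fnorm (T (\<lambda>_. 0))"])
     (auto intro!: exI[of _ "\<lambda>_. 0"] simp: Fock_zero)

lemma opnorm_le:
  assumes "K \<ge> 0" "\<And>x. x \<in> Fock n \<Longrightarrow> fnorm (T x) \<le> K * fnorm x"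
  shows "opnorm n T \<le> K"
  unfolding opnorm_def
proof (rule cSup_least)
  show "{fnorm (T x) |x. x \<in> Fock n \<and> fnorm x \<le> 1} \<noteq> {}"
    using Fock_zero fnorm_zero by (metis (mono_tags, lifting) empty_Collect_eq zero_le_one)
  fix r assume "r \<in> {fnorm (T x) |x. x \<in> Fock n \<and> fnorm x \<le> 1}"
  then obtain x where x: "r = fnorm (T x)" "x \<in> Fock n" "fnorm x \<le> 1" by blast
  then show "r \<le> K" using assms(2)[OF x(2)] mult_left_mono[OF x(3) assms(1)] by simp
qed

subsection \<open>The weights\<close>

lemma symbolD:
  assumes "symbol n a"
  shows "finite {\<alpha>. a \<alpha> \<noteq> 0}" "a \<alpha> \<noteq> 0 \<Longrightarrow> set \<alpha> \<subseteq> {..<n}" "a [] = 0" "a \<alpha> \<ge> 0" "i < n \<Longrightarrow> a [i] > 0"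
  using assms unfolding symbol_def by blast+

definition decomps :: "nat list \<Rightarrow> nat list list set" where
  "decomps \<alpha> = {\<gamma>s. concat \<gamma>s = \<alpha> \<and> (\<forall>\<gamma>\<in>set \<gamma>s. \<gamma> \<noteq> [])}"

lemma decomps_Nil: "decomps [] = {[]}"
  unfolding decomps_def
proof (intro equalityI subsetI)
  fix \<gamma>s :: "nat list list" assume "\<gamma>s \<in> {\<gamma>s. concat \<gamma>s = [] \<and> (\<forall>\<gamma>\<in>set \<gamma>s. \<gamma> \<noteq> [])}"
  then show "\<gamma>s \<in> {[]}" by (cases \<gamma>s) auto
qed auto

text \<open>A decomposition of a nonempty word is determined by the length of its first factor and a
  decomposition of what remains; this is the source of the recursion for the weights.\<close>

lemma decomps_step:
  assumes "\<alpha> \<noteq> []"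
  shows "decomps \<alpha> = (\<Union>i\<in>{1..length \<alpha>}. (#) (take i \<alpha>) ` decomps (drop i \<alpha>))"
proof (intro equalityI subsetI)
  fix \<gamma>s assume s: "\<gamma>s \<in> decomps \<alpha>"
  then obtain \<gamma> \<delta>s where \<gamma>: "\<gamma>s = \<gamma> # \<delta>s" using assms by (cases \<gamma>s) (auto simp: decomps_def)
  then have "\<gamma> \<noteq> []" "\<alpha> = \<gamma> @ concat \<delta>s" "\<delta>s \<in> decomps (concat \<delta>s)" using s by (auto simp: decomps_def)
  then show "\<gamma>s \<in> (\<Union>i\<in>{1..length \<alpha>}. (#) (take i \<alpha>) ` decomps (drop i \<alpha>))"
    unfolding \<gamma> by (intro UN_I[of "length \<gamma>"]) (auto simp: Suc_le_eq)
next
  fix \<gamma>s assume "\<gamma>s \<in> (\<Union>i\<in>{1..length \<alpha>}. (#) (take i \<alpha>) ` decomps (drop i \<alpha>))"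
  then show "\<gamma>s \<in> decomps \<alpha>" by (auto simp: decomps_def)
qed

lemma finite_decomps: "finite (decomps \<alpha>)"
proof (induction \<alpha> rule: length_induct)
  case (1 \<alpha>)
  show ?case
  proof (cases "\<alpha> = []")
    case False
    then show ?thesis unfolding decomps_step[OF False] using 1 by auto
  qed (simp add: decomps_Nil)
qed

lemma bcoef_Nil [simp]: "bcoef a [] = 1"
  unfolding bcoef_def decomps_def[symmetric] decomps_Nil by simp

lemma bcoef_rec:
  assumes "\<alpha> \<noteq> []"
  shows "bcoef a \<alpha> = (\<Sum>i=1..length \<alpha>. a (take i \<alpha>) * bcoef a (drop i \<alpha>))"
proof -
  have "bcoef a \<alpha> = (\<Sum>i=1..length \<alpha>. \<Sum>\<gamma>s\<in>(#) (take i \<alpha>) ` decomps (drop i \<alpha>). prod_list (map a \<gamma>s))"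
    unfolding bcoef_def decomps_def[symmetric] decomps_step[OF assms]
  proof (rule sum.UNION_disjoint)
    show "\<forall>i\<in>{1..length \<alpha>}. \<forall>j\<in>{1..length \<alpha>}. i \<noteq> j \<longrightarrow>
      (#) (take i \<alpha>) ` decomps (drop i \<alpha>) \<inter> (#) (take j \<alpha>) ` decomps (drop j \<alpha>) = {}"
    proof (intro ballI impI)
      fix i j assume "i \<in> {1..length \<alpha>}" "j \<in> {1..length \<alpha>}" "i \<noteq> j"
      then have "take i \<alpha> \<noteq> take j \<alpha>"
        by (metis atLeastAtMost_iff length_take min.absorb2)
      then show "(#) (take i \<alpha>) ` decomps (drop i \<alpha>) \<inter> (#) (take j \<alpha>) ` decomps (drop j \<alpha>) = {}" by auto
    qed
  qed (auto simp: finite_decomps)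
  also have "\<dots> = (\<Sum>i=1..length \<alpha>. a (take i \<alpha>) * bcoef a (drop i \<alpha>))"
    unfolding bcoef_def decomps_def[symmetric]
    by (intro sum.cong refl, subst sum.reindex) (auto simp: sum_distrib_left)
  finally show ?thesis .
qed

lemma bcoef_nonneg:
  assumes "symbol n a"
  shows "bcoef a \<alpha> \<ge> 0"
  unfolding bcoef_def by (intro sum_nonneg prod_list_nonneg) (auto simp: symbolD(4)[OF assms])

text \<open>Keeps only the decompositions whose first factor is a single letter. This one estimate
  gives the positivity of the weights and the bound \<open>sqrt (1 / a [j])\<close> for the
  shifts.\<close>

lemma bcoef_Cons_ge:
  assumes "symbol n a"
  shows "bcoef a (i # \<alpha>) \<ge> a [i] * bcoef a \<alpha>"
proof -
  have "a (take 1 (i # \<alpha>)) * bcoef a (drop 1 (i # \<alpha>)) \<le> bcoef a (i # \<alpha>)"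
    unfolding bcoef_rec[of "i # \<alpha>" a, OF list.distinct(2)]
    by (rule member_le_sum) (auto simp: symbolD(4)[OF assms] bcoef_nonneg[OF assms])
  then show ?thesis by simp
qed

lemma bcoef_pos:
  assumes "symbol n a" "set \<alpha> \<subseteq> {..<n}"
  shows "bcoef a \<alpha> > 0"
  using assms(2)
proof (induction \<alpha>)
  case (Cons i \<alpha>)
  then have "a [i] * bcoef a \<alpha> > 0" using symbolD(5)[OF assms(1)] by simp
  then show ?case using bcoef_Cons_ge[OF assms(1), of i \<alpha>] by linarith
qed simp

lemma bcoef_single [simp]: "bcoef a [i] = a [i]"
  by (subst bcoef_rec) simp_all

subsection \<open>Weighted shifts\<close>

lemma finite_words: "finite {\<alpha>. set \<alpha> \<subseteq> {..<n::nat} \<and> length \<alpha> \<le> k}"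
  by (rule finite_lists_length_le) simp

text \<open>Prefixing \<open>\<alpha>\<close> is injective, and its range is recognised by
  \<open>take\<close>. Everything that depends on how an operator word moves the basis is summed
  through this reindexing.\<close>

lemma append_summable:
  fixes h :: "nat list \<Rightarrow> 'a::real_normed_vector"
  assumes "h summable_on UNIV"
  shows "(\<lambda>\<beta>. if take (length \<alpha>) \<beta> = \<alpha> then h (drop (length \<alpha>) \<beta>) else 0) summable_on UNIV"
    and "(\<Sum>\<^sub>\<infinity>\<beta>. if take (length \<alpha>) \<beta> = \<alpha> then h (drop (length \<alpha>) \<beta>) else 0) = (\<Sum>\<^sub>\<infinity>\<gamma>. h \<gamma>)"
proof -
  let ?g = "\<lambda>\<beta>. if take (length \<alpha>) \<beta> = \<alpha> then h (drop (length \<alpha>) \<beta>) else 0"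
  have inj: "inj_on ((@) \<alpha>) UNIV" by (auto simp: inj_on_def)
  have "(h has_sum infsum h UNIV) UNIV" using assms by (rule has_sum_infsum)
  then have "((?g \<circ> (@) \<alpha>) has_sum infsum h UNIV) UNIV" by (simp add: o_def)
  then have "(?g has_sum infsum h UNIV) (range ((@) \<alpha>))"
    using has_sum_reindex[OF inj] by blast
  moreover have "?g \<beta> = 0" if "\<beta> \<notin> range ((@) \<alpha>)" for \<beta>
    using that by (metis append_take_drop_id rangeI)
  ultimately have "(?g has_sum infsum h UNIV) UNIV"
    by (subst has_sum_cong_neutral[where T = "range ((@) \<alpha>)" and g = ?g]) auto
  then show "?g summable_on UNIV" "(\<Sum>\<^sub>\<infinity>\<beta>. ?g \<beta>) = (\<Sum>\<^sub>\<infinity>\<gamma>. h \<gamma>)"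
    by (auto simp: has_sum_imp_summable infsumI)
qed

lemma wshift_apply:
  assumes "x \<in> Fock n"
  shows "wshift n a j x \<beta> = (case \<beta> of [] \<Rightarrow> 0
     | i # \<alpha> \<Rightarrow> (if i = j then complex_of_real (sqrt (bcoef a \<alpha> / bcoef a \<beta>)) * x \<alpha> else 0))"
  using assms by (simp add: wshift_def)

lemma bounded_op_wshift:
  assumes "symbol n a" "j < n"
  shows "bounded_op n (wshift n a j)"
proof -
  have aj: "a [j] > 0" using symbolD(5)[OF assms(1,2)] .
  have ratio: "bcoef a \<alpha> / bcoef a (j # \<alpha>) \<le> 1 / a [j]" if "set \<alpha> \<subseteq> {..<n}" for \<alpha>
    using bcoef_Cons_ge[OF assms(1), of j \<alpha>] bcoef_pos[OF assms(1), of "j # \<alpha>"] that assms(2) aj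
    by (simp add: field_simps)
  have pt: "(cmod (wshift n a j x \<beta>))\<^sup>2 \<le> (if take (length [j]) \<beta> = [j] then (1 / a [j]) * (cmod (x (drop (length [j]) \<beta>)))\<^sup>2 else 0)"
    if x: "x \<in> Fock n" for x \<beta>
  proof (cases \<beta>)
    case (Cons i \<alpha>)
    show ?thesis
    proof (cases "i = j \<and> set \<alpha> \<subseteq> {..<n}")
      case True
      have "(cmod (wshift n a j x \<beta>))\<^sup>2 = (bcoef a \<alpha> / bcoef a (j # \<alpha>)) * (cmod (x \<alpha>))\<^sup>2"
        using True Cons by (simp add: wshift_apply[OF x] norm_mult power_mult_distrib bcoef_nonneg[OF assms(1)])
      also have "\<dots> \<le> (1 / a [j]) * (cmod (x \<alpha>))\<^sup>2" using ratio True by (intro mult_right_mono) auto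
      finally show ?thesis using True Cons by simp
    next
      case False
      then show ?thesis using Cons Fock_eq_0[OF x] aj by (auto simp: wshift_apply[OF x])
    qed
  qed (simp add: wshift_apply[OF x])
  have sm: "(\<lambda>\<beta>. if take (length [j]) \<beta> = [j] then (1 / a [j]) * (cmod (x (drop (length [j]) \<beta>)))\<^sup>2 else 0) summable_on UNIV"
    "(\<Sum>\<^sub>\<infinity>\<beta>. if take (length [j]) \<beta> = [j] then (1 / a [j]) * (cmod (x (drop (length [j]) \<beta>)))\<^sup>2 else 0) = (1 / a [j]) * (fnorm x)\<^sup>2"
    if x: "x \<in> Fock n" for x
    using append_summable[OF summable_on_cmult_right[OF Fock_summable[OF x]], of "[j]" "1 / a [j]"]
    by (simp_all only: infsum_cmult_right' fnorm_sq)
  have mem: "wshift n a j x \<in> Fock n" if x: "x \<in> Fock n" for x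
  proof -
    have "(\<lambda>\<beta>. (cmod (wshift n a j x \<beta>))\<^sup>2) summable_on UNIV"
      by (rule summable_on_comparison_test[OF sm(1)[OF x] pt[OF x]]) auto
    moreover have "set \<beta> \<subseteq> {..<n}" if "wshift n a j x \<beta> \<noteq> 0" for \<beta>
      using that Fock_letters[OF x] assms(2) by (auto simp: wshift_apply[OF x] split: list.splits if_splits)
    ultimately show ?thesis unfolding Fock_def by blast
  qed
  show ?thesis
  proof (rule bounded_opI[where K = "sqrt (1 / a [j])"])
    fix x assume x: "x \<in> Fock n"
    have "(fnorm (wshift n a j x))\<^sup>2 \<le> (1 / a [j]) * (fnorm x)\<^sup>2"
      unfolding sm(2)[OF x, symmetric] fnorm_sq[of "wshift n a j x"]
      by (rule infsum_mono[OF Fock_summable[OF mem[OF x]] sm(1)[OF x] pt[OF x]])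
    also have "\<dots> = (sqrt (1 / a [j]) * fnorm x)\<^sup>2" using aj by (simp add: power_mult_distrib real_sqrt_divide power_divide)
    finally show "fnorm (wshift n a j x) \<le> sqrt (1 / a [j]) * fnorm x"
      by (rule power2_le_imp_le) (use aj in simp)
  next
    fix x y assume "x \<in> Fock n" "y \<in> Fock n"
    then show "wshift n a j (\<lambda>\<beta>. x \<beta> + y \<beta>) = (\<lambda>\<beta>. wshift n a j x \<beta> + wshift n a j y \<beta>)"
      by (auto simp: wshift_def Fock_add fun_eq_iff algebra_simps split: list.splits)
  next
    fix c x assume "x \<in> Fock n"
    then show "wshift n a j (\<lambda>\<beta>. c * x \<beta>) = (\<lambda>\<beta>. c * wshift n a j x \<beta>)"
      by (auto simp: wshift_def Fock_scale fun_eq_iff algebra_simps split: list.splits)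
  qed (use mem in \<open>simp_all add: wshift_def\<close>)
qed

lemma wword_Nil [simp]: "wword n a [] = idop n"
  by (simp add: wword_def)

lemma wword_Cons: "wword n a (i # \<alpha>) = wshift n a i \<circ> wword n a \<alpha>"
  by (simp add: wword_def)

lemma bounded_op_wword:
  assumes "symbol n a" "set \<alpha> \<subseteq> {..<n}"
  shows "bounded_op n (wword n a \<alpha>)"
  using assms(2)
  by (induction \<alpha>) (auto simp: wword_Cons bounded_op_idop intro!: bounded_op_comp bounded_op_wshift[OF assms(1)])

text \<open>The quotients of weights along the word telescope. Cancelling an intermediate weight
  requires it to be nonzero, which is guaranteed only on words over the alphabet; elsewhere the
  value of \<open>x\<close> vanishes, hence the case distinction.\<close>

lemma wword_apply:
  assumes "symbol n a" "set \<alpha> \<subseteq> {..<n}" "x \<in> Fock n"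
  shows "wword n a \<alpha> x \<beta> = (if take (length \<alpha>) \<beta> = \<alpha>
      then complex_of_real (sqrt (bcoef a (drop (length \<alpha>) \<beta>) / bcoef a \<beta>)) * x (drop (length \<alpha>) \<beta>) else 0)"
  using assms(2)
proof (induction \<alpha> arbitrary: \<beta>)
  case Nil
  show ?case
  proof (cases "set \<beta> \<subseteq> {..<n}")
    case True
    then show ?thesis using bcoef_pos[OF assms(1) True] assms(3) by (simp add: idop_def)
  next
    case False
    then show ?thesis using Fock_eq_0[OF assms(3) False] assms(3) by (simp add: idop_def)
  qed
next
  case (Cons i \<alpha>)
  then have \<alpha>: "set \<alpha> \<subseteq> {..<n}" and i: "i < n" by auto
  have F: "wword n a \<alpha> x \<in> Fock n" by (rule bounded_opD(1)[OF bounded_op_wword[OF assms(1) \<alpha>] assms(3)])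
  show ?case
  proof (cases \<beta>)
    case Nil
    then show ?thesis by (simp add: wword_Cons wshift_apply[OF F])
  next
    case (Cons k \<gamma>)
    note IH = Cons.IH[OF \<alpha>, of \<gamma>]
    show ?thesis
    proof (cases "k = i \<and> take (length \<alpha>) \<gamma> = \<alpha> \<and> x (drop (length \<alpha>) \<gamma>) \<noteq> 0")
      case True
      then have "set (drop (length \<alpha>) \<gamma>) \<subseteq> {..<n}" using Fock_letters[OF assms(3)] by blast
      then have "set \<gamma> \<subseteq> {..<n}"
        using True \<alpha> by (metis append_take_drop_id set_append le_sup_iff)
      then have "bcoef a \<gamma> > 0" by (rule bcoef_pos[OF assms(1)])
      then show ?thesis
        using True Cons by (simp add: wword_Cons wshift_apply[OF F] IH real_sqrt_divide del: of_real_divide flip: of_real_mult)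
    next
      case False
      then show ?thesis using Cons by (auto simp: wword_Cons wshift_apply[OF F] IH)
    qed
  qed
qed

subsection \<open>The domain algebra\<close>

lemma polyopsE:
  assumes "P \<in> polyops n a"
  obtains F c where "finite F" "\<And>\<alpha>. \<alpha> \<in> F \<Longrightarrow> set \<alpha> \<subseteq> {..<n}" "P = (\<lambda>x \<beta>. \<Sum>\<alpha>\<in>F. c \<alpha> * wword n a \<alpha> x \<beta>)"
  using assms unfolding polyops_def by blast

lemma polyopsI:
  assumes "finite F" "\<And>\<alpha>. \<alpha> \<in> F \<Longrightarrow> set \<alpha> \<subseteq> {..<n}"
  shows "(\<lambda>x \<beta>. \<Sum>\<alpha>\<in>F. c \<alpha> * wword n a \<alpha> x \<beta>) \<in> polyops n a"
  using assms unfolding polyops_def by blast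

lemma bounded_op_polyops:
  assumes "symbol n a" "P \<in> polyops n a"
  shows "bounded_op n P"
  using assms(2)
  by (rule polyopsE) (auto intro!: bounded_op_sum bounded_op_scale bounded_op_wword[OF assms(1)])

lemma domalg_bounded: "T \<in> domalg n a \<Longrightarrow> bounded_op n T"
  by (simp add: domalg_def)

lemma polyops_domalg:
  assumes "symbol n a" "P \<in> polyops n a"
  shows "P \<in> domalg n a"
proof -
  have "opnorm n (\<lambda>x \<beta>. P x \<beta> - P x \<beta>) \<le> 0" by (rule opnorm_le) auto
  then show ?thesis
    unfolding domalg_def using bounded_op_polyops[OF assms] assms(2) by force
qed

lemma wword_polyops:
  assumes "set \<alpha> \<subseteq> {..<n}"
  shows "wword n a \<alpha> \<in> polyops n a"
  using polyopsI[of "{\<alpha>}" n "\<lambda>_. 1" a] assms by simp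

lemmas wword_domalg = polyops_domalg[OF _ wword_polyops]

lemma polyops_add:
  assumes "P \<in> polyops n a" "Q \<in> polyops n a"
  shows "(\<lambda>x \<beta>. P x \<beta> + Q x \<beta>) \<in> polyops n a"
proof -
  obtain F c where P: "finite F" "\<And>\<alpha>. \<alpha> \<in> F \<Longrightarrow> set \<alpha> \<subseteq> {..<n}" "P = (\<lambda>x \<beta>. \<Sum>\<alpha>\<in>F. c \<alpha> * wword n a \<alpha> x \<beta>)"
    using polyopsE[OF assms(1)] by blast
  obtain G d where Q: "finite G" "\<And>\<alpha>. \<alpha> \<in> G \<Longrightarrow> set \<alpha> \<subseteq> {..<n}" "Q = (\<lambda>x \<beta>. \<Sum>\<alpha>\<in>G. d \<alpha> * wword n a \<alpha> x \<beta>)"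
    using polyopsE[OF assms(2)] by blast
  let ?c = "\<lambda>\<alpha>. if \<alpha> \<in> F then c \<alpha> else 0" and ?d = "\<lambda>\<alpha>. if \<alpha> \<in> G then d \<alpha> else 0"
  have "P x \<beta> = (\<Sum>\<alpha>\<in>F \<union> G. ?c \<alpha> * wword n a \<alpha> x \<beta>)" "Q x \<beta> = (\<Sum>\<alpha>\<in>F \<union> G. ?d \<alpha> * wword n a \<alpha> x \<beta>)" for x \<beta>
    unfolding P(3) Q(3) by (rule sum.mono_neutral_cong_left; use P(1) Q(1) in auto)+
  then have "(\<lambda>x \<beta>. P x \<beta> + Q x \<beta>) = (\<lambda>x \<beta>. \<Sum>\<alpha>\<in>F \<union> G. (?c \<alpha> + ?d \<alpha>) * wword n a \<alpha> x \<beta>)"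
    by (simp only: distrib_right sum.distrib)
  then show ?thesis using polyopsI[of "F \<union> G" n "\<lambda>\<alpha>. ?c \<alpha> + ?d \<alpha>" a] P(1,2) Q(1,2) by auto
qed

lemma polyops_scale:
  assumes "P \<in> polyops n a"
  shows "(\<lambda>x \<beta>. k * P x \<beta>) \<in> polyops n a"
proof -
  obtain F c where P: "finite F" "\<And>\<alpha>. \<alpha> \<in> F \<Longrightarrow> set \<alpha> \<subseteq> {..<n}" "P = (\<lambda>x \<beta>. \<Sum>\<alpha>\<in>F. c \<alpha> * wword n a \<alpha> x \<beta>)"
    using polyopsE[OF assms(1)] by blast
  have "(\<lambda>x \<beta>. k * P x \<beta>) = (\<lambda>x \<beta>. \<Sum>\<alpha>\<in>F. (k * c \<alpha>) * wword n a \<alpha> x \<beta>)"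
    unfolding P(3) by (simp add: sum_distrib_left mult.assoc)
  then show ?thesis using polyopsI[of F n "\<lambda>\<alpha>. k * c \<alpha>" a] P(1,2) by auto
qed

lemma opnorm_triangle:
  assumes "bounded_op n S" "bounded_op n T"
  shows "opnorm n (\<lambda>x \<beta>. S x \<beta> + T x \<beta>) \<le> opnorm n S + opnorm n T"
proof (rule opnorm_le)
  show "0 \<le> opnorm n S + opnorm n T" using opnorm_nonneg[OF assms(1)] opnorm_nonneg[OF assms(2)] by simp
  fix x assume x: "x \<in> Fock n"
  show "fnorm (\<lambda>\<beta>. S x \<beta> + T x \<beta>) \<le> (opnorm n S + opnorm n T) * fnorm x"
    using fnorm_triangle[OF bounded_opD(1)[OF assms(1) x] bounded_opD(1)[OF assms(2) x]]
      opnorm_bound[OF assms(1) x] opnorm_bound[OF assms(2) x] by (simp add: distrib_right)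
qed

lemma opnorm_scale:
  assumes "bounded_op n S"
  shows "opnorm n (\<lambda>x \<beta>. c * S x \<beta>) \<le> cmod c * opnorm n S"
proof (rule opnorm_le)
  show "0 \<le> cmod c * opnorm n S" using opnorm_nonneg[OF assms(1)] by simp
  fix x assume x: "x \<in> Fock n"
  show "fnorm (\<lambda>\<beta>. c * S x \<beta>) \<le> cmod c * opnorm n S * fnorm x"
    using opnorm_bound[OF assms x] by (simp add: fnorm_scale mult.assoc mult_left_mono)
qed

lemma domalg_add:
  assumes a: "symbol n a" and S: "S \<in> domalg n a" and T: "T \<in> domalg n a"
  shows "(\<lambda>x \<beta>. S x \<beta> + T x \<beta>) \<in> domalg n a"
  unfolding domalg_def
proof (intro CollectI conjI allI impI)
  show "bounded_op n (\<lambda>x \<beta>. S x \<beta> + T x \<beta>)" by (intro bounded_op_add domalg_bounded[OF S] domalg_bounded[OF T])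
  fix \<epsilon> :: real assume "\<epsilon> > 0"
  then have e: "\<epsilon> / 2 > 0" by simp
  \<comment> \<open>The sum of the two approximating polynomials approximates the sum, each with
    half of the error.\<close>
  obtain P where P: "P \<in> polyops n a" "opnorm n (\<lambda>x \<beta>. S x \<beta> - P x \<beta>) < \<epsilon> / 2" using S e unfolding domalg_def by blast
  obtain Q where Q: "Q \<in> polyops n a" "opnorm n (\<lambda>x \<beta>. T x \<beta> - Q x \<beta>) < \<epsilon> / 2" using T e unfolding domalg_def by blast
  have "opnorm n (\<lambda>x \<beta>. (S x \<beta> - P x \<beta>) + (T x \<beta> - Q x \<beta>)) \<le> opnorm n (\<lambda>x \<beta>. S x \<beta> - P x \<beta>) + opnorm n (\<lambda>x \<beta>. T x \<beta> - Q x \<beta>)"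
    by (intro opnorm_triangle bounded_op_diff domalg_bounded[OF S] domalg_bounded[OF T] bounded_op_polyops[OF a] P Q)
  then have "opnorm n (\<lambda>x \<beta>. (S x \<beta> + T x \<beta>) - (P x \<beta> + Q x \<beta>)) < \<epsilon>"
    using P(2) Q(2) by (simp add: algebra_simps)
  then show "\<exists>P\<in>polyops n a. opnorm n (\<lambda>x \<beta>. (S x \<beta> + T x \<beta>) - P x \<beta>) < \<epsilon>"
    using polyops_add[OF P(1) Q(1)] by (intro bexI[of _ "\<lambda>x \<beta>. P x \<beta> + Q x \<beta>"]) auto
qed

lemma domalg_scale:
  assumes a: "symbol n a" and S: "S \<in> domalg n a"
  shows "(\<lambda>x \<beta>. c * S x \<beta>) \<in> domalg n a"
  unfolding domalg_def
proof (intro CollectI conjI allI impI)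
  show "bounded_op n (\<lambda>x \<beta>. c * S x \<beta>)" by (intro bounded_op_scale domalg_bounded[OF S])
  fix \<epsilon> :: real assume \<epsilon>: "\<epsilon> > 0"
  then have e: "\<epsilon> / (cmod c + 1) > 0" by (simp add: add_nonneg_pos)
  obtain P where P: "P \<in> polyops n a" "opnorm n (\<lambda>x \<beta>. S x \<beta> - P x \<beta>) < \<epsilon> / (cmod c + 1)"
    using S e unfolding domalg_def by blast
  have d: "bounded_op n (\<lambda>x \<beta>. S x \<beta> - P x \<beta>)"
    by (intro bounded_op_diff domalg_bounded[OF S] bounded_op_polyops[OF a] P)
  have "opnorm n (\<lambda>x \<beta>. c * (S x \<beta> - P x \<beta>)) \<le> cmod c * opnorm n (\<lambda>x \<beta>. S x \<beta> - P x \<beta>)"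
    by (rule opnorm_scale[OF d])
  also have "\<dots> \<le> (cmod c + 1) * opnorm n (\<lambda>x \<beta>. S x \<beta> - P x \<beta>)"
    using opnorm_nonneg[OF d] by (intro mult_right_mono) auto
  also have "\<dots> < \<epsilon>" using P(2) by (simp add: pos_less_divide_eq add_nonneg_pos mult.commute)
  finally show "\<exists>P\<in>polyops n a. opnorm n (\<lambda>x \<beta>. c * S x \<beta> - P x \<beta>) < \<epsilon>"
    using polyops_scale[OF P(1), of c] by (intro bexI[of _ "\<lambda>x \<beta>. c * P x \<beta>"]) (auto simp: right_diff_distrib)
qed

lemma domalg_diff:
  assumes a: "symbol n a" and S: "S \<in> domalg n a" and T: "T \<in> domalg n a"
  shows "(\<lambda>x \<beta>. S x \<beta> - T x \<beta>) \<in> domalg n a"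
  using domalg_add[OF a S domalg_scale[OF a T, of "-1"]] by simp

text \<open>The density principle behind every passage from polynomials to the norm closure. The
  bound compares \<open>L\<close> at the given \<open>T\<close> with \<open>L\<close> at
  polynomials, which allows \<open>L\<close> to be the defect of any identity whose terms are norm
  continuous.\<close>

lemma domalg_functional_eq_0:
  assumes "symbol n a" "T \<in> domalg n a"
    and bd: "\<And>P. P \<in> polyops n a \<Longrightarrow> cmod (L T - L P) \<le> C * opnorm n (\<lambda>x \<beta>. T x \<beta> - P x \<beta>)"
    and z: "\<And>P. P \<in> polyops n a \<Longrightarrow> L P = 0"
  shows "L T = (0::complex)"
proof (rule ccontr)
  assume "L T \<noteq> 0"
  then have pos: "cmod (L T) > 0" by simp
  \<comment> \<open>\<open>\<bar>C\<bar> + 1\<close> keeps the denominator positive whatever the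
    sign of \<open>C\<close>.\<close>
  define \<epsilon> where "\<epsilon> = cmod (L T) / (\<bar>C\<bar> + 1)"
  have "\<epsilon> > 0" using pos by (simp add: \<epsilon>_def add_nonneg_pos)
  then obtain P where P: "P \<in> polyops n a" "opnorm n (\<lambda>x \<beta>. T x \<beta> - P x \<beta>) < \<epsilon>"
    using assms(2) unfolding domalg_def by blast
  have nn: "opnorm n (\<lambda>x \<beta>. T x \<beta> - P x \<beta>) \<ge> 0"
    by (intro opnorm_nonneg bounded_op_diff domalg_bounded[OF assms(2)] bounded_op_polyops[OF assms(1) P(1)])
  have "cmod (L T) \<le> C * opnorm n (\<lambda>x \<beta>. T x \<beta> - P x \<beta>)" using bd[OF P(1)] z[OF P(1)] by simp
  also have "\<dots> \<le> (\<bar>C\<bar> + 1) * opnorm n (\<lambda>x \<beta>. T x \<beta> - P x \<beta>)" using nn by (intro mult_right_mono) auto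
  also have "\<dots> < (\<bar>C\<bar> + 1) * \<epsilon>" using P(2) by (intro mult_strict_left_mono) auto
  also have "\<dots> = cmod (L T)" unfolding \<epsilon>_def by (simp add: add_nonneg_pos)
  finally show False by simp
qed

section \<open>Generating function of the weights\<close>

abbreviation supp :: "(nat list \<Rightarrow> real) \<Rightarrow> nat list set" where
  "supp a \<equiv> {\<alpha>. a \<alpha> \<noteq> 0}"

text \<open>As formal power series this is B = 1 + f B, so the weights are the coefficients of 1 /
  (1 - f). The summation runs over the finite support of the symbol, the same for every
  \<open>\<alpha>\<close>, so it can be interchanged with sums over words.\<close>

lemma bcoef_prefix:
  assumes "symbol n a"
  shows "bcoef a \<alpha> = (if \<alpha> = [] then 1 else 0)
    + (\<Sum>\<beta>\<in>supp a. if take (length \<beta>) \<alpha> = \<beta> then a \<beta> * bcoef a (drop (length \<beta>) \<alpha>) else 0)"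
proof (cases "\<alpha> = []")
  case True
  then show ?thesis using symbolD(3)[OF assms] by (auto intro!: sum.neutral)
next
  case False
  let ?I = "{i\<in>{1..length \<alpha>}. a (take i \<alpha>) \<noteq> 0}"
  have "bcoef a \<alpha> = (\<Sum>i\<in>?I. a (take i \<alpha>) * bcoef a (drop i \<alpha>))"
    unfolding bcoef_rec[OF False] by (rule sum.mono_neutral_right) auto
  also have "\<dots> = (\<Sum>\<beta>\<in>{\<beta>\<in>supp a. take (length \<beta>) \<alpha> = \<beta>}. a \<beta> * bcoef a (drop (length \<beta>) \<alpha>))"
  proof (rule sum.reindex_bij_witness[where i = length and j = "\<lambda>i. take i \<alpha>"])
    fix \<beta> assume b: "\<beta> \<in> {\<beta> \<in> supp a. take (length \<beta>) \<alpha> = \<beta>}"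
    then have "\<beta> \<noteq> []" using symbolD(3)[OF assms] by auto
    moreover have "length \<beta> \<le> length \<alpha>" using b by (metis (mono_tags, lifting) mem_Collect_eq nle_le take_all)
    ultimately show "length \<beta> \<in> ?I" using b by (auto simp: Suc_le_eq)
  qed (auto simp: min_absorb2)
  also have "\<dots> = (\<Sum>\<beta>\<in>supp a. if take (length \<beta>) \<alpha> = \<beta> then a \<beta> * bcoef a (drop (length \<beta>) \<alpha>) else 0)"
    by (rule sum.inter_filter) (rule symbolD(1)[OF assms])
  finally show ?thesis using False by simp
qed

text \<open>Lets sums over all lists stand for sums over words in the alphabet: a letter outside the
  alphabet ends up in some factor, whose coefficient is 0.\<close>

lemma bcoef_eq_0:
  assumes "symbol n a" "\<not> set \<alpha> \<subseteq> {..<n}"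
  shows "bcoef a \<alpha> = 0"
  using assms(2)
proof (induction \<alpha> rule: length_induct)
  case (1 \<alpha>)
  have "a \<beta> * bcoef a (drop (length \<beta>) \<alpha>) = 0" if "\<beta> \<in> supp a" "take (length \<beta>) \<alpha> = \<beta>" for \<beta>
  proof -
    have "set \<beta> \<subseteq> {..<n}" "\<beta> \<noteq> []" using symbolD(2,3)[OF assms(1)] that(1) by auto
    moreover have "set \<alpha> = set \<beta> \<union> set (drop (length \<beta>) \<alpha>)" using that(2) by (metis append_take_drop_id set_append)
    moreover have "\<alpha> \<noteq> []" using 1 by auto
    ultimately have "\<not> set (drop (length \<beta>) \<alpha>) \<subseteq> {..<n}" "length (drop (length \<beta>) \<alpha>) < length \<alpha>"
      using 1 by auto
    then show ?thesis using 1 by simp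
  qed
  then have "(\<Sum>\<beta>\<in>supp a. if take (length \<beta>) \<alpha> = \<beta> then a \<beta> * bcoef a (drop (length \<beta>) \<alpha>) else 0) = 0"
    by (intro sum.neutral) auto
  then show ?case using bcoef_prefix[OF assms(1), of \<alpha>] 1 by auto
qed

text \<open>The monomial of a word evaluated at a tuple of commuting scalars; the order of the
  letters is forgotten here.\<close>

definition wp :: "(nat \<Rightarrow> 'a) \<Rightarrow> nat list \<Rightarrow> 'a::comm_monoid_mult" where
  "wp z \<alpha> = prod_list (map z \<alpha>)"

lemma wp_simps [simp]: "wp z [] = 1" "wp z (i # \<alpha>) = z i * wp z \<alpha>" "wp z (\<alpha> @ \<beta>) = wp z \<alpha> * wp z \<beta>"
  by (simp_all add: wp_def)

lemma wp_norm: "cmod (wp z \<alpha>) = wp (\<lambda>i. cmod (z i)) \<alpha>"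
  by (induction \<alpha>) (auto simp: norm_mult)

lemma wp_cnj: "cnj (wp z \<alpha>) = wp (\<lambda>i. cnj (z i)) \<alpha>"
  by (induction \<alpha>) auto

lemma wp_mult: "wp (\<lambda>i. z i * w i) \<alpha> = wp z \<alpha> * wp w (\<alpha> :: nat list)" for z w :: "nat \<Rightarrow> 'a::comm_monoid_mult"
  by (induction \<alpha>) (auto simp: ac_simps)

lemma wp_nonneg: "(\<And>i. (z i :: real) \<ge> 0) \<Longrightarrow> wp z \<alpha> \<ge> 0"
  by (induction \<alpha>) auto

lemma wp_const: "wp (\<lambda>_. c) \<alpha> = c ^ length \<alpha>"
  by (induction \<alpha>) auto

lemma wp_cong: "(\<And>i. i \<in> set \<alpha> \<Longrightarrow> z i = w i) \<Longrightarrow> wp z \<alpha> = wp w \<alpha>"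
  unfolding wp_def by (metis map_cong)

lemma wp_zero: "\<alpha> \<noteq> [] \<Longrightarrow> wp (\<lambda>_. 0 :: complex) \<alpha> = 0"
  by (cases \<alpha>) auto

lemma wp_take_drop: "wp z (take i \<alpha>) * wp z (drop i \<alpha>) = wp z \<alpha>"
  by (metis append_take_drop_id wp_simps(3))

lemma has_sum_finite_sum:
  fixes f :: "'i \<Rightarrow> 'a \<Rightarrow> 'b::real_normed_vector"
  assumes "\<And>i. i \<in> I \<Longrightarrow> (f i has_sum s i) A"
  shows "((\<lambda>x. \<Sum>i\<in>I. f i x) has_sum (\<Sum>i\<in>I. s i)) A"
  using assms by (induction I rule: infinite_finite_induct) (auto intro!: has_sum_add)

text \<open>Stripping a prefix does not lengthen a word, so the sum S over words of length at most
  \<open>N\<close> satisfies S \<le> 1 + \<rho> S with \<rho> < 1. This bounds all finite sums by 1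
  / (1 - \<rho>). The complex identity can be solved for its sum only after this summability is
  known.\<close>

lemma geometric_kernel_real:
  fixes r :: "nat \<Rightarrow> real"
  assumes a: "symbol n a" and r: "\<And>i. r i \<ge> 0" and lt: "(\<Sum>\<beta>\<in>supp a. a \<beta> * wp r \<beta>) < 1"
  shows "(\<lambda>\<alpha>. bcoef a \<alpha> * wp r \<alpha>) summable_on UNIV"
proof (rule nonneg_bdd_above_summable_on)
  let ?h = "\<lambda>\<alpha>. bcoef a \<alpha> * wp r \<alpha>" and ?\<rho> = "\<Sum>\<beta>\<in>supp a. a \<beta> * wp r \<beta>"
  let ?W = "\<lambda>N. {\<alpha>. set \<alpha> \<subseteq> {..<n} \<and> length \<alpha> \<le> N}"
  have h0: "?h \<alpha> \<ge> 0" for \<alpha> by (simp add: bcoef_nonneg[OF a] wp_nonneg r)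
  then show "\<And>\<alpha>. \<alpha> \<in> UNIV \<Longrightarrow> ?h \<alpha> \<ge> 0" by blast
  have step: "?h \<alpha> = (if \<alpha> = [] then 1 else 0) + (\<Sum>\<beta>\<in>supp a. a \<beta> * wp r \<beta> * (if take (length \<beta>) \<alpha> = \<beta> then ?h (drop (length \<beta>) \<alpha>) else 0))" for \<alpha>
  proof -
    have "?h \<alpha> = (if \<alpha> = [] then 1 else 0) * wp r \<alpha> + (\<Sum>\<beta>\<in>supp a. (if take (length \<beta>) \<alpha> = \<beta> then a \<beta> * bcoef a (drop (length \<beta>) \<alpha>) else 0) * wp r \<alpha>)"
      by (subst bcoef_prefix[OF a]) (simp only: distrib_right sum_distrib_right)
    also have "(\<Sum>\<beta>\<in>supp a. (if take (length \<beta>) \<alpha> = \<beta> then a \<beta> * bcoef a (drop (length \<beta>) \<alpha>) else 0) * wp r \<alpha>)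
      = (\<Sum>\<beta>\<in>supp a. a \<beta> * wp r \<beta> * (if take (length \<beta>) \<alpha> = \<beta> then ?h (drop (length \<beta>) \<alpha>) else 0))"
      by (intro sum.cong refl) (auto simp: ac_simps, metis wp_take_drop mult.commute)
    finally show ?thesis by auto
  qed
  have le: "(\<Sum>\<alpha>\<in>?W N. ?h \<alpha>) \<le> 1 / (1 - ?\<rho>)" for N
  proof -
    have "(\<Sum>\<alpha>\<in>?W N. ?h \<alpha>) = (\<Sum>\<alpha>\<in>?W N. if \<alpha> = [] then 1 else 0)
      + (\<Sum>\<beta>\<in>supp a. a \<beta> * wp r \<beta> * (\<Sum>\<alpha>\<in>?W N. if take (length \<beta>) \<alpha> = \<beta> then ?h (drop (length \<beta>) \<alpha>) else 0))"
      by (subst step) (simp only: sum.distrib sum_distrib_left sum.swap[of _ "supp a"])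
    also have "\<dots> \<le> 1 + (\<Sum>\<beta>\<in>supp a. a \<beta> * wp r \<beta> * (\<Sum>\<gamma>\<in>?W N. ?h \<gamma>))"
    proof (rule add_mono)
      show "(\<Sum>\<alpha>\<in>?W N. if \<alpha> = [] then 1 else 0) \<le> (1::real)"
        by (subst sum.delta[OF finite_words]) auto
      show "(\<Sum>\<beta>\<in>supp a. a \<beta> * wp r \<beta> * (\<Sum>\<alpha>\<in>?W N. if take (length \<beta>) \<alpha> = \<beta> then ?h (drop (length \<beta>) \<alpha>) else 0))
        \<le> (\<Sum>\<beta>\<in>supp a. a \<beta> * wp r \<beta> * (\<Sum>\<gamma>\<in>?W N. ?h \<gamma>))"
      proof (rule sum_mono, rule mult_left_mono)
        fix \<beta>
        let ?P = "{\<alpha>\<in>?W N. take (length \<beta>) \<alpha> = \<beta>}"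
        \<comment> \<open>On words with prefix \<open>\<beta>\<close> the remainder determines the
          word, so the sum over these words is a sum over distinct words of length at most
          \<open>N\<close>.\<close>
        have inj: "inj_on (drop (length \<beta>)) ?P"
          by (rule inj_onI) (metis (mono_tags, lifting) append_take_drop_id mem_Collect_eq)
        have "(\<Sum>\<alpha>\<in>?W N. if take (length \<beta>) \<alpha> = \<beta> then ?h (drop (length \<beta>) \<alpha>) else 0) = (\<Sum>\<alpha>\<in>?P. ?h (drop (length \<beta>) \<alpha>))"
          by (rule sum.inter_filter[symmetric]) (rule finite_words)
        also have "\<dots> = sum ?h (drop (length \<beta>) ` ?P)" by (subst sum.reindex[OF inj]) (simp add: o_def)
        also have "\<dots> \<le> (\<Sum>\<gamma>\<in>?W N. ?h \<gamma>)"
          by (rule sum_mono2[OF finite_words]) (use h0 in \<open>auto dest: in_set_dropD\<close>)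
        finally show "(\<Sum>\<alpha>\<in>?W N. if take (length \<beta>) \<alpha> = \<beta> then ?h (drop (length \<beta>) \<alpha>) else 0) \<le> (\<Sum>\<gamma>\<in>?W N. ?h \<gamma>)" .
        show "0 \<le> a \<beta> * wp r \<beta>" by (simp add: symbolD(4)[OF a] wp_nonneg r)
      qed
    qed
    also have "\<dots> = 1 + ?\<rho> * (\<Sum>\<gamma>\<in>?W N. ?h \<gamma>)" by (simp add: sum_distrib_right)
    finally show ?thesis using lt by (simp add: field_simps)
  qed
  have "sum ?h F \<le> 1 / (1 - ?\<rho>)" if "finite F" for F
  proof -
    obtain N where N: "\<forall>\<alpha>\<in>F. length \<alpha> \<le> N" using \<open>finite F\<close> by (meson finite_nat_set_iff_bounded_le finite_imageI imageI)
    have "sum ?h F = sum ?h (F \<inter> {\<alpha>. set \<alpha> \<subseteq> {..<n}})"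
      by (rule sum.mono_neutral_right) (use that in \<open>auto simp: bcoef_eq_0[OF a]\<close>)
    also have "\<dots> \<le> sum ?h (?W N)" by (rule sum_mono2[OF finite_words]) (use N h0 in auto)
    also note le
    finally show ?thesis .
  qed
  then show "bdd_above (sum ?h ` {F. F \<subseteq> UNIV \<and> finite F})" by (intro bdd_aboveI2) auto
qed

text \<open>Summing the prefix recursion gives S = 1 + \<rho> S; the equation itself shows 1 -
  \<rho> \<noteq> 0.\<close>

lemma geometric_kernel:
  fixes u :: "nat \<Rightarrow> complex"
  assumes a: "symbol n a" and lt: "(\<Sum>\<beta>\<in>supp a. a \<beta> * cmod (wp u \<beta>)) < 1"
  shows "((\<lambda>\<alpha>. of_real (bcoef a \<alpha>) * wp u \<alpha>) has_sum 1 / (1 - (\<Sum>\<beta>\<in>supp a. of_real (a \<beta>) * wp u \<beta>))) UNIV"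
proof -
  let ?h = "\<lambda>\<alpha>. of_real (bcoef a \<alpha>) * wp u \<alpha>" and ?\<rho> = "\<Sum>\<beta>\<in>supp a. of_real (a \<beta>) * wp u \<beta>"
  have "(\<lambda>\<alpha>. norm (?h \<alpha>)) summable_on UNIV"
    using geometric_kernel_real[OF a, of "\<lambda>i. cmod (u i)"] lt by (simp add: norm_mult wp_norm bcoef_nonneg[OF a])
  then have sm: "?h summable_on UNIV" by (rule abs_summable_summable)
  have step: "?h \<alpha> = (if \<alpha> = [] then 1 else 0) + (\<Sum>\<beta>\<in>supp a. (if take (length \<beta>) \<alpha> = \<beta> then (\<lambda>\<gamma>. (of_real (a \<beta>) * wp u \<beta>) * ?h \<gamma>) (drop (length \<beta>) \<alpha>) else 0))" for \<alpha>
  proof -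
    have "?h \<alpha> = of_real (if \<alpha> = [] then 1 else 0) * wp u \<alpha> + (\<Sum>\<beta>\<in>supp a. of_real (if take (length \<beta>) \<alpha> = \<beta> then a \<beta> * bcoef a (drop (length \<beta>) \<alpha>) else 0) * wp u \<alpha>)"
      by (subst bcoef_prefix[OF a]) (simp only: of_real_add of_real_sum distrib_right sum_distrib_right)
    also have "(\<Sum>\<beta>\<in>supp a. of_real (if take (length \<beta>) \<alpha> = \<beta> then a \<beta> * bcoef a (drop (length \<beta>) \<alpha>) else 0) * wp u \<alpha>)
      = (\<Sum>\<beta>\<in>supp a. (if take (length \<beta>) \<alpha> = \<beta> then (\<lambda>\<gamma>. (of_real (a \<beta>) * wp u \<beta>) * ?h \<gamma>) (drop (length \<beta>) \<alpha>) else 0))"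
      by (intro sum.cong refl) (auto simp: ac_simps, metis wp_take_drop mult.commute)
    finally show ?thesis by auto
  qed
  have app: "((\<lambda>\<alpha>. if take (length \<beta>) \<alpha> = \<beta> then (\<lambda>\<gamma>. (of_real (a \<beta>) * wp u \<beta>) * ?h \<gamma>) (drop (length \<beta>) \<alpha>) else 0) has_sum (of_real (a \<beta>) * wp u \<beta>) * infsum ?h UNIV) UNIV" for \<beta>
    unfolding infsum_cmult_right'[symmetric]
    using append_summable[OF summable_on_cmult_right[OF sm, of "of_real (a \<beta>) * wp u \<beta>"], of \<beta>]
    by (metis (no_types, lifting) has_sum_infsum)
  have "((\<lambda>\<alpha>. (if \<alpha> = [] then 1 else 0) + (\<Sum>\<beta>\<in>supp a. (if take (length \<beta>) \<alpha> = \<beta> then (\<lambda>\<gamma>. (of_real (a \<beta>) * wp u \<beta>) * ?h \<gamma>) (drop (length \<beta>) \<alpha>) else 0)))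
     has_sum 1 + (\<Sum>\<beta>\<in>supp a. (of_real (a \<beta>) * wp u \<beta>) * infsum ?h UNIV)) UNIV"
  proof (intro has_sum_add has_sum_finite_sum app)
    show "((\<lambda>\<alpha>::nat list. if \<alpha> = [] then 1 else 0) has_sum (1::complex)) UNIV"
      by (rule has_sum_finite_neutralI[of "{[]}"]) auto
  qed
  then have "(?h has_sum 1 + (\<Sum>\<beta>\<in>supp a. (of_real (a \<beta>) * wp u \<beta>) * infsum ?h UNIV)) UNIV"
    by (subst (asm) step[symmetric])
  then have "infsum ?h UNIV = 1 + ?\<rho> * infsum ?h UNIV" unfolding sum_distrib_right by (rule infsumI)
  then have *: "infsum ?h UNIV * (1 - ?\<rho>) = 1" by (simp add: algebra_simps)
  then have "1 - ?\<rho> \<noteq> 0" by auto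
  then have "infsum ?h UNIV = 1 / (1 - ?\<rho>)" using * by (simp add: field_simps)
  then show ?thesis using has_sum_infsum[OF sm] by simp
qed

subsection \<open>Point evaluations\<close>

text \<open>\<open>pairing a z w\<close> is the symbol evaluated at the commuting tuples \<open>z\<close> and the conjugate of \<open>w\<close>; the
  characters used below are the points with \<open>rho a z < 1\<close>. Their evaluation functionals are induced by the
  vectors \<open>kv a z\<close>, which are joint eigenvectors of the adjoints of all elements of the algebra.\<close>

definition pairing :: "(nat list \<Rightarrow> real) \<Rightarrow> (nat \<Rightarrow> complex) \<Rightarrow> (nat \<Rightarrow> complex) \<Rightarrow> complex" where
  "pairing a z w = (\<Sum>\<alpha>\<in>supp a. of_real (a \<alpha>) * wp z \<alpha> * cnj (wp w \<alpha>))"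

definition rho :: "(nat list \<Rightarrow> real) \<Rightarrow> (nat \<Rightarrow> complex) \<Rightarrow> real" where
  "rho a z = (\<Sum>\<alpha>\<in>supp a. a \<alpha> * (cmod (wp z \<alpha>))\<^sup>2)"

definition kv :: "(nat list \<Rightarrow> real) \<Rightarrow> (nat \<Rightarrow> complex) \<Rightarrow> nat list \<Rightarrow> complex" where
  "kv a z \<alpha> = of_real (sqrt (bcoef a \<alpha>)) * cnj (wp z \<alpha>)"

definition vac :: "nat list \<Rightarrow> complex" where
  "vac \<beta> = (if \<beta> = [] then 1 else 0)"

definition ev :: "(nat list \<Rightarrow> real) \<Rightarrow> (nat \<Rightarrow> complex) \<Rightarrow> op \<Rightarrow> complex" where
  "ev a z T = ip (T vac) (kv a z)"

lemma pairing_self: "pairing a z z = of_real (rho a z)"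
  unfolding pairing_def rho_def of_real_sum of_real_mult
  by (intro sum.cong refl) (metis complex_norm_square mult.assoc)

lemma pairing_cnj: "pairing a w z = cnj (pairing a z w)"
  unfolding pairing_def by (simp add: mult_ac)

lemma rho_nonneg: "symbol n a \<Longrightarrow> rho a z \<ge> 0"
  unfolding rho_def by (intro sum_nonneg mult_nonneg_nonneg) (auto simp: symbolD(4))

lemma pairing_abs:
  assumes a: "symbol n a"
  shows "(\<Sum>\<alpha>\<in>supp a. a \<alpha> * cmod (wp z \<alpha>) * cmod (wp w \<alpha>)) \<le> (rho a z + rho a w) / 2"
proof -
  have "(\<Sum>\<alpha>\<in>supp a. a \<alpha> * cmod (wp z \<alpha>) * cmod (wp w \<alpha>)) \<le> (\<Sum>\<alpha>\<in>supp a. a \<alpha> * ((cmod (wp z \<alpha>))\<^sup>2 + (cmod (wp w \<alpha>))\<^sup>2) / 2)"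
  proof (rule sum_mono)
    fix \<alpha>
    have "cmod (wp z \<alpha>) * cmod (wp w \<alpha>) \<le> ((cmod (wp z \<alpha>))\<^sup>2 + (cmod (wp w \<alpha>))\<^sup>2) / 2"
      using sum_squares_bound[of "cmod (wp z \<alpha>)" "cmod (wp w \<alpha>)"] by simp
    from mult_left_mono[OF this symbolD(4)[OF a, of \<alpha>]]
    show "a \<alpha> * cmod (wp z \<alpha>) * cmod (wp w \<alpha>) \<le> a \<alpha> * ((cmod (wp z \<alpha>))\<^sup>2 + (cmod (wp w \<alpha>))\<^sup>2) / 2"
      by (simp add: mult.assoc)
  qed
  also have "\<dots> = (rho a z + rho a w) / 2"
    unfolding rho_def by (simp add: distrib_left sum.distrib flip: sum_divide_distrib)
  finally show ?thesis .
qed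

lemma pairing_ne_1:
  assumes "symbol n a" "rho a z < 1" "rho a w < 1"
  shows "1 - pairing a z w \<noteq> 0"
proof -
  have "cmod (pairing a z w) \<le> (\<Sum>\<alpha>\<in>supp a. a \<alpha> * cmod (wp z \<alpha>) * cmod (wp w \<alpha>))"
    unfolding pairing_def by (rule order_trans[OF norm_sum]) (simp add: norm_mult symbolD(4)[OF assms(1)])
  also have "\<dots> \<le> (rho a z + rho a w) / 2" by (rule pairing_abs[OF assms(1)])
  also have "\<dots> < 1" using assms(2,3) by simp
  finally have "cmod (pairing a z w) < 1" .
  then show ?thesis by auto
qed

text \<open>The product of two kernel vectors is the geometric series at the pointwise product tuple
  \<open>u\<close>; the arithmetic-geometric estimate \<open>pairing_abs\<close> keeps that tuple
  within the range of convergence. The value is the reproducing kernel of the domain.\<close>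

lemma kv_has_sum:
  assumes "symbol n a" "rho a z < 1" "rho a w < 1"
  shows "((\<lambda>\<alpha>. kv a z \<alpha> * cnj (kv a w \<alpha>)) has_sum 1 / (1 - pairing a w z)) UNIV"
proof -
  define u where "u = (\<lambda>i. w i * cnj (z i))"
  have u: "wp u \<alpha> = wp w \<alpha> * cnj (wp z \<alpha>)" for \<alpha> by (simp add: u_def wp_mult wp_cnj)
  have "(\<Sum>\<beta>\<in>supp a. a \<beta> * cmod (wp u \<beta>)) < 1"
    using pairing_abs[OF assms(1), of w z] assms(2,3) by (simp add: u norm_mult mult.assoc)
  from geometric_kernel[OF assms(1) this] show ?thesis
    by (simp add: u pairing_def kv_def mult_ac bcoef_nonneg[OF assms(1)] flip: of_real_mult)
qed

lemma kv_Fock: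
  assumes "symbol n a" "rho a z < 1"
  shows "kv a z \<in> Fock n"
proof -
  have "((\<lambda>\<alpha>. norm (kv a z \<alpha> * cnj (kv a z \<alpha>))) summable_on UNIV)"
    using kv_has_sum[OF assms assms(2)] summable_on_iff_abs_summable_on_complex[of "\<lambda>\<alpha>. kv a z \<alpha> * cnj (kv a z \<alpha>)" UNIV]
    by (auto simp: has_sum_imp_summable)
  then have "(\<lambda>\<alpha>. (cmod (kv a z \<alpha>))\<^sup>2) summable_on UNIV" by (simp add: norm_mult power2_eq_square)
  moreover have "set \<alpha> \<subseteq> {..<n}" if "kv a z \<alpha> \<noteq> 0" for \<alpha>
    using that bcoef_eq_0[OF assms(1), of \<alpha>] by (auto simp: kv_def)
  ultimately show ?thesis unfolding Fock_def by blast
qed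

lemma kv_ip:
  assumes "symbol n a" "rho a z < 1" "rho a w < 1"
  shows "ip (kv a z) (kv a w) = 1 / (1 - pairing a w z)"
  unfolding ip_def by (rule infsumI[OF kv_has_sum[OF assms]])

lemma kv_norm:
  assumes "symbol n a" "rho a z < 1"
  shows "(fnorm (kv a z))\<^sup>2 = 1 / (1 - rho a z)"
proof -
  have "complex_of_real ((fnorm (kv a z))\<^sup>2) = of_real (1 / (1 - rho a z))"
    using kv_ip[OF assms assms(2)] ip_self[OF kv_Fock[OF assms]] by (simp add: pairing_self)
  then show ?thesis by (simp only: of_real_eq_iff)
qed

lemma vac_Fock: "vac \<in> Fock n"
  by (rule Fock_finite_support[of "{[]}"]) (auto simp: vac_def split: if_splits)

lemma ip_vac: "ip vac y = cnj (y [])"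
proof -
  have "((\<lambda>\<alpha>. vac \<alpha> * cnj (y \<alpha>)) has_sum cnj (y [])) UNIV"
    by (rule has_sum_finite_neutralI[of "{[]}"]) (auto simp: vac_def)
  then show ?thesis unfolding ip_def by (rule infsumI)
qed

lemma fnorm_vac: "fnorm vac = 1"
proof -
  have "complex_of_real ((fnorm vac)\<^sup>2) = 1" using ip_self[OF vac_Fock[of 0]] by (simp add: ip_vac vac_def)
  then have "(fnorm vac)\<^sup>2 = 1" using of_real_eq_1_iff by blast
  then show ?thesis using fnorm_nonneg[of vac] by (auto simp: power2_eq_1_iff)
qed

text \<open>The square roots in the shift cancel against those in the kernel vector, so the adjoint
  of each operator word multiplies \<open>kv a z\<close> by the conjugate of a monomial.\<close>

lemma wword_kv:
  assumes a: "symbol n a" and z: "rho a z < 1" and \<alpha>: "set \<alpha> \<subseteq> {..<n}" and x: "x \<in> Fock n"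
  shows "ip (wword n a \<alpha> x) (kv a z) = wp z \<alpha> * ip x (kv a z)"
proof -
  have "wword n a \<alpha> x \<beta> * cnj (kv a z \<beta>) = (if take (length \<alpha>) \<beta> = \<alpha> then
      (\<lambda>\<gamma>. wp z \<alpha> * (x \<gamma> * cnj (kv a z \<gamma>))) (drop (length \<alpha>) \<beta>) else 0)" for \<beta>
  proof (cases "take (length \<alpha>) \<beta> = \<alpha> \<and> x (drop (length \<alpha>) \<beta>) \<noteq> 0")
    case True
    then have "set (drop (length \<alpha>) \<beta>) \<subseteq> {..<n}" using Fock_letters[OF x] by blast
    then have "set \<beta> \<subseteq> {..<n}"
      using True \<alpha> by (metis append_take_drop_id set_append le_sup_iff)
    then have "bcoef a \<beta> > 0" by (rule bcoef_pos[OF a])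
    moreover have "wp z \<beta> = wp z \<alpha> * wp z (drop (length \<alpha>) \<beta>)" using True wp_take_drop by metis
    ultimately show ?thesis
      using True by (simp add: wword_apply[OF a \<alpha> x] kv_def real_sqrt_divide)
  next
    case False
    then show ?thesis by (auto simp: wword_apply[OF a \<alpha> x])
  qed
  then have "ip (wword n a \<alpha> x) (kv a z) = (\<Sum>\<^sub>\<infinity>\<beta>. if take (length \<alpha>) \<beta> = \<alpha> then
      (\<lambda>\<gamma>. wp z \<alpha> * (x \<gamma> * cnj (kv a z \<gamma>))) (drop (length \<alpha>) \<beta>) else 0)" unfolding ip_def by simp
  also have "\<dots> = (\<Sum>\<^sub>\<infinity>\<gamma>. wp z \<alpha> * (x \<gamma> * cnj (kv a z \<gamma>)))"
    by (rule append_summable(2)) (intro summable_on_cmult_right ip_summable[OF x kv_Fock[OF a z]])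
  also have "\<dots> = wp z \<alpha> * ip x (kv a z)" unfolding ip_def by (rule infsum_cmult_right')
  finally show ?thesis .
qed

lemma ip_kv_vac: "ip vac (kv a z) = 1"
  by (simp add: ip_vac kv_def)

lemma ev_wword:
  assumes "symbol n a" "rho a z < 1" "set \<alpha> \<subseteq> {..<n}"
  shows "ev a z (wword n a \<alpha>) = wp z \<alpha>"
  unfolding ev_def by (simp add: wword_kv[OF assms vac_Fock] ip_kv_vac)

lemma ip_op_diff_bound:
  assumes "bounded_op n S" "bounded_op n T" "x \<in> Fock n" "y \<in> Fock n"
  shows "cmod (ip (S x) y - ip (T x) y) \<le> opnorm n (\<lambda>x \<beta>. S x \<beta> - T x \<beta>) * fnorm x * fnorm y"
proof -
  have d: "bounded_op n (\<lambda>x \<beta>. S x \<beta> - T x \<beta>)" by (intro bounded_op_diff assms)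
  have "ip (S x) y - ip (T x) y = ip (\<lambda>\<beta>. S x \<beta> - T x \<beta>) y"
    by (rule ip_diff_left[symmetric]) (auto intro: bounded_opD(1) assms)
  also have "cmod \<dots> \<le> fnorm (\<lambda>\<beta>. S x \<beta> - T x \<beta>) * fnorm y"
    by (rule ip_Cauchy_Schwarz[OF bounded_opD(1)[OF d assms(3)] assms(4)])
  also have "\<dots> \<le> opnorm n (\<lambda>x \<beta>. S x \<beta> - T x \<beta>) * fnorm x * fnorm y"
    by (intro mult_right_mono opnorm_bound[OF d assms(3)]) simp
  finally show ?thesis .
qed

lemma ev_diff_bound:
  assumes "symbol n a" "rho a z < 1" "bounded_op n S" "bounded_op n T"
  shows "cmod (ev a z S - ev a z T) \<le> opnorm n (\<lambda>x \<beta>. S x \<beta> - T x \<beta>) * fnorm (kv a z)"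
  using ip_op_diff_bound[OF assms(3,4) vac_Fock kv_Fock[OF assms(1,2)]] by (simp add: ev_def fnorm_vac)

lemma ip_polyop:
  assumes "symbol n a" "finite F" "\<And>\<alpha>. \<alpha> \<in> F \<Longrightarrow> set \<alpha> \<subseteq> {..<n}" "x \<in> Fock n" "y \<in> Fock n"
  shows "ip (\<lambda>\<beta>. \<Sum>\<alpha>\<in>F. c \<alpha> * wword n a \<alpha> x \<beta>) y = (\<Sum>\<alpha>\<in>F. c \<alpha> * ip (wword n a \<alpha> x) y)"
  by (subst ip_sum_left) (auto simp: ip_scale_left intro!: assms Fock_scale bounded_opD(1)[OF bounded_op_wword])

text \<open>The eigenvalue must be \<open>ev a z T\<close>, as one sees at the vacuum, where
  \<open>ip vac (kv a z) = 1\<close>. Multiplicativity of \<open>ev\<close> is an immediate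
  consequence.\<close>

lemma domalg_kv:
  assumes a: "symbol n a" and z: "rho a z < 1" and T: "T \<in> domalg n a" and x: "x \<in> Fock n"
  shows "ip (T x) (kv a z) = ev a z T * ip x (kv a z)"
proof -
  define L where "L T = ip (T x) (kv a z) - ev a z T * ip x (kv a z)" for T
  have "L T = 0"
  proof (rule domalg_functional_eq_0[OF a T])
    fix P assume P: "P \<in> polyops n a"
    let ?d = "opnorm n (\<lambda>x \<beta>. T x \<beta> - P x \<beta>)"
    have PT: "bounded_op n T" "bounded_op n P" using domalg_bounded[OF T] bounded_op_polyops[OF a P] by auto
    have "cmod (L T - L P) = cmod ((ip (T x) (kv a z) - ip (P x) (kv a z)) - (ev a z T - ev a z P) * ip x (kv a z))"
      by (simp add: L_def algebra_simps)
    also have "\<dots> \<le> ?d * fnorm x * fnorm (kv a z) + ?d * fnorm (kv a z) * cmod (ip x (kv a z))"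
      by (rule order_trans[OF norm_triangle_ineq4])
         (intro add_mono ip_op_diff_bound[OF PT x kv_Fock[OF a z]], simp add: norm_mult mult_right_mono ev_diff_bound[OF a z PT])
    finally show "cmod (L T - L P) \<le> (fnorm x * fnorm (kv a z) + fnorm (kv a z) * cmod (ip x (kv a z))) * ?d"
      by (simp add: algebra_simps)
    obtain F c where F: "finite F" "\<And>\<alpha>. \<alpha> \<in> F \<Longrightarrow> set \<alpha> \<subseteq> {..<n}" "P = (\<lambda>x \<beta>. \<Sum>\<alpha>\<in>F. c \<alpha> * wword n a \<alpha> x \<beta>)"
      using polyopsE[OF P] by blast
    have "ip (P y) (kv a z) = (\<Sum>\<alpha>\<in>F. c \<alpha> * wp z \<alpha>) * ip y (kv a z)" if "y \<in> Fock n" for y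
      unfolding F(3) sum_distrib_right
      by (subst ip_polyop[OF a F(1) F(2) that kv_Fock[OF a z]]) (auto intro!: sum.cong simp: wword_kv[OF a z F(2) that])
    from this[OF x] this[OF vac_Fock] show "L P = 0" by (simp add: L_def ev_def ip_kv_vac)
  qed
  then show ?thesis by (simp add: L_def)
qed

lemma ev_mult:
  assumes "symbol n a" "rho a z < 1" "S \<in> domalg n a" "T \<in> domalg n a"
  shows "ev a z (S \<circ> T) = ev a z S * ev a z T"
  using domalg_kv[OF assms(1,2,3) bounded_opD(1)[OF domalg_bounded[OF assms(4)] vac_Fock]]
  by (simp add: ev_def)

lemma ev_idop: "ev a z (idop n) = 1"
  by (simp add: ev_def idop_def vac_Fock ip_kv_vac)

subsection \<open>Fourier coefficients\<close>

text \<open>Coordinates rescaled so that the weighted shifts become plain prefixing of letters. For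
  \<open>T vac\<close> they are the coefficients of the formal series of \<open>T\<close> in the
  operator words.\<close>

definition hv :: "(nat list \<Rightarrow> real) \<Rightarrow> (nat list \<Rightarrow> complex) \<Rightarrow> nat list \<Rightarrow> complex" where
  "hv a x \<beta> = of_real (sqrt (bcoef a \<beta>)) * x \<beta>"

definition hat :: "(nat list \<Rightarrow> real) \<Rightarrow> op \<Rightarrow> nat list \<Rightarrow> complex" where
  "hat a T = hv a (T vac)"

lemma hv_wword:
  assumes a: "symbol n a" and \<alpha>: "set \<alpha> \<subseteq> {..<n}" and x: "x \<in> Fock n"
  shows "hv a (wword n a \<alpha> x) \<beta> = (if take (length \<alpha>) \<beta> = \<alpha> then hv a x (drop (length \<alpha>) \<beta>) else 0)"
proof (cases "take (length \<alpha>) \<beta> = \<alpha> \<and> x (drop (length \<alpha>) \<beta>) \<noteq> 0")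
  case True
  then have "set (drop (length \<alpha>) \<beta>) \<subseteq> {..<n}" using Fock_letters[OF x] by blast
  then have "set \<beta> \<subseteq> {..<n}"
    using True \<alpha> by (metis append_take_drop_id set_append le_sup_iff)
  then have "bcoef a \<beta> > 0" by (rule bcoef_pos[OF a])
  then show ?thesis
    using True by (simp add: wword_apply[OF a \<alpha> x] hv_def real_sqrt_divide)
next
  case False
  then show ?thesis by (auto simp: wword_apply[OF a \<alpha> x] hv_def)
qed

lemma hat_wword:
  assumes a: "symbol n a" and \<alpha>: "set \<alpha> \<subseteq> {..<n}"
  shows "hat a (wword n a \<alpha>) \<beta> = (if \<beta> = \<alpha> then 1 else 0)"
proof -
  have "take (length \<alpha>) \<beta> = \<alpha> \<and> length \<beta> \<le> length \<alpha> \<longleftrightarrow> \<beta> = \<alpha>" by auto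
  then show ?thesis
    unfolding hat_def hv_wword[OF a \<alpha> vac_Fock] by (auto simp: hv_def vac_def)
qed

lemma hv_bound:
  assumes "symbol n a" "bounded_op n S" "bounded_op n T" "x \<in> Fock n"
  shows "cmod (hv a (S x) \<beta> - hv a (T x) \<beta>) \<le> sqrt (bcoef a \<beta>) * fnorm x * opnorm n (\<lambda>x \<beta>. S x \<beta> - T x \<beta>)"
proof -
  have d: "bounded_op n (\<lambda>x \<beta>. S x \<beta> - T x \<beta>)" by (intro bounded_op_diff assms)
  have "cmod (hv a (S x) \<beta> - hv a (T x) \<beta>) = sqrt (bcoef a \<beta>) * cmod (S x \<beta> - T x \<beta>)"
    by (simp add: hv_def norm_mult bcoef_nonneg[OF assms(1)] flip: right_diff_distrib)
  also have "\<dots> \<le> sqrt (bcoef a \<beta>) * (opnorm n (\<lambda>x \<beta>. S x \<beta> - T x \<beta>) * fnorm x)"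
    using fnorm_coord_le[OF bounded_opD(1)[OF d assms(4)]] opnorm_bound[OF d assms(4)]
    by (intro mult_left_mono) (auto simp: bcoef_nonneg[OF assms(1)] intro: order_trans)
  finally show ?thesis by (simp add: mult_ac)
qed

lemma hat_bound:
  assumes "symbol n a" "bounded_op n S" "bounded_op n T"
  shows "cmod (hat a S \<beta> - hat a T \<beta>) \<le> sqrt (bcoef a \<beta>) * opnorm n (\<lambda>x \<beta>. S x \<beta> - T x \<beta>)"
  using hv_bound[OF assms vac_Fock] by (simp add: hat_def fnorm_vac)

text \<open>For polynomials this is the rule for prefixing a word. Each coordinate depends
  continuously on the operator, so the convolution formula survives in the closure, one finite sum
  per coordinate.\<close>

lemma hv_conv:
  assumes a: "symbol n a" and T: "T \<in> domalg n a" and x: "x \<in> Fock n"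
  shows "hv a (T x) \<beta> = (\<Sum>i\<le>length \<beta>. hat a T (take i \<beta>) * hv a x (drop i \<beta>))"
proof -
  define L where "L T = hv a (T x) \<beta> - (\<Sum>i\<le>length \<beta>. hat a T (take i \<beta>) * hv a x (drop i \<beta>))" for T
  have "L T = 0"
  proof (rule domalg_functional_eq_0[OF a T])
    fix P assume P: "P \<in> polyops n a"
    let ?d = "opnorm n (\<lambda>x \<beta>. T x \<beta> - P x \<beta>)"
    have PT: "bounded_op n T" "bounded_op n P" using domalg_bounded[OF T] bounded_op_polyops[OF a P] by auto
    have "cmod (L T - L P) = cmod ((hv a (T x) \<beta> - hv a (P x) \<beta>) - (\<Sum>i\<le>length \<beta>. (hat a T (take i \<beta>) - hat a P (take i \<beta>)) * hv a x (drop i \<beta>)))"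
      by (simp add: L_def algebra_simps sum_subtractf)
    also have "\<dots> \<le> cmod (hv a (T x) \<beta> - hv a (P x) \<beta>) + (\<Sum>i\<le>length \<beta>. cmod ((hat a T (take i \<beta>) - hat a P (take i \<beta>)) * hv a x (drop i \<beta>)))"
      by (rule order_trans[OF norm_triangle_ineq4]) (intro add_mono order_refl norm_sum)
    also have "\<dots> \<le> sqrt (bcoef a \<beta>) * fnorm x * ?d + (\<Sum>i\<le>length \<beta>. sqrt (bcoef a (take i \<beta>)) * ?d * cmod (hv a x (drop i \<beta>)))"
      unfolding norm_mult by (intro add_mono sum_mono mult_right_mono hv_bound[OF a PT x] hat_bound[OF a PT]) simp
    finally show "cmod (L T - L P) \<le> (sqrt (bcoef a \<beta>) * fnorm x + (\<Sum>i\<le>length \<beta>. sqrt (bcoef a (take i \<beta>)) * cmod (hv a x (drop i \<beta>)))) * ?d"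
      unfolding distrib_right sum_distrib_right by (simp only: mult_ac)
    obtain F c where F: "finite F" "\<And>\<alpha>. \<alpha> \<in> F \<Longrightarrow> set \<alpha> \<subseteq> {..<n}" "P = (\<lambda>x \<beta>. \<Sum>\<alpha>\<in>F. c \<alpha> * wword n a \<alpha> x \<beta>)"
      using polyopsE[OF P] by blast
    have hP: "hv a (P y) \<gamma> = (\<Sum>\<alpha>\<in>F. c \<alpha> * hv a (wword n a \<alpha> y) \<gamma>)" for y \<gamma>
      unfolding F(3) hv_def by (simp add: sum_distrib_left mult_ac)
    have "(\<Sum>i\<le>length \<beta>. hat a P (take i \<beta>) * hv a x (drop i \<beta>)) = (\<Sum>\<alpha>\<in>F. c \<alpha> * (\<Sum>i\<le>length \<beta>. hat a (wword n a \<alpha>) (take i \<beta>) * hv a x (drop i \<beta>)))"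
      unfolding hat_def hP by (simp add: sum_distrib_left sum_distrib_right mult.assoc) (rule sum.swap)
    also have "\<dots> = (\<Sum>\<alpha>\<in>F. c \<alpha> * hv a (wword n a \<alpha> x) \<beta>)"
    proof (intro sum.cong refl arg_cong2[where f = "(*)"])
      fix \<alpha> assume \<alpha>: "\<alpha> \<in> F"
      \<comment> \<open>Only the cut at \<open>length \<alpha>\<close> can contribute, and only when
        the prefix cut off there is \<open>\<alpha>\<close>.\<close>
      have "(\<Sum>i\<le>length \<beta>. hat a (wword n a \<alpha>) (take i \<beta>) * hv a x (drop i \<beta>))
        = (\<Sum>i\<le>length \<beta>. if i = length \<alpha> then (if take (length \<alpha>) \<beta> = \<alpha> then hv a x (drop (length \<alpha>) \<beta>) else 0) else 0)"
        by (intro sum.cong refl) (auto simp: hat_wword[OF a F(2)[OF \<alpha>]])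
      also have "\<dots> = hv a (wword n a \<alpha> x) \<beta>"
        unfolding hv_wword[OF a F(2)[OF \<alpha>] x] by (auto dest: arg_cong[of _ _ length])
      finally show "(\<Sum>i\<le>length \<beta>. hat a (wword n a \<alpha>) (take i \<beta>) * hv a x (drop i \<beta>)) = hv a (wword n a \<alpha> x) \<beta>" .
    qed
    finally show "L P = 0" by (simp add: L_def hP)
  qed
  then show ?thesis by (simp add: L_def)
qed

lemma hat_mult:
  assumes a: "symbol n a" and S: "S \<in> domalg n a" and T: "T \<in> domalg n a"
  shows "hat a (S \<circ> T) \<beta> = (\<Sum>i\<le>length \<beta>. hat a S (take i \<beta>) * hat a T (drop i \<beta>))"
  using hv_conv[OF a S bounded_opD(1)[OF domalg_bounded[OF T] vac_Fock]] by (simp add: hat_def)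

lemma hat_Nil:
  assumes "T vac \<in> Fock n"
  shows "hat a T [] = ev a (\<lambda>_. 0) T"
proof -
  have "((\<lambda>\<alpha>. T vac \<alpha> * cnj (kv a (\<lambda>_. 0) \<alpha>)) has_sum T vac []) UNIV"
    by (rule has_sum_finite_neutralI[of "{[]}"]) (auto simp: kv_def wp_zero)
  then have "ip (T vac) (kv a (\<lambda>_. 0)) = T vac []" unfolding ip_def by (rule infsumI)
  then show ?thesis by (simp add: hat_def hv_def ev_def)
qed

subsection \<open>Row contractions\<close>

text \<open>Indexed by a set of words, so that the support of a symbol can be used directly; an
  enumeration is chosen only when the row is compared with a matrix.\<close>

definition row_contr :: "nat \<Rightarrow> nat list set \<Rightarrow> (nat list \<Rightarrow> op) \<Rightarrow> bool" where
  "row_contr m S X \<longleftrightarrow> (\<forall>x. (\<forall>\<alpha>\<in>S. x \<alpha> \<in> Fock m) \<longrightarrow>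
     (fnorm (\<lambda>\<beta>. \<Sum>\<alpha>\<in>S. X \<alpha> (x \<alpha>) \<beta>))\<^sup>2 \<le> (\<Sum>\<alpha>\<in>S. (fnorm (x \<alpha>))\<^sup>2))"

text \<open>By Cauchy-Schwarz, since the weights \<open>a \<alpha> * bcoef a \<gamma> / bcoef a \<beta>\<close> over the
  factorisations \<open>\<beta> = \<alpha> @ \<gamma>\<close> add up to at most 1.\<close>

lemma row_contr_wword:
  assumes a: "symbol n a"
  shows "row_contr n (supp a) (\<lambda>\<alpha> x \<beta>. of_real (sqrt (a \<alpha>)) * wword n a \<alpha> x \<beta>)"
  unfolding row_contr_def
proof (intro allI impI)
  fix x assume x: "\<forall>\<alpha>\<in>supp a. x \<alpha> \<in> Fock n"
  let ?y = "\<lambda>\<beta>. \<Sum>\<alpha>\<in>supp a. of_real (sqrt (a \<alpha>)) * wword n a \<alpha> (x \<alpha>) \<beta>"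
  let ?H = "\<lambda>\<beta>. \<Sum>\<alpha>\<in>supp a. if take (length \<alpha>) \<beta> = \<alpha> then (cmod (x \<alpha> (drop (length \<alpha>) \<beta>)))\<^sup>2 else 0"
  have y: "?y \<in> Fock n"
    by (rule Fock_sum, rule Fock_scale, rule bounded_opD(1)[OF bounded_op_wword[OF a]])
       (use x symbolD(2)[OF a] in auto)
  have pt: "(cmod (?y \<beta>))\<^sup>2 \<le> ?H \<beta>" for \<beta>
  proof -
    define s where "s \<alpha> = (if take (length \<alpha>) \<beta> = \<alpha> then sqrt (a \<alpha> * bcoef a (drop (length \<alpha>) \<beta>) / bcoef a \<beta>) else 0)" for \<alpha>
    define t where "t \<alpha> = (if take (length \<alpha>) \<beta> = \<alpha> then cmod (x \<alpha> (drop (length \<alpha>) \<beta>)) else 0)" for \<alpha>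
    have "cmod (?y \<beta>) \<le> (\<Sum>\<alpha>\<in>supp a. s \<alpha> * t \<alpha>)"
    proof (rule order_trans[OF norm_sum], rule sum_mono)
      fix \<alpha> assume \<alpha>: "\<alpha> \<in> supp a"
      then have "set \<alpha> \<subseteq> {..<n}" "x \<alpha> \<in> Fock n" using symbolD(2)[OF a] x by auto
      then show "cmod (of_real (sqrt (a \<alpha>)) * wword n a \<alpha> (x \<alpha>) \<beta>) \<le> s \<alpha> * t \<alpha>"
        by (simp add: wword_apply[OF a] s_def t_def norm_mult symbolD(4)[OF a] bcoef_nonneg[OF a] real_sqrt_mult real_sqrt_divide norm_divide)
    qed
    then have "(cmod (?y \<beta>))\<^sup>2 \<le> (\<Sum>\<alpha>\<in>supp a. s \<alpha> * t \<alpha>)\<^sup>2" by (rule power_mono) simp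
    also have "\<dots> \<le> (\<Sum>\<alpha>\<in>supp a. (s \<alpha>)\<^sup>2) * (\<Sum>\<alpha>\<in>supp a. (t \<alpha>)\<^sup>2)" by (rule Cauchy_Schwarz_ineq_sum)
    also have "\<dots> \<le> 1 * (\<Sum>\<alpha>\<in>supp a. (t \<alpha>)\<^sup>2)"
    proof (rule mult_right_mono)
      have "(\<Sum>\<alpha>\<in>supp a. (s \<alpha>)\<^sup>2) = (\<Sum>\<alpha>\<in>supp a. if take (length \<alpha>) \<beta> = \<alpha> then a \<alpha> * bcoef a (drop (length \<alpha>) \<beta>) else 0) / bcoef a \<beta>"
        unfolding sum_divide_distrib
        by (intro sum.cong refl) (simp add: s_def symbolD(4)[OF a] bcoef_nonneg[OF a])
      also have "\<dots> \<le> 1"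
      proof -
        have "(\<Sum>\<alpha>\<in>supp a. if take (length \<alpha>) \<beta> = \<alpha> then a \<alpha> * bcoef a (drop (length \<alpha>) \<beta>) else 0) \<le> bcoef a \<beta>"
          using bcoef_prefix[OF a, of \<beta>] by (auto split: if_splits)
        then show ?thesis using bcoef_nonneg[OF a, of \<beta>] by (auto simp: divide_le_eq_1 less_eq_real_def)
      qed
      finally show "(\<Sum>\<alpha>\<in>supp a. (s \<alpha>)\<^sup>2) \<le> 1" .
    qed (simp add: sum_nonneg)
    also have "\<dots> = ?H \<beta>" unfolding t_def by (auto intro!: sum.cong)
    finally show ?thesis .
  qed
  have H: "(?H has_sum (\<Sum>\<alpha>\<in>supp a. (fnorm (x \<alpha>))\<^sup>2)) UNIV"
  proof (rule has_sum_finite_sum)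
    fix \<alpha> assume "\<alpha> \<in> supp a"
    then have "(\<lambda>\<gamma>. (cmod (x \<alpha> \<gamma>))\<^sup>2) summable_on UNIV" using x Fock_summable by blast
    from append_summable[OF this, of \<alpha>]
    show "((\<lambda>\<beta>. if take (length \<alpha>) \<beta> = \<alpha> then (cmod (x \<alpha> (drop (length \<alpha>) \<beta>)))\<^sup>2 else 0) has_sum (fnorm (x \<alpha>))\<^sup>2) UNIV"
      unfolding fnorm_sq by (metis (no_types, lifting) has_sum_infsum)
  qed
  show "(fnorm ?y)\<^sup>2 \<le> (\<Sum>\<alpha>\<in>supp a. (fnorm (x \<alpha>))\<^sup>2)"
    unfolding infsumI[OF H, symmetric] fnorm_sq[of ?y]
    by (rule infsum_mono[OF Fock_summable[OF y] has_sum_imp_summable[OF H] pt])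
qed

subsection \<open>Matrix norms\<close>

text \<open>A crude bound, but it is what turns the supremum \<open>mnorm\<close> into an upper
  bound for its members.\<close>

lemma mnorm_bdd:
  fixes k :: nat
  assumes M: "\<And>i j. i < k \<Longrightarrow> j < k \<Longrightarrow> bounded_op n (M i j)"
  shows "bdd_above {sqrt (\<Sum>i<k. (fnorm (\<lambda>\<beta>. \<Sum>j<k. M i j (x j) \<beta>))\<^sup>2) | x.
       (\<forall>j<k. x j \<in> Fock n) \<and> (\<Sum>j<k. (fnorm (x j))\<^sup>2) \<le> 1}" (is "bdd_above ?A")
proof (rule bdd_aboveI)
  fix r assume "r \<in> ?A"
  then obtain x where r: "r = sqrt (\<Sum>i<k. (fnorm (\<lambda>\<beta>. \<Sum>j<k. M i j (x j) \<beta>))\<^sup>2)"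
    and x: "\<And>j. j < k \<Longrightarrow> x j \<in> Fock n" "(\<Sum>j<k. (fnorm (x j))\<^sup>2) \<le> 1" by blast
  have x1: "fnorm (x j) \<le> 1" if "j < k" for j
  proof -
    have "(fnorm (x j))\<^sup>2 \<le> (\<Sum>j<k. (fnorm (x j))\<^sup>2)" by (rule member_le_sum) (use that in auto)
    then have "(fnorm (x j))\<^sup>2 \<le> 1\<^sup>2" using x(2) by simp
    then show ?thesis by (rule power2_le_imp_le) simp
  qed
  have "fnorm (\<lambda>\<beta>. \<Sum>j<k. M i j (x j) \<beta>) \<le> (\<Sum>j<k. opnorm n (M i j))" if i: "i < k" for i
  proof (rule order_trans[OF fnorm_sum_triangle[where n = n] sum_mono])
    fix j assume "j \<in> {..<k}"
    then have j: "j < k" by simp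
    show "M i j (x j) \<in> Fock n" by (rule bounded_opD(1)[OF M[OF i j] x(1)[OF j]])
  next
    fix j assume "j \<in> {..<k}"
    then have j: "j < k" by simp
    show "fnorm (M i j (x j)) \<le> opnorm n (M i j)"
      using opnorm_bound[OF M[OF i j] x(1)[OF j]] mult_left_mono[OF x1[OF j] opnorm_nonneg[OF M[OF i j]]] by simp
  qed
  then show "r \<le> sqrt (\<Sum>i<k. (\<Sum>j<k. opnorm n (M i j))\<^sup>2)"
    unfolding r by (intro real_sqrt_le_mono sum_mono power_mono) auto
qed

lemma mnorm_bound:
  assumes M: "\<And>i j. i < k \<Longrightarrow> j < k \<Longrightarrow> bounded_op n (M i j)"
    and x: "\<And>j. j < k \<Longrightarrow> x j \<in> Fock n" and le: "mnorm n k M \<le> 1"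
  shows "(\<Sum>i<k. (fnorm (\<lambda>\<beta>. \<Sum>j<k. M i j (x j) \<beta>))\<^sup>2) \<le> (\<Sum>j<k. (fnorm (x j))\<^sup>2)"
proof -
  define N where "N = (\<Sum>j<k. (fnorm (x j))\<^sup>2)"
  show ?thesis
  proof (cases "N = 0")
    case True
    then have "fnorm (x j) = 0" if "j < k" for j
      using that unfolding N_def by (subst (asm) sum_nonneg_eq_0_iff) auto
    then have "x j = (\<lambda>_. 0)" if "j < k" for j using fnorm_eq_0[OF x] that by blast
    then have "M i j (x j) \<beta> = 0" if "i < k" "j < k" for i j \<beta> using bounded_op_zero_vec[OF M] that by simp
    then show ?thesis by (simp add: sum_nonneg)
  next
    case False
    then have N: "N > 0" unfolding N_def using sum_nonneg[of "{..<k}" "\<lambda>j. (fnorm (x j))\<^sup>2"] by force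
    define c where "c = complex_of_real (1 / sqrt N)"
    have c: "(cmod c)\<^sup>2 = 1 / N" unfolding c_def norm_of_real using N by (simp add: power_divide)
    let ?x = "\<lambda>j \<beta>. c * x j \<beta>"
    have "sqrt (\<Sum>i<k. (fnorm (\<lambda>\<beta>. \<Sum>j<k. M i j (?x j) \<beta>))\<^sup>2) \<le> mnorm n k M"
      unfolding mnorm_def
    proof (rule cSup_upper[OF _ mnorm_bdd[OF M]], intro CollectI exI[of _ ?x] conjI refl allI impI)
      show "(\<Sum>j<k. (fnorm (?x j))\<^sup>2) \<le> 1"
        using N unfolding fnorm_scale power_mult_distrib c by (simp add: N_def flip: sum_divide_distrib)
    qed (auto intro: Fock_scale x)
    also note le
    finally have "(\<Sum>i<k. (fnorm (\<lambda>\<beta>. \<Sum>j<k. M i j (?x j) \<beta>))\<^sup>2) \<le> 1" by simp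
    moreover have "(\<lambda>\<beta>. \<Sum>j<k. M i j (?x j) \<beta>) = (\<lambda>\<beta>. c * (\<Sum>j<k. M i j (x j) \<beta>))" if "i < k" for i
      unfolding sum_distrib_left by (intro ext sum.cong refl) (simp add: bounded_opD(3)[OF M x] that)
    ultimately have "(\<Sum>i<k. (1 / N) * (fnorm (\<lambda>\<beta>. \<Sum>j<k. M i j (x j) \<beta>))\<^sup>2) \<le> 1"
      by (simp add: fnorm_scale power_mult_distrib c)
    then show ?thesis using N unfolding N_def[symmetric] sum_distrib_left[symmetric] by (simp add: field_simps)
  qed
qed

lemma mnorm_le_1:
  assumes "\<And>x. (\<And>j. j < k \<Longrightarrow> x j \<in> Fock n) \<Longrightarrow>
    (\<Sum>i<k. (fnorm (\<lambda>\<beta>. \<Sum>j<k. M i j (x j) \<beta>))\<^sup>2) \<le> (\<Sum>j<k. (fnorm (x j))\<^sup>2)"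
  shows "mnorm n k M \<le> 1"
  unfolding mnorm_def
proof (rule cSup_least)
  show "{sqrt (\<Sum>i<k. (fnorm (\<lambda>\<beta>. \<Sum>j<k. M i j (x j) \<beta>))\<^sup>2) | x.
       (\<forall>j<k. x j \<in> Fock n) \<and> (\<Sum>j<k. (fnorm (x j))\<^sup>2) \<le> 1} \<noteq> {}"
    using Fock_zero by (auto intro!: exI[of _ "\<lambda>_ _. 0"])
next
  fix r assume "r \<in> {sqrt (\<Sum>i<k. (fnorm (\<lambda>\<beta>. \<Sum>j<k. M i j (x j) \<beta>))\<^sup>2) | x.
       (\<forall>j<k. x j \<in> Fock n) \<and> (\<Sum>j<k. (fnorm (x j))\<^sup>2) \<le> 1}"
  then obtain x where "r = sqrt (\<Sum>i<k. (fnorm (\<lambda>\<beta>. \<Sum>j<k. M i j (x j) \<beta>))\<^sup>2)"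
    and x: "\<And>j. j < k \<Longrightarrow> x j \<in> Fock n" "(\<Sum>j<k. (fnorm (x j))\<^sup>2) \<le> 1" by blast
  then show "r \<le> 1" using assms[of x] by force
qed

lemma mnorm_1: "mnorm n 1 (\<lambda>_ _. T) = opnorm n T"
proof -
  have "{sqrt (\<Sum>i<(1::nat). (fnorm (\<lambda>\<beta>. \<Sum>j<(1::nat). T (x j) \<beta>))\<^sup>2) | x.
       (\<forall>j<(1::nat). x j \<in> Fock n) \<and> (\<Sum>j<(1::nat). (fnorm (x j))\<^sup>2) \<le> 1} = {fnorm (T x) | x. x \<in> Fock n \<and> fnorm x \<le> 1}"
  proof (intro equalityI subsetI)
    fix r assume "r \<in> {fnorm (T x) | x. x \<in> Fock n \<and> fnorm x \<le> 1}"
    then obtain x where "r = fnorm (T x)" "x \<in> Fock n" "fnorm x \<le> 1" by blast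
    then show "r \<in> {sqrt (\<Sum>i<(1::nat). (fnorm (\<lambda>\<beta>. \<Sum>j<(1::nat). T (x j) \<beta>))\<^sup>2) | x.
       (\<forall>j<(1::nat). x j \<in> Fock n) \<and> (\<Sum>j<(1::nat). (fnorm (x j))\<^sup>2) \<le> 1}"
      by (intro CollectI exI[of _ "\<lambda>_. x"]) (auto simp: power_le_one)
  next
    fix r assume "r \<in> {sqrt (\<Sum>i<(1::nat). (fnorm (\<lambda>\<beta>. \<Sum>j<(1::nat). T (x j) \<beta>))\<^sup>2) | x.
       (\<forall>j<(1::nat). x j \<in> Fock n) \<and> (\<Sum>j<(1::nat). (fnorm (x j))\<^sup>2) \<le> 1}"
    then obtain x where "r = fnorm (T (x 0))" "x 0 \<in> Fock n" "(fnorm (x 0))\<^sup>2 \<le> 1\<^sup>2" by auto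
    then show "r \<in> {fnorm (T x) | x. x \<in> Fock n \<and> fnorm x \<le> 1}"
      using power2_le_imp_le[of "fnorm (x 0)" 1] by auto
  qed
  then show ?thesis unfolding mnorm_def opnorm_def by simp
qed

subsection \<open>Products in the domain algebra\<close>

lemma wword_append:
  assumes a: "symbol n a" and "set \<beta> \<subseteq> {..<n}"
  shows "wword n a (\<alpha> @ \<beta>) = wword n a \<alpha> \<circ> wword n a \<beta>"
proof (induction \<alpha>)
  case Nil
  show ?case
    using bounded_opD(1,4)[OF bounded_op_wword[OF a assms(2)]] by (auto simp: fun_eq_iff idop_def Fock_zero)
next
  case (Cons i \<alpha>)
  then show ?case by (simp add: wword_Cons o_assoc)
qed

lemma polyops_zero: "(\<lambda>x \<beta>. 0) \<in> polyops n a"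
  using polyopsI[of "{}" n "\<lambda>_. 0" a] by simp

lemma polyops_sum:
  assumes "\<And>i. i \<in> I \<Longrightarrow> P i \<in> polyops n a"
  shows "(\<lambda>x \<beta>. \<Sum>i\<in>I. P i x \<beta>) \<in> polyops n a"
  using assms
  by (induction I rule: infinite_finite_induct) (auto simp: polyops_zero intro!: polyops_add)

lemma polyops_comp:
  assumes a: "symbol n a" and P: "P \<in> polyops n a" and Q: "Q \<in> polyops n a"
  shows "P \<circ> Q \<in> polyops n a"
proof -
  obtain F c where F: "finite F" "\<And>\<alpha>. \<alpha> \<in> F \<Longrightarrow> set \<alpha> \<subseteq> {..<n}" "P = (\<lambda>x \<beta>. \<Sum>\<alpha>\<in>F. c \<alpha> * wword n a \<alpha> x \<beta>)"
    using polyopsE[OF P] by blast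
  obtain G d where G: "finite G" "\<And>\<alpha>. \<alpha> \<in> G \<Longrightarrow> set \<alpha> \<subseteq> {..<n}" "Q = (\<lambda>x \<beta>. \<Sum>\<alpha>\<in>G. d \<alpha> * wword n a \<alpha> x \<beta>)"
    using polyopsE[OF Q] by blast
  have "P \<circ> Q = (\<lambda>x \<beta>. \<Sum>\<alpha>\<in>F. \<Sum>\<gamma>\<in>G. (c \<alpha> * d \<gamma>) * wword n a (\<alpha> @ \<gamma>) x \<beta>)"
  proof (intro ext)
    fix x \<beta>
    show "(P \<circ> Q) x \<beta> = (\<Sum>\<alpha>\<in>F. \<Sum>\<gamma>\<in>G. (c \<alpha> * d \<gamma>) * wword n a (\<alpha> @ \<gamma>) x \<beta>)"
    proof (cases "x \<in> Fock n")
      case True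
      have W: "wword n a \<gamma> x \<in> Fock n" if "\<gamma> \<in> G" for \<gamma>
        using bounded_opD(1)[OF bounded_op_wword[OF a G(2)[OF that]] True] .
      have "wword n a \<alpha> (Q x) = (\<lambda>\<beta>. \<Sum>\<gamma>\<in>G. d \<gamma> * wword n a (\<alpha> @ \<gamma>) x \<beta>)" if "\<alpha> \<in> F" for \<alpha>
      proof -
        note B = bounded_op_wword[OF a F(2)[OF that]]
        have "wword n a \<alpha> (Q x) = (\<lambda>\<beta>. \<Sum>\<gamma>\<in>G. wword n a \<alpha> (\<lambda>\<beta>. d \<gamma> * wword n a \<gamma> x \<beta>) \<beta>)"
          unfolding G(3) by (rule bounded_op_sum_vec[OF B]) (intro Fock_scale W)
        also have "\<dots> = (\<lambda>\<beta>. \<Sum>\<gamma>\<in>G. d \<gamma> * wword n a (\<alpha> @ \<gamma>) x \<beta>)"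
          by (intro ext sum.cong refl) (simp add: bounded_opD(3)[OF B W] wword_append[OF a G(2)])
        finally show ?thesis .
      qed
      then show ?thesis unfolding F(3) by (simp add: sum_distrib_left mult.assoc)
    next
      case False
      have "wword n a (\<alpha> @ \<gamma>) x \<beta> = 0" if "\<alpha> \<in> F" "\<gamma> \<in> G" for \<alpha> \<gamma>
        using bounded_opD(4)[OF bounded_op_wword[OF a] False, of "\<alpha> @ \<gamma>"] F(2)[OF that(1)] G(2)[OF that(2)] by simp
      then show ?thesis
        using bounded_opD(4)[OF bounded_op_polyops[OF a Q] False] bounded_op_zero_vec[OF bounded_op_polyops[OF a P]] by simp
    qed
  qed
  also have "\<dots> \<in> polyops n a"
    using F(2) G(2) by (intro polyops_sum polyops_scale wword_polyops) auto
  finally show ?thesis .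
qed

lemma opnorm_comp:
  assumes "bounded_op n S" "bounded_op n T"
  shows "opnorm n (S \<circ> T) \<le> opnorm n S * opnorm n T"
proof (rule opnorm_le)
  show "0 \<le> opnorm n S * opnorm n T" using opnorm_nonneg[OF assms(1)] opnorm_nonneg[OF assms(2)] by simp
  fix x assume x: "x \<in> Fock n"
  show "fnorm ((S \<circ> T) x) \<le> opnorm n S * opnorm n T * fnorm x"
    using opnorm_bound[OF assms(1) bounded_opD(1)[OF assms(2) x]]
      mult_left_mono[OF opnorm_bound[OF assms(2) x] opnorm_nonneg[OF assms(1)]] by (simp add: mult.assoc)
qed

lemma domalg_approx:
  assumes "T \<in> domalg n a" "\<epsilon> > 0" "K \<ge> 0"
  obtains P where "P \<in> polyops n a" "K * opnorm n (\<lambda>x \<beta>. T x \<beta> - P x \<beta>) < \<epsilon>"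
proof -
  have "\<epsilon> / (K + 1) > 0" using assms by simp
  then obtain P where P: "P \<in> polyops n a" "opnorm n (\<lambda>x \<beta>. T x \<beta> - P x \<beta>) < \<epsilon> / (K + 1)"
    using assms(1) unfolding domalg_def by blast
  then have "K * opnorm n (\<lambda>x \<beta>. T x \<beta> - P x \<beta>) \<le> K * (\<epsilon> / (K + 1))" using assms(3) by (intro mult_left_mono) auto
  also have "\<dots> < \<epsilon>" using assms(2,3) by (simp add: field_simps)
  finally show ?thesis using that P(1) by blast
qed

lemma domalg_comp:
  assumes a: "symbol n a" and S: "S \<in> domalg n a" and T: "T \<in> domalg n a"
  shows "S \<circ> T \<in> domalg n a"
  unfolding domalg_def
proof (intro CollectI conjI allI impI)
  have BS: "bounded_op n S" and BT: "bounded_op n T" using domalg_bounded S T by auto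
  show "bounded_op n (S \<circ> T)" by (intro bounded_op_comp BS BT)
  fix \<epsilon> :: real assume "\<epsilon> > 0"
  then have e: "\<epsilon> / 2 > 0" by simp
  \<comment> \<open>From S T - P Q = (S - P) T + P (T - Q): first \<open>P\<close> is chosen against
    the norm of \<open>T\<close>, then \<open>Q\<close> against the norm of this
    \<open>P\<close>.\<close>
  obtain P where P: "P \<in> polyops n a" "opnorm n T * opnorm n (\<lambda>x \<beta>. S x \<beta> - P x \<beta>) < \<epsilon> / 2"
    using domalg_approx[OF S e opnorm_nonneg[OF BT]] by blast
  have BP: "bounded_op n P" by (rule bounded_op_polyops[OF a P(1)])
  obtain Q where Q: "Q \<in> polyops n a" "opnorm n P * opnorm n (\<lambda>x \<beta>. T x \<beta> - Q x \<beta>) < \<epsilon> / 2"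
    using domalg_approx[OF T e opnorm_nonneg[OF BP]] by blast
  have BQ: "bounded_op n Q" by (rule bounded_op_polyops[OF a Q(1)])
  have BSP: "bounded_op n (\<lambda>x \<beta>. S x \<beta> - P x \<beta>)" and BTQ: "bounded_op n (\<lambda>x \<beta>. T x \<beta> - Q x \<beta>)"
    by (intro bounded_op_diff BS BP BT BQ)+
  have Pdiff: "P (\<lambda>\<beta>. T x \<beta> - Q x \<beta>) = (\<lambda>\<beta>. P (T x) \<beta> - P (Q x) \<beta>)" for x
  proof (cases "x \<in> Fock n")
    case True
    then have "T x \<in> Fock n" "Q x \<in> Fock n" using bounded_opD(1) BT BQ by auto
    then show ?thesis
      using bounded_opD(2)[OF BP _ Fock_scale, of "T x" "Q x" "-1"] bounded_opD(3)[OF BP, of "Q x" "-1"] by simp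
  next
    case False
    then show ?thesis using bounded_opD(4) BT BQ bounded_op_zero_vec[OF BP] by simp
  qed
  have "(\<lambda>x \<beta>. (S \<circ> T) x \<beta> - (P \<circ> Q) x \<beta>) = (\<lambda>x \<beta>. ((\<lambda>x \<beta>. S x \<beta> - P x \<beta>) \<circ> T) x \<beta> + (P \<circ> (\<lambda>x \<beta>. T x \<beta> - Q x \<beta>)) x \<beta>)"
    by (simp add: Pdiff)
  then have "opnorm n (\<lambda>x \<beta>. (S \<circ> T) x \<beta> - (P \<circ> Q) x \<beta>) \<le> opnorm n ((\<lambda>x \<beta>. S x \<beta> - P x \<beta>) \<circ> T) + opnorm n (P \<circ> (\<lambda>x \<beta>. T x \<beta> - Q x \<beta>))"
    using opnorm_triangle[OF bounded_op_comp[OF BSP BT] bounded_op_comp[OF BP BTQ]] by simp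
  also have "\<dots> < \<epsilon>"
    using opnorm_comp[OF BSP BT] opnorm_comp[OF BP BTQ] P(2) Q(2) by (simp add: mult.commute)
  finally show "\<exists>P\<in>polyops n a. opnorm n (\<lambda>x \<beta>. (S \<circ> T) x \<beta> - P x \<beta>) < \<epsilon>"
    using polyops_comp[OF a P(1) Q(1)] by (intro bexI[of _ "P \<circ> Q"]) auto
qed

subsection \<open>Homomorphisms of domain algebras\<close>

definition ci_map :: "nat \<Rightarrow> (nat list \<Rightarrow> real) \<Rightarrow> nat \<Rightarrow> (nat list \<Rightarrow> real) \<Rightarrow> (op \<Rightarrow> op) \<Rightarrow> bool" where
  "ci_map n a m b \<Phi> \<longleftrightarrow> bij_betw \<Phi> (domalg n a) (domalg m b)
     \<and> (\<forall>S\<in>domalg n a. \<forall>T\<in>domalg n a.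
          \<Phi> (\<lambda>x \<beta>. S x \<beta> + T x \<beta>) = (\<lambda>x \<beta>. \<Phi> S x \<beta> + \<Phi> T x \<beta>))
     \<and> (\<forall>c. \<forall>S\<in>domalg n a. \<Phi> (\<lambda>x \<beta>. c * S x \<beta>) = (\<lambda>x \<beta>. c * \<Phi> S x \<beta>))
     \<and> (\<forall>S\<in>domalg n a. \<forall>T\<in>domalg n a. \<Phi> (S \<circ> T) = \<Phi> S \<circ> \<Phi> T)
     \<and> (\<forall>k>0. \<forall>M. (\<forall>i<k. \<forall>j<k. M i j \<in> domalg n a) \<longrightarrow>
          mnorm m k (\<lambda>i j. \<Phi> (M i j)) = mnorm n k M)"

lemma ci_isomorphic_iff: "ci_isomorphic n a m b \<longleftrightarrow> (\<exists>\<Phi>. ci_map n a m b \<Phi>)"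
  unfolding ci_isomorphic_def ci_map_def ..

lemma ci_mapD:
  assumes "ci_map n a m b \<Phi>"
  shows "bij_betw \<Phi> (domalg n a) (domalg m b)"
    and "S \<in> domalg n a \<Longrightarrow> T \<in> domalg n a \<Longrightarrow> \<Phi> (\<lambda>x \<beta>. S x \<beta> + T x \<beta>) = (\<lambda>x \<beta>. \<Phi> S x \<beta> + \<Phi> T x \<beta>)"
    and "S \<in> domalg n a \<Longrightarrow> \<Phi> (\<lambda>x \<beta>. c * S x \<beta>) = (\<lambda>x \<beta>. c * \<Phi> S x \<beta>)"
    and "S \<in> domalg n a \<Longrightarrow> T \<in> domalg n a \<Longrightarrow> \<Phi> (S \<circ> T) = \<Phi> S \<circ> \<Phi> T"
    and "k > 0 \<Longrightarrow> (\<And>i j. i < k \<Longrightarrow> j < k \<Longrightarrow> M i j \<in> domalg n a) \<Longrightarrow> mnorm m k (\<lambda>i j. \<Phi> (M i j)) = mnorm n k M"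
  using assms unfolding ci_map_def by simp_all

text \<open>What is retained of a complete isometry: contractivity and one row. None of the
  conditions mentions an inverse, so an isomorphism becomes a pair of such maps that is symmetric in
  the two symbols.\<close>

definition cc_hom :: "nat \<Rightarrow> (nat list \<Rightarrow> real) \<Rightarrow> nat \<Rightarrow> (nat list \<Rightarrow> real) \<Rightarrow> (op \<Rightarrow> op) \<Rightarrow> bool" where
  "cc_hom n a m b \<Phi> \<longleftrightarrow> (\<forall>S\<in>domalg n a. \<Phi> S \<in> domalg m b)
     \<and> (\<forall>S\<in>domalg n a. \<forall>T\<in>domalg n a. \<Phi> (\<lambda>x \<beta>. S x \<beta> + T x \<beta>) = (\<lambda>x \<beta>. \<Phi> S x \<beta> + \<Phi> T x \<beta>))
     \<and> (\<forall>c. \<forall>S\<in>domalg n a. \<Phi> (\<lambda>x \<beta>. c * S x \<beta>) = (\<lambda>x \<beta>. c * \<Phi> S x \<beta>))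
     \<and> (\<forall>S\<in>domalg n a. \<forall>T\<in>domalg n a. \<Phi> (S \<circ> T) = \<Phi> S \<circ> \<Phi> T)
     \<and> \<Phi> (idop n) = idop m
     \<and> (\<forall>S\<in>domalg n a. opnorm m (\<Phi> S) \<le> opnorm n S)
     \<and> row_contr m (supp a) (\<lambda>\<alpha> x \<beta>. of_real (sqrt (a \<alpha>)) * \<Phi> (wword n a \<alpha>) x \<beta>)"

lemma cc_homD:
  assumes "cc_hom n a m b \<Phi>"
  shows "S \<in> domalg n a \<Longrightarrow> \<Phi> S \<in> domalg m b"
    and "S \<in> domalg n a \<Longrightarrow> T \<in> domalg n a \<Longrightarrow> \<Phi> (\<lambda>x \<beta>. S x \<beta> + T x \<beta>) = (\<lambda>x \<beta>. \<Phi> S x \<beta> + \<Phi> T x \<beta>)"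
    and "S \<in> domalg n a \<Longrightarrow> \<Phi> (\<lambda>x \<beta>. c * S x \<beta>) = (\<lambda>x \<beta>. c * \<Phi> S x \<beta>)"
    and "S \<in> domalg n a \<Longrightarrow> T \<in> domalg n a \<Longrightarrow> \<Phi> (S \<circ> T) = \<Phi> S \<circ> \<Phi> T"
    and "\<Phi> (idop n) = idop m"
    and "S \<in> domalg n a \<Longrightarrow> opnorm m (\<Phi> S) \<le> opnorm n S"
    and "row_contr m (supp a) (\<lambda>\<alpha> x \<beta>. of_real (sqrt (a \<alpha>)) * \<Phi> (wword n a \<alpha>) x \<beta>)"
  using assms unfolding cc_hom_def by auto

text \<open>\<open>mnorm\<close> is defined for square matrices; a row is the first line of a square
  matrix whose other lines are zero.\<close>

lemma row_as_matrix:
  assumes bij: "bij_betw h {..<k} S" and k: "k > (0::nat)"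
  shows "(\<Sum>i<k. (fnorm (\<lambda>\<beta>. \<Sum>j<k. (if i = 0 then X (h j) else (\<lambda>x \<beta>. 0)) (y j) \<beta>))\<^sup>2)
    = (fnorm (\<lambda>\<beta>. \<Sum>\<alpha>\<in>S. X \<alpha> (y (the_inv_into {..<k} h \<alpha>)) \<beta>))\<^sup>2"
proof -
  have "(\<Sum>i<k. (fnorm (\<lambda>\<beta>. \<Sum>j<k. (if i = 0 then X (h j) else (\<lambda>x \<beta>. 0)) (y j) \<beta>))\<^sup>2)
    = (\<Sum>i<k. if i = 0 then (fnorm (\<lambda>\<beta>. \<Sum>j<k. X (h j) (y j) \<beta>))\<^sup>2 else 0)"
    by (intro sum.cong refl) auto
  also have "\<dots> = (fnorm (\<lambda>\<beta>. \<Sum>j<k. X (h j) (y j) \<beta>))\<^sup>2" using k by simp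
  also have "(\<lambda>\<beta>. \<Sum>j<k. X (h j) (y j) \<beta>) = (\<lambda>\<beta>. \<Sum>\<alpha>\<in>S. X \<alpha> (y (the_inv_into {..<k} h \<alpha>)) \<beta>)"
  proof
    fix \<beta>
    have "(\<Sum>j<k. X (h j) (y j) \<beta>) = (\<Sum>j<k. X (h j) (y (the_inv_into {..<k} h (h j))) \<beta>)"
      by (intro sum.cong refl) (simp add: the_inv_into_f_f[OF bij_betw_imp_inj_on[OF bij]])
    also have "\<dots> = (\<Sum>\<alpha>\<in>S. X \<alpha> (y (the_inv_into {..<k} h \<alpha>)) \<beta>)"
      by (rule sum.reindex_bij_betw[OF bij])
    finally show "(\<Sum>j<k. X (h j) (y j) \<beta>) = (\<Sum>\<alpha>\<in>S. X \<alpha> (y (the_inv_into {..<k} h \<alpha>)) \<beta>)" .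
  qed
  finally show ?thesis .
qed

lemma ci_map_cc_hom:
  assumes n: "n > 0" and a: "symbol n a" and b: "symbol m b" and \<Phi>: "ci_map n a m b \<Phi>"
  shows "cc_hom n a m b \<Phi>"
proof -
  note bij = ci_mapD(1)[OF \<Phi>] and nrm = ci_mapD(5)[OF \<Phi>]
  have add: "\<forall>S\<in>domalg n a. \<forall>T\<in>domalg n a. \<Phi> (\<lambda>x \<beta>. S x \<beta> + T x \<beta>) = (\<lambda>x \<beta>. \<Phi> S x \<beta> + \<Phi> T x \<beta>)"
    and scale: "\<forall>c. \<forall>S\<in>domalg n a. \<Phi> (\<lambda>x \<beta>. c * S x \<beta>) = (\<lambda>x \<beta>. c * \<Phi> S x \<beta>)"
    and mult: "\<forall>S\<in>domalg n a. \<forall>T\<in>domalg n a. \<Phi> (S \<circ> T) = \<Phi> S \<circ> \<Phi> T"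
    using ci_mapD(2-4)[OF \<Phi>] by simp_all
  have to: "\<forall>S\<in>domalg n a. \<Phi> S \<in> domalg m b" using bij by (auto simp: bij_betw_def)
  have idn: "idop n \<in> domalg n a" using wword_domalg[OF a, of "[]"] by simp
  have idm: "idop m \<in> domalg m b" using wword_domalg[OF b, of "[]"] by simp
  \<comment> \<open>\<open>idop k\<close> is not the identity function. It is a unit because bounded
    operators take values in the Fock space and are 0 outside of it.\<close>
  have id_left: "idop k \<circ> T = T" and id_right: "T \<circ> idop k = T" if "bounded_op k T" for k T
    using bounded_opD(1,4)[OF that] bounded_op_zero_vec[OF that] unfolding fun_eq_iff[of "_ \<circ> _"]
    by (simp_all add: idop_def Fock_zero) (metis Fock_zero)
  \<comment> \<open>Unitality comes from surjectivity: multiplying the image of the unit by a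
    preimage of the unit shows that the former is the unit.\<close>
  have unital: "\<Phi> (idop n) = idop m"
  proof -
    obtain S where S: "S \<in> domalg n a" "\<Phi> S = idop m" using bij idm by (metis bij_betw_imp_surj_on imageE)
    have "\<Phi> (idop n) \<circ> \<Phi> S = \<Phi> S" using mult idn S(1) id_left[OF domalg_bounded[OF S(1)]] by metis
    then show ?thesis using S(2) id_right[OF domalg_bounded, of "\<Phi> (idop n)" m b] to idn by auto
  qed
  have iso: "opnorm m (\<Phi> S) = opnorm n S" if "S \<in> domalg n a" for S
    using nrm[of 1 "\<lambda>_ _. S"] that by (simp add: mnorm_1[simplified])
  have zero: "(\<lambda>x \<beta>. 0) \<in> domalg n a" by (rule polyops_domalg[OF a polyops_zero])
  have Phi0: "\<Phi> (\<lambda>x \<beta>. 0) = (\<lambda>x \<beta>. 0)" using scale[rule_format, OF zero, of 0] by simp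
  have row: "row_contr m (supp a) (\<lambda>\<alpha> x \<beta>. of_real (sqrt (a \<alpha>)) * \<Phi> (wword n a \<alpha>) x \<beta>)"
  proof -
    define k where "k = card (supp a)"
    \<comment> \<open>The degree-one coefficients make the support nonempty, so the matrix has
      positive size, as the condition on matrix norms demands.\<close>
    have "[0] \<in> supp a" using symbolD(5)[OF a n] by simp
    then have k: "k > 0" unfolding k_def using symbolD(1)[OF a] by (auto simp: card_gt_0_iff)
    obtain h where h: "bij_betw h {..<k} (supp a)"
      using ex_bij_betw_nat_finite[OF symbolD(1)[OF a]] unfolding k_def atLeast0LessThan by blast
    define X where "X \<alpha> = (\<lambda>x \<beta>. of_real (sqrt (a \<alpha>)) * wword n a \<alpha> x \<beta>)" for \<alpha>
    define M where "M i j = (if i = 0 then X (h j) else (\<lambda>x \<beta>. 0))" for i j :: nat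
    have hs: "h j \<in> supp a" if "j < k" for j using h that by (auto simp: bij_betw_def)
    have XD: "X \<alpha> \<in> domalg n a" if "\<alpha> \<in> supp a" for \<alpha>
      unfolding X_def using symbolD(2)[OF a] that by (intro domalg_scale[OF a] wword_domalg[OF a]) auto
    have MD: "M i j \<in> domalg n a" if "j < k" for i j using XD[OF hs[OF that]] zero by (simp add: M_def)
    have inv: "the_inv_into {..<k} h \<alpha> < k" if "\<alpha> \<in> supp a" for \<alpha>
      using the_inv_into_into[OF bij_betw_imp_inj_on[OF h], of \<alpha> "{..<k}"] that h by (auto simp: bij_betw_def)
    have "mnorm n k M \<le> 1"
    proof (rule mnorm_le_1)
      fix x :: "nat \<Rightarrow> nat list \<Rightarrow> complex" assume x: "\<And>j. j < k \<Longrightarrow> x j \<in> Fock n"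
      have "(\<Sum>i<k. (fnorm (\<lambda>\<beta>. \<Sum>j<k. M i j (x j) \<beta>))\<^sup>2) = (fnorm (\<lambda>\<beta>. \<Sum>\<alpha>\<in>supp a. X \<alpha> (x (the_inv_into {..<k} h \<alpha>)) \<beta>))\<^sup>2"
        unfolding M_def by (rule row_as_matrix[OF h k])
      also have "\<dots> \<le> (\<Sum>\<alpha>\<in>supp a. (fnorm (x (the_inv_into {..<k} h \<alpha>)))\<^sup>2)"
        using row_contr_wword[OF a] unfolding row_contr_def X_def
        by (rule mp[OF spec[where x = "\<lambda>\<alpha>. x (the_inv_into {..<k} h \<alpha>)"]]) (use x inv in simp)
      also have "\<dots> = (\<Sum>j<k. (fnorm (x j))\<^sup>2)"
        by (subst sum.reindex_bij_betw[OF h, symmetric], intro sum.cong refl)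
           (simp add: the_inv_into_f_f[OF bij_betw_imp_inj_on[OF h]])
      finally show "(\<Sum>i<k. (fnorm (\<lambda>\<beta>. \<Sum>j<k. M i j (x j) \<beta>))\<^sup>2) \<le> (\<Sum>j<k. (fnorm (x j))\<^sup>2)" .
    qed
    then have le: "mnorm m k (\<lambda>i j. \<Phi> (M i j)) \<le> 1" using nrm[OF k, of M] MD by simp
    define Y where "Y \<alpha> = (\<lambda>x \<beta>. of_real (sqrt (a \<alpha>)) * \<Phi> (wword n a \<alpha>) x \<beta>)" for \<alpha>
    have XY: "\<Phi> (X \<alpha>) = Y \<alpha>" if "\<alpha> \<in> supp a" for \<alpha>
      unfolding X_def Y_def using scale wword_domalg[OF a] symbolD(2)[OF a, of \<alpha>] that by blast
    have PM: "\<Phi> (M i j) = (if i = 0 then Y (h j) else (\<lambda>x \<beta>. 0))" if "j < k" for i j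
      unfolding M_def using XY[OF hs[OF that]] Phi0 by simp
    show ?thesis
      unfolding row_contr_def Y_def[symmetric]
    proof (intro allI impI)
      fix x assume x: "\<forall>\<alpha>\<in>supp a. x \<alpha> \<in> Fock m"
      let ?x = "\<lambda>j. x (h j)"
      have xinv: "?x (the_inv_into {..<k} h \<alpha>) = x \<alpha>" if "\<alpha> \<in> supp a" for \<alpha>
        using f_the_inv_into_f_bij_betw[OF h] that by simp
      have "(fnorm (\<lambda>\<beta>. \<Sum>\<alpha>\<in>supp a. Y \<alpha> (x \<alpha>) \<beta>))\<^sup>2 = (fnorm (\<lambda>\<beta>. \<Sum>\<alpha>\<in>supp a. Y \<alpha> (?x (the_inv_into {..<k} h \<alpha>)) \<beta>))\<^sup>2"
        by (intro arg_cong[where f = "\<lambda>y. (fnorm y)\<^sup>2"] ext sum.cong refl) (simp add: xinv)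
      also have "\<dots> = (\<Sum>i<k. (fnorm (\<lambda>\<beta>. \<Sum>j<k. (if i = 0 then Y (h j) else (\<lambda>x \<beta>. 0)) (?x j) \<beta>))\<^sup>2)"
        by (rule row_as_matrix[OF h k, symmetric])
      also have "\<dots> = (\<Sum>i<k. (fnorm (\<lambda>\<beta>. \<Sum>j<k. \<Phi> (M i j) (?x j) \<beta>))\<^sup>2)"
        by (intro arg_cong[where f = "\<lambda>y. (fnorm y)\<^sup>2"] ext sum.cong refl) (simp add: PM)
      also have "\<dots> \<le> (\<Sum>j<k. (fnorm (?x j))\<^sup>2)"
        by (rule mnorm_bound[OF _ _ le]) (use to MD x hs domalg_bounded in blast)+
      also have "\<dots> = (\<Sum>\<alpha>\<in>supp a. (fnorm (x \<alpha>))\<^sup>2)" by (rule sum.reindex_bij_betw[OF h])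
      finally show "(fnorm (\<lambda>\<beta>. \<Sum>\<alpha>\<in>supp a. Y \<alpha> (x \<alpha>) \<beta>))\<^sup>2 \<le> (\<Sum>\<alpha>\<in>supp a. (fnorm (x \<alpha>))\<^sup>2)" .
    qed
  qed
  show ?thesis unfolding cc_hom_def
    by (intro conjI to add scale mult unital row ballI) (simp add: iso)
qed

lemma ci_map_inverse:
  assumes a: "symbol n a" and b: "symbol m b" and \<Phi>: "ci_map n a m b \<Phi>"
  shows "ci_map m b n a (the_inv_into (domalg n a) \<Phi>)"
proof -
  let ?\<Psi> = "the_inv_into (domalg n a) \<Phi>"
  note bij = ci_mapD(1)[OF \<Phi>] and add = ci_mapD(2)[OF \<Phi>] and scale = ci_mapD(3)[OF \<Phi>]
    and mult = ci_mapD(4)[OF \<Phi>] and nrm = ci_mapD(5)[OF \<Phi>]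
  have bij': "bij_betw ?\<Psi> (domalg m b) (domalg n a)" by (rule bij_betw_the_inv_into[OF bij])
  have to: "?\<Psi> T \<in> domalg n a" if "T \<in> domalg m b" for T using bij' that by (auto simp: bij_betw_def)
  have L: "?\<Psi> (\<Phi> S) = S" if "S \<in> domalg n a" for S by (rule the_inv_into_f_f[OF bij_betw_imp_inj_on[OF bij] that])
  have R: "\<Phi> (?\<Psi> T) = T" if "T \<in> domalg m b" for T by (rule f_the_inv_into_f_bij_betw[OF bij]) (use that in auto)
  show ?thesis
    unfolding ci_map_def
  proof (intro conjI ballI allI impI bij')
    fix S T assume S: "S \<in> domalg m b" and T: "T \<in> domalg m b"
    show "?\<Psi> (\<lambda>x \<beta>. S x \<beta> + T x \<beta>) = (\<lambda>x \<beta>. ?\<Psi> S x \<beta> + ?\<Psi> T x \<beta>)"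
      using L[OF domalg_add[OF a to[OF S] to[OF T]]] add[OF to[OF S] to[OF T]] R[OF S] R[OF T] by simp
    show "?\<Psi> (S \<circ> T) = ?\<Psi> S \<circ> ?\<Psi> T"
      using L[OF domalg_comp[OF a to[OF S] to[OF T]]] mult[OF to[OF S] to[OF T]] R[OF S] R[OF T] by simp
  next
    fix c S assume S: "S \<in> domalg m b"
    show "?\<Psi> (\<lambda>x \<beta>. c * S x \<beta>) = (\<lambda>x \<beta>. c * ?\<Psi> S x \<beta>)"
      using L[OF domalg_scale[OF a to[OF S], of c]] scale[OF to[OF S], of c] R[OF S] by simp
  next
    fix k :: nat and M assume k: "k > 0" and M: "\<forall>i<k. \<forall>j<k. M i j \<in> domalg m b"
    have "mnorm n k (\<lambda>i j. ?\<Psi> (M i j)) = mnorm m k (\<lambda>i j. \<Phi> (?\<Psi> (M i j)))"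
      using nrm[OF k, of "\<lambda>i j. ?\<Psi> (M i j)"] to M by simp
    \<comment> \<open>The cancellation is valid only for entries in the algebra, that is for indices
      below \<open>k\<close>, so it is carried out inside the sums.\<close>
    also have "\<dots> = mnorm m k M"
    proof -
      have "(\<Sum>j<k. \<Phi> (?\<Psi> (M i j)) (x j) \<beta>) = (\<Sum>j<k. M i j (x j) \<beta>)" if "i < k" for i x \<beta>
        using M R that by (intro sum.cong refl) auto
      then have "(\<Sum>i<k. (fnorm (\<lambda>\<beta>. \<Sum>j<k. \<Phi> (?\<Psi> (M i j)) (x j) \<beta>))\<^sup>2) = (\<Sum>i<k. (fnorm (\<lambda>\<beta>. \<Sum>j<k. M i j (x j) \<beta>))\<^sup>2)" for x
        by (intro sum.cong refl) auto
      then show ?thesis unfolding mnorm_def by simp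
    qed
    finally show "mnorm n k (\<lambda>i j. ?\<Psi> (M i j)) = mnorm m k M" .
  qed
qed

lemma ci_isomorphic_cc_homs:
  assumes "n > 0" "m > 0" and a: "symbol n a" and b: "symbol m b" and ci: "ci_isomorphic n a m b"
  obtains \<Phi> \<Psi> where "cc_hom n a m b \<Phi>" "cc_hom m b n a \<Psi>"
    "\<And>S. S \<in> domalg n a \<Longrightarrow> \<Psi> (\<Phi> S) = S" "\<And>T. T \<in> domalg m b \<Longrightarrow> \<Phi> (\<Psi> T) = T"
proof -
  obtain \<Phi> where \<Phi>: "ci_map n a m b \<Phi>" using ci unfolding ci_isomorphic_iff by blast
  note bij = ci_mapD(1)[OF \<Phi>]
  show ?thesis
  proof (rule that)
    show "cc_hom n a m b \<Phi>" by (rule ci_map_cc_hom[OF assms(1) a b \<Phi>])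
    show "cc_hom m b n a (the_inv_into (domalg n a) \<Phi>)"
      by (rule ci_map_cc_hom[OF assms(2) b a ci_map_inverse[OF a b \<Phi>]])
    show "the_inv_into (domalg n a) \<Phi> (\<Phi> S) = S" if "S \<in> domalg n a" for S
      by (rule the_inv_into_f_f[OF bij_betw_imp_inj_on[OF bij] that])
    show "\<Phi> (the_inv_into (domalg n a) \<Phi> T) = T" if "T \<in> domalg m b" for T
      by (rule f_the_inv_into_f_bij_betw[OF bij]) (use that in auto)
  qed
qed

lemma cc_hom_zero:
  assumes "symbol n a" "cc_hom n a m b \<Phi>"
  shows "\<Phi> (\<lambda>x \<beta>. 0) = (\<lambda>x \<beta>. 0)"
  using cc_homD(3)[OF assms(2) polyops_domalg[OF assms(1) polyops_zero], of 0] by simp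

lemma domalg_lincomb:
  assumes "symbol n a" "\<And>i. i \<in> F \<Longrightarrow> S i \<in> domalg n a"
  shows "(\<lambda>x \<beta>. \<Sum>i\<in>F. c i * S i x \<beta>) \<in> domalg n a"
  using assms(2)
  by (induction F rule: infinite_finite_induct)
     (auto simp: polyops_domalg[OF assms(1) polyops_zero] intro!: domalg_add[OF assms(1)] domalg_scale[OF assms(1)])

lemma cc_hom_lincomb:
  assumes a: "symbol n a" and \<Phi>: "cc_hom n a m b \<Phi>" and S: "\<And>i. i \<in> F \<Longrightarrow> S i \<in> domalg n a"
  shows "\<Phi> (\<lambda>x \<beta>. \<Sum>i\<in>F. c i * S i x \<beta>) = (\<lambda>x \<beta>. \<Sum>i\<in>F. c i * \<Phi> (S i) x \<beta>)"
  using S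
proof (induction F rule: infinite_finite_induct)
  case (insert i F)
  have "\<Phi> (\<lambda>x \<beta>. (\<lambda>x \<beta>. c i * S i x \<beta>) x \<beta> + (\<lambda>x \<beta>. \<Sum>i\<in>F. c i * S i x \<beta>) x \<beta>)
    = (\<lambda>x \<beta>. \<Phi> (\<lambda>x \<beta>. c i * S i x \<beta>) x \<beta> + \<Phi> (\<lambda>x \<beta>. \<Sum>i\<in>F. c i * S i x \<beta>) x \<beta>)"
    by (rule cc_homD(2)[OF \<Phi>]) (use insert in \<open>auto intro!: domalg_scale[OF a] domalg_lincomb[OF a]\<close>)
  then show ?case using insert cc_homD(3)[OF \<Phi>, of "S i" "c i"] by simp
qed (simp_all add: cc_hom_zero[OF a \<Phi>])

lemma cc_hom_wword_Cons:
  assumes a: "symbol n a" and \<Phi>: "cc_hom n a m b \<Phi>" and "i < n" "set \<alpha> \<subseteq> {..<n}"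
  shows "\<Phi> (wword n a (i # \<alpha>)) = \<Phi> (wword n a [i]) \<circ> \<Phi> (wword n a \<alpha>)"
  using cc_homD(4)[OF \<Phi> wword_domalg[OF a] wword_domalg[OF a], of "[i]" \<alpha>] assms(3,4) wword_append[OF a assms(4), of "[i]"]
  by simp

lemma cc_hom_diff_bound:
  assumes a: "symbol n a" and \<Phi>: "cc_hom n a m b \<Phi>" and S: "S \<in> domalg n a" "T \<in> domalg n a"
  shows "opnorm m (\<lambda>x \<beta>. \<Phi> S x \<beta> - \<Phi> T x \<beta>) \<le> opnorm n (\<lambda>x \<beta>. S x \<beta> - T x \<beta>)"
proof -
  have "\<Phi> (\<lambda>x \<beta>. S x \<beta> + (\<lambda>x \<beta>. (-1) * T x \<beta>) x \<beta>) = (\<lambda>x \<beta>. \<Phi> S x \<beta> + (\<lambda>x \<beta>. (-1) * \<Phi> T x \<beta>) x \<beta>)"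
    using cc_homD(2)[OF \<Phi> S(1) domalg_scale[OF a S(2), of "-1"]] cc_homD(3)[OF \<Phi> S(2), of "-1"] by simp
  then have "\<Phi> (\<lambda>x \<beta>. S x \<beta> - T x \<beta>) = (\<lambda>x \<beta>. \<Phi> S x \<beta> - \<Phi> T x \<beta>)" by simp
  then show ?thesis using cc_homD(6)[OF \<Phi> domalg_diff[OF a S]] by simp
qed

subsection \<open>Rank-one kernels\<close>

text \<open>Hermitian symmetry is a separate clause because positivity is tested on real
  parts.\<close>

definition psd :: "('a \<Rightarrow> 'a \<Rightarrow> complex) \<Rightarrow> 'a set \<Rightarrow> bool" where
  "psd k D \<longleftrightarrow> (\<forall>z\<in>D. \<forall>w\<in>D. k w z = cnj (k z w)) \<and>
     (\<forall>N z c. (\<forall>i<(N::nat). z i \<in> D) \<longrightarrow> 0 \<le> Re (\<Sum>i<N. \<Sum>l<N. c i * cnj (c l) * k (z l) (z i)))"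

lemma psdD:
  assumes "psd k D"
  shows "z \<in> D \<Longrightarrow> w \<in> D \<Longrightarrow> k w z = cnj (k z w)"
    and "(\<And>i. i < (N::nat) \<Longrightarrow> p i \<in> D) \<Longrightarrow> 0 \<le> Re (\<Sum>i<N. \<Sum>l<N. c i * cnj (c l) * k (p l) (p i))"
  subgoal using assms unfolding psd_def by blast
  subgoal using assms[unfolded psd_def, THEN conjunct2] by (elim allE[of _ N] allE[of _ p] allE[of _ c]) blast
  done

lemma psd_diag:
  assumes "psd k D" "z \<in> D"
  shows "k z z = of_real (Re (k z z))" "Re (k z z) \<ge> 0"
proof -
  have "k z z = cnj (k z z)" by (rule psdD(1)[OF assms(1)]; fact)
  then show "k z z = of_real (Re (k z z))" by (metis Reals_cnj_iff of_real_Re)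
  show "Re (k z z) \<ge> 0" using psdD(2)[OF assms(1), of 1 "\<lambda>_. z" "\<lambda>_. 1"] assms(2) by simp
qed

text \<open>Three points are enough for all that follows: two give the Cauchy-Schwarz inequality,
  the third detects the vectors orthogonal to a null vector.\<close>

lemma psd_three:
  assumes "psd k D" "x \<in> D" "y \<in> D" "z \<in> D"
  shows "0 \<le> (cmod p)\<^sup>2 * Re (k x x) + (cmod q)\<^sup>2 * Re (k y y) + (cmod r)\<^sup>2 * Re (k z z)
     + 2 * Re (p * cnj q * k y x) + 2 * Re (q * cnj r * k z y) + 2 * Re (p * cnj r * k z x)"
proof -
  let ?z = "\<lambda>i::nat. if i = 0 then x else if i = 1 then y else z"
  let ?c = "\<lambda>i::nat. if i = 0 then p else if i = 1 then q else r"
  have N: "{..<3::nat} = {0, 1, 2}" by auto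
  have h: "k x y = cnj (k y x)" "k y z = cnj (k z y)" "k x z = cnj (k z x)"
    by (rule psdD(1)[OF assms(1)]; fact)+
  have d: "k x x = of_real (Re (k x x))" "k y y = of_real (Re (k y y))" "k z z = of_real (Re (k z z))"
    using psd_diag(1)[OF assms(1)] assms(2-4) by auto
  have "0 \<le> Re (\<Sum>i<3. \<Sum>l<3. ?c i * cnj (?c l) * k (?z l) (?z i))"
    by (rule psdD(2)[OF assms(1)]) (use assms(2-4) in auto)
  also have "(\<Sum>i<3. \<Sum>l<3. ?c i * cnj (?c l) * k (?z l) (?z i)) = p * cnj p * k x x + q * cnj q * k y y + r * cnj r * k z z
    + (p * cnj q * k y x + cnj (p * cnj q * k y x)) + (q * cnj r * k z y + cnj (q * cnj r * k z y)) + (p * cnj r * k z x + cnj (p * cnj r * k z x))"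
    unfolding N by (simp add: h algebra_simps)
  also have "Re \<dots> = (cmod p)\<^sup>2 * Re (k x x) + (cmod q)\<^sup>2 * Re (k y y) + (cmod r)\<^sup>2 * Re (k z z)
     + 2 * Re (p * cnj q * k y x) + 2 * Re (q * cnj r * k z y) + 2 * Re (p * cnj r * k z x)"
    by (subst d(1), subst d(2), subst d(3)) (simp add: complex_mult_cnj cmod_power2 algebra_simps flip: of_real_mult)
  finally show ?thesis .
qed

lemma psd_Cauchy_Schwarz:
  assumes "psd k D" "x \<in> D" "y \<in> D" "k y y \<noteq> 0"
  shows "(cmod (k y x))\<^sup>2 \<le> Re (k x x) * Re (k y y)"
proof -
  let ?r = "Re (k y y)"
  have r: "k y y = of_real ?r" "?r > 0" using psd_diag[OF assms(1,3)] assms(4) by (auto simp: less_eq_real_def)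
  \<comment> \<open>The coefficients \<open>k y y\<close> at \<open>x\<close> and
    \<open>- k y x\<close> at \<open>y\<close> are, up to scaling, the minimising ones; the third
    coefficient is 0.\<close>
  have "Re (of_real ?r * cnj (- k y x) * k y x) = - (?r * (cmod (k y x))\<^sup>2)"
    unfolding cmod_power2 by (simp add: power2_eq_square algebra_simps)
  then have "0 \<le> ?r\<^sup>2 * Re (k x x) + (cmod (k y x))\<^sup>2 * ?r - 2 * (?r * (cmod (k y x))\<^sup>2)"
    using psd_three[OF assms(1,2,3,3), of "of_real ?r" "- k y x" 0] r(2) by simp
  also have "\<dots> = ?r * (Re (k x x) * ?r - (cmod (k y x))\<^sup>2)" by (simp add: algebra_simps power2_eq_square)
  finally show ?thesis using r(2) by (simp add: zero_le_mult_iff)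
qed

text \<open>Cauchy-Schwarz for \<open>k\<close> and for \<open>1 / k\<close> are opposite
  inequalities, so equality holds for every pair. The vector with coefficients \<open>k u u\<close>
  at \<open>x\<close> and \<open>- k u x\<close> at \<open>u\<close> is then null for the form, and
  a null vector of a positive form is orthogonal to the point \<open>y\<close>. That orthogonality
  is the claim.\<close>

lemma psd_rank_one:
  assumes k: "psd k D" and k': "psd (\<lambda>z w. 1 / k z w) D" and nz: "\<And>z w. z \<in> D \<Longrightarrow> w \<in> D \<Longrightarrow> k z w \<noteq> 0"
    and D: "u \<in> D" "x \<in> D" "y \<in> D"
  shows "k y x * k u u = k y u * k u x"
proof -
  have pos: "Re (k z z) > 0" if "z \<in> D" for z
  proof -
    have "Re (k z z) \<noteq> 0" using psd_diag(1)[OF k that] nz[OF that that] by auto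
    then show ?thesis using psd_diag(2)[OF k that] by simp
  qed
  have eq: "(cmod (k u x))\<^sup>2 = Re (k x x) * Re (k u u)"
  proof (rule antisym)
    show "(cmod (k u x))\<^sup>2 \<le> Re (k x x) * Re (k u u)" by (rule psd_Cauchy_Schwarz[OF k D(2,1) nz[OF D(1,1)]])
    have "Re (1 / k z z) = 1 / Re (k z z)" if "z \<in> D" for z
      by (subst psd_diag(1)[OF k that]) (simp add: Re_divide power2_eq_square)
    then have "(cmod (1 / k u x))\<^sup>2 \<le> 1 / (Re (k x x) * Re (k u u))"
      using psd_Cauchy_Schwarz[OF k' D(2,1)] nz D by simp
    moreover have "cmod (k u x) > 0" using nz D by simp
    ultimately show "Re (k x x) * Re (k u u) \<le> (cmod (k u x))\<^sup>2"
      using pos[OF D(1)] pos[OF D(2)] by (simp add: norm_divide power_divide field_simps)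
  qed
  let ?u = "Re (k u u)" and ?y = "Re (k y y)"
  define B where "B = of_real ?u * k y x - k u x * k y u"
  have null: "?u\<^sup>2 * Re (k x x) + (cmod (k u x))\<^sup>2 * ?u - 2 * (?u * (cmod (k u x))\<^sup>2) = 0"
    unfolding eq by (simp add: power2_eq_square)
  have *: "Re (of_real ?u * cnj (- k u x) * k u x) = - (?u * (cmod (k u x))\<^sup>2)"
    unfolding cmod_power2 by (simp add: power2_eq_square algebra_simps)
  \<comment> \<open>Perturbing the null vector by \<open>- t * B\<close> at \<open>y\<close> changes
    the form by a linear term -2 t |B|^2 and a quadratic term; this \<open>t\<close> makes the
    quadratic term t |B|^2, so the total is -t |B|^2.\<close>
  define t where "t = 1 / ?y"
  have t: "t > 0" "t * ?y = 1" using pos[OF D(3)] by (simp_all add: t_def)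
  have 3: "Re (of_real ?u * cnj (- of_real t * B) * k y x) + Re (- k u x * cnj (- of_real t * B) * k y u) = - t * (cmod B)\<^sup>2"
  proof -
    have "of_real ?u * cnj (- of_real t * B) * k y x + (- k u x) * cnj (- of_real t * B) * k y u = - of_real t * (B * cnj B)"
      unfolding B_def by (simp add: algebra_simps)
    also have "\<dots> = of_real (- t * (cmod B)\<^sup>2)" by (simp only: complex_norm_square[symmetric] of_real_mult of_real_minus)
    finally show ?thesis by (simp only: plus_complex.simps(1)[symmetric] Re_complex_of_real)
  qed
  have n: "(cmod (of_real ?u))\<^sup>2 = ?u\<^sup>2" "(cmod (- k u x))\<^sup>2 = (cmod (k u x))\<^sup>2" "(cmod (- of_real t * B))\<^sup>2 = t\<^sup>2 * (cmod B)\<^sup>2"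
    by (simp_all add: norm_mult power_mult_distrib)
  have "0 \<le> t\<^sup>2 * (cmod B)\<^sup>2 * ?y - 2 * t * (cmod B)\<^sup>2"
    using psd_three[OF k D(2,1,3), of "of_real ?u" "- k u x" "- of_real t * B"] null 3
    unfolding n * by (simp only: algebra_simps)
  also have "t\<^sup>2 * (cmod B)\<^sup>2 * ?y = (t * ?y) * (t * (cmod B)\<^sup>2)" by (simp add: power2_eq_square)
  finally have "t * (cmod B)\<^sup>2 \<le> 0" unfolding t(2) by simp
  then have "B = 0" using t(1) by (simp add: mult_le_0_iff)
  then show ?thesis using psd_diag(1)[OF k D(1)] by (simp add: B_def mult_ac)
qed

text \<open>The adjoint of a contractive row is a contractive column, expressed without adjoints:
  \<open>x\<close> stands for the column applied to \<open>y\<close>, and \<open>eq\<close> is the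
  relation that makes it so. With A the squared norm of \<open>x\<close>, Cauchy-Schwarz gives A
  \<le> sqrt A * fnorm y.\<close>

lemma row_contr_dual:
  assumes row: "row_contr m S X" and x: "\<And>\<alpha>. \<alpha> \<in> S \<Longrightarrow> x \<alpha> \<in> Fock m" and y: "y \<in> Fock m"
    and V: "(\<lambda>\<beta>. \<Sum>\<alpha>\<in>S. X \<alpha> (x \<alpha>) \<beta>) \<in> Fock m"
    and eq: "ip (\<lambda>\<beta>. \<Sum>\<alpha>\<in>S. X \<alpha> (x \<alpha>) \<beta>) y = of_real (\<Sum>\<alpha>\<in>S. (fnorm (x \<alpha>))\<^sup>2)"
  shows "(\<Sum>\<alpha>\<in>S. (fnorm (x \<alpha>))\<^sup>2) \<le> (fnorm y)\<^sup>2"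
proof -
  define A where "A = (\<Sum>\<alpha>\<in>S. (fnorm (x \<alpha>))\<^sup>2)"
  let ?V = "\<lambda>\<beta>. \<Sum>\<alpha>\<in>S. X \<alpha> (x \<alpha>) \<beta>"
  have A0: "A \<ge> 0" unfolding A_def by (intro sum_nonneg) auto
  have "A = cmod (ip ?V y)" using A0 unfolding eq A_def[symmetric] by simp
  also have "\<dots> \<le> fnorm ?V * fnorm y" by (rule ip_Cauchy_Schwarz[OF V y])
  also have "\<dots> \<le> sqrt A * fnorm y"
  proof (rule mult_right_mono)
    have "(fnorm ?V)\<^sup>2 \<le> A" unfolding A_def by (rule row[unfolded row_contr_def, THEN spec, THEN mp]) (simp add: x)
    then show "fnorm ?V \<le> sqrt A" by (rule real_le_rsqrt)
  qed simp
  finally have le: "sqrt A * sqrt A \<le> sqrt A * fnorm y" using A0 by simp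
  have "sqrt A \<le> fnorm y"
  proof (cases "A = 0")
    case False
    then have "sqrt A > 0" using A0 by simp
    then show ?thesis using le by (simp only: mult_le_cancel_left_pos)
  qed simp
  then have "(sqrt A)\<^sup>2 \<le> (fnorm y)\<^sup>2" using A0 by (intro power_mono) auto
  then show ?thesis using A0 unfolding A_def[symmetric] by simp
qed

text \<open>On a combination \<open>y\<close> of kernel vectors the adjoints act diagonally, so the
  column in \<open>row_contr_dual\<close> is explicit. The difference of the two squared norms is
  the asserted quadratic form.\<close>

lemma row_contr_kernel:
  fixes N :: nat
  assumes b: "symbol m b" and S: "finite S" and T: "\<And>\<alpha>. \<alpha> \<in> S \<Longrightarrow> T \<alpha> \<in> domalg m b"
    and a: "\<And>\<alpha>. a \<alpha> \<ge> (0::real)"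
    and row: "row_contr m S (\<lambda>\<alpha> x \<beta>. of_real (sqrt (a \<alpha>)) * T \<alpha> x \<beta>)"
    and z: "\<And>i. i < N \<Longrightarrow> rho b (z i) < 1"
  shows "0 \<le> Re (\<Sum>i<N. \<Sum>l<N. c i * cnj (c l) *
    ((1 - (\<Sum>\<alpha>\<in>S. of_real (a \<alpha>) * ev b (z l) (T \<alpha>) * cnj (ev b (z i) (T \<alpha>)))) / (1 - pairing b (z l) (z i))))"
proof -
  let ?k = "\<lambda>i. kv b (z i)" and ?t = "\<lambda>\<alpha> i. of_real (sqrt (a \<alpha>)) * ev b (z i) (T \<alpha>)"
  have k: "?k i \<in> Fock m" if "i < N" for i using kv_Fock[OF b z[OF that]] .
  \<comment> \<open>The image of \<open>y\<close> under the adjoint of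
    \<open>sqrt (a \<alpha>)\<close> times \<open>T \<alpha>\<close>.\<close>
  define x where "x \<alpha> = (\<lambda>\<beta>. \<Sum>i<N. (c i * cnj (?t \<alpha> i)) * ?k i \<beta>)" for \<alpha>
  define y where "y = (\<lambda>\<beta>. \<Sum>i<N. c i * ?k i \<beta>)"
  define V where "V = (\<lambda>\<beta>. \<Sum>\<alpha>\<in>S. of_real (sqrt (a \<alpha>)) * T \<alpha> (x \<alpha>) \<beta>)"
  define A where "A = (\<Sum>\<alpha>\<in>S. (fnorm (x \<alpha>))\<^sup>2)"
  have x: "x \<alpha> \<in> Fock m" for \<alpha> unfolding x_def by (intro Fock_sum Fock_scale k) auto
  have y: "y \<in> Fock m" unfolding y_def by (intro Fock_sum Fock_scale k) auto
  have Tx: "T \<alpha> (x \<alpha>) \<in> Fock m" if "\<alpha> \<in> S" for \<alpha> using bounded_opD(1)[OF domalg_bounded[OF T[OF that]] x] .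
  have V: "V \<in> Fock m" unfolding V_def by (intro Fock_sum Fock_scale Tx)
  have ipx: "ip w (x \<alpha>) = (\<Sum>l<N. cnj (c l) * ?t \<alpha> l * ip w (?k l))" if "w \<in> Fock m" for w \<alpha>
    unfolding x_def by (subst ip_sum_right[where n = m, OF _ that]) (auto simp: ip_scale_right intro!: Fock_scale k)
  have ipy: "ip w y = (\<Sum>l<N. cnj (c l) * ip w (?k l))" if "w \<in> Fock m" for w
    unfolding y_def by (subst ip_sum_right[where n = m, OF _ that]) (auto simp: ip_scale_right intro!: Fock_scale k)
  have ipxk: "ip (x \<alpha>) (?k l) = (\<Sum>i<N. c i * cnj (?t \<alpha> i) * ip (?k i) (?k l))" if "l < N" for \<alpha> l
    unfolding x_def by (subst ip_sum_left[where n = m, OF _ k[OF that]]) (auto simp: ip_scale_left intro!: Fock_scale k)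
  have ipyk: "ip y (?k l) = (\<Sum>i<N. c i * ip (?k i) (?k l))" if "l < N" for l
    unfolding y_def by (subst ip_sum_left[where n = m, OF _ k[OF that]]) (auto simp: ip_scale_left intro!: Fock_scale k)
  have "ip V y = (\<Sum>\<alpha>\<in>S. of_real (sqrt (a \<alpha>)) * ip (T \<alpha> (x \<alpha>)) y)"
    unfolding V_def by (subst ip_sum_left[where n = m, OF _ y]) (auto simp: ip_scale_left intro!: Fock_scale Tx)
  also have "\<dots> = (\<Sum>\<alpha>\<in>S. ip (x \<alpha>) (x \<alpha>))"
  proof (intro sum.cong refl)
    fix \<alpha> assume \<alpha>: "\<alpha> \<in> S"
    show "of_real (sqrt (a \<alpha>)) * ip (T \<alpha> (x \<alpha>)) y = ip (x \<alpha>) (x \<alpha>)"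
      unfolding ipy[OF Tx[OF \<alpha>]] ipx[OF x] sum_distrib_left
      by (intro sum.cong refl) (simp add: domalg_kv[OF b z T[OF \<alpha>] x])
  qed
  also have "\<dots> = of_real A" unfolding A_def of_real_sum by (intro sum.cong refl ip_self[OF x])
  finally have "A \<le> (fnorm y)\<^sup>2"
    using row_contr_dual[OF row x y V[unfolded V_def]] unfolding A_def V_def by simp
  moreover have "(\<Sum>\<alpha>\<in>S. ip (x \<alpha>) (x \<alpha>)) = of_real A" unfolding A_def of_real_sum by (intro sum.cong refl ip_self[OF x])
  ultimately have nonneg: "0 \<le> Re (ip y y - (\<Sum>\<alpha>\<in>S. ip (x \<alpha>) (x \<alpha>)))"
    by (simp add: ip_self[OF y] del: of_real_power)
  have e1: "ip y y = (\<Sum>i<N. \<Sum>l<N. c i * cnj (c l) * (1 / (1 - pairing b (z l) (z i))))"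
  proof -
    have "ip y y = (\<Sum>l<N. cnj (c l) * (\<Sum>i<N. c i * ip (?k i) (?k l)))"
      unfolding ipy[OF y] by (intro sum.cong refl) (simp add: ipyk)
    also have "\<dots> = (\<Sum>l<N. \<Sum>i<N. c i * cnj (c l) * (1 / (1 - pairing b (z l) (z i))))"
      unfolding sum_distrib_left by (intro sum.cong refl) (simp add: kv_ip[OF b z z] mult_ac)
    also have "\<dots> = (\<Sum>i<N. \<Sum>l<N. c i * cnj (c l) * (1 / (1 - pairing b (z l) (z i))))" by (rule sum.swap)
    finally show ?thesis .
  qed
  have e2: "(\<Sum>\<alpha>\<in>S. ip (x \<alpha>) (x \<alpha>)) = (\<Sum>i<N. \<Sum>l<N. c i * cnj (c l) *
    ((\<Sum>\<alpha>\<in>S. of_real (a \<alpha>) * ev b (z l) (T \<alpha>) * cnj (ev b (z i) (T \<alpha>))) / (1 - pairing b (z l) (z i))))"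
  proof -
    have "ip (x \<alpha>) (x \<alpha>) = (\<Sum>i<N. \<Sum>l<N. c i * cnj (c l) *
      (of_real (a \<alpha>) * ev b (z l) (T \<alpha>) * cnj (ev b (z i) (T \<alpha>)) / (1 - pairing b (z l) (z i))))" for \<alpha>
    proof -
      have aa: "complex_of_real (a \<alpha>) = of_real (sqrt (a \<alpha>)) * of_real (sqrt (a \<alpha>))"
        unfolding of_real_mult[symmetric] real_sqrt_mult_self using a by simp
      have "ip (x \<alpha>) (x \<alpha>) = (\<Sum>l<N. cnj (c l) * ?t \<alpha> l * (\<Sum>i<N. c i * cnj (?t \<alpha> i) * ip (?k i) (?k l)))"
        unfolding ipx[OF x] by (intro sum.cong refl) (simp add: ipxk)
      also have "\<dots> = (\<Sum>l<N. \<Sum>i<N. c i * cnj (c l) *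
        (of_real (a \<alpha>) * ev b (z l) (T \<alpha>) * cnj (ev b (z i) (T \<alpha>)) / (1 - pairing b (z l) (z i))))"
        unfolding sum_distrib_left
      proof (intro sum.cong refl)
        fix l i assume "l \<in> {..<N}" "i \<in> {..<N}"
        then have "ip (?k i) (?k l) = 1 / (1 - pairing b (z l) (z i))" using kv_ip[OF b z z] by simp
        then show "cnj (c l) * ?t \<alpha> l * (c i * cnj (?t \<alpha> i) * ip (?k i) (?k l)) = c i * cnj (c l) *
          (of_real (a \<alpha>) * ev b (z l) (T \<alpha>) * cnj (ev b (z i) (T \<alpha>)) / (1 - pairing b (z l) (z i)))"
          unfolding aa by (simp only: complex_cnj_mult complex_cnj_complex_of_real) simp
      qed
      also have "\<dots> = (\<Sum>i<N. \<Sum>l<N. c i * cnj (c l) *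
        (of_real (a \<alpha>) * ev b (z l) (T \<alpha>) * cnj (ev b (z i) (T \<alpha>)) / (1 - pairing b (z l) (z i))))" by (rule sum.swap)
      finally show ?thesis .
    qed
    then have "(\<Sum>\<alpha>\<in>S. ip (x \<alpha>) (x \<alpha>)) = (\<Sum>\<alpha>\<in>S. \<Sum>i<N. \<Sum>l<N. c i * cnj (c l) *
      (of_real (a \<alpha>) * ev b (z l) (T \<alpha>) * cnj (ev b (z i) (T \<alpha>)) / (1 - pairing b (z l) (z i))))" by simp
    also have "\<dots> = (\<Sum>i<N. \<Sum>l<N. \<Sum>\<alpha>\<in>S. c i * cnj (c l) *
      (of_real (a \<alpha>) * ev b (z l) (T \<alpha>) * cnj (ev b (z i) (T \<alpha>)) / (1 - pairing b (z l) (z i))))"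
    proof -
      have "(\<Sum>\<alpha>\<in>S. \<Sum>i<N. \<Sum>l<N. h \<alpha> i l) = (\<Sum>i<N. \<Sum>l<N. \<Sum>\<alpha>\<in>S. h \<alpha> i l)" for h :: "nat list \<Rightarrow> nat \<Rightarrow> nat \<Rightarrow> complex"
        by (rule trans[OF sum.swap]) (intro sum.cong refl sum.swap)
      then show ?thesis .
    qed
    also have "\<dots> = (\<Sum>i<N. \<Sum>l<N. c i * cnj (c l) *
      ((\<Sum>\<alpha>\<in>S. of_real (a \<alpha>) * ev b (z l) (T \<alpha>) * cnj (ev b (z i) (T \<alpha>))) / (1 - pairing b (z l) (z i))))"
      by (simp only: sum_distrib_left sum_divide_distrib)
    finally show ?thesis .
  qed
  from nonneg show ?thesis unfolding e1 e2 by (simp only: sum_subtractf[symmetric] right_diff_distrib[symmetric] diff_divide_distrib[symmetric])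
qed

subsection \<open>The map induced on point evaluations\<close>

lemma symbol_Nil: "symbol n a \<Longrightarrow> \<alpha> \<in> supp a \<Longrightarrow> \<alpha> \<noteq> []"
  using symbolD(3) by blast

lemma rho_scale_le:
  assumes a: "symbol n a" and t: "cmod t \<le> 1"
  shows "rho a (\<lambda>i. t * z i) \<le> (cmod t)\<^sup>2 * rho a z"
  unfolding rho_def sum_distrib_left
proof (rule sum_mono)
  fix \<alpha> assume \<alpha>: "\<alpha> \<in> supp a"
  have "length \<alpha> \<ge> 1" using symbol_Nil[OF a \<alpha>] by (simp add: Suc_le_eq)
  then have "cmod t ^ length \<alpha> \<le> cmod t ^ 1" using t by (intro power_decreasing) auto
  then have "(cmod t ^ length \<alpha>)\<^sup>2 \<le> (cmod t)\<^sup>2" by (intro power_mono) auto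
  then have "(cmod t ^ length \<alpha>)\<^sup>2 * (a \<alpha> * (cmod (wp z \<alpha>))\<^sup>2) \<le> (cmod t)\<^sup>2 * (a \<alpha> * (cmod (wp z \<alpha>))\<^sup>2)"
    by (rule mult_right_mono) (simp add: symbolD(4)[OF a])
  then show "a \<alpha> * (cmod (wp (\<lambda>i. t * z i) \<alpha>))\<^sup>2 \<le> (cmod t)\<^sup>2 * (a \<alpha> * (cmod (wp z \<alpha>))\<^sup>2)"
    by (simp add: wp_mult wp_const norm_mult norm_power power_mult_distrib mult_ac)
qed

text \<open>The domain is absorbing at the origin. One direction at a time is enough, since all
  later analysis takes place on lines through a point.\<close>

lemma rho_small:
  assumes a: "symbol n a"
  obtains \<epsilon> where "\<epsilon> > 0" "\<epsilon> \<le> 1" "\<And>t. cmod t \<le> \<epsilon> \<Longrightarrow> rho a (\<lambda>i. t * z i) < 1"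
proof
  let ?r = "rho a z"
  note r = rho_nonneg[OF a, of z]
  show "1 / (1 + ?r) > 0" "1 / (1 + ?r) \<le> 1" using r by auto
  fix t assume t: "cmod t \<le> 1 / (1 + ?r)"
  then have t1: "cmod t \<le> 1" using r by (auto intro: order_trans)
  have "rho a (\<lambda>i. t * z i) \<le> (cmod t)\<^sup>2 * ?r" by (rule rho_scale_le[OF a t1])
  also have "\<dots> \<le> cmod t * ?r"
    using t1 r by (intro mult_right_mono) (auto simp: power2_eq_square intro: mult_left_le)
  also have "\<dots> \<le> 1 / (1 + ?r) * ?r" using t r by (intro mult_right_mono) auto
  also have "\<dots> < 1" using r by (simp add: field_simps)
  finally show "rho a (\<lambda>i. t * z i) < 1" .
qed

lemma rho_0: "symbol n a \<Longrightarrow> rho a (\<lambda>_. 0) = 0"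
  unfolding rho_def using symbol_Nil wp_zero by (intro sum.neutral ballI) auto

lemma pairing_0:
  assumes "symbol n a"
  shows "pairing a z (\<lambda>_. 0) = 0" "pairing a (\<lambda>_. 0) z = 0"
  unfolding pairing_def using symbol_Nil[OF assms] wp_zero by (auto intro!: sum.neutral)

definition unitv :: "nat \<Rightarrow> nat \<Rightarrow> complex" where
  "unitv k i = (if i = k then 1 else 0)"

text \<open>The character \<open>ev b z\<close> composed with \<open>\<Phi>\<close>, recorded
  through its values on the generators.\<close>

definition phi :: "nat \<Rightarrow> (nat list \<Rightarrow> real) \<Rightarrow> (nat list \<Rightarrow> real) \<Rightarrow> (op \<Rightarrow> op) \<Rightarrow> (nat \<Rightarrow> complex) \<Rightarrow> nat \<Rightarrow> complex" where
  "phi n a b \<Phi> z j = ev b z (\<Phi> (wword n a [j]))"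

locale cc_iso =
  fixes n :: nat and a :: "nat list \<Rightarrow> real" and m :: nat and b :: "nat list \<Rightarrow> real"
    and \<Phi> \<Psi> :: "op \<Rightarrow> op"
  assumes n0: "n > 0" and m0: "m > 0" and a: "symbol n a" and b: "symbol m b"
    and \<Phi>: "cc_hom n a m b \<Phi>" and \<Psi>: "cc_hom m b n a \<Psi>"
    and \<Psi>\<Phi>: "\<And>S. S \<in> domalg n a \<Longrightarrow> \<Psi> (\<Phi> S) = S" and \<Phi>\<Psi>: "\<And>T. T \<in> domalg m b \<Longrightarrow> \<Phi> (\<Psi> T) = T"
begin

text \<open>Makes every statement of the locale available with the two symbols exchanged; most
  two-sided results are obtained by proving one side.\<close>

lemma swap: "cc_iso m b n a \<Psi> \<Phi>"
  by unfold_locales (rule m0 n0 b a \<Psi> \<Phi> \<Phi>\<Psi> \<Psi>\<Phi>; assumption?)+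

abbreviation "\<phi> \<equiv> phi n a b \<Phi>"
abbreviation "\<psi> \<equiv> phi m b a \<Psi>"

lemma ev_word:
  assumes z: "rho b z < 1" and "set \<alpha> \<subseteq> {..<n}"
  shows "ev b z (\<Phi> (wword n a \<alpha>)) = wp (\<phi> z) \<alpha>"
  using assms(2)
proof (induction \<alpha>)
  case Nil
  then show ?case using cc_homD(5)[OF \<Phi>] by (simp add: ev_idop)
next
  case (Cons i \<alpha>)
  then have i: "i < n" "set \<alpha> \<subseteq> {..<n}" by auto
  have D: "\<Phi> (wword n a [i]) \<in> domalg m b" "\<Phi> (wword n a \<alpha>) \<in> domalg m b"
    using i by (auto intro!: cc_homD(1)[OF \<Phi>] wword_domalg[OF a])
  show ?case
    unfolding cc_hom_wword_Cons[OF a \<Phi> i] ev_mult[OF b z D] Cons.IH[OF i(2)] wp_simps phi_def[symmetric] ..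
qed

lemma ev_lincomb:
  assumes z: "rho b z < 1" and F: "finite F" "\<And>\<alpha>. \<alpha> \<in> F \<Longrightarrow> set \<alpha> \<subseteq> {..<n}"
  shows "ev b z (\<Phi> (\<lambda>x \<beta>. \<Sum>\<alpha>\<in>F. c \<alpha> * wword n a \<alpha> x \<beta>)) = (\<Sum>\<alpha>\<in>F. c \<alpha> * wp (\<phi> z) \<alpha>)"
proof -
  have D: "\<Phi> (wword n a \<alpha>) \<in> domalg m b" if "\<alpha> \<in> F" for \<alpha>
    by (intro cc_homD(1)[OF \<Phi>] wword_domalg[OF a] F(2) that)
  have "\<Phi> (\<lambda>x \<beta>. \<Sum>\<alpha>\<in>F. c \<alpha> * wword n a \<alpha> x \<beta>) = (\<lambda>x \<beta>. \<Sum>\<alpha>\<in>F. c \<alpha> * \<Phi> (wword n a \<alpha>) x \<beta>)"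
    by (rule cc_hom_lincomb[OF a \<Phi>]) (intro wword_domalg[OF a] F(2))
  moreover have "ip (\<lambda>\<beta>. \<Sum>\<alpha>\<in>F. c \<alpha> * \<Phi> (wword n a \<alpha>) vac \<beta>) (kv b z) = (\<Sum>\<alpha>\<in>F. c \<alpha> * ev b z (\<Phi> (wword n a \<alpha>)))"
    by (subst ip_sum_left[where n = m, OF _ kv_Fock[OF b z]])
       (auto simp: ip_scale_left ev_def intro!: Fock_scale bounded_opD(1)[OF domalg_bounded[OF D] vac_Fock])
  moreover have "(\<Sum>\<alpha>\<in>F. c \<alpha> * ev b z (\<Phi> (wword n a \<alpha>))) = (\<Sum>\<alpha>\<in>F. c \<alpha> * wp (\<phi> z) \<alpha>)"
    by (intro sum.cong refl) (simp add: ev_word[OF z F(2)])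
  ultimately show ?thesis by (simp add: ev_def)
qed

lemma ev_Phi_diff:
  assumes z: "rho b z < 1" and S: "S \<in> domalg n a" "T \<in> domalg n a"
  shows "cmod (ev b z (\<Phi> S) - ev b z (\<Phi> T)) \<le> fnorm (kv b z) * opnorm n (\<lambda>x \<beta>. S x \<beta> - T x \<beta>)"
proof -
  have "cmod (ev b z (\<Phi> S) - ev b z (\<Phi> T)) \<le> opnorm m (\<lambda>x \<beta>. \<Phi> S x \<beta> - \<Phi> T x \<beta>) * fnorm (kv b z)"
    by (rule ev_diff_bound[OF b z domalg_bounded[OF cc_homD(1)[OF \<Phi> S(1)]] domalg_bounded[OF cc_homD(1)[OF \<Phi> S(2)]]])
  also have "\<dots> \<le> opnorm n (\<lambda>x \<beta>. S x \<beta> - T x \<beta>) * fnorm (kv b z)"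
    by (intro mult_right_mono cc_hom_diff_bound[OF a \<Phi> S]) simp
  finally show ?thesis by (simp add: mult.commute)
qed

text \<open>Used before \<open>\<phi> z\<close> is known to lie in the domain, when evaluation at
  \<open>\<phi> z\<close> is not yet available on the whole algebra.\<close>

lemma ev_Phi_unique:
  assumes z: "rho b z < 1" and w: "rho b w < 1" and eq: "\<And>j. j < n \<Longrightarrow> \<phi> z j = \<phi> w j" and S: "S \<in> domalg n a"
  shows "ev b z (\<Phi> S) = ev b w (\<Phi> S)"
proof -
  define L where "L T = ev b z (\<Phi> T) - ev b w (\<Phi> T)" for T
  have "L S = 0"
  proof (rule domalg_functional_eq_0[OF a S])
    fix P assume P: "P \<in> polyops n a"
    let ?d = "opnorm n (\<lambda>x \<beta>. S x \<beta> - P x \<beta>)"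
    have PD: "P \<in> domalg n a" by (rule polyops_domalg[OF a P])
    have "cmod (L S - L P) = cmod ((ev b z (\<Phi> S) - ev b z (\<Phi> P)) - (ev b w (\<Phi> S) - ev b w (\<Phi> P)))"
      by (simp add: L_def algebra_simps)
    also have "\<dots> \<le> fnorm (kv b z) * ?d + fnorm (kv b w) * ?d"
      by (rule order_trans[OF norm_triangle_ineq4]) (intro add_mono ev_Phi_diff z w S PD)
    finally show "cmod (L S - L P) \<le> (fnorm (kv b z) + fnorm (kv b w)) * ?d" by (simp add: distrib_right)
    obtain F c where F: "finite F" "\<And>\<alpha>. \<alpha> \<in> F \<Longrightarrow> set \<alpha> \<subseteq> {..<n}" "P = (\<lambda>x \<beta>. \<Sum>\<alpha>\<in>F. c \<alpha> * wword n a \<alpha> x \<beta>)"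
      using polyopsE[OF P] by blast
    have "wp (\<phi> z) \<alpha> = wp (\<phi> w) \<alpha>" if "\<alpha> \<in> F" for \<alpha> using F(2)[OF that] by (intro wp_cong eq) auto
    then show "L P = 0"
      unfolding L_def F(3) using ev_lincomb[OF z F(1) F(2), of c] ev_lincomb[OF w F(1) F(2), of c] by simp
  qed
  then show ?thesis by (simp add: L_def)
qed

lemma kernel_psd:
  assumes "\<And>i. i < (N::nat) \<Longrightarrow> rho b (z i) < 1"
  shows "0 \<le> Re (\<Sum>i<N. \<Sum>l<N. c i * cnj (c l) * ((1 - pairing a (\<phi> (z l)) (\<phi> (z i))) / (1 - pairing b (z l) (z i))))"
proof -
  have "0 \<le> Re (\<Sum>i<N. \<Sum>l<N. c i * cnj (c l) *
    ((1 - (\<Sum>\<alpha>\<in>supp a. of_real (a \<alpha>) * ev b (z l) (\<Phi> (wword n a \<alpha>)) * cnj (ev b (z i) (\<Phi> (wword n a \<alpha>))))) / (1 - pairing b (z l) (z i))))"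
    by (rule row_contr_kernel[OF b symbolD(1)[OF a] _ symbolD(4)[OF a] cc_homD(7)[OF \<Phi>] assms])
       (use symbolD(2)[OF a] in \<open>auto intro!: cc_homD(1)[OF \<Phi>] wword_domalg[OF a]\<close>)
  also have "(\<Sum>i<N. \<Sum>l<N. c i * cnj (c l) *
    ((1 - (\<Sum>\<alpha>\<in>supp a. of_real (a \<alpha>) * ev b (z l) (\<Phi> (wword n a \<alpha>)) * cnj (ev b (z i) (\<Phi> (wword n a \<alpha>))))) / (1 - pairing b (z l) (z i))))
    = (\<Sum>i<N. \<Sum>l<N. c i * cnj (c l) * ((1 - pairing a (\<phi> (z l)) (\<phi> (z i))) / (1 - pairing b (z l) (z i))))"
  proof (intro sum.cong refl)
    fix i l assume il: "i \<in> {..<N}" "l \<in> {..<N}"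
    have "(\<Sum>\<alpha>\<in>supp a. of_real (a \<alpha>) * ev b (z l) (\<Phi> (wword n a \<alpha>)) * cnj (ev b (z i) (\<Phi> (wword n a \<alpha>)))) = pairing a (\<phi> (z l)) (\<phi> (z i))"
      unfolding pairing_def
    proof (intro sum.cong refl)
      fix \<alpha> assume "\<alpha> \<in> supp a"
      then have "set \<alpha> \<subseteq> {..<n}" using symbolD(2)[OF a] by simp
      then show "of_real (a \<alpha>) * ev b (z l) (\<Phi> (wword n a \<alpha>)) * cnj (ev b (z i) (\<Phi> (wword n a \<alpha>))) = of_real (a \<alpha>) * wp (\<phi> (z l)) \<alpha> * cnj (wp (\<phi> (z i)) \<alpha>)"
        using il assms by (simp add: ev_word)
    qed
    then show "c i * cnj (c l) *
      ((1 - (\<Sum>\<alpha>\<in>supp a. of_real (a \<alpha>) * ev b (z l) (\<Phi> (wword n a \<alpha>)) * cnj (ev b (z i) (\<Phi> (wword n a \<alpha>))))) / (1 - pairing b (z l) (z i)))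
      = c i * cnj (c l) * ((1 - pairing a (\<phi> (z l)) (\<phi> (z i))) / (1 - pairing b (z l) (z i)))" by simp
  qed
  finally show ?thesis .
qed

definition ker :: "(nat \<Rightarrow> complex) \<Rightarrow> (nat \<Rightarrow> complex) \<Rightarrow> complex" where
  "ker z w = (1 - pairing a (\<phi> z) (\<phi> w)) / (1 - pairing b z w)"

lemma psd_ker: "psd ker {z. rho b z < 1}"
  unfolding psd_def
proof (intro conjI ballI allI impI)
  fix z w show "ker w z = cnj (ker z w)" unfolding ker_def pairing_cnj[of _ w z] pairing_cnj[of _ "\<phi> w" "\<phi> z"] by simp
next
  fix N :: nat and z c assume "\<forall>i<N. z i \<in> {z. rho b z < 1}"
  then show "0 \<le> Re (\<Sum>i<N. \<Sum>l<N. c i * cnj (c l) * ker (z l) (z i))"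
    unfolding ker_def by (intro kernel_psd) auto
qed

text \<open>If \<open>\<phi> z\<close> lay on the boundary, equality in Cauchy-Schwarz would make \<open>\<phi>\<close> constant.\<close>

lemma phi_dom:
  assumes z: "rho b z < 1"
  shows "rho a (\<phi> z) < 1"
proof (rule ccontr)
  assume "\<not> rho a (\<phi> z) < 1"
  moreover have le: "rho a (\<phi> w) \<le> 1" if w: "rho b w < 1" for w
  proof -
    have "Re (ker w w) \<ge> 0" using psd_diag(2)[OF psd_ker] w by simp
    also have "ker w w = of_real ((1 - rho a (\<phi> w)) / (1 - rho b w))" by (simp add: ker_def pairing_self)
    finally show ?thesis using w by (simp add: zero_le_divide_iff)
  qed
  ultimately have r1: "rho a (\<phi> z) = 1" using z by force
  have const: "\<phi> w j = \<phi> z j" if w: "rho b w < 1" and j: "j < n" for w j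
  proof -
    have kz: "ker z z = 0" using r1 by (simp add: ker_def pairing_self)
    have kw: "ker w z = 0"
    proof (rule ccontr)
      assume nz: "ker w z \<noteq> 0"
      let ?r = "Re (ker w w)" and ?B = "ker w z"
      have r: "?r \<ge> 0" using psd_diag(2)[OF psd_ker] w by simp
      \<comment> \<open>As \<open>ker z z = 0\<close>, the coefficient at \<open>z\<close> costs
        nothing; with this choice the form equals r - 2 (r + 1) < 0, where r is the value at
        \<open>w\<close>.\<close>
      define p where "p = - complex_of_real (?r + 1) / ?B"
      have 1: "p * cnj 1 * ?B = of_real (- (?r + 1))" using nz by (simp add: p_def)
      show False
        using psd_three[OF psd_ker, of z w w p 1 0] z w kz r unfolding 1 Re_complex_of_real by simp
    qed
    then have "pairing a (\<phi> w) (\<phi> z) = 1" using pairing_ne_1[OF b w z] by (simp add: ker_def)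
    then have p1: "Re (pairing a (\<phi> w) (\<phi> z)) = 1" by simp
    \<comment> \<open>Both points have \<open>rho\<close> at most 1 and their pairing is 1, so their
      weighted distance is 0. The one-letter words then identify the coordinates.\<close>
    have "(\<Sum>\<alpha>\<in>supp a. a \<alpha> * (cmod (wp (\<phi> w) \<alpha> - wp (\<phi> z) \<alpha>))\<^sup>2) = rho a (\<phi> w) + rho a (\<phi> z) - 2 * Re (pairing a (\<phi> w) (\<phi> z))"
    proof -
      have *: "(cmod (u - v))\<^sup>2 = (cmod u)\<^sup>2 + (cmod v)\<^sup>2 - 2 * Re (u * cnj v)" for u v
        unfolding cmod_power2 by (simp add: power2_eq_square algebra_simps)
      show ?thesis
        unfolding rho_def pairing_def * Re_sum sum_distrib_left sum.distrib[symmetric] sum_subtractf[symmetric]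
        by (intro sum.cong refl) (simp add: algebra_simps)
    qed
    also have "\<dots> \<le> 0" using p1 r1 le[OF w] by simp
    finally have s0: "(\<Sum>\<alpha>\<in>supp a. a \<alpha> * (cmod (wp (\<phi> w) \<alpha> - wp (\<phi> z) \<alpha>))\<^sup>2) \<le> 0" .
    have "a [j] * (cmod (wp (\<phi> w) [j] - wp (\<phi> z) [j]))\<^sup>2 \<le> (\<Sum>\<alpha>\<in>supp a. a \<alpha> * (cmod (wp (\<phi> w) \<alpha> - wp (\<phi> z) \<alpha>))\<^sup>2)"
      using symbolD(5)[OF a j] by (intro member_le_sum) (auto simp: symbolD(4)[OF a] symbolD(1)[OF a])
    then have "a [j] * (cmod (\<phi> w j - \<phi> z j))\<^sup>2 \<le> 0" using s0 by simp
    then show ?thesis using symbolD(5)[OF a j] by (simp add: mult_le_0_iff)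
  qed
  \<comment> \<open>If \<open>\<phi>\<close> were constant, evaluation at a point near the origin
    would agree with evaluation at the origin on the whole range of \<open>\<Phi>\<close>, which
    contains a generator that separates the two points.\<close>
  obtain \<epsilon> where e: "\<epsilon> > 0" "\<And>t. cmod t \<le> \<epsilon> \<Longrightarrow> rho b (\<lambda>i. t * unitv 0 i) < 1" using rho_small[OF b, of "unitv 0"] by blast
  let ?w = "\<lambda>i. complex_of_real \<epsilon> * unitv 0 i"
  have w: "rho b ?w < 1" using e(1) by (intro e(2)) simp
  have W: "wword m b [0] \<in> domalg m b" using m0 by (intro wword_domalg[OF b]) auto
  have "ev b ?w (\<Phi> (\<Psi> (wword m b [0]))) = ev b (\<lambda>_. 0) (\<Phi> (\<Psi> (wword m b [0])))"
    by (rule ev_Phi_unique[OF w _ _ cc_homD(1)[OF \<Psi> W]]) (use const w rho_0[OF b] in auto)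
  then have "wp ?w [0] = wp (\<lambda>_. 0) [0]"
    unfolding \<Phi>\<Psi>[OF W] using ev_wword[OF b w, of "[0]"] ev_wword[OF b, of "\<lambda>_. 0" "[0]"] rho_0[OF b] m0 by simp
  then show False using e(1) by (simp add: unitv_def)
qed

lemma ev_Phi:
  assumes z: "rho b z < 1" and S: "S \<in> domalg n a"
  shows "ev b z (\<Phi> S) = ev a (\<phi> z) S"
proof -
  note w = phi_dom[OF z]
  define L where "L T = ev b z (\<Phi> T) - ev a (\<phi> z) T" for T
  have "L S = 0"
  proof (rule domalg_functional_eq_0[OF a S])
    fix P assume P: "P \<in> polyops n a"
    let ?d = "opnorm n (\<lambda>x \<beta>. S x \<beta> - P x \<beta>)"
    have PD: "P \<in> domalg n a" by (rule polyops_domalg[OF a P])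
    have "cmod (L S - L P) = cmod ((ev b z (\<Phi> S) - ev b z (\<Phi> P)) - (ev a (\<phi> z) S - ev a (\<phi> z) P))"
      by (simp add: L_def algebra_simps)
    also have "\<dots> \<le> fnorm (kv b z) * ?d + ?d * fnorm (kv a (\<phi> z))"
      by (rule order_trans[OF norm_triangle_ineq4])
         (intro add_mono ev_Phi_diff z S PD ev_diff_bound[OF a w] domalg_bounded[OF S] domalg_bounded[OF PD])
    finally show "cmod (L S - L P) \<le> (fnorm (kv b z) + fnorm (kv a (\<phi> z))) * ?d" by (simp add: algebra_simps)
    obtain F c where F: "finite F" "\<And>\<alpha>. \<alpha> \<in> F \<Longrightarrow> set \<alpha> \<subseteq> {..<n}" "P = (\<lambda>x \<beta>. \<Sum>\<alpha>\<in>F. c \<alpha> * wword n a \<alpha> x \<beta>)"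
      using polyopsE[OF P] by blast
    have "ev a (\<phi> z) P = (\<Sum>\<alpha>\<in>F. c \<alpha> * wp (\<phi> z) \<alpha>)"
      unfolding F(3) ev_def
      by (subst ip_polyop[OF a F(1) F(2) vac_Fock kv_Fock[OF a w]])
         (auto intro!: sum.cong simp: wword_kv[OF a w F(2) vac_Fock] ip_kv_vac)
    then show "L P = 0" unfolding L_def F(3) using ev_lincomb[OF z F(1) F(2), of c] by simp
  qed
  then show ?thesis by (simp add: L_def)
qed

lemma psi_phi:
  assumes z: "rho b z < 1" and i: "i < m"
  shows "\<psi> (\<phi> z) i = z i"
proof -
  have W: "wword m b [i] \<in> domalg m b" using i by (intro wword_domalg[OF b]) auto
  have "\<psi> (\<phi> z) i = ev b z (\<Phi> (\<Psi> (wword m b [i])))"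
    unfolding phi_def[of m] by (rule ev_Phi[OF z cc_homD(1)[OF \<Psi> W], symmetric])
  also have "\<dots> = z i" unfolding \<Phi>\<Psi>[OF W] using i by (simp add: ev_wword[OF b z])
  finally show ?thesis .
qed

end

lemma pairing_cong:
  assumes "symbol n a" "\<And>j. j < n \<Longrightarrow> z j = z' j" "\<And>j. j < n \<Longrightarrow> w j = w' j"
  shows "pairing a z w = pairing a z' w'"
  unfolding pairing_def
proof (intro sum.cong refl)
  fix \<alpha> assume "\<alpha> \<in> supp a"
  then have "set \<alpha> \<subseteq> {..<n}" using symbolD(2)[OF assms(1)] by simp
  then have "wp z \<alpha> = wp z' \<alpha>" "wp w \<alpha> = wp w' \<alpha>" using assms(2,3) by (auto intro!: wp_cong)
  then show "of_real (a \<alpha>) * wp z \<alpha> * cnj (wp w \<alpha>) = of_real (a \<alpha>) * wp z' \<alpha> * cnj (wp w' \<alpha>)" by simp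
qed

context cc_iso begin

lemma phi_psi:
  assumes "rho a x < 1" "j < n"
  shows "\<phi> (\<psi> x) j = x j"
  using cc_iso.psi_phi[OF swap assms] .

lemma psi_dom: "rho a x < 1 \<Longrightarrow> rho b (\<psi> x) < 1"
  using cc_iso.phi_dom[OF swap] .

text \<open>The reciprocal of \<open>ker\<close> is the kernel of the inverse isomorphism
  transported by \<open>\<phi>\<close>, hence positive as well, and \<open>psd_rank_one\<close>
  applies. The base point is the origin because \<open>pairing b\<close> vanishes there.\<close>

lemma kernel_identity:
  assumes z: "rho b z < 1" and w: "rho b w < 1"
  defines "p \<equiv> \<phi> (\<lambda>_. 0)"
  shows "(1 - pairing a (\<phi> z) (\<phi> w)) * (1 - pairing a p p) = (1 - pairing a (\<phi> z) p) * (1 - pairing a p (\<phi> w)) * (1 - pairing b z w)"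
proof -
  let ?D = "{z. rho b z < 1}"
  have nz: "ker z w \<noteq> 0" if "z \<in> ?D" "w \<in> ?D" for z w
    using pairing_ne_1[OF a phi_dom phi_dom] pairing_ne_1[OF b] that by (simp add: ker_def)
  have inv: "1 / ker z w = cc_iso.ker m b a \<Psi> (\<phi> z) (\<phi> w)" if "z \<in> ?D" "w \<in> ?D" for z w
  proof -
    have "pairing b (\<psi> (\<phi> z)) (\<psi> (\<phi> w)) = pairing b z w"
      using that by (intro pairing_cong[OF b] psi_phi) auto
    then show ?thesis by (simp add: cc_iso.ker_def[OF swap] ker_def)
  qed
  have "psd (\<lambda>z w. 1 / ker z w) ?D"
    unfolding psd_def
  proof (intro conjI ballI allI impI)
    fix z w assume zw: "z \<in> ?D" "w \<in> ?D"
    show "1 / ker w z = cnj (1 / ker z w)" using psdD(1)[OF psd_ker zw] by simp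
  next
    fix N :: nat and z c assume z: "\<forall>i<N. z i \<in> ?D"
    have "0 \<le> Re (\<Sum>i<N. \<Sum>l<N. c i * cnj (c l) * cc_iso.ker m b a \<Psi> (\<phi> (z l)) (\<phi> (z i)))"
      by (rule psdD(2)[OF cc_iso.psd_ker[OF swap], of N "\<lambda>i. \<phi> (z i)"]) (use z phi_dom in auto)
    also have "(\<Sum>i<N. \<Sum>l<N. c i * cnj (c l) * cc_iso.ker m b a \<Psi> (\<phi> (z l)) (\<phi> (z i))) = (\<Sum>i<N. \<Sum>l<N. c i * cnj (c l) * (1 / ker (z l) (z i)))"
      using inv z by (intro sum.cong refl) auto
    finally show "0 \<le> Re (\<Sum>i<N. \<Sum>l<N. c i * cnj (c l) * (1 / ker (z l) (z i)))" .
  qed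
  from psd_rank_one[OF psd_ker this nz, of "\<lambda>_. 0" w z]
  have "ker z w * ker (\<lambda>_. 0) (\<lambda>_. 0) = ker z (\<lambda>_. 0) * ker (\<lambda>_. 0) w" using z w rho_0[OF b] by simp
  then show ?thesis
    unfolding ker_def pairing_0[OF b] p_def using pairing_ne_1[OF b z w] by (simp add: field_simps)
qed

end

subsection \<open>Linear algebra\<close>

text \<open>The system is padded to a square one by zero equations; every term of the determinant
  meets one of them.\<close>

lemma underdetermined_system:
  fixes u :: "nat \<Rightarrow> nat \<Rightarrow> complex"
  assumes "n < m"
  shows "\<exists>c. (\<exists>i<m. c i \<noteq> 0) \<and> (\<forall>j<n. (\<Sum>i<m. c i * u i j) = 0)"
proof -
  define A where "A = Matrix.mat m m (\<lambda>(j, i). if j < n then u i j else 0)"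
  have A: "A \<in> carrier_mat m m" by (simp add: A_def)
  have "(\<Prod>i = 0..<m. A $$ (i, p i)) = 0" if "p permutes {0..<m}" for p
  proof (rule prod_zero)
    have "p n < m" using permutes_in_image[OF that, of n] assms by simp
    then show "\<exists>i\<in>{0..<m}. A $$ (i, p i) = 0" using assms by (intro bexI[of _ n]) (auto simp: A_def)
  qed simp
  then have "Determinant.det A = 0" unfolding det_def'[OF A] by (intro sum.neutral) auto
  then obtain v where v: "v \<in> carrier_vec m" "v \<noteq> 0\<^sub>v m" "A *\<^sub>v v = 0\<^sub>v m"
    using det_0_iff_vec_prod_zero_field[OF A] by blast
  have dv: "dim_vec v = m" using v(1) by simp
  have "\<exists>i<m. vec_index v i \<noteq> 0"
  proof (rule ccontr)
    assume "\<not> (\<exists>i<m. vec_index v i \<noteq> 0)"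
    then have "v = 0\<^sub>v m" using dv by (intro eq_vecI) auto
    then show False using v(2) by simp
  qed
  then obtain i where i: "i < m" "vec_index v i \<noteq> 0" by blast
  have "(\<Sum>i<m. vec_index v i * u i j) = 0" if j: "j < n" for j
  proof -
    have "vec_index (A *\<^sub>v v) j = 0" using v(3) j assms by simp
    then show ?thesis
      using j assms dv by (simp add: A_def scalar_prod_def mult.commute atLeast0LessThan)
  qed
  then show ?thesis using i by (intro exI[of _ "vec_index v"]) auto
qed

lemma nonzero_permutation_entries:
  fixes u v :: "nat \<Rightarrow> nat \<Rightarrow> complex"
  assumes "\<And>i k. i < n \<Longrightarrow> k < n \<Longrightarrow> (\<Sum>j<n. u i j * v j k) = (if i = k then 1 else 0)"
  obtains \<sigma> where "bij_betw \<sigma> {..<n} {..<n}" "\<And>i. i < n \<Longrightarrow> u i (\<sigma> i) \<noteq> 0"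
proof -
  define U where "U = Matrix.mat n n (\<lambda>(i, j). u i j)"
  define V where "V = Matrix.mat n n (\<lambda>(i, j). v i j)"
  have U: "U \<in> carrier_mat n n" and V: "V \<in> carrier_mat n n" by (simp_all add: U_def V_def)
  have "U * V = 1\<^sub>m n"
    by (rule eq_matI) (auto simp: U_def V_def scalar_prod_def assms atLeast0LessThan)
  then have "Determinant.det U * Determinant.det V = 1" using det_mult[OF U V] by simp
  then have "Determinant.det U \<noteq> 0" by auto
  have "\<exists>p. p permutes {0..<n} \<and> signof p * (\<Prod>i = 0..<n. U $$ (i, p i)) \<noteq> 0"
  proof (rule ccontr)
    assume "\<not> (\<exists>p. p permutes {0..<n} \<and> signof p * (\<Prod>i = 0..<n. U $$ (i, p i)) \<noteq> 0)"
    then have "Determinant.det U = 0" unfolding det_def'[OF U] by (intro sum.neutral) blast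
    then show False using \<open>Determinant.det U \<noteq> 0\<close> by simp
  qed
  then obtain p where p: "p permutes {0..<n}" "signof p * (\<Prod>i = 0..<n. U $$ (i, p i)) \<noteq> 0" by blast
  have "bij_betw p {..<n} {..<n}" using permutes_imp_bij[OF p(1)] by (simp add: atLeast0LessThan)
  moreover have "u i (p i) \<noteq> 0" if "i < n" for i
  proof -
    have "p i < n" using permutes_in_image[OF p(1), of i] that by simp
    moreover have "U $$ (i, p i) \<noteq> 0" using p(2) that by auto
    ultimately show ?thesis using that by (simp add: U_def)
  qed
  ultimately show ?thesis using that by blast
qed

subsection \<open>Equality of the numbers of generators\<close>

text \<open>\<open>dpr x v \<alpha>\<close> is the derivative of the monomial \<open>wp x \<alpha>\<close> in the direction \<open>v\<close>.\<close>

fun dpr :: "(nat \<Rightarrow> complex) \<Rightarrow> (nat \<Rightarrow> complex) \<Rightarrow> nat list \<Rightarrow> complex" where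
  "dpr x v [] = 0"
| "dpr x v (i # \<alpha>) = v i * wp x \<alpha> + x i * dpr x v \<alpha>"

lemma dpr_lincomb: "(\<Sum>i\<in>I. c i * dpr x (v i) \<alpha>) = dpr x (\<lambda>j. \<Sum>i\<in>I. c i * v i j) \<alpha>"
proof (induction \<alpha>)
  case (Cons k \<alpha>)
  have "(\<Sum>i\<in>I. c i * dpr x (v i) (k # \<alpha>)) = (\<Sum>i\<in>I. c i * v i k) * wp x \<alpha> + x k * (\<Sum>i\<in>I. c i * dpr x (v i) \<alpha>)"
    by (simp add: sum.distrib sum_distrib_left sum_distrib_right algebra_simps)
  then show ?case using Cons by simp
qed simp

lemma dpr_eq_0: "(\<And>j. j \<in> set \<alpha> \<Longrightarrow> v j = 0) \<Longrightarrow> dpr x v \<alpha> = 0"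
  by (induction \<alpha>) auto

lemma dpr_cong:
  assumes "\<And>j. j \<in> set \<alpha> \<Longrightarrow> x j = x' j" "\<And>j. j \<in> set \<alpha> \<Longrightarrow> v j = v' j"
  shows "dpr x v \<alpha> = dpr x' v' \<alpha>"
  using assms
proof (induction \<alpha>)
  case (Cons i \<alpha>)
  then show ?case using wp_cong[of \<alpha> x x'] by auto
qed simp

context cc_iso begin

lemma hat_word_Nil:
  assumes "set \<alpha> \<subseteq> {..<n}"
  shows "hat b (\<Phi> (wword n a \<alpha>)) [] = wp (\<phi> (\<lambda>_. 0)) \<alpha>"
proof -
  have "\<Phi> (wword n a \<alpha>) \<in> domalg m b" by (intro cc_homD(1)[OF \<Phi>] wword_domalg[OF a] assms)
  then have "hat b (\<Phi> (wword n a \<alpha>)) [] = ev b (\<lambda>_. 0) (\<Phi> (wword n a \<alpha>))"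
    by (rule hat_Nil[OF bounded_opD(1)[OF domalg_bounded vac_Fock]])
  then show ?thesis using ev_word[OF _ assms, of "\<lambda>_. 0"] rho_0[OF b] by simp
qed

text \<open>The convolution formula at a one-letter word is the Leibniz rule: the coefficient at
  \<open>[i]\<close> is a point derivation over the character at the origin, transported by
  \<open>\<Phi>\<close>.\<close>

lemma hat_word_single:
  assumes "set \<alpha> \<subseteq> {..<n}"
  shows "hat b (\<Phi> (wword n a \<alpha>)) [i] = dpr (\<phi> (\<lambda>_. 0)) (\<lambda>j. hat b (\<Phi> (wword n a [j])) [i]) \<alpha>"
  using assms
proof (induction \<alpha>)
  case Nil
  then show ?case using cc_homD(5)[OF \<Phi>] hat_wword[OF b, of "[]" "[i]"] by simp
next
  case (Cons k \<alpha>)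
  then have k: "k < n" "set \<alpha> \<subseteq> {..<n}" by auto
  have D: "\<Phi> (wword n a [k]) \<in> domalg m b" "\<Phi> (wword n a \<alpha>) \<in> domalg m b"
    using k by (auto intro!: cc_homD(1)[OF \<Phi>] wword_domalg[OF a])
  have "hat b (\<Phi> (wword n a [k])) [] = \<phi> (\<lambda>_. 0) k" using hat_word_Nil[of "[k]"] k by simp
  then show ?case
    unfolding cc_hom_wword_Cons[OF a \<Phi> k] hat_mult[OF b D]
    using Cons.IH[OF k(2)] hat_word_Nil[OF k(2)] by (simp add: atMost_Suc)
qed

lemma hat_Phi_lincomb:
  assumes "finite F" "\<And>\<alpha>. \<alpha> \<in> F \<Longrightarrow> set \<alpha> \<subseteq> {..<n}"
  shows "hat b (\<Phi> (\<lambda>x \<beta>. \<Sum>\<alpha>\<in>F. c \<alpha> * wword n a \<alpha> x \<beta>)) \<beta> = (\<Sum>\<alpha>\<in>F. c \<alpha> * hat b (\<Phi> (wword n a \<alpha>)) \<beta>)"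
proof -
  have "\<Phi> (\<lambda>x \<beta>. \<Sum>\<alpha>\<in>F. c \<alpha> * wword n a \<alpha> x \<beta>) = (\<lambda>x \<beta>. \<Sum>\<alpha>\<in>F. c \<alpha> * \<Phi> (wword n a \<alpha>) x \<beta>)"
    by (rule cc_hom_lincomb[OF a \<Phi>]) (intro wword_domalg[OF a] assms(2))
  then show ?thesis by (simp add: hat_def hv_def sum_distrib_left mult_ac)
qed

lemma hat_Phi_bound:
  assumes "S \<in> domalg n a" "T \<in> domalg n a"
  shows "cmod (hat b (\<Phi> S) \<beta> - hat b (\<Phi> T) \<beta>) \<le> sqrt (bcoef b \<beta>) * opnorm n (\<lambda>x \<beta>. S x \<beta> - T x \<beta>)"
proof -
  have "cmod (hat b (\<Phi> S) \<beta> - hat b (\<Phi> T) \<beta>) \<le> sqrt (bcoef b \<beta>) * opnorm m (\<lambda>x \<beta>. \<Phi> S x \<beta> - \<Phi> T x \<beta>)"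
    by (rule hat_bound[OF b domalg_bounded[OF cc_homD(1)[OF \<Phi> assms(1)]] domalg_bounded[OF cc_homD(1)[OF \<Phi> assms(2)]]])
  also have "\<dots> \<le> sqrt (bcoef b \<beta>) * opnorm n (\<lambda>x \<beta>. S x \<beta> - T x \<beta>)"
    by (intro mult_left_mono cc_hom_diff_bound[OF a \<Phi> assms]) (simp add: bcoef_nonneg[OF b])
  finally show ?thesis .
qed

text \<open>The \<open>m\<close> one-letter coefficients of \<open>\<Phi> S\<close> are point
  derivations over the same character, each determined by its values on \<open>n\<close> generators.
  If n < m, a nontrivial combination of them vanishes identically, although the generators of the
  target separate them. Both cases of the main argument are covered, since the position of
  \<open>\<phi> 0\<close> is immaterial here.\<close>

lemma m_le_n: "m \<le> n"
proof (rule ccontr)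
  define u where "u i j = hat b (\<Phi> (wword n a [j])) [i]" for i j
  assume "\<not> m \<le> n"
  then have "n < m" by simp
  from underdetermined_system[OF this, of u]
  obtain c k where k: "k < m" "c k \<noteq> 0" and c: "\<forall>j<n. (\<Sum>i<m. c i * u i j) = 0"
    by (elim exE conjE)
  define L where "L S = (\<Sum>i<m. c i * hat b (\<Phi> S) [i])" for S
  have L0: "L S = 0" if S: "S \<in> domalg n a" for S
  proof (rule domalg_functional_eq_0[OF a S])
    fix P assume P: "P \<in> polyops n a"
    let ?d = "opnorm n (\<lambda>x \<beta>. S x \<beta> - P x \<beta>)"
    have PD: "P \<in> domalg n a" by (rule polyops_domalg[OF a P])
    have "cmod (L S - L P) = cmod (\<Sum>i<m. c i * (hat b (\<Phi> S) [i] - hat b (\<Phi> P) [i]))"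
      by (simp add: L_def sum_subtractf right_diff_distrib)
    also have "\<dots> \<le> (\<Sum>i<m. cmod (c i) * (sqrt (bcoef b [i]) * ?d))"
      by (rule order_trans[OF norm_sum], unfold norm_mult) (intro sum_mono mult_left_mono hat_Phi_bound[OF S PD] norm_ge_zero)
    finally show "cmod (L S - L P) \<le> (\<Sum>i<m. cmod (c i) * sqrt (bcoef b [i])) * ?d"
      by (simp add: sum_distrib_right mult.assoc)
    obtain F d where F: "finite F" "\<And>\<alpha>. \<alpha> \<in> F \<Longrightarrow> set \<alpha> \<subseteq> {..<n}" "P = (\<lambda>x \<beta>. \<Sum>\<alpha>\<in>F. d \<alpha> * wword n a \<alpha> x \<beta>)"
      using polyopsE[OF P] by blast
    have "L P = (\<Sum>i<m. \<Sum>\<alpha>\<in>F. d \<alpha> * (c i * dpr (\<phi> (\<lambda>_. 0)) (u i) \<alpha>))"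
      unfolding L_def F(3)
    proof (intro sum.cong refl)
      fix i
      have "hat b (\<Phi> (wword n a \<alpha>)) [i] = dpr (\<phi> (\<lambda>_. 0)) (u i) \<alpha>" if "\<alpha> \<in> F" for \<alpha>
        unfolding hat_word_single[OF F(2)[OF that]] u_def ..
      moreover have e: "hat b (\<Phi> (\<lambda>x \<beta>. \<Sum>\<alpha>\<in>F. d \<alpha> * wword n a \<alpha> x \<beta>)) [i] = (\<Sum>\<alpha>\<in>F. d \<alpha> * hat b (\<Phi> (wword n a \<alpha>)) [i])"
        by (rule hat_Phi_lincomb[OF F(1) F(2)])
      ultimately show "c i * hat b (\<Phi> (\<lambda>x \<beta>. \<Sum>\<alpha>\<in>F. d \<alpha> * wword n a \<alpha> x \<beta>)) [i] = (\<Sum>\<alpha>\<in>F. d \<alpha> * (c i * dpr (\<phi> (\<lambda>_. 0)) (u i) \<alpha>))"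
        unfolding e sum_distrib_left by (intro sum.cong refl) simp
    qed
    also have "\<dots> = (\<Sum>\<alpha>\<in>F. d \<alpha> * (\<Sum>i<m. c i * dpr (\<phi> (\<lambda>_. 0)) (u i) \<alpha>))"
      unfolding sum_distrib_left by (rule sum.swap)
    also have "\<dots> = 0"
    proof (intro sum.neutral ballI)
      fix \<alpha> assume "\<alpha> \<in> F"
      then have "dpr (\<phi> (\<lambda>_. 0)) (\<lambda>j. \<Sum>i<m. c i * u i j) \<alpha> = 0" using F(2) c by (intro dpr_eq_0) blast
      then show "d \<alpha> * (\<Sum>i<m. c i * dpr (\<phi> (\<lambda>_. 0)) (u i) \<alpha>) = 0" by (simp add: dpr_lincomb)
    qed
    finally show "L P = 0" .
  qed
  have W: "wword m b [k] \<in> domalg m b" using k by (intro wword_domalg[OF b]) auto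
  have "(\<Sum>i<m. c i * hat b (wword m b [k]) [i]) = 0"
    using L0[OF cc_homD(1)[OF \<Psi> W]] unfolding L_def \<Phi>\<Psi>[OF W] .
  moreover have "(\<Sum>i<m. c i * hat b (wword m b [k]) [i]) = (\<Sum>i<m. if i = k then c i else 0)"
    by (intro sum.cong refl) (use k hat_wword[OF b, of "[k]"] in auto)
  ultimately show False using k by simp
qed

lemma n_eq_m: "n = m"
  using m_le_n cc_iso.m_le_n[OF swap] by simp

end

subsection \<open>Infinitesimal automorphisms not fixing the origin\<close>

text \<open>The derivative of \<open>dpr x w \<alpha>\<close> when \<open>x\<close> moves with
  velocity \<open>v\<close> and \<open>w\<close> with velocity \<open>u\<close>.\<close>

fun ddpr :: "(nat \<Rightarrow> complex) \<Rightarrow> (nat \<Rightarrow> complex) \<Rightarrow> (nat \<Rightarrow> complex) \<Rightarrow> (nat \<Rightarrow> complex) \<Rightarrow> nat list \<Rightarrow> complex" where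
  "ddpr x v w u [] = 0"
| "ddpr x v w u (i # \<alpha>) = u i * wp x \<alpha> + w i * dpr x v \<alpha> + v i * dpr x w \<alpha> + x i * ddpr x v w u \<alpha>"

lemma wp_has_vector_derivative:
  assumes "\<And>k. k \<in> set \<alpha> \<Longrightarrow> ((\<lambda>t. x t k) has_vector_derivative v k) (at s)"
  shows "((\<lambda>t. wp (x t) \<alpha>) has_vector_derivative dpr (x s) v \<alpha>) (at s)"
  using assms
proof (induction \<alpha>)
  case (Cons i \<alpha>)
  have "((\<lambda>t. x t i * wp (x t) \<alpha>) has_vector_derivative (x s i * dpr (x s) v \<alpha> + v i * wp (x s) \<alpha>)) (at s)"
    using Cons by (intro has_vector_derivative_mult) auto
  then show ?case by (simp add: add.commute)
qed simp

lemma dpr_has_vector_derivative: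
  assumes "\<And>k. k \<in> set \<alpha> \<Longrightarrow> ((\<lambda>t. x t k) has_vector_derivative v k) (at s)"
    and "\<And>k. k \<in> set \<alpha> \<Longrightarrow> ((\<lambda>t. w t k) has_vector_derivative u k) (at s)"
  shows "((\<lambda>t. dpr (x t) (w t) \<alpha>) has_vector_derivative ddpr (x s) v (w s) u \<alpha>) (at s)"
  using assms
proof (induction \<alpha>)
  case (Cons i \<alpha>)
  have "((\<lambda>t. w t i * wp (x t) \<alpha> + x t i * dpr (x t) (w t) \<alpha>) has_vector_derivative
    ((w s i * dpr (x s) v \<alpha> + u i * wp (x s) \<alpha>) + (x s i * ddpr (x s) v (w s) u \<alpha> + v i * dpr (x s) (w s) \<alpha>))) (at s)"
    using Cons by (intro has_vector_derivative_add has_vector_derivative_mult wp_has_vector_derivative) auto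
  then show ?case by (simp add: algebra_simps)
qed simp

lemma dpr_zero: "dpr (\<lambda>_. 0) v \<alpha> = (if length \<alpha> = 1 then v (hd \<alpha>) else 0)"
  by (cases \<alpha>; cases "tl \<alpha>") (auto simp: wp_zero)

lemma ddpr_zero: "ddpr (\<lambda>_. 0) v w u \<alpha> = (if length \<alpha> = 1 then u (hd \<alpha>) else
   if length \<alpha> = 2 then w (\<alpha> ! 0) * v (\<alpha> ! 1) + v (\<alpha> ! 0) * w (\<alpha> ! 1) else 0)"
  by (cases \<alpha>; cases "tl \<alpha>"; cases "tl (tl \<alpha>)") (auto simp: wp_zero dpr_zero)

text \<open>Stated for a word with an explicit first letter, so that its degree minus one is the
  length of the tail.\<close>

lemma dpr_scale: "dpr (\<lambda>i. t * x i) v (i # \<alpha>) = t ^ length \<alpha> * dpr x v (i # \<alpha>)"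
proof (induction \<alpha> arbitrary: i)
  case (Cons j \<alpha>)
  have "dpr (\<lambda>i. t * x i) v (i # j # \<alpha>) = v i * wp (\<lambda>i. t * x i) (j # \<alpha>) + t * x i * (t ^ length \<alpha> * dpr x v (j # \<alpha>))"
    unfolding Cons[symmetric] by simp
  also have "\<dots> = t ^ length (j # \<alpha>) * dpr x v (i # j # \<alpha>)"
    by (simp add: wp_mult wp_const algebra_simps)
  finally show ?case .
qed simp

lemma dpr_add: "dpr x (\<lambda>i. v i + w i) \<alpha> = dpr x v \<alpha> + dpr x w \<alpha>"
  by (induction \<alpha>) (auto simp: algebra_simps)

lemma dpr_cmult: "dpr x (\<lambda>i. c * v i) \<alpha> = c * dpr x v \<alpha>"
  by (induction \<alpha>) (auto simp: algebra_simps)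

lemma dpr_diag: "dpr x (\<lambda>i. x i * \<theta> i) \<alpha> = wp x \<alpha> * (\<Sum>i\<leftarrow>\<alpha>. \<theta> i)"
  by (induction \<alpha>) (auto simp: algebra_simps)

lemma wp_scale: "wp (\<lambda>i. t * x i) \<alpha> = t ^ length \<alpha> * wp x (\<alpha> :: nat list)" for t :: complex
  by (simp add: wp_mult wp_const)

text \<open>The derivative of \<open>pairing a\<close> in its first argument at \<open>x\<close> in
  the direction \<open>v\<close>.\<close>

definition dpair :: "(nat list \<Rightarrow> real) \<Rightarrow> (nat \<Rightarrow> complex) \<Rightarrow> (nat \<Rightarrow> complex) \<Rightarrow> (nat \<Rightarrow> complex) \<Rightarrow> complex" where
  "dpair a x v y = (\<Sum>\<alpha>\<in>supp a. of_real (a \<alpha>) * dpr x v \<alpha> * cnj (wp y \<alpha>))"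

lemma sum_supp_single:
  fixes F :: "nat list \<Rightarrow> 'b::comm_monoid_add"
  assumes a: "symbol n a" and F: "\<And>\<alpha>. length \<alpha> \<noteq> 1 \<Longrightarrow> F \<alpha> = 0"
  shows "(\<Sum>\<alpha>\<in>supp a. F \<alpha>) = (\<Sum>k<n. F [k])"
proof -
  have "(\<Sum>k<n. F [k]) = (\<Sum>\<alpha>\<in>(\<lambda>k. [k]) ` {..<n}. F \<alpha>)"
    by (subst sum.reindex) (auto simp: inj_on_def)
  also have "\<dots> = (\<Sum>\<alpha>\<in>supp a. F \<alpha>)"
  proof (rule sum.mono_neutral_left[OF symbolD(1)[OF a]])
    show "(\<lambda>k. [k]) ` {..<n} \<subseteq> supp a" using symbolD(5)[OF a] by fastforce
    show "\<forall>\<alpha>\<in>supp a - (\<lambda>k. [k]) ` {..<n}. F \<alpha> = 0"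
    proof
      fix \<alpha> assume \<alpha>: "\<alpha> \<in> supp a - (\<lambda>k. [k]) ` {..<n}"
      then have "length \<alpha> \<noteq> 1" using symbolD(2)[OF a, of \<alpha>] by (auto simp: length_Suc_conv)
      then show "F \<alpha> = 0" by (rule F)
    qed
  qed
  finally show ?thesis by simp
qed

lemma sum_supp_singletons:
  assumes a: "symbol n a" and F: "\<And>\<alpha>. length \<alpha> \<noteq> 1 \<Longrightarrow> F \<alpha> = 0"
  shows "(\<Sum>\<alpha>\<in>supp a. of_real (a \<alpha>) * F \<alpha>) = (\<Sum>k<n. of_real (a [k]) * (F [k] :: complex))"
  by (rule sum_supp_single[OF a]) (simp add: F)

text \<open>A polynomial with infinitely many zeros is 0. The exponent 2 d + 1 is reached only by
  the \<open>Z\<close> terms with \<open>k i = d\<close>: the \<open>X\<close> exponents are at most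
  2 d - 1, the \<open>Y\<close> exponents are even, and the term with \<open>e\<close> has degree
  1.\<close>

lemma infinite_zeros_top_coeff:
  fixes X Y Z :: "'i \<Rightarrow> complex" and k :: "'i \<Rightarrow> nat"
  assumes S: "finite S" and k1: "\<And>i. i \<in> S \<Longrightarrow> k i \<ge> 1" and kd: "\<And>i. i \<in> S \<Longrightarrow> k i \<le> d" and d: "d \<ge> 1" and \<epsilon>: "\<epsilon> > 0"
    and eq: "\<And>t::real. 0 < t \<Longrightarrow> t < \<epsilon> \<Longrightarrow>
      (\<Sum>i\<in>S. X i * of_real t ^ (2 * k i - 1) + Y i * of_real t ^ (2 * k i) + Z i * of_real t ^ (2 * k i + 1)) + e * of_real t = 0"
  shows "(\<Sum>i\<in>{i\<in>S. k i = d}. Z i) = 0"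
proof -
  define p where "p = (\<Sum>i\<in>S. Polynomial.monom (X i) (2 * k i - 1) + Polynomial.monom (Y i) (2 * k i) + Polynomial.monom (Z i) (2 * k i + 1)) + Polynomial.monom e 1"
  have "poly p (of_real t) = 0" if "0 < t" "t < \<epsilon>" for t
    using eq[OF that] by (simp add: p_def poly_sum poly_monom)
  then have sub: "complex_of_real ` {0<..<\<epsilon>} \<subseteq> {x. poly p x = 0}" by auto
  have "infinite (complex_of_real ` {0<..<\<epsilon>})"
    using \<epsilon> by (subst finite_image_iff) (auto simp: inj_on_def)
  then have "p = 0" using poly_roots_finite[of p] sub finite_subset by blast
  then have "0 = Polynomial.coeff p (2 * d + 1)" by simp
  also have "\<dots> = (\<Sum>i\<in>S. if k i = d then Z i else 0)"
  proof -
    have "Polynomial.coeff (Polynomial.monom (X i) (2 * k i - 1) + Polynomial.monom (Y i) (2 * k i) + Polynomial.monom (Z i) (2 * k i + 1)) (2 * d + 1) = (if k i = d then Z i else 0)"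
      if "i \<in> S" for i
    proof -
      have "2 * k i - 1 \<noteq> 2 * d + 1" using kd[OF that] by simp
      moreover have "2 * k i \<noteq> 2 * d + 1" by presburger
      ultimately show ?thesis by (simp add: coeff_monom)
    qed
    then show ?thesis using d by (simp add: p_def coeff_sum coeff_monom)
  qed
  also have "\<dots> = (\<Sum>i\<in>{i\<in>S. k i = d}. Z i)" by (rule sum.inter_filter[symmetric, OF S])
  finally show ?thesis by simp
qed

lemma dpr_const:
  assumes "set \<alpha> \<subseteq> {k}"
  shows "dpr y v \<alpha> = of_nat (length \<alpha>) * y k ^ (length \<alpha> - 1) * v k"
  using assms
proof (induction \<alpha>)
  case (Cons i \<alpha>)
  then have "wp y \<alpha> = wp (\<lambda>_. y k) \<alpha>" by (intro wp_cong) auto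
  then have "wp y \<alpha> = y k ^ length \<alpha>" by (simp add: wp_const)
  moreover have "y k * (of_nat (length \<alpha>) * y k ^ (length \<alpha> - 1)) = of_nat (length \<alpha>) * y k ^ length \<alpha>"
    by (cases \<alpha>) auto
  moreover have "i = k" using Cons.prems by simp
  ultimately show ?case using Cons by (simp add: algebra_simps)
qed simp

definition line :: "nat \<Rightarrow> real \<Rightarrow> nat \<Rightarrow> complex" where
  "line j t i = of_real t * unitv j i"

lemma wp_line: "wp (line k s) \<alpha> = (if set \<alpha> \<subseteq> {k} then of_real s ^ length \<alpha> else 0)"
  by (induction \<alpha>) (auto simp: line_def unitv_def)

lemma line_has_vector_derivative: "((\<lambda>t. line j t i) has_vector_derivative unitv j i) (at s)"
  unfolding line_def by (auto intro!: derivative_eq_intros)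

lemma line_0: "line j 0 = (\<lambda>_. 0)"
  by (simp add: line_def fun_eq_iff)

lemma line_dom:
  assumes "symbol n a"
  obtains \<epsilon> where "\<epsilon> > 0" "\<And>t. \<bar>t\<bar> \<le> \<epsilon> \<Longrightarrow> rho a (line j t) < 1"
proof -
  obtain \<epsilon> where e: "\<epsilon> > 0" "\<And>t. cmod t \<le> \<epsilon> \<Longrightarrow> rho a (\<lambda>i. t * unitv j i) < 1"
    using rho_small[OF assms, of "unitv j"] by blast
  have "rho a (line j t) < 1" if "\<bar>t\<bar> \<le> \<epsilon>" for t
    using e(2)[of "of_real t"] that by (simp add: line_def[abs_def])
  then show ?thesis using that e(1) by blast
qed

text \<open>\<open>id\<close> is the derivative of the kernel identity, with \<open>\<xi>\<close>
  the velocity and \<open>\<mu>\<close> the logarithmic derivative of the factor depending on one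
  variable. The differentiability of \<open>\<xi>\<close> is extracted from
  \<open>id\<close>.\<close>

locale infinitesimal =
  fixes n :: nat and a :: "nat list \<Rightarrow> real" and \<xi> :: "(nat \<Rightarrow> complex) \<Rightarrow> nat \<Rightarrow> complex" and \<mu> :: "(nat \<Rightarrow> complex) \<Rightarrow> complex"
  assumes a: "symbol n a"
    and id: "\<And>x y. rho a x < 1 \<Longrightarrow> rho a y < 1 \<Longrightarrow>
      dpair a x (\<xi> x) y - cnj (dpair a y (\<xi> y) x) + (\<mu> x - cnj (\<mu> y)) * (1 - pairing a x y) = 0"
begin

abbreviation "c \<equiv> \<xi> (\<lambda>_. 0)"

definition l :: "(nat \<Rightarrow> complex) \<Rightarrow> complex" where
  "l x = (\<Sum>k<n. of_real (a [k]) * (cnj (c k) * x k))"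

lemma dpair_0_right: "dpair a x v (\<lambda>_. 0) = 0"
  unfolding dpair_def using symbol_Nil[OF a] by (auto intro!: sum.neutral simp: wp_zero)

lemma dpair_0_left: "cnj (dpair a (\<lambda>_. 0) c x) = l x"
proof -
  have "dpair a (\<lambda>_. 0) c x = (\<Sum>\<alpha>\<in>supp a. of_real (a \<alpha>) * (dpr (\<lambda>_. 0) c \<alpha> * cnj (wp x \<alpha>)))"
    by (simp add: dpair_def mult.assoc)
  also have "\<dots> = (\<Sum>k<n. of_real (a [k]) * (c k * cnj (x k)))"
    by (subst sum_supp_singletons[OF a]) (auto simp: dpr_zero)
  finally show ?thesis by (simp add: l_def)
qed

text \<open>At y = 0 the pairing and one of the two derivative terms vanish, so \<open>\<mu>\<close>
  is affine and its linear part is determined by the constant term of the field.\<close>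

lemma mu_eq:
  assumes "rho a x < 1"
  shows "\<mu> x = cnj (\<mu> (\<lambda>_. 0)) + l x"
  using id[OF assms, of "\<lambda>_. 0"] rho_0[OF a] pairing_0[OF a] by (simp add: dpair_0_right dpair_0_left algebra_simps)

text \<open>The constant term of \<open>\<mu>\<close> equals its conjugate, so it cancels from the
  difference.\<close>

lemma id':
  assumes x: "rho a x < 1" and y: "rho a y < 1"
  shows "dpair a x (\<xi> x) y - cnj (dpair a y (\<xi> y) x) + (l x - cnj (l y)) * (1 - pairing a x y) = 0"
proof -
  have "\<mu> (\<lambda>_. 0) = cnj (\<mu> (\<lambda>_. 0))" using mu_eq[of "\<lambda>_. 0"] rho_0[OF a] by (simp add: l_def)
  then have "\<mu> x - cnj (\<mu> y) = l x - cnj (l y)" unfolding mu_eq[OF x] mu_eq[OF y] by simp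
  then show ?thesis using id[OF x y] by simp
qed

text \<open>On the \<open>k\<close>-th axis only powers of the letter \<open>k\<close> survive, so
  the pairing sees only the component \<open>k\<close> of the field.\<close>

lemma dpair_line:
  "dpair a y v (line k s) = (\<Sum>\<alpha>\<in>supp a. of_real (a \<alpha>) * (if set \<alpha> \<subseteq> {k} then of_nat (length \<alpha>) * y k ^ (length \<alpha> - 1) * of_real s ^ length \<alpha> else 0)) * v k"
  unfolding dpair_def wp_line sum_distrib_right by (intro sum.cong refl) (auto simp: dpr_const)

text \<open>One variable is fixed on the \<open>k\<close>-th axis, the other moves along the
  \<open>j\<close>-th. In the identity every term but one is a polynomial in \<open>t\<close>, up to
  conjugation, and that term is \<open>\<xi> (line j t) k\<close> times \<open>A t\<close>. At t = 0
  only the one-letter word contributes to \<open>A\<close>, so it may be divided out.\<close>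

lemma xi_differentiable:
  assumes j: "j < n" and k: "k < n"
  shows "\<exists>D. ((\<lambda>t. \<xi> (line j t) k) has_vector_derivative D) (at 0)"
proof -
  obtain s where s: "s > 0" "\<And>t. \<bar>t\<bar> \<le> s \<Longrightarrow> rho a (line k t) < 1" using line_dom[OF a, of k] by blast
  obtain \<epsilon> where e: "\<epsilon> > 0" "\<And>t. \<bar>t\<bar> \<le> \<epsilon> \<Longrightarrow> rho a (line j t) < 1" using line_dom[OF a, of j] by blast
  let ?x = "line k s"
  have x: "rho a ?x < 1" using s by simp
  define A where "A t = (\<Sum>\<alpha>\<in>supp a. of_real (a \<alpha>) * (if set \<alpha> \<subseteq> {k} then of_nat (length \<alpha>) * line j t k ^ (length \<alpha> - 1) * of_real s ^ length \<alpha> else 0))" for t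
  define B where "B t = dpair a ?x (\<xi> ?x) (line j t) + (l ?x - cnj (l (line j t))) * (1 - pairing a ?x (line j t))" for t
  have AB: "A t * \<xi> (line j t) k = cnj (B t)" if "\<bar>t\<bar> \<le> \<epsilon>" for t
  proof -
    have "B t = cnj (dpair a (line j t) (\<xi> (line j t)) ?x)" using id'[OF x e(2)[OF that]] by (simp add: B_def algebra_simps)
    then show ?thesis by (simp add: dpair_line A_def)
  qed
  have dline: "(\<lambda>t. line j t i) differentiable (at t)" for t i
    by (rule differentiableI_vector[OF line_has_vector_derivative])
  have dwp: "(\<lambda>t. cnj (wp (line j t) \<alpha>)) differentiable (at t)" for \<alpha> t
    by (rule differentiableI_vector[OF has_vector_derivative_cnj[OF wp_has_vector_derivative[OF line_has_vector_derivative]]])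
  have dA: "A differentiable (at 0)"
    unfolding A_def[abs_def]
  proof (intro differentiable_sum ballI differentiable_mult differentiable_const symbolD(1)[OF a])
    fix \<alpha> :: "nat list"
    have "(\<lambda>t. of_nat (length \<alpha>) * line j t k ^ (length \<alpha> - 1) * of_real s ^ length \<alpha>) differentiable (at 0)"
      by (intro differentiable_mult differentiable_const differentiable_power dline)
    then show "(\<lambda>t. if set \<alpha> \<subseteq> {k} then of_nat (length \<alpha>) * line j t k ^ (length \<alpha> - 1) * of_real s ^ length \<alpha> else 0) differentiable (at 0)"
      by (cases "set \<alpha> \<subseteq> {k}") simp_all
  qed
  have "(\<lambda>t. cnj (l (line j t))) differentiable (at 0)"
    unfolding l_def cnj_sum complex_cnj_mult
    by (intro differentiable_sum ballI differentiable_mult differentiable_const)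
       (auto intro!: differentiableI_vector[OF has_vector_derivative_cnj[OF line_has_vector_derivative]])
  then have dB: "B differentiable (at 0)"
    unfolding B_def[abs_def] dpair_def pairing_def
    by (intro differentiable_add differentiable_mult differentiable_diff differentiable_const differentiable_sum ballI symbolD(1)[OF a] dwp)
  have A0: "A 0 \<noteq> 0"
  proof -
    have "A 0 = (\<Sum>i<n. of_real (a [i]) * (if set [i] \<subseteq> {k} then of_nat (length [i]) * line j 0 k ^ (length [i] - 1) * of_real s ^ length [i] else 0))"
      unfolding A_def by (rule sum_supp_singletons[OF a]) (auto simp: line_0 Suc_lessI)
    also have "\<dots> = of_real (a [k]) * of_real s" using k by (simp add: if_distrib cong: if_cong)
    finally show ?thesis using s(1) symbolD(5)[OF a k] by simp
  qed
  obtain d where d: "d > 0" "\<forall>t. dist 0 t < d \<longrightarrow> A t \<noteq> 0"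
    using continuous_at_avoid[OF differentiable_imp_continuous_within[OF dA] A0] by blast
  have "(\<lambda>t. cnj (B t)) differentiable (at 0)"
    using dB by (auto simp: differentiable_def intro: has_derivative_cnj)
  then have "(\<lambda>t. cnj (B t) / A t) differentiable (at 0)" using dA A0 by (intro differentiable_divide)
  then obtain D where D: "((\<lambda>t. cnj (B t) / A t) has_vector_derivative D) (at 0)"
    using vector_derivative_works by blast
  have "((\<lambda>t. \<xi> (line j t) k) has_vector_derivative D) (at 0)"
  proof (rule has_vector_derivative_transform_within[OF D])
    show "0 < min d \<epsilon>" using d e by simp
    fix t :: real assume "dist t 0 < min d \<epsilon>"
    then have "A t \<noteq> 0" "\<bar>t\<bar> \<le> \<epsilon>" using d(2) by (auto simp: dist_commute)
    then show "cnj (B t) / A t = \<xi> (line j t) k" using AB[of t] by (simp add: field_simps)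
  qed simp
  then show ?thesis by blast
qed

text \<open>Differentiates the identity in \<open>y\<close> along the \<open>j\<close>-th axis at
  the origin. There \<open>ddpr\<close> vanishes except on words of length 1 and 2, which is why the
  field is quadratic in \<open>x\<close>.\<close>

lemma xi_formula:
  assumes j: "j < n"
  shows "\<exists>\<kappa>. \<forall>x. rho a x < 1 \<longrightarrow> of_real (a [j]) * \<xi> x j = of_real (a [j]) * c j + of_real (a [j]) * x j * l x
     + (\<Sum>\<alpha>\<in>supp a. of_real (a \<alpha>) * (wp x \<alpha> * cnj (ddpr (\<lambda>_. 0) (unitv j) c \<kappa> \<alpha>)))"
proof -
  obtain \<epsilon> where e: "\<epsilon> > 0" "\<And>t. \<bar>t\<bar> \<le> \<epsilon> \<Longrightarrow> rho a (line j t) < 1" using line_dom[OF a, of j] by blast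
  have "\<forall>k. \<exists>D. k < n \<longrightarrow> ((\<lambda>t. \<xi> (line j t) k) has_vector_derivative D) (at 0)" using xi_differentiable[OF j] by blast
  then obtain \<kappa> where \<kappa>: "\<And>k. k < n \<Longrightarrow> ((\<lambda>t. \<xi> (line j t) k) has_vector_derivative \<kappa> k) (at 0)" by metis
  have single: "(\<Sum>\<alpha>\<in>supp a. of_real (a \<alpha>) * (G \<alpha> * cnj (dpr (\<lambda>_. 0) (unitv j) \<alpha>))) = of_real (a [j]) * G [j]" for G
  proof -
    have "(\<Sum>\<alpha>\<in>supp a. of_real (a \<alpha>) * (G \<alpha> * cnj (dpr (\<lambda>_. 0) (unitv j) \<alpha>))) = (\<Sum>k<n. of_real (a [k]) * (G [k] * cnj (dpr (\<lambda>_. 0) (unitv j) [k])))"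
      by (rule sum_supp_singletons[OF a]) (auto simp: dpr_zero)
    also have "\<dots> = (\<Sum>k<n. if k = j then of_real (a [j]) * G [j] else 0)" by (intro sum.cong refl) (auto simp: unitv_def)
    also have "\<dots> = of_real (a [j]) * G [j]" using j by simp
    finally show ?thesis .
  qed
  have "of_real (a [j]) * \<xi> x j = of_real (a [j]) * c j + of_real (a [j]) * x j * l x
     + (\<Sum>\<alpha>\<in>supp a. of_real (a \<alpha>) * (wp x \<alpha> * cnj (ddpr (\<lambda>_. 0) (unitv j) c \<kappa> \<alpha>)))" if x: "rho a x < 1" for x
  proof -
    define F where "F t = dpair a x (\<xi> x) (line j t) - cnj (dpair a (line j t) (\<xi> (line j t)) x) + (l x - cnj (l (line j t))) * (1 - pairing a x (line j t))" for t
    have dwp: "((\<lambda>t. cnj (wp (line j t) \<alpha>)) has_vector_derivative cnj (dpr (\<lambda>_. 0) (unitv j) \<alpha>)) (at 0)" for \<alpha>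
      using has_vector_derivative_cnj[OF wp_has_vector_derivative[of \<alpha> "line j" "unitv j" 0, OF line_has_vector_derivative]] by (simp add: line_0)
    have d1: "((\<lambda>t. dpair a x (\<xi> x) (line j t)) has_vector_derivative (\<Sum>\<alpha>\<in>supp a. of_real (a \<alpha>) * (dpr x (\<xi> x) \<alpha> * cnj (dpr (\<lambda>_. 0) (unitv j) \<alpha>)))) (at 0)"
      unfolding dpair_def mult.assoc by (intro has_vector_derivative_sum has_vector_derivative_mult_right dwp)
    have d2: "((\<lambda>t. dpair a (line j t) (\<xi> (line j t)) x) has_vector_derivative (\<Sum>\<alpha>\<in>supp a. of_real (a \<alpha>) * (ddpr (\<lambda>_. 0) (unitv j) c \<kappa> \<alpha> * cnj (wp x \<alpha>)))) (at 0)"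
      unfolding dpair_def mult.assoc
    proof (intro has_vector_derivative_sum has_vector_derivative_mult_right has_vector_derivative_mult_left)
      fix \<alpha> assume "\<alpha> \<in> supp a"
      then have "k < n" if "k \<in> set \<alpha>" for k using symbolD(2)[OF a, of \<alpha>] that by auto
      then show "((\<lambda>t. dpr (line j t) (\<xi> (line j t)) \<alpha>) has_vector_derivative ddpr (\<lambda>_. 0) (unitv j) c \<kappa> \<alpha>) (at 0)"
        using dpr_has_vector_derivative[OF line_has_vector_derivative \<kappa>, of \<alpha>] by (simp add: line_0)
    qed
    have d3: "((\<lambda>t. pairing a x (line j t)) has_vector_derivative (\<Sum>\<alpha>\<in>supp a. of_real (a \<alpha>) * (wp x \<alpha> * cnj (dpr (\<lambda>_. 0) (unitv j) \<alpha>)))) (at 0)"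
      unfolding pairing_def mult.assoc by (intro has_vector_derivative_sum has_vector_derivative_mult_right dwp)
    have d4: "((\<lambda>t. cnj (l (line j t))) has_vector_derivative cnj (\<Sum>k<n. of_real (a [k]) * (cnj (c k) * unitv j k))) (at 0)"
      unfolding l_def by (intro has_vector_derivative_cnj has_vector_derivative_sum has_vector_derivative_mult_right line_has_vector_derivative)
    have lj: "cnj (\<Sum>k<n. of_real (a [k]) * (cnj (c k) * unitv j k)) = of_real (a [j]) * c j"
    proof -
      have "(\<Sum>k<n. of_real (a [k]) * (cnj (c k) * unitv j k)) = (\<Sum>k<n. if k = j then of_real (a [j]) * cnj (c j) else 0)"
        by (intro sum.cong refl) (auto simp: unitv_def)
      then show ?thesis using j by simp
    qed
    have l0: "l (\<lambda>_. 0) = 0" by (simp add: l_def)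
    let ?D = "of_real (a [j]) * \<xi> x j - cnj (\<Sum>\<alpha>\<in>supp a. of_real (a \<alpha>) * (ddpr (\<lambda>_. 0) (unitv j) c \<kappa> \<alpha> * cnj (wp x \<alpha>)))
      + ((l x - cnj (l (line j 0))) * (0 - of_real (a [j]) * x j) + (0 - of_real (a [j]) * c j) * (1 - pairing a x (line j 0)))"
    have "(F has_vector_derivative ?D) (at 0)"
      unfolding F_def[abs_def]
      using d1 d2 d3 d4 unfolding single lj
      by (intro has_vector_derivative_add has_vector_derivative_diff has_vector_derivative_mult has_vector_derivative_cnj has_vector_derivative_const) simp_all
    \<comment> \<open>\<open>F\<close> is identically 0 near 0; equating its two derivatives and
      solving for the component \<open>j\<close> of the field gives the formula.\<close>
    moreover have "(F has_vector_derivative 0) (at 0)"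
    proof (rule has_vector_derivative_transform_within[of "\<lambda>_. 0"])
      fix t :: real assume "dist t 0 < \<epsilon>"
      then show "0 = F t" using id'[OF x e(2), of t] by (simp add: F_def)
    qed (use e in auto)
    ultimately have "?D = 0" by (rule vector_derivative_unique_at)
    then show ?thesis by (simp add: line_0 l0 pairing_0[OF a] algebra_simps)
  qed
  then show ?thesis by blast
qed

end

section \<open>The field along a ray with aligned phases\<close>

context infinitesimal begin

definition w :: "nat \<Rightarrow> complex" where
  "w k = (if c k = 0 then 1 else sgn (c k))"

definition lw :: real where
  "lw = (\<Sum>k<n. a [k] * cmod (c k))"

lemma w_norm: "w k * cnj (w k) = 1"
proof -
  have "cmod (w k) = 1" by (simp add: w_def norm_sgn)
  then show ?thesis by (simp flip: complex_norm_square)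
qed

lemma cw: "cnj (c k) * w k = of_real (cmod (c k))"
proof (cases "c k = 0")
  case False
  then have "c k * cnj (c k) / of_real (cmod (c k)) = of_real (cmod (c k))"
    unfolding complex_norm_square[symmetric] by (simp add: power2_eq_square)
  then show ?thesis using False by (simp add: w_def sgn_eq mult.commute)
qed (simp add: w_def)

lemma wpw_norm: "wp w \<alpha> * cnj (wp w \<alpha>) = 1"
proof -
  have "wp w \<alpha> * cnj (wp w \<alpha>) = wp (\<lambda>k. w k * cnj (w k)) \<alpha>" by (simp add: wp_mult wp_cnj)
  then show ?thesis by (simp add: w_norm wp_const)
qed

lemma l_w: "l (\<lambda>i. of_real t * w i) = of_real (t * lw)"
proof -
  have "l (\<lambda>i. of_real t * w i) = (\<Sum>k<n. of_real (a [k]) * (of_real t * (cnj (c k) * w k)))"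
    by (simp add: l_def mult_ac)
  then show ?thesis unfolding cw lw_def by (simp add: sum_distrib_left mult_ac)
qed

text \<open>Along \<open>w\<close> the phases of \<open>c\<close> cancel, so the quadratic
  coefficient is \<open>w j\<close> times a real number. It has two nonnegative parts:
  \<open>lw\<close> from the product of \<open>x j\<close> with \<open>l x\<close>, and a
  contribution of the two-letter words containing \<open>j\<close>.\<close>

lemma xi_along_w:
  assumes j: "j < n"
  shows "\<exists>L \<theta>. \<theta> \<ge> lw \<and> (\<forall>t. rho a (\<lambda>i. of_real t * w i) < 1 \<longrightarrow>
    \<xi> (\<lambda>i. of_real t * w i) j = c j + of_real t * L + (of_real t)\<^sup>2 * (w j * of_real \<theta>))"
proof -
  obtain \<kappa> where \<kappa>: "\<And>x. rho a x < 1 \<Longrightarrow> of_real (a [j]) * \<xi> x j = of_real (a [j]) * c j + of_real (a [j]) * x j * l x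
     + (\<Sum>\<alpha>\<in>supp a. of_real (a \<alpha>) * (wp x \<alpha> * cnj (ddpr (\<lambda>_. 0) (unitv j) c \<kappa> \<alpha>)))"
    using xi_formula[OF j] by blast
  have aj: "a [j] > 0" by (rule symbolD(5)[OF a j])
  define N where "N = (\<Sum>\<alpha>\<in>supp a. of_real (a \<alpha>) * (if length \<alpha> = 1 then wp w \<alpha> * cnj (\<kappa> (hd \<alpha>)) else 0))"
  \<comment> \<open>The phase-free contribution of a two-letter word: each occurrence of
    \<open>j\<close> leaves the modulus of \<open>c\<close> at the other letter.\<close>
  define q where "q \<alpha> = (if length \<alpha> = 2 then (if \<alpha> ! 1 = j then cmod (c (\<alpha> ! 0)) else 0) + (if \<alpha> ! 0 = j then cmod (c (\<alpha> ! 1)) else 0) else 0)" for \<alpha>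
  define \<nu> where "\<nu> = (\<Sum>\<alpha>\<in>supp a. a \<alpha> * q \<alpha>)"
  have \<nu>: "\<nu> \<ge> 0" unfolding \<nu>_def by (intro sum_nonneg mult_nonneg_nonneg symbolD(4)[OF a]) (simp add: q_def)
  have tm: "wp (\<lambda>i. of_real t * w i) \<alpha> * cnj (ddpr (\<lambda>_. 0) (unitv j) c \<kappa> \<alpha>)
     = of_real t * (if length \<alpha> = 1 then wp w \<alpha> * cnj (\<kappa> (hd \<alpha>)) else 0) + (of_real t)\<^sup>2 * (w j * of_real (q \<alpha>))" for t \<alpha>
  proof (cases "length \<alpha> = 2")
    case True
    then obtain p r where \<alpha>: "\<alpha> = [p, r]" by (auto simp: numeral_2_eq_2 length_Suc_conv)
    have "w p * w r * cnj (c p * unitv j r + unitv j p * c r) = w j * of_real (q \<alpha>)"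
      using cw[of p] cw[of r] unfolding \<alpha> q_def by (auto simp: unitv_def algebra_simps mult.left_commute[of "cnj _"])
    then show ?thesis unfolding wp_scale by (simp add: \<alpha> ddpr_zero power2_eq_square mult_ac)
  next
    case False
    then show ?thesis unfolding wp_scale by (auto simp: ddpr_zero q_def)
  qed
  show ?thesis
  proof (intro exI conjI allI impI)
    show "lw + \<nu> / a [j] \<ge> lw" using \<nu> aj by simp
    fix t assume t: "rho a (\<lambda>i. of_real t * w i) < 1"
    have "(\<Sum>\<alpha>\<in>supp a. of_real (a \<alpha>) * (wp (\<lambda>i. of_real t * w i) \<alpha> * cnj (ddpr (\<lambda>_. 0) (unitv j) c \<kappa> \<alpha>)))
       = of_real t * N + (of_real t)\<^sup>2 * (w j * of_real \<nu>)"
      unfolding tm N_def \<nu>_def by (simp add: distrib_left sum.distrib sum_distrib_left mult_ac)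
    then have "of_real (a [j]) * \<xi> (\<lambda>i. of_real t * w i) j = of_real (a [j]) * c j + of_real (a [j]) * (of_real t * w j) * of_real (t * lw)
      + (of_real t * N + (of_real t)\<^sup>2 * (w j * of_real \<nu>))"
      using \<kappa>[OF t] unfolding l_w by simp
    then show "\<xi> (\<lambda>i. of_real t * w i) j = c j + of_real t * (N / of_real (a [j])) + (of_real t)\<^sup>2 * (w j * of_real (lw + \<nu> / a [j]))"
      using aj by (simp add: field_simps power2_eq_square)
  qed
qed

text \<open>\<open>w\<close> aligns the phases with the constant term \<open>c\<close> of the vector field, so that in the identity at
  \<open>(t w, - t w)\<close> all contributions to the coefficient of the top power of \<open>t\<close> have the same sign.\<close>

lemma linear_symbol:
  assumes k0: "k0 < n" "c k0 \<noteq> 0" and \<alpha>0: "length \<alpha>0 \<ge> 2"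
  shows "a \<alpha>0 = 0"
proof (rule ccontr)
  assume nz: "a \<alpha>0 \<noteq> 0"
  define d where "d = Max (length ` supp a)"
  have fin: "finite (supp a)" by (rule symbolD(1)[OF a])
  have kd: "length \<alpha> \<le> d" if "\<alpha> \<in> supp a" for \<alpha> unfolding d_def using that fin by simp
  have d2: "d \<ge> 2" using kd[of \<alpha>0] nz \<alpha>0 by simp
  obtain \<alpha>1 where \<alpha>1: "\<alpha>1 \<in> supp a" "length \<alpha>1 = d"
    using Max_in[of "length ` supp a"] fin nz unfolding d_def by fastforce
  have lw: "lw > 0"
  proof -
    have "a [k0] * cmod (c k0) \<le> lw"
      unfolding lw_def by (rule member_le_sum) (use k0 in \<open>auto simp: symbolD(4)[OF a]\<close>)
    moreover have "a [k0] * cmod (c k0) > 0" using symbolD(5)[OF a k0(1)] k0(2) by simp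
    ultimately show ?thesis by linarith
  qed
  obtain \<epsilon> where e: "\<epsilon> > 0" "\<And>t. cmod t \<le> \<epsilon> \<Longrightarrow> rho a (\<lambda>i. t * w i) < 1" using rho_small[OF a, of w] by blast
  have "\<forall>j. \<exists>L \<theta>. j < n \<longrightarrow> \<theta> \<ge> lw \<and> (\<forall>t. rho a (\<lambda>i. of_real t * w i) < 1 \<longrightarrow>
    \<xi> (\<lambda>i. of_real t * w i) j = c j + of_real t * L + (of_real t)\<^sup>2 * (w j * of_real \<theta>))" using xi_along_w by blast
  then obtain L \<theta> where L: "\<And>j. j < n \<Longrightarrow> \<theta> j \<ge> lw"
    "\<And>j t. j < n \<Longrightarrow> rho a (\<lambda>i. of_real t * w i) < 1 \<Longrightarrow>
    \<xi> (\<lambda>i. of_real t * w i) j = c j + of_real t * L j + (of_real t)\<^sup>2 * (w j * of_real (\<theta> j))" by metis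
  define \<Theta> where "\<Theta> \<alpha> = (\<Sum>i\<leftarrow>\<alpha>. \<theta> i)" for \<alpha>
  define P where "P = dpr w c"
  define Q where "Q = dpr w L"
  have dxi: "dpr (\<lambda>i. of_real t * w i) (\<xi> (\<lambda>i. of_real t * w i)) \<alpha>
    = of_real t ^ (length \<alpha> - 1) * P \<alpha> + of_real t ^ length \<alpha> * Q \<alpha> + of_real t ^ (length \<alpha> + 1) * wp w \<alpha> * of_real (\<Theta> \<alpha>)"
    if \<alpha>: "\<alpha> \<in> supp a" and t: "\<bar>t\<bar> \<le> \<epsilon>" for \<alpha> t
  proof -
    obtain i \<beta> where ib: "\<alpha> = i # \<beta>" using symbol_Nil[OF a \<alpha>] by (cases \<alpha>) auto
    have r: "rho a (\<lambda>i. of_real t * w i) < 1" using e(2)[of "of_real t"] t by simp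
    have "dpr (\<lambda>i. of_real t * w i) (\<xi> (\<lambda>i. of_real t * w i)) \<alpha> = dpr (\<lambda>i. of_real t * w i) (\<lambda>j. (c j + of_real t * L j) + (of_real t)\<^sup>2 * (w j * of_real (\<theta> j))) \<alpha>"
      by (rule dpr_cong) (use symbolD(2)[OF a, of \<alpha>] \<alpha> L(2)[OF _ r] in auto)
    also have "\<dots> = of_real t ^ length \<beta> * dpr w (\<lambda>j. (c j + of_real t * L j) + (of_real t)\<^sup>2 * (w j * of_real (\<theta> j))) \<alpha>"
      unfolding ib dpr_scale ..
    also have "\<dots> = of_real t ^ length \<beta> * (P \<alpha> + of_real t * Q \<alpha> + (of_real t)\<^sup>2 * (wp w \<alpha> * of_real (\<Theta> \<alpha>)))"
    proof -
      have "(\<Sum>i\<leftarrow>\<alpha>. complex_of_real (\<theta> i)) = of_real (\<Theta> \<alpha>)" unfolding \<Theta>_def by (induction \<alpha>) auto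
      then show ?thesis unfolding dpr_add dpr_cmult dpr_diag P_def Q_def by simp
    qed
    finally show ?thesis unfolding ib by (simp add: algebra_simps power2_eq_square)
  qed
  define s :: "nat list \<Rightarrow> complex" where "s \<alpha> = (-1) ^ length \<alpha>" for \<alpha>
  \<comment> \<open>A word of length k contributes \<open>X\<close>, \<open>Y\<close> and
    \<open>Z\<close> to the powers 2 k - 1, 2 k and 2 k + 1 of \<open>t\<close>; the sign
    \<open>s\<close> comes from the second argument - t w. The summand 1 in the factor
    \<open>1 - pairing\<close> only yields a term linear in \<open>t\<close>.\<close>
  define X where "X \<alpha> = of_real (a \<alpha>) * s \<alpha> * (P \<alpha> * cnj (wp w \<alpha>) + cnj (P \<alpha>) * wp w \<alpha>)" for \<alpha>
  define Y where "Y \<alpha> = of_real (a \<alpha>) * s \<alpha> * (Q \<alpha> * cnj (wp w \<alpha>) - cnj (Q \<alpha>) * wp w \<alpha>)" for \<alpha>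
  define Z where "Z \<alpha> = of_real (a \<alpha>) * s \<alpha> * of_real (2 * (\<Theta> \<alpha> - lw))" for \<alpha>
  have "(\<Sum>\<alpha>\<in>{\<alpha>\<in>supp a. length \<alpha> = d}. Z \<alpha>) = 0"
  proof (rule infinite_zeros_top_coeff[where X = X and Y = Y and k = length and e = "of_real (2 * lw)", OF fin _ kd _ e(1)])
    show "length \<alpha> \<ge> 1" if "\<alpha> \<in> supp a" for \<alpha> using symbol_Nil[OF a that] by (simp add: Suc_le_eq)
    show "d \<ge> 1" using d2 by simp
    fix t :: real assume t: "0 < t" "t < \<epsilon>"
    let ?x = "\<lambda>i. of_real t * w i" and ?y = "\<lambda>i. of_real (- t) * w i"
    have xy: "rho a ?x < 1" "rho a ?y < 1" using e(2)[of "of_real t"] e(2)[of "of_real (- t)"] t by simp_all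
    have main: "of_real (a \<alpha>) * dpr ?x (\<xi> ?x) \<alpha> * cnj (wp ?y \<alpha>) - cnj (of_real (a \<alpha>) * dpr ?y (\<xi> ?y) \<alpha> * cnj (wp ?x \<alpha>))
      - of_real (2 * (t * lw)) * (of_real (a \<alpha>) * wp ?x \<alpha> * cnj (wp ?y \<alpha>))
      = X \<alpha> * of_real t ^ (2 * length \<alpha> - 1) + Y \<alpha> * of_real t ^ (2 * length \<alpha>) + Z \<alpha> * of_real t ^ (2 * length \<alpha> + 1)"
      if \<alpha>: "\<alpha> \<in> supp a" for \<alpha>
    proof -
      obtain q where q: "length \<alpha> = Suc q" using symbol_Nil[OF a \<alpha>] by (cases \<alpha>) auto
      have tt: "\<bar>t\<bar> \<le> \<epsilon>" "\<bar>- t\<bar> \<le> \<epsilon>" using t by auto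
      define T where "T = complex_of_real t"
      have cT: "cnj T = T" by (simp add: T_def)
      define W where "W = wp w \<alpha>"
      have W: "W * cnj W = 1" unfolding W_def by (rule wpw_norm)
      have sg: "s \<alpha> = - ((-1) ^ q)" by (simp add: s_def q)
      have e1: "2 * length \<alpha> - 1 = q + Suc q" "2 * length \<alpha> = Suc q + Suc q" "2 * length \<alpha> + 1 = Suc q + Suc (Suc q)" by (simp_all add: q)
      have "of_real (a \<alpha>) * (T ^ q * P \<alpha> + T ^ Suc q * Q \<alpha> + T ^ Suc (Suc q) * W * of_real (\<Theta> \<alpha>)) * cnj ((- T) ^ Suc q * W)
        - cnj (of_real (a \<alpha>) * ((- T) ^ q * P \<alpha> + (- T) ^ Suc q * Q \<alpha> + (- T) ^ Suc (Suc q) * W * of_real (\<Theta> \<alpha>)) * cnj (T ^ Suc q * W))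
        - of_real 2 * T * of_real lw * (of_real (a \<alpha>) * (T ^ Suc q * W) * cnj ((- T) ^ Suc q * W))
        = of_real (a \<alpha>) * s \<alpha> * ((P \<alpha> * cnj W + cnj (P \<alpha>) * W) * T ^ (q + Suc q) + (Q \<alpha> * cnj W - cnj (Q \<alpha>) * W) * T ^ (Suc q + Suc q)
          + (W * cnj W) * of_real (2 * (\<Theta> \<alpha> - lw)) * T ^ (Suc q + Suc (Suc q)))"
        unfolding sg power_minus[of T] by (simp add: cT power_add algebra_simps)
      then show ?thesis
        unfolding dxi[OF \<alpha> tt(1)] dxi[OF \<alpha> tt(2)] wp_scale e1 unfolding q X_def Y_def Z_def W_def[symmetric]
        by (simp add: W T_def[symmetric] algebra_simps)
    qed
    have "0 = dpair a ?x (\<xi> ?x) ?y - cnj (dpair a ?y (\<xi> ?y) ?x) + (l ?x - cnj (l ?y)) * (1 - pairing a ?x ?y)"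
      using id'[OF xy] by simp
    also have "l ?x - cnj (l ?y) = of_real (2 * (t * lw))" unfolding l_w by simp
    also have "dpair a ?x (\<xi> ?x) ?y - cnj (dpair a ?y (\<xi> ?y) ?x) + of_real (2 * (t * lw)) * (1 - pairing a ?x ?y)
      = (\<Sum>\<alpha>\<in>supp a. of_real (a \<alpha>) * dpr ?x (\<xi> ?x) \<alpha> * cnj (wp ?y \<alpha>) - cnj (of_real (a \<alpha>) * dpr ?y (\<xi> ?y) \<alpha> * cnj (wp ?x \<alpha>))
      - of_real (2 * (t * lw)) * (of_real (a \<alpha>) * wp ?x \<alpha> * cnj (wp ?y \<alpha>))) + of_real (2 * (t * lw))"
      unfolding dpair_def pairing_def sum_subtractf cnj_sum sum_distrib_left[symmetric] by (simp only: algebra_simps mult_1_left)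
    also have "\<dots> = (\<Sum>\<alpha>\<in>supp a. X \<alpha> * of_real t ^ (2 * length \<alpha> - 1) + Y \<alpha> * of_real t ^ (2 * length \<alpha>) + Z \<alpha> * of_real t ^ (2 * length \<alpha> + 1)) + of_real (2 * (t * lw))"
      using main by simp
    finally show "(\<Sum>\<alpha>\<in>supp a. X \<alpha> * of_real t ^ (2 * length \<alpha> - 1) + Y \<alpha> * of_real t ^ (2 * length \<alpha>) + Z \<alpha> * of_real t ^ (2 * length \<alpha> + 1)) + of_real (2 * lw) * of_real t = 0"
      by (simp add: mult_ac)
  qed
  moreover have "(\<Sum>\<alpha>\<in>{\<alpha>\<in>supp a. length \<alpha> = d}. Z \<alpha>) = (\<Sum>\<alpha>\<in>{\<alpha>\<in>supp a. length \<alpha> = d}. of_real (a \<alpha> * (2 * (\<Theta> \<alpha> - lw))) * (-1) ^ d)"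
    by (intro sum.cong refl) (auto simp: Z_def s_def)
  ultimately have "(\<Sum>\<alpha>\<in>{\<alpha>\<in>supp a. length \<alpha> = d}. of_real (a \<alpha> * (2 * (\<Theta> \<alpha> - lw))) * (-1) ^ d) = (0::complex)" by simp
  then have "(\<Sum>\<alpha>\<in>{\<alpha>\<in>supp a. length \<alpha> = d}. complex_of_real (a \<alpha> * (2 * (\<Theta> \<alpha> - lw)))) = 0"
    unfolding sum_distrib_right[symmetric] by simp
  then have "(\<Sum>\<alpha>\<in>{\<alpha>\<in>supp a. length \<alpha> = d}. a \<alpha> * (2 * (\<Theta> \<alpha> - lw))) = 0"
    unfolding of_real_sum[symmetric] of_real_eq_0_iff .
  \<comment> \<open>Here d \<ge> 2 is decisive: \<Theta> is at least d times \<open>lw\<close>,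
    hence exceeds the single \<open>lw\<close> subtracted from it. In degree 1 the bound only gives
    \<Theta> \<ge> \<open>lw\<close> and there is no contradiction.\<close>
  moreover have "(\<Sum>\<alpha>\<in>{\<alpha>\<in>supp a. length \<alpha> = d}. a \<alpha> * (2 * (\<Theta> \<alpha> - lw))) > 0"
  proof (rule sum_pos)
    show "{\<alpha>\<in>supp a. length \<alpha> = d} \<noteq> {}" using \<alpha>1 by auto
    fix \<alpha> assume \<alpha>: "\<alpha> \<in> {\<alpha>\<in>supp a. length \<alpha> = d}"
    then have "a \<alpha> > 0" using symbolD(4)[OF a, of \<alpha>] by auto
    moreover have "\<Theta> \<alpha> \<ge> real (length \<alpha>) * lw"
      using symbolD(2)[OF a, of \<alpha>] \<alpha> unfolding \<Theta>_def
    proof -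
      assume "a \<alpha> \<noteq> 0 \<Longrightarrow> set \<alpha> \<subseteq> {..<n}"
      then have "set \<alpha> \<subseteq> {..<n}" using \<alpha> by simp
      then show "real (length \<alpha>) * lw \<le> (\<Sum>i\<leftarrow>\<alpha>. \<theta> i)"
        by (induction \<alpha>) (use L(1) in \<open>auto simp: algebra_simps intro: add_mono\<close>)
    qed
    moreover have "real (length \<alpha>) * lw > lw" using \<alpha> d2 lw by simp
    ultimately show "0 < a \<alpha> * (2 * (\<Theta> \<alpha> - lw))" by simp
  qed (use fin in simp)
  ultimately show False by simp
qed

end

subsection \<open>Isomorphisms moving the origin\<close>

lemma kv_cong:
  assumes "symbol n a" "\<And>i. i < n \<Longrightarrow> z i = z' i"
  shows "kv a z = kv a z'"
proof
  fix \<alpha>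
  show "kv a z \<alpha> = kv a z' \<alpha>"
  proof (cases "set \<alpha> \<subseteq> {..<n}")
    case True
    then have "wp z \<alpha> = wp z' \<alpha>" using assms(2) by (intro wp_cong) auto
    then show ?thesis by (simp add: kv_def)
  next
    case False
    then show ?thesis using bcoef_eq_0[OF assms(1)] by (simp add: kv_def)
  qed
qed

text \<open>On a ray \<open>rho\<close> is a polynomial in the modulus, so a strict inequality at 1
  persists a little beyond. The uniform \<open>q\<close> later bounds the norms of all kernel
  vectors on the disc.\<close>

lemma rho_dilate:
  assumes a: "symbol n a" and z: "rho a z < 1"
  obtains R q where "R > 1" "q < 1" "\<And>\<zeta>. cmod \<zeta> < R \<Longrightarrow> rho a (\<lambda>i. \<zeta> * z i) \<le> q"
proof -
  define g where "g r = (\<Sum>\<alpha>\<in>supp a. a \<alpha> * ((r ^ length \<alpha>)\<^sup>2 * (cmod (wp z \<alpha>))\<^sup>2))" for r :: real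
  have g: "rho a (\<lambda>i. \<zeta> * z i) = g (cmod \<zeta>)" for \<zeta>
    unfolding rho_def g_def by (intro sum.cong refl) (simp add: wp_scale norm_mult norm_power power_mult_distrib)
  have g1: "g 1 < 1" using g[of 1] z by simp
  define q where "q = (g 1 + 1) / 2"
  have "isCont g 1" unfolding g_def by (intro continuous_intros)
  then have "\<forall>\<^sub>F r in at 1. g r < q" using g1 unfolding isCont_def q_def by (intro order_tendstoD) auto
  then obtain d where d: "d > 0" "\<And>r. r \<noteq> 1 \<Longrightarrow> dist r 1 < d \<Longrightarrow> g r < q" unfolding eventually_at by blast
  show ?thesis
  proof (rule that)
    show "1 + d / 2 > 1" "q < 1" using d(1) g1 by (simp_all add: q_def)
    fix \<zeta> assume \<zeta>: "cmod \<zeta> < 1 + d / 2"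
    have "g (cmod \<zeta>) \<le> g (1 + d / 2)"
      unfolding g_def by (intro sum_mono mult_left_mono mult_right_mono power_mono symbolD(4)[OF a]) (use \<zeta> in auto)
    also have "\<dots> < q" using d by (intro d(2)) (auto simp: dist_real_def)
    finally show "rho a (\<lambda>i. \<zeta> * z i) \<le> q" using g by simp
  qed
qed

text \<open>Polynomials of the algebra evaluate to polynomials in \<zeta>, and approximation in
  operator norm is uniform on the disc, because the squared norms of the kernel vectors are at most
  1 / (1 - q).\<close>

lemma ev_holomorphic:
  assumes a: "symbol n a" and T: "T \<in> domalg n a" and R: "q < 1" "\<And>\<zeta>. cmod \<zeta> < R \<Longrightarrow> rho a (\<lambda>i. \<zeta> * z i) \<le> q"
  shows "(\<lambda>\<zeta>. ev a (\<lambda>i. \<zeta> * z i) T) holomorphic_on ball 0 R"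
proof -
  have dom: "rho a (\<lambda>i. \<zeta> * z i) < 1" if "\<zeta> \<in> ball 0 R" for \<zeta> using R(1) R(2)[of \<zeta>] that by simp
  have "\<exists>P. P \<in> polyops n a \<and> opnorm n (\<lambda>x \<beta>. T x \<beta> - P x \<beta>) < 1 / real (Suc k)" for k
  proof -
    have "1 / real (Suc k) > 0" by simp
    then show ?thesis using T unfolding domalg_def by blast
  qed
  then have "\<forall>k. \<exists>P. P \<in> polyops n a \<and> opnorm n (\<lambda>x \<beta>. T x \<beta> - P x \<beta>) < 1 / real (Suc k)" ..
  from choice[OF this] obtain P where "\<forall>k. P k \<in> polyops n a \<and> opnorm n (\<lambda>x \<beta>. T x \<beta> - P k x \<beta>) < 1 / real (Suc k)" ..
  then have P: "P k \<in> polyops n a" "opnorm n (\<lambda>x \<beta>. T x \<beta> - P k x \<beta>) < 1 / real (Suc k)" for k by simp_all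
  define C where "C = sqrt (1 / (1 - q))"
  have C: "C > 0" using R(1) by (simp add: C_def)
  have kvC: "fnorm (kv a (\<lambda>i. \<zeta> * z i)) \<le> C" if "\<zeta> \<in> ball 0 R" for \<zeta>
  proof -
    have "(fnorm (kv a (\<lambda>i. \<zeta> * z i)))\<^sup>2 \<le> 1 / (1 - q)"
      unfolding kv_norm[OF a dom[OF that]] using dom[OF that] R(1) R(2)[of \<zeta>] that by (intro divide_left_mono) auto
    then show ?thesis unfolding C_def by (rule real_le_rsqrt)
  qed
  have ul: "uniform_limit (ball 0 R) (\<lambda>k \<zeta>. ev a (\<lambda>i. \<zeta> * z i) (P k)) (\<lambda>\<zeta>. ev a (\<lambda>i. \<zeta> * z i) T) sequentially"
  proof (rule uniform_limitI)
    fix e :: real assume e: "e > 0"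
    have "(\<lambda>k. C * inverse (real (Suc k))) \<longlonglongrightarrow> C * 0" by (intro tendsto_mult tendsto_const LIMSEQ_inverse_real_of_nat)
    then have "\<forall>\<^sub>F k in sequentially. C * inverse (real (Suc k)) < e" using e by (intro order_tendstoD) auto
    then show "\<forall>\<^sub>F k in sequentially. \<forall>\<zeta>\<in>ball 0 R. dist (ev a (\<lambda>i. \<zeta> * z i) (P k)) (ev a (\<lambda>i. \<zeta> * z i) T) < e"
    proof (rule eventually_mono, intro ballI)
      fix k and \<zeta> :: complex assume k: "C * inverse (real (Suc k)) < e" and \<zeta>: "\<zeta> \<in> ball 0 R"
      have bd: "bounded_op n (\<lambda>x \<beta>. T x \<beta> - P k x \<beta>)"
        by (rule bounded_op_diff[OF domalg_bounded[OF T] bounded_op_polyops[OF a P(1)]])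
      have "dist (ev a (\<lambda>i. \<zeta> * z i) (P k)) (ev a (\<lambda>i. \<zeta> * z i) T) \<le> opnorm n (\<lambda>x \<beta>. T x \<beta> - P k x \<beta>) * fnorm (kv a (\<lambda>i. \<zeta> * z i))"
        using ev_diff_bound[OF a dom[OF \<zeta>] domalg_bounded[OF T] bounded_op_polyops[OF a P(1)]] by (simp add: dist_norm norm_minus_commute)
      also have "\<dots> \<le> (1 / real (Suc k)) * C"
        by (intro mult_mono less_imp_le[OF P(2)] kvC[OF \<zeta>]) auto
      also have "\<dots> < e" using k by (simp add: field_simps)
      finally show "dist (ev a (\<lambda>i. \<zeta> * z i) (P k)) (ev a (\<lambda>i. \<zeta> * z i) T) < e" .
    qed
  qed
  show ?thesis
  proof (rule holomorphic_uniform_sequence[OF open_ball])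
    fix k
    obtain F c where F: "finite F" "\<And>\<alpha>. \<alpha> \<in> F \<Longrightarrow> set \<alpha> \<subseteq> {..<n}" "P k = (\<lambda>x \<beta>. \<Sum>\<alpha>\<in>F. c \<alpha> * wword n a \<alpha> x \<beta>)"
      using polyopsE[OF P(1)] by blast
    have eq: "ev a (\<lambda>i. \<zeta> * z i) (P k) = (\<Sum>\<alpha>\<in>F. c \<alpha> * (\<zeta> ^ length \<alpha> * wp z \<alpha>))" if "\<zeta> \<in> ball 0 R" for \<zeta>
      unfolding F(3) ev_def
      by (subst ip_polyop[OF a F(1) F(2) vac_Fock kv_Fock[OF a dom[OF that]]])
         (auto intro!: sum.cong simp: wword_kv[OF a dom[OF that] F(2) vac_Fock] ip_kv_vac wp_scale)
    have "(\<lambda>\<zeta>. \<Sum>\<alpha>\<in>F. c \<alpha> * (\<zeta> ^ length \<alpha> * wp z \<alpha>)) holomorphic_on ball 0 R"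
      by (intro holomorphic_intros)
    then show "(\<lambda>\<zeta>. ev a (\<lambda>i. \<zeta> * z i) (P k)) holomorphic_on ball 0 R"
      by (rule holomorphic_transform) (rule eq[symmetric])
  next
    fix x :: complex assume "x \<in> ball 0 R"
    then obtain d where d: "d > 0" "cball x d \<subseteq> ball 0 R" using open_contains_cball[of "ball (0::complex) R"] open_ball by blast
    then show "\<exists>d>0. cball x d \<subseteq> ball 0 R \<and> uniform_limit (cball x d) (\<lambda>k \<zeta>. ev a (\<lambda>i. \<zeta> * z i) (P k)) (\<lambda>\<zeta>. ev a (\<lambda>i. \<zeta> * z i) T) sequentially"
      using uniform_limit_on_subset[OF ul d(2)] by blast
  qed
qed

lemma pairing_has_vector_derivative:
  assumes a: "symbol n a" and "\<And>k. k < n \<Longrightarrow> ((\<lambda>t. x t k) has_vector_derivative v k) (at s)"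
    and "\<And>k. k < n \<Longrightarrow> ((\<lambda>t. y t k) has_vector_derivative u k) (at s)"
  shows "((\<lambda>t. pairing a (x t) (y t)) has_vector_derivative (dpair a (x s) v (y s) + cnj (dpair a (y s) u (x s)))) (at s)"
proof -
  have "((\<lambda>t. pairing a (x t) (y t)) has_vector_derivative
    (\<Sum>\<alpha>\<in>supp a. of_real (a \<alpha>) * (wp (x s) \<alpha> * cnj (dpr (y s) u \<alpha>) + dpr (x s) v \<alpha> * cnj (wp (y s) \<alpha>)))) (at s)"
    unfolding pairing_def mult.assoc
  proof (intro has_vector_derivative_sum has_vector_derivative_mult_right has_vector_derivative_mult has_vector_derivative_cnj wp_has_vector_derivative)
    fix \<alpha> k assume "\<alpha> \<in> supp a" "k \<in> set \<alpha>"
    then have "k < n" using symbolD(2)[OF a, of \<alpha>] by auto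
    then show "((\<lambda>t. x t k) has_vector_derivative v k) (at s)" "((\<lambda>t. y t k) has_vector_derivative u k) (at s)" using assms by auto
  qed
  then show ?thesis unfolding dpair_def by (simp add: sum.distrib algebra_simps)
qed

lemma dpair_cong:
  assumes "symbol n a" "\<And>j. j < n \<Longrightarrow> x j = x' j" "\<And>j. j < n \<Longrightarrow> v j = v' j" "\<And>j. j < n \<Longrightarrow> y j = y' j"
  shows "dpair a x v y = dpair a x' v' y'"
  unfolding dpair_def
proof (intro sum.cong refl)
  fix \<alpha> assume "\<alpha> \<in> supp a"
  then have "set \<alpha> \<subseteq> {..<n}" using symbolD(2)[OF assms(1)] by simp
  then have "wp y \<alpha> = wp y' \<alpha>" "dpr x v \<alpha> = dpr x' v' \<alpha>" using assms(2-4) by (auto intro!: wp_cong dpr_cong)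
  then show "of_real (a \<alpha>) * dpr x v \<alpha> * cnj (wp y \<alpha>) = of_real (a \<alpha>) * dpr x' v' \<alpha> * cnj (wp y' \<alpha>)" by simp
qed

lemma dpair_cmult: "dpair a x (\<lambda>k. c * v k) y = c * dpair a x v y"
  unfolding dpair_def dpr_cmult sum_distrib_left by (intro sum.cong refl) (simp add: mult_ac)

lemma rho_cis:
  assumes "cmod t = 1"
  shows "rho a (\<lambda>i. t * z i) = rho a z"
  unfolding rho_def by (simp add: wp_scale norm_mult norm_power assms)

lemma pairing_cis:
  assumes "cmod t = 1"
  shows "pairing a (\<lambda>i. t * z i) (\<lambda>i. t * w i) = pairing a z w"
proof -
  have "t * cnj t = 1" using assms by (simp flip: complex_norm_square)
  then have tk: "t ^ k * cnj (t ^ k) = 1" for k by (simp flip: power_mult_distrib)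
  have "r * (t ^ k * u) * cnj (t ^ k * v) = r * u * cnj v" for r k u v
  proof -
    have "r * (t ^ k * u) * cnj (t ^ k * v) = r * u * cnj v * (t ^ k * cnj (t ^ k))" by simp
    then show ?thesis unfolding tk by simp
  qed
  then show ?thesis unfolding pairing_def wp_scale by (intro sum.cong refl)
qed

section \<open>The vector field transported by the isomorphism\<close>

context cc_iso begin

lemma phi_cong: "(\<And>i. i < m \<Longrightarrow> z i = z' i) \<Longrightarrow> \<phi> z = \<phi> z'"
  using kv_cong[OF b, of z z'] by (intro ext) (simp add: phi_def ev_def)

lemma phi_holomorphic:
  assumes "rho b z < 1"
  shows "\<exists>R>1. \<forall>k<n. (\<lambda>\<zeta>. \<phi> (\<lambda>i. \<zeta> * z i) k) holomorphic_on ball 0 R"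
proof -
  obtain R q where R: "R > 1" "q < 1" "\<And>\<zeta>. cmod \<zeta> < R \<Longrightarrow> rho b (\<lambda>i. \<zeta> * z i) \<le> q"
    using rho_dilate[OF b assms] by blast
  have "(\<lambda>\<zeta>. \<phi> (\<lambda>i. \<zeta> * z i) k) holomorphic_on ball 0 R" if "k < n" for k
    unfolding phi_def
    by (rule ev_holomorphic[OF b cc_homD(1)[OF \<Phi> wword_domalg[OF a]] R(2) R(3)]) (use that in simp_all)
  then show ?thesis using R(1) by (intro exI[of _ R]) simp
qed

text \<open>The derivative of \<open>\<phi>\<close> along the Euler field, which generates both the
  circle action and the dilations. Holomorphy on the complex line through \<open>z\<close> is all
  that it involves.\<close>

definition eta :: "(nat \<Rightarrow> complex) \<Rightarrow> nat \<Rightarrow> complex" where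
  "eta z k = deriv (\<lambda>\<zeta>. \<phi> (\<lambda>i. \<zeta> * z i) k) 1"

lemma eta_deriv:
  assumes "rho b z < 1" "k < n"
  shows "((\<lambda>\<zeta>. \<phi> (\<lambda>i. \<zeta> * z i) k) has_field_derivative eta z k) (at 1)"
proof -
  from phi_holomorphic[OF assms(1)]
  obtain R where R1: "R > 1" and Rh: "\<forall>k<n. (\<lambda>\<zeta>. \<phi> (\<lambda>i. \<zeta> * z i) k) holomorphic_on ball 0 R" by (elim exE conjE)
  note R = R1 Rh[rule_format]
  show ?thesis unfolding eta_def by (rule holomorphic_derivI[OF R(2)[OF assms(2)]]) (use R(1) in simp_all)
qed

lemma eta_cong: "(\<And>i. i < m \<Longrightarrow> z i = z' i) \<Longrightarrow> eta z = eta z'"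
proof -
  assume eq: "\<And>i. i < m \<Longrightarrow> z i = z' i"
  have "\<phi> (\<lambda>i. \<zeta> * z i) = \<phi> (\<lambda>i. \<zeta> * z' i)" for \<zeta> by (rule phi_cong) (simp add: eq)
  then show ?thesis by (simp add: eta_def fun_eq_iff)
qed

lemma eta_0: "eta (\<lambda>_. 0) k = 0"
  by (simp add: eta_def)

lemma eta_cis:
  assumes "rho b z < 1" "k < n"
  shows "((\<lambda>\<theta>. \<phi> (\<lambda>i. cis \<theta> * z i) k) has_vector_derivative \<i> * eta z k) (at 0)"
proof -
  have "(cis has_vector_derivative \<i>) (at 0)"
    unfolding has_vector_derivative_def by (auto intro!: derivative_eq_intros simp: scaleR_conv_of_real)
  from field_vector_diff_chain_at[OF this, of "\<lambda>\<zeta>. \<phi> (\<lambda>i. \<zeta> * z i) k" "eta z k"] eta_deriv[OF assms]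
  show ?thesis by (simp add: o_def)
qed

text \<open>Rescaling the base point to t z moves the derivative at \<zeta> = 1 to the point
  \<open>t\<close> of the ray; the reparametrisation produces the factor
  \<open>inverse t\<close>.\<close>

lemma eta_ray:
  assumes "rho b (\<lambda>i. of_real t * z i) < 1" "k < n" "t \<noteq> 0"
  shows "((\<lambda>s. \<phi> (\<lambda>i. of_real s * z i) k) has_vector_derivative inverse (of_real t) * eta (\<lambda>i. of_real t * z i) k) (at t)"
proof -
  have "((\<lambda>s. of_real s * inverse (complex_of_real t)) has_vector_derivative inverse (of_real t)) (at t)"
    by (auto intro!: derivative_eq_intros)
  moreover have "((\<lambda>\<zeta>. \<phi> (\<lambda>i. \<zeta> * (of_real t * z i)) k) has_field_derivative eta (\<lambda>i. of_real t * z i) k) (at (of_real t * inverse (complex_of_real t)))"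
    using eta_deriv[OF assms(1,2)] assms(3) by simp
  ultimately have "((\<lambda>\<zeta>. \<phi> (\<lambda>i. \<zeta> * (of_real t * z i)) k) \<circ> (\<lambda>s. of_real s * inverse (complex_of_real t)) has_vector_derivative inverse (of_real t) * eta (\<lambda>i. of_real t * z i) k) (at t)"
    by (rule field_vector_diff_chain_at)
  moreover have "complex_of_real s * inverse (complex_of_real t) * (complex_of_real t * z i) = of_real s * z i" for s i
    using assms(3) by simp
  ultimately show ?thesis by (simp only: o_def)
qed

text \<open>The push-forward under \<open>\<phi>\<close> of the Euler field on the domain of
  \<open>b\<close>.\<close>

definition xi :: "(nat \<Rightarrow> complex) \<Rightarrow> nat \<Rightarrow> complex" where
  "xi x = eta (\<psi> x)"

abbreviation "pt \<equiv> \<phi> (\<lambda>_. 0)"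

text \<open>The logarithmic derivative along \<open>xi\<close> of \<open>1 - pairing a x pt\<close>,
  a factor of the kernel identity.\<close>

definition mu :: "(nat \<Rightarrow> complex) \<Rightarrow> complex" where
  "mu x = - dpair a x (xi x) pt / (1 - pairing a x pt)"

lemma pt_dom: "rho a pt < 1"
  using phi_dom rho_0[OF b] by simp

text \<open>Differentiating the kernel identity along the circle action, which preserves the kernel of \<open>b\<close>.\<close>

lemma infinitesimal_identity:
  assumes x: "rho a x < 1" and y: "rho a y < 1"
  shows "dpair a x (xi x) y - cnj (dpair a y (xi y) x) + (mu x - cnj (mu y)) * (1 - pairing a x y) = 0"
proof -
  define z w where "z = \<psi> x" and "w = \<psi> y"
  have z: "rho b z < 1" and w: "rho b w < 1" unfolding z_def w_def using psi_dom x y by auto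
  have xz: "\<phi> z k = x k" and yw: "\<phi> w k = y k" if "k < n" for k unfolding z_def w_def using phi_psi that x y by auto
  define g where "g = 1 - pairing b z w"
  define C where "C = 1 - pairing a pt pt"
  have C: "C \<noteq> 0" unfolding C_def by (rule pairing_ne_1[OF a pt_dom pt_dom])
  define X where "X \<theta> = \<phi> (\<lambda>i. cis \<theta> * z i)" for \<theta>
  define Y where "Y \<theta> = \<phi> (\<lambda>i. cis \<theta> * w i)" for \<theta>
  have X0: "X 0 = \<phi> z" and Y0: "Y 0 = \<phi> w" by (simp_all add: X_def Y_def)
  have dX: "((\<lambda>\<theta>. X \<theta> k) has_vector_derivative \<i> * eta z k) (at 0)" if "k < n" for k
    unfolding X_def by (rule eta_cis[OF z that])
  have dY: "((\<lambda>\<theta>. Y \<theta> k) has_vector_derivative \<i> * eta w k) (at 0)" if "k < n" for k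
    unfolding Y_def by (rule eta_cis[OF w that])
  have d0: "((\<lambda>\<theta>. pt k) has_vector_derivative 0) (at 0)" for k by simp
  define D1 D2 D3 D4 hz hw where "D1 = dpair a x (xi x) y" and "D2 = dpair a y (xi y) x"
    and "D3 = dpair a x (xi x) pt" and "D4 = dpair a y (xi y) pt"
    and "hz = 1 - pairing a x pt" and "hw = 1 - pairing a y pt"
  have z0: "dpair a p (\<lambda>k. 0) q = 0" for p q using dpair_cmult[of a p 0 "\<lambda>_. 0" q] by simp
  \<comment> \<open>The velocity of the circle action carries a factor i, which becomes - i in the
    conjugate-linear slot. This is the origin of the minus sign in the identity.\<close>
  have dXY: "((\<lambda>\<theta>. pairing a (X \<theta>) (Y \<theta>)) has_vector_derivative \<i> * D1 - \<i> * cnj D2) (at 0)"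
  proof -
    have "dpair a (\<phi> z) (\<lambda>k. \<i> * eta z k) (\<phi> w) = \<i> * D1" "dpair a (\<phi> w) (\<lambda>k. \<i> * eta w k) (\<phi> z) = \<i> * D2"
      unfolding dpair_cmult D1_def D2_def xi_def z_def[symmetric] w_def[symmetric]
      using dpair_cong[OF a, of "\<phi> z" x "eta z" "eta z" "\<phi> w" y] dpair_cong[OF a, of "\<phi> w" y "eta w" "eta w" "\<phi> z" x] xz yw by simp_all
    then show ?thesis using pairing_has_vector_derivative[OF a, of X "\<lambda>k. \<i> * eta z k" 0 Y "\<lambda>k. \<i> * eta w k"] dX dY by (simp add: X0 Y0)
  qed
  have dXp: "((\<lambda>\<theta>. pairing a (X \<theta>) pt) has_vector_derivative \<i> * D3) (at 0)"
  proof -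
    have "dpair a (\<phi> z) (\<lambda>k. \<i> * eta z k) pt = \<i> * D3"
      unfolding dpair_cmult D3_def xi_def z_def[symmetric] using dpair_cong[OF a, of "\<phi> z" x "eta z" "eta z" pt pt] xz by simp
    then show ?thesis using pairing_has_vector_derivative[OF a, of X "\<lambda>k. \<i> * eta z k" 0 "\<lambda>_. pt" "\<lambda>_. 0"] dX d0 by (simp add: X0 z0)
  qed
  have dYp: "((\<lambda>\<theta>. pairing a (Y \<theta>) pt) has_vector_derivative \<i> * D4) (at 0)"
  proof -
    have "dpair a (\<phi> w) (\<lambda>k. \<i> * eta w k) pt = \<i> * D4"
      unfolding dpair_cmult D4_def xi_def w_def[symmetric] using dpair_cong[OF a, of "\<phi> w" y "eta w" "eta w" pt pt] yw by simp
    then show ?thesis using pairing_has_vector_derivative[OF a, of Y "\<lambda>k. \<i> * eta w k" 0 "\<lambda>_. pt" "\<lambda>_. 0"] dY d0 by (simp add: Y0 z0)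
  qed
  have p0: "pairing a (X 0) pt = pairing a x pt" "pairing a (Y 0) pt = pairing a y pt" "pairing a (X 0) (Y 0) = pairing a x y"
    unfolding X0 Y0 using xz yw by (auto intro!: pairing_cong[OF a])
  define L where "L \<theta> = (1 - pairing a (X \<theta>) (Y \<theta>)) * C" for \<theta>
  have key: "L \<theta> = (1 - pairing a (X \<theta>) pt) * (1 - cnj (pairing a (Y \<theta>) pt)) * g" for \<theta>
  proof -
    have "rho b (\<lambda>i. cis \<theta> * z i) < 1" "rho b (\<lambda>i. cis \<theta> * w i) < 1" using z w by (simp_all add: rho_cis)
    from kernel_identity[OF this] show ?thesis
      unfolding L_def X_def Y_def C_def g_def pairing_cis[OF norm_cis] pairing_cnj[of a pt "\<phi> (\<lambda>i. cis \<theta> * w i)"] .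
  qed
  have "(L has_vector_derivative (0 - (\<i> * D1 - \<i> * cnj D2)) * C) (at 0)"
    unfolding L_def[abs_def] by (intro has_vector_derivative_mult_left has_vector_derivative_diff has_vector_derivative_const dXY)
  moreover have "(L has_vector_derivative ((1 - pairing a (X 0) pt) * (0 - cnj (\<i> * D4)) + (0 - \<i> * D3) * (1 - cnj (pairing a (Y 0) pt))) * g) (at 0)"
    unfolding key[abs_def]
    by (intro has_vector_derivative_mult_left has_vector_derivative_mult has_vector_derivative_diff has_vector_derivative_const has_vector_derivative_cnj dXp dYp)
  ultimately have "(0 - (\<i> * D1 - \<i> * cnj D2)) * C = ((1 - pairing a (X 0) pt) * (0 - cnj (\<i> * D4)) + (0 - \<i> * D3) * (1 - cnj (pairing a (Y 0) pt))) * g"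
    by (rule vector_derivative_unique_at)
  then have "\<i> * ((D1 - cnj D2) * C) = \<i> * ((D3 * cnj hw - hz * cnj D4) * g)"
    unfolding p0 hz_def hw_def by (simp add: algebra_simps)
  then have e1: "(D1 - cnj D2) * C = (D3 * cnj hw - hz * cnj D4) * g" by simp
  have e2: "(1 - pairing a x y) * C = hz * cnj hw * g"
    using key[of 0] unfolding L_def p0 hz_def hw_def by simp
  have h: "hz \<noteq> 0" "hw \<noteq> 0" unfolding hz_def hw_def using pairing_ne_1[OF a _ pt_dom] x y by auto
  have "C * (D1 - cnj D2 + (- D3 / hz - cnj (- D4 / hw)) * (1 - pairing a x y))
    = (D1 - cnj D2) * C + (- D3 / hz + cnj D4 / cnj hw) * ((1 - pairing a x y) * C)" by (simp add: algebra_simps)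
  also have "\<dots> = 0" unfolding e1 e2 using h by (simp add: field_simps)
  finally show ?thesis using C unfolding D1_def D2_def D3_def D4_def hz_def hw_def mu_def by simp
qed

lemma infinitesimal: "infinitesimal n a xi mu"
  by unfold_locales (rule a, rule infinitesimal_identity)

text \<open>Otherwise \<open>pairing a (\<phi> z) pt\<close> would be constant in \<open>z\<close>.\<close>

lemma xi_0_nonzero:
  assumes p: "k0 < n" "pt k0 \<noteq> 0"
  shows "\<exists>k<n. xi (\<lambda>_. 0) k \<noteq> 0"
proof (rule ccontr)
  assume "\<not> (\<exists>k<n. xi (\<lambda>_. 0) k \<noteq> 0)"
  then have "infinitesimal.l n a xi x = 0" for x by (simp add: infinitesimal.l_def[OF infinitesimal])
  then have mu: "mu x = cnj (mu (\<lambda>_. 0))" if "rho a x < 1" for x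
    using infinitesimal.mu_eq[OF infinitesimal that] by simp
  \<comment> \<open>The Euler field vanishes at the origin, so its push-forward vanishes at
    \<open>pt\<close>. As \<open>mu\<close> is constant when \<open>xi\<close> vanishes at the
    origin, this forces the constant to be 0.\<close>
  have "xi pt = eta (\<lambda>_. 0)"
    unfolding xi_def by (rule eta_cong) (use psi_phi rho_0[OF b] in simp)
  then have "xi pt = (\<lambda>_. 0)" by (simp add: fun_eq_iff eta_0)
  then have "mu pt = 0" unfolding mu_def using dpair_cmult[of a pt 0 "\<lambda>_. 0" pt] by simp
  then have mu0: "mu x = 0" if "rho a x < 1" for x using mu[OF that] mu[OF pt_dom] by simp
  \<comment> \<open>\<open>r\<close> is the point that \<open>\<phi>\<close> sends to the origin.
    Along the segment from 0 to \<open>r\<close> the pairing of the image with \<open>pt\<close>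
    starts at \<open>rho a pt\<close> and ends at 0.\<close>
  define r where "r = \<psi> (\<lambda>_. 0)"
  have r: "rho b r < 1" unfolding r_def using psi_dom rho_0[OF a] by simp
  have dom: "rho b (\<lambda>i. of_real t * r i) < 1" if "t \<in> {0..1}" for t :: real
  proof -
    have t: "cmod (of_real t) \<le> 1" using that by simp
    have "rho b (\<lambda>i. of_real t * r i) \<le> (cmod (of_real t))\<^sup>2 * rho b r" by (rule rho_scale_le[OF b t])
    also have "\<dots> \<le> 1 * rho b r" using t rho_nonneg[OF b] by (intro mult_right_mono power_le_one) auto
    finally show ?thesis using r by simp
  qed
  define H where "H t = pairing a (\<phi> (\<lambda>i. complex_of_real t * r i)) pt" for t
  \<comment> \<open>The point t = 0 is excluded because \<open>eta_ray\<close> divides by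
    \<open>t\<close>; continuity of \<open>H\<close> bridges it.\<close>
  have dH: "(H has_vector_derivative 0) (at t)" if t: "t \<in> {0..1} - {0}" for t
  proof -
    let ?z = "\<lambda>i. complex_of_real t * r i"
    have zd: "rho b ?z < 1" using dom t by simp
    have "(H has_vector_derivative (dpair a (\<phi> ?z) (\<lambda>k. inverse (of_real t) * eta ?z k) pt + cnj (dpair a pt (\<lambda>k. 0) (\<phi> ?z)))) (at t)"
      unfolding H_def by (rule pairing_has_vector_derivative[OF a]) (use eta_ray[OF zd] t in auto)
    moreover have "dpair a (\<phi> ?z) (eta ?z) pt = 0"
    proof -
      have "eta ?z = xi (\<phi> ?z)" unfolding xi_def by (rule eta_cong) (simp add: psi_phi[OF zd])
      then show ?thesis using mu0[OF phi_dom[OF zd]] pairing_ne_1[OF a phi_dom[OF zd] pt_dom] by (simp add: mu_def)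
    qed
    ultimately show ?thesis
      using dpair_cmult[of a pt 0 "\<lambda>_. 0" "\<phi> ?z"] by (simp add: dpair_cmult)
  qed
  from phi_holomorphic[OF r]
  obtain R where R1: "R > 1" and Rh: "\<forall>k<n. (\<lambda>\<zeta>. \<phi> (\<lambda>i. \<zeta> * r i) k) holomorphic_on ball 0 R" by (elim exE conjE)
  note R = R1 Rh[rule_format]
  have contk: "continuous_on {0..1} (\<lambda>t. \<phi> (\<lambda>i. complex_of_real t * r i) k)" if "k < n" for k
  proof -
    have "continuous_on (complex_of_real ` {0..1}) (\<lambda>\<zeta>. \<phi> (\<lambda>i. \<zeta> * r i) k)"
      by (rule continuous_on_subset[OF holomorphic_on_imp_continuous_on[OF R(2)[OF that]]]) (use R(1) in auto)
    then show ?thesis by (rule continuous_on_compose2) (auto intro: continuous_intros)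
  qed
  have contw: "continuous_on {0..1} (\<lambda>t. wp (\<phi> (\<lambda>i. complex_of_real t * r i)) \<alpha>)" if "set \<alpha> \<subseteq> {..<n}" for \<alpha>
    using that by (induction \<alpha>) (auto intro!: continuous_intros contk)
  have contH: "continuous_on {0..1} H"
    unfolding H_def pairing_def using symbolD(2)[OF a] by (intro continuous_intros contw) auto
  have "H 1 = H 0"
  proof (rule has_derivative_zero_unique_strong_interval[where k = "{0}", OF _ contH refl])
    fix t :: real assume "t \<in> {0..1} - {0}"
    from dH[OF this] show "(H has_derivative (\<lambda>h. 0)) (at t within {0..1})"
      by (simp add: has_vector_derivative_def has_derivative_at_withinI)
  qed simp_all
  moreover have "H 1 = 0"
  proof -
    have "pairing a (\<phi> r) pt = pairing a (\<lambda>_. 0) pt"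
      unfolding r_def by (rule pairing_cong[OF a]) (use phi_psi rho_0[OF a] in auto)
    then show ?thesis by (simp add: H_def pairing_0[OF a])
  qed
  moreover have "H 0 = of_real (rho a pt)" by (simp add: H_def pairing_self)
  ultimately have "rho a pt = 0" by simp
  moreover have "a [k0] * (cmod (wp pt [k0]))\<^sup>2 \<le> rho a pt"
    unfolding rho_def using symbolD(5)[OF a p(1)] by (intro member_le_sum) (auto simp: symbolD(4)[OF a] symbolD(1)[OF a])
  ultimately show False using symbolD(5)[OF a p(1)] p(2) by (simp add: mult_le_0_iff)
qed

lemma moved_origin_linear:
  assumes "k0 < n" "pt k0 \<noteq> 0" "length \<alpha> \<ge> 2"
  shows "a \<alpha> = 0"
proof -
  obtain k where "k < n" "xi (\<lambda>_. 0) k \<noteq> 0" using xi_0_nonzero[OF assms(1,2)] by (elim exE conjE)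
  then show ?thesis by (rule infinitesimal.linear_symbol[OF infinitesimal _ _ assms(3)])
qed

text \<open>Transfers the case distinction to the inverse, so that the degree of the second symbol
  is also bounded.\<close>

lemma psi_0_nonzero:
  assumes "k0 < n" "pt k0 \<noteq> 0"
  shows "\<exists>i<m. \<psi> (\<lambda>_. 0) i \<noteq> 0"
proof (rule ccontr)
  assume "\<not> (\<exists>i<m. \<psi> (\<lambda>_. 0) i \<noteq> 0)"
  then have "\<psi> (\<lambda>_. 0) i = 0" if "i < m" for i using that by blast
  then have "\<phi> (\<psi> (\<lambda>_. 0)) = pt" by (rule phi_cong)
  moreover have "\<phi> (\<psi> (\<lambda>_. 0)) k0 = 0" by (rule phi_psi[OF _ assms(1)]) (simp add: rho_0[OF a])
  ultimately show False using assms(2) by simp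
qed

end

subsection \<open>Isomorphisms fixing the origin\<close>

lemma fnorm_finite_support:
  assumes "finite F" "\<And>\<alpha>. \<alpha> \<notin> F \<Longrightarrow> x \<alpha> = 0"
  shows "(fnorm x)\<^sup>2 = (\<Sum>\<alpha>\<in>F. (cmod (x \<alpha>))\<^sup>2)"
proof -
  have "((\<lambda>\<alpha>. (cmod (x \<alpha>))\<^sup>2) has_sum (\<Sum>\<alpha>\<in>F. (cmod (x \<alpha>))\<^sup>2)) UNIV"
    by (rule has_sum_finite_neutralI[of F]) (use assms in auto)
  then show ?thesis unfolding fnorm_sq by (rule infsumI)
qed

lemma ip_finite_support:
  assumes "finite F" "\<And>\<alpha>. \<alpha> \<notin> F \<Longrightarrow> y \<alpha> = 0"
  shows "ip x y = (\<Sum>\<alpha>\<in>F. x \<alpha> * cnj (y \<alpha>))"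
proof -
  have "((\<lambda>\<alpha>. x \<alpha> * cnj (y \<alpha>)) has_sum (\<Sum>\<alpha>\<in>F. x \<alpha> * cnj (y \<alpha>))) UNIV"
    by (rule has_sum_finite_neutralI[of F]) (use assms in auto)
  then show ?thesis unfolding ip_def by (rule infsumI)
qed

section \<open>Words of fixed length and tensor powers\<close>

definition words :: "nat \<Rightarrow> nat \<Rightarrow> nat list set" where
  "words n k = {\<beta>. set \<beta> \<subseteq> {..<n} \<and> length \<beta> = k}"

lemma finite_words_eq: "finite (words n k)"
  unfolding words_def by (rule finite_lists_length_eq) simp

lemma words_append:
  assumes "j \<le> k"
  shows "(\<Sum>\<delta>\<in>words n k. G (take j \<delta>) (drop j \<delta>)) = (\<Sum>\<beta>\<in>words n j. \<Sum>\<gamma>\<in>words n (k - j). G \<beta> \<gamma>)"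
proof -
  have "(\<Sum>\<delta>\<in>words n k. G (take j \<delta>) (drop j \<delta>)) = (\<Sum>(\<beta>, \<gamma>)\<in>words n j \<times> words n (k - j). G \<beta> \<gamma>)"
    by (rule sum.reindex_bij_witness[where i = "\<lambda>(\<beta>, \<gamma>). \<beta> @ \<gamma>" and j = "\<lambda>\<delta>. (take j \<delta>, drop j \<delta>)"])
       (use assms in \<open>auto simp: words_def dest: in_set_takeD in_set_dropD\<close>)
  then show ?thesis by (simp add: sum.cartesian_product)
qed

text \<open>Matrix entries of all tensor powers of \<open>u\<close> at once; words of different
  lengths give 0.\<close>

fun tensor :: "(nat \<Rightarrow> nat \<Rightarrow> complex) \<Rightarrow> nat list \<Rightarrow> nat list \<Rightarrow> complex" where
  "tensor u [] [] = 1"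
| "tensor u (i # \<beta>) (j # \<alpha>) = u i j * tensor u \<beta> \<alpha>"
| "tensor u _ _ = 0"

lemma words_0: "words n 0 = {[]}"
  by (auto simp: words_def)

lemma words_Suc: "(\<Sum>\<alpha>\<in>words n (Suc k). G \<alpha>) = (\<Sum>j<n. \<Sum>\<alpha>\<in>words n k. G (j # \<alpha>))"
proof -
  have "(\<Sum>\<alpha>\<in>words n (Suc k). G \<alpha>) = (\<Sum>(j, \<alpha>)\<in>{..<n} \<times> words n k. G (j # \<alpha>))"
    by (rule sum.reindex_bij_witness[where i = "\<lambda>(j, \<alpha>). j # \<alpha>" and j = "\<lambda>\<delta>. (hd \<delta>, tl \<delta>)"])
       (auto simp: words_def length_Suc_conv)
  then show ?thesis by (simp add: sum.cartesian_product)
qed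

lemma tensor_inverse:
  assumes uv: "\<And>i k. i < m \<Longrightarrow> k < m \<Longrightarrow> (\<Sum>j<n. u i j * v j k) = (if i = k then 1 else 0)"
    and "\<beta> \<in> words m k" "\<beta>' \<in> words m k"
  shows "(\<Sum>\<alpha>\<in>words n k. tensor u \<beta> \<alpha> * tensor v \<alpha> \<beta>') = (if \<beta> = \<beta>' then 1 else 0)"
  using assms(2,3)
proof (induction k arbitrary: \<beta> \<beta>')
  case 0
  then show ?case by (simp add: words_0)
next
  case (Suc k)
  then obtain i \<gamma> i' \<gamma>' where e: "\<beta> = i # \<gamma>" "\<beta>' = i' # \<gamma>'" "i < m" "i' < m" "\<gamma> \<in> words m k" "\<gamma>' \<in> words m k"
    by (auto simp: words_def length_Suc_conv)
  have "(\<Sum>\<alpha>\<in>words n (Suc k). tensor u \<beta> \<alpha> * tensor v \<alpha> \<beta>') = (\<Sum>j<n. u i j * v j i') * (\<Sum>\<alpha>\<in>words n k. tensor u \<gamma> \<alpha> * tensor v \<alpha> \<gamma>')"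
    unfolding words_Suc e sum_product by (intro sum.cong refl) simp
  then show ?case using Suc.IH[OF e(5,6)] uv[OF e(3,4)] e(1,2) by simp
qed

lemma tensor_scale:
  assumes "\<And>i j. i \<in> set \<beta> \<Longrightarrow> j \<in> set \<alpha> \<Longrightarrow> v j i = p j * q i * cnj (u i j)"
  shows "length \<alpha> = length \<beta> \<Longrightarrow> tensor v \<alpha> \<beta> = wp p \<alpha> * wp q \<beta> * cnj (tensor u \<beta> \<alpha>)"
  using assms
proof (induction \<alpha> arbitrary: \<beta>)
  case (Cons j \<alpha>)
  then obtain i \<gamma> where e: "\<beta> = i # \<gamma>" by (cases \<beta>) auto
  have "tensor v \<alpha> \<gamma> = wp p \<alpha> * wp q \<gamma> * cnj (tensor u \<gamma> \<alpha>)" using Cons e by (intro Cons.IH) auto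
  moreover have "v j i = p j * q i * cnj (u i j)" using Cons.prems(2) e by simp
  ultimately show ?case by (simp add: e mult_ac)
qed simp

text \<open>A unit vector gives the diagonal. A unit vector plus a unimodular multiple
  \<open>c\<close> of another gives the real part of the off-diagonal entry times the conjugate of
  \<open>c\<close>; taking c = 1 and c = i annihilates it.\<close>

lemma polarization:
  fixes A :: "'i \<Rightarrow> 'k \<Rightarrow> complex" and p :: "'i \<Rightarrow> real" and q :: "'k \<Rightarrow> real"
  assumes K: "finite K" and eq: "\<And>\<eta>. (\<Sum>i\<in>I. p i * (cmod (\<Sum>k\<in>K. A i k * \<eta> k))\<^sup>2) = (\<Sum>k\<in>K. q k * (cmod (\<eta> k))\<^sup>2)"
    and k: "k \<in> K" and l: "l \<in> K"
  shows "(\<Sum>i\<in>I. of_real (p i) * (A i k * cnj (A i l))) = (if k = l then of_real (q k) else 0)"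
proof -
  have single: "(\<Sum>i\<in>I. p i * (cmod (A i k))\<^sup>2) = q k" if "k \<in> K" for k
  proof -
    have "(\<Sum>k'\<in>K. A i k' * (if k' = k then 1 else 0)) = A i k" for i using K that by (simp add: if_distrib cong: if_cong)
    moreover have "(\<Sum>k'\<in>K. q k' * (cmod (if k' = k then 1 else 0))\<^sup>2) = (\<Sum>k'\<in>K. if k' = k then q k else 0)"
      by (intro sum.cong refl) auto
    moreover have "\<dots> = q k" using K that by simp
    ultimately show ?thesis using eq[of "\<lambda>k'. if k' = k then 1 else 0"] by simp
  qed
  show ?thesis
  proof (cases "k = l")
    case True
    have "(\<Sum>i\<in>I. of_real (p i) * (A i k * cnj (A i k))) = complex_of_real (\<Sum>i\<in>I. p i * (cmod (A i k))\<^sup>2)"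
      unfolding of_real_sum by (intro sum.cong refl) (simp only: complex_norm_square of_real_mult)
    also have "\<dots> = of_real (q k)" unfolding single[OF k] ..
    finally show ?thesis using True by simp
  next
    case False
    let ?S = "\<Sum>i\<in>I. of_real (p i) * (A i k * cnj (A i l))"
    have zero: "Re (cnj c * ?S) = 0" if "cmod c = 1" for c
    proof -
      let ?\<eta> = "\<lambda>k'. if k' = k then 1 else if k' = l then c else 0"
      have s1: "(\<Sum>k'\<in>K. G k') = G k + G l" if "\<And>k'. k' \<noteq> k \<Longrightarrow> k' \<noteq> l \<Longrightarrow> G k' = 0" for G :: "'k \<Rightarrow> 'z::comm_monoid_add"
      proof -
        have "(\<Sum>k'\<in>K. G k') = (\<Sum>k'\<in>{k, l}. G k')" by (rule sum.mono_neutral_right) (use K k l that in auto)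
        then show ?thesis using False by simp
      qed
      have "(\<Sum>k'\<in>K. A i k' * ?\<eta> k') = A i k + A i l * c" for i by (subst s1) (use False in auto)
      moreover have "(\<Sum>k'\<in>K. q k' * (cmod (?\<eta> k'))\<^sup>2) = q k + q l" by (subst s1) (use False that in auto)
      ultimately have e: "(\<Sum>i\<in>I. p i * (cmod (A i k + A i l * c))\<^sup>2) = q k + q l" using eq[of ?\<eta>] by simp
      have "(cmod (x + y * c))\<^sup>2 = (cmod x)\<^sup>2 + (cmod y)\<^sup>2 + 2 * Re (cnj c * (x * cnj y))" for x y
      proof -
        have e1: "(cmod (y * c))\<^sup>2 = (cmod y)\<^sup>2" using that by (simp add: norm_mult)
        have e2: "(cmod (x + z))\<^sup>2 = (cmod x)\<^sup>2 + (cmod z)\<^sup>2 + 2 * Re (x * cnj z)" for z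
          unfolding cmod_power2 by (simp add: power2_eq_square algebra_simps)
        show ?thesis unfolding e2 e1 by (simp add: algebra_simps)
      qed
      note ex = this
      have "(\<Sum>i\<in>I. p i * (cmod (A i k + A i l * c))\<^sup>2) = q k + q l + 2 * (\<Sum>i\<in>I. p i * Re (cnj c * (A i k * cnj (A i l))))"
        unfolding single[OF k, symmetric] single[OF l, symmetric] ex sum_distrib_left sum.distrib[symmetric]
        by (intro sum.cong refl) (simp only: algebra_simps)
      moreover have "(\<Sum>i\<in>I. p i * Re (cnj c * (A i k * cnj (A i l)))) = Re (cnj c * ?S)"
        unfolding sum_distrib_left Re_sum by (intro sum.cong refl) (simp add: algebra_simps)
      ultimately show ?thesis using e by simp
    qed
    have "Re ?S = 0" using zero[of 1] by simp
    moreover have "Im ?S = 0" using zero[of "\<i>"] by simp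
    ultimately have "?S = 0" by (intro complex_eqI) simp_all
    then show ?thesis using False by simp
  qed
qed

section \<open>The linear part of an isomorphism fixing the origin\<close>

definition ucoef :: "nat \<Rightarrow> (nat list \<Rightarrow> real) \<Rightarrow> (nat list \<Rightarrow> real) \<Rightarrow> (op \<Rightarrow> op) \<Rightarrow> nat \<Rightarrow> nat \<Rightarrow> complex" where
  "ucoef n a b \<Phi> i j = hat b (\<Phi> (wword n a [j])) [i]"

locale cc_iso_fixed = cc_iso +
  assumes pt0: "\<And>k. k < n \<Longrightarrow> \<phi> (\<lambda>_. 0) k = 0"
begin

abbreviation "u \<equiv> ucoef n a b \<Phi>"
abbreviation "v \<equiv> ucoef m b a \<Psi>"

lemma swap_fixed: "cc_iso_fixed m b n a \<Psi> \<Phi>"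
proof -
  have "\<psi> (\<lambda>_. 0) i = 0" if i: "i < m" for i
  proof -
    have "\<psi> (\<lambda>_. 0) = \<psi> (\<phi> (\<lambda>_. 0))" by (rule cc_iso.phi_cong[OF swap]) (simp add: pt0)
    then show ?thesis using psi_phi[OF _ i, of "\<lambda>_. 0"] rho_0[OF b] by simp
  qed
  then show ?thesis using swap by (simp add: cc_iso_fixed_def cc_iso_fixed_axioms_def)
qed

text \<open>With the origin fixed, the derivative of a monomial at \<open>\<phi> 0\<close> vanishes
  unless the word has one letter. So the one-letter coefficients transform by the matrix
  \<open>u\<close> alone.\<close>

lemma hat_single:
  assumes S: "S \<in> domalg n a"
  shows "hat b (\<Phi> S) [i] = (\<Sum>j<n. hat a S [j] * u i j)"
proof -
  define L where "L S = hat b (\<Phi> S) [i] - (\<Sum>j<n. hat a S [j] * u i j)" for S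
  have "L S = 0"
  proof (rule domalg_functional_eq_0[OF a S])
    fix P assume P: "P \<in> polyops n a"
    let ?d = "opnorm n (\<lambda>x \<beta>. S x \<beta> - P x \<beta>)"
    have PD: "P \<in> domalg n a" by (rule polyops_domalg[OF a P])
    have "cmod (L S - L P) = cmod ((hat b (\<Phi> S) [i] - hat b (\<Phi> P) [i]) - (\<Sum>j<n. (hat a S [j] - hat a P [j]) * u i j))"
      by (simp add: L_def sum_subtractf algebra_simps)
    also have "\<dots> \<le> cmod (hat b (\<Phi> S) [i] - hat b (\<Phi> P) [i]) + (\<Sum>j<n. cmod (hat a S [j] - hat a P [j]) * cmod (u i j))"
      by (rule order_trans[OF norm_triangle_ineq4], rule add_left_mono, rule order_trans[OF norm_sum]) (simp add: norm_mult)
    also have "\<dots> \<le> sqrt (bcoef b [i]) * ?d + (\<Sum>j<n. (sqrt (bcoef a [j]) * ?d) * cmod (u i j))"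
      by (intro add_mono sum_mono mult_right_mono hat_Phi_bound[OF S PD] hat_bound[OF a domalg_bounded[OF S] domalg_bounded[OF PD]] norm_ge_zero)
    finally show "cmod (L S - L P) \<le> (sqrt (bcoef b [i]) + (\<Sum>j<n. sqrt (bcoef a [j]) * cmod (u i j))) * ?d"
      unfolding distrib_right sum_distrib_right by (simp only: mult_ac)
    obtain F c where F: "finite F" "\<And>\<alpha>. \<alpha> \<in> F \<Longrightarrow> set \<alpha> \<subseteq> {..<n}" "P = (\<lambda>x \<beta>. \<Sum>\<alpha>\<in>F. c \<alpha> * wword n a \<alpha> x \<beta>)"
      using polyopsE[OF P] by blast
    have "hat b (\<Phi> P) [i] = (\<Sum>\<alpha>\<in>F. c \<alpha> * hat b (\<Phi> (wword n a \<alpha>)) [i])"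
      unfolding F(3) by (rule hat_Phi_lincomb[OF F(1) F(2)])
    also have "\<dots> = (\<Sum>\<alpha>\<in>F. c \<alpha> * (if length \<alpha> = 1 then u i (hd \<alpha>) else 0))"
    proof (intro sum.cong refl arg_cong2[where f = "(*)"])
      fix \<alpha> assume \<alpha>: "\<alpha> \<in> F"
      have "hat b (\<Phi> (wword n a \<alpha>)) [i] = dpr (\<lambda>_. 0) (u i) \<alpha>"
        unfolding hat_word_single[OF F(2)[OF \<alpha>]] by (rule dpr_cong) (use F(2)[OF \<alpha>] pt0 in \<open>auto simp: ucoef_def\<close>)
      then show "hat b (\<Phi> (wword n a \<alpha>)) [i] = (if length \<alpha> = 1 then u i (hd \<alpha>) else 0)" unfolding dpr_zero .
    qed
    also have "\<dots> = (\<Sum>\<alpha>\<in>F. c \<alpha> * (\<Sum>j<n. (if \<alpha> = [j] then 1 else 0) * u i j))"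
    proof (intro sum.cong refl arg_cong2[where f = "(*)"])
      fix \<alpha> assume \<alpha>: "\<alpha> \<in> F"
      show "(if length \<alpha> = 1 then u i (hd \<alpha>) else 0) = (\<Sum>j<n. (if \<alpha> = [j] then 1 else 0) * u i j)"
      proof (cases "length \<alpha> = 1")
        case True
        then obtain k where k: "\<alpha> = [k]" by (auto simp: length_Suc_conv)
        have "(\<Sum>j<n. (if \<alpha> = [j] then 1 else 0) * u i j) = (\<Sum>j<n. if j = k then u i k else 0)"
          unfolding k by (intro sum.cong refl) auto
        then show ?thesis using F(2)[OF \<alpha>] k by simp
      next
        case False
        then have "\<alpha> \<noteq> [j]" for j by auto
        then show ?thesis using False by simp
      qed
    qed
    also have "\<dots> = (\<Sum>j<n. (\<Sum>\<alpha>\<in>F. c \<alpha> * (if \<alpha> = [j] then 1 else 0)) * u i j)"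
      unfolding sum_distrib_left sum_distrib_right mult.assoc by (rule sum.swap)
    also have "\<dots> = (\<Sum>j<n. hat a P [j] * u i j)"
    proof (intro sum.cong refl arg_cong2[where f = "(*)"])
      fix j
      have "hat a P [j] = (\<Sum>\<alpha>\<in>F. c \<alpha> * hat a (wword n a \<alpha>) [j])"
        unfolding F(3) hat_def hv_def by (simp add: sum_distrib_left mult_ac)
      also have "\<dots> = (\<Sum>\<alpha>\<in>F. c \<alpha> * (if \<alpha> = [j] then 1 else 0))"
        by (intro sum.cong refl) (auto simp: hat_wword[OF a F(2)])
      finally show "(\<Sum>\<alpha>\<in>F. c \<alpha> * (if \<alpha> = [j] then 1 else 0)) = hat a P [j]" by simp
    qed
    finally show "L P = 0" by (simp add: L_def)
  qed
  then show ?thesis by (simp add: L_def)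
qed

lemma uv:
  assumes "i < m" "k < m"
  shows "(\<Sum>j<n. u i j * v j k) = (if i = k then 1 else 0)"
proof -
  have W: "wword m b [k] \<in> domalg m b" using assms by (intro wword_domalg[OF b]) auto
  have "(\<Sum>j<n. hat a (\<Psi> (wword m b [k])) [j] * u i j) = hat b (wword m b [k]) [i]"
    using hat_single[OF cc_homD(1)[OF \<Psi> W], of i] \<Phi>\<Psi>[OF W] by simp
  also have "\<dots> = (if i = k then 1 else 0)" using hat_wword[OF b, of "[k]" "[i]"] assms by simp
  finally show ?thesis by (simp add: ucoef_def[of m] mult.commute)
qed

text \<open>The row is applied to multiples of the vacuum placed in the one-letter slots. Dividing
  by \<open>sqrt (a [j])\<close> removes the row's own factor, and a finite set of coordinates of
  the result is bounded by its norm.\<close>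

lemma vacuum_row:
  assumes F: "finite F" "\<And>\<beta>. \<beta> \<in> F \<Longrightarrow> set \<beta> \<subseteq> {..<m}"
  shows "(\<Sum>\<beta>\<in>F. (cmod (\<Sum>j<n. s j * hat b (\<Phi> (wword n a [j])) \<beta>))\<^sup>2 / bcoef b \<beta>) \<le> (\<Sum>j<n. (cmod (s j))\<^sup>2 / a [j])"
proof -
  define x where "x \<alpha> = (\<lambda>\<beta>. (if length \<alpha> = 1 then s (hd \<alpha>) / of_real (sqrt (a \<alpha>)) else 0) * vac \<beta>)" for \<alpha>
  have x: "x \<alpha> \<in> Fock m" for \<alpha> unfolding x_def by (rule Fock_scale[OF vac_Fock])
  have D: "bounded_op m (\<Phi> (wword n a \<alpha>))" if "set \<alpha> \<subseteq> {..<n}" for \<alpha>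
    by (rule domalg_bounded[OF cc_homD(1)[OF \<Phi> wword_domalg[OF a that]]])
  define V where "V = (\<lambda>\<beta>. \<Sum>\<alpha>\<in>supp a. of_real (sqrt (a \<alpha>)) * \<Phi> (wword n a \<alpha>) (x \<alpha>) \<beta>)"
  have VF: "V \<in> Fock m"
    unfolding V_def
  proof (rule Fock_sum, rule Fock_scale)
    fix \<alpha> assume "\<alpha> \<in> supp a"
    then have "set \<alpha> \<subseteq> {..<n}" using symbolD(2)[OF a] by simp
    then show "\<Phi> (wword n a \<alpha>) (x \<alpha>) \<in> Fock m" by (rule bounded_opD(1)[OF D x])
  qed
  have V: "V \<beta> = (\<Sum>j<n. s j * \<Phi> (wword n a [j]) vac \<beta>)" for \<beta>
  proof -
    have "V \<beta> = (\<Sum>\<alpha>\<in>supp a. if length \<alpha> = 1 then s (hd \<alpha>) * \<Phi> (wword n a \<alpha>) vac \<beta> else 0)"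
      unfolding V_def
    proof (intro sum.cong refl)
      fix \<alpha> assume \<alpha>: "\<alpha> \<in> supp a"
      then have "set \<alpha> \<subseteq> {..<n}" using symbolD(2)[OF a] by simp
      then have "\<Phi> (wword n a \<alpha>) (x \<alpha>) \<beta> = (if length \<alpha> = 1 then s (hd \<alpha>) / of_real (sqrt (a \<alpha>)) else 0) * \<Phi> (wword n a \<alpha>) vac \<beta>"
        unfolding x_def by (subst bounded_opD(3)[OF D vac_Fock]) auto
      moreover have "sqrt (a \<alpha>) \<noteq> 0" using \<alpha> by simp
      ultimately show "of_real (sqrt (a \<alpha>)) * \<Phi> (wword n a \<alpha>) (x \<alpha>) \<beta> = (if length \<alpha> = 1 then s (hd \<alpha>) * \<Phi> (wword n a \<alpha>) vac \<beta> else 0)"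
        by simp
    qed
    also have "\<dots> = (\<Sum>j<n. s j * \<Phi> (wword n a [j]) vac \<beta>)" by (subst sum_supp_single[OF a]) auto
    finally show ?thesis .
  qed
  have "(\<Sum>\<beta>\<in>F. (cmod (\<Sum>j<n. s j * hat b (\<Phi> (wword n a [j])) \<beta>))\<^sup>2 / bcoef b \<beta>) = (\<Sum>\<beta>\<in>F. (cmod (V \<beta>))\<^sup>2)"
  proof (intro sum.cong refl)
    fix \<beta> assume "\<beta> \<in> F"
    then have pos: "bcoef b \<beta> > 0" using F(2) bcoef_pos[OF b] by blast
    have "(\<Sum>j<n. s j * hat b (\<Phi> (wword n a [j])) \<beta>) = of_real (sqrt (bcoef b \<beta>)) * V \<beta>"
      unfolding V hat_def hv_def sum_distrib_left by (intro sum.cong refl) simp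
    then show "(cmod (\<Sum>j<n. s j * hat b (\<Phi> (wword n a [j])) \<beta>))\<^sup>2 / bcoef b \<beta> = (cmod (V \<beta>))\<^sup>2"
      using pos by (simp add: norm_mult power_mult_distrib)
  qed
  also have "\<dots> \<le> (fnorm V)\<^sup>2" by (rule fnorm_sum_le[OF VF F(1)])
  also have "\<dots> \<le> (\<Sum>\<alpha>\<in>supp a. (fnorm (x \<alpha>))\<^sup>2)"
    unfolding V_def by (rule cc_homD(7)[OF \<Phi>, unfolded row_contr_def, THEN spec, THEN mp]) (simp add: x)
  also have "\<dots> = (\<Sum>j<n. (fnorm (x [j]))\<^sup>2)" by (rule sum_supp_single[OF a]) (simp add: x_def)
  also have "\<dots> = (\<Sum>j<n. (cmod (s j))\<^sup>2 / a [j])"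
    unfolding x_def fnorm_scale fnorm_vac
    by (intro sum.cong refl) (simp add: norm_divide power_divide symbolD(4)[OF a])
  finally show ?thesis .
qed

lemma level_one:
  "(\<Sum>i<m. (cmod (\<Sum>j<n. u i j * s j))\<^sup>2 / b [i]) \<le> (\<Sum>j<n. (cmod (s j))\<^sup>2 / a [j])"
proof -
  have "(\<Sum>\<beta>\<in>(\<lambda>i. [i]) ` {..<m}. (cmod (\<Sum>j<n. s j * hat b (\<Phi> (wword n a [j])) \<beta>))\<^sup>2 / bcoef b \<beta>) \<le> (\<Sum>j<n. (cmod (s j))\<^sup>2 / a [j])"
    by (rule vacuum_row) auto
  then show ?thesis by (subst (asm) sum.reindex) (auto simp: inj_on_def ucoef_def mult.commute)
qed

text \<open>A squeeze: \<open>level_one\<close> for the inverse, applied to the image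
  \<open>t\<close> of \<open>s\<close> under \<open>u\<close>, shows that the one-letter coordinates
  already exhaust the bound of \<open>vacuum_row\<close>. Nothing remains for the coordinate at
  \<open>\<beta>\<close>.\<close>

lemma hat_linear:
  assumes j: "j < n" and len: "length \<beta> \<noteq> 1"
  shows "hat b (\<Phi> (wword n a [j])) \<beta> = 0"
proof (cases "set \<beta> \<subseteq> {..<m}")
  case False
  then show ?thesis by (simp add: hat_def hv_def bcoef_eq_0[OF b])
next
  case True
  define s where "s k = (if k = j then 1 else 0 :: complex)" for k
  define t where "t i = (\<Sum>k<n. u i k * s k)" for i
  let ?F = "insert \<beta> ((\<lambda>i. [i]) ` {..<m})"
  have nin: "\<beta> \<notin> (\<lambda>i. [i]) ` {..<m}" using len by auto
  have "(\<Sum>\<gamma>\<in>?F. (cmod (\<Sum>j<n. s j * hat b (\<Phi> (wword n a [j])) \<gamma>))\<^sup>2 / bcoef b \<gamma>) \<le> (\<Sum>j<n. (cmod (s j))\<^sup>2 / a [j])"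
    by (rule vacuum_row) (use True in auto)
  moreover have "(\<Sum>\<gamma>\<in>(\<lambda>i. [i]) ` {..<m}. (cmod (\<Sum>j<n. s j * hat b (\<Phi> (wword n a [j])) \<gamma>))\<^sup>2 / bcoef b \<gamma>) = (\<Sum>i<m. (cmod (t i))\<^sup>2 / b [i])"
    by (subst sum.reindex) (auto simp: inj_on_def ucoef_def t_def mult.commute)
  moreover have "(\<Sum>j<n. (cmod (s j))\<^sup>2 / a [j]) \<le> (\<Sum>i<m. (cmod (t i))\<^sup>2 / b [i])"
  proof -
    have "(\<Sum>i<m. v k i * t i) = s k" if k: "k < n" for k
    proof -
      have "(\<Sum>i<m. v k i * t i) = (\<Sum>l<n. (\<Sum>i<m. v k i * u i l) * s l)"
        unfolding t_def sum_distrib_left sum_distrib_right mult.assoc by (rule sum.swap)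
      also have "\<dots> = (\<Sum>l<n. if l = k then s k else 0)"
        using cc_iso_fixed.uv[OF swap_fixed k] by (intro sum.cong refl) auto
      finally show ?thesis using k by simp
    qed
    then show ?thesis using cc_iso_fixed.level_one[OF swap_fixed, of t] by simp
  qed
  ultimately have "(cmod (\<Sum>j<n. s j * hat b (\<Phi> (wword n a [j])) \<beta>))\<^sup>2 / bcoef b \<beta> \<le> 0" using nin by simp
  then have "(\<Sum>j<n. s j * hat b (\<Phi> (wword n a [j])) \<beta>) = 0"
    using bcoef_pos[OF b True] by (simp add: divide_le_0_iff)
  moreover have "(\<Sum>k<n. s k * hat b (\<Phi> (wword n a [k])) \<beta>) = (\<Sum>k<n. if k = j then hat b (\<Phi> (wword n a [j])) \<beta> else 0)"
    by (intro sum.cong refl) (simp add: s_def)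
  ultimately show ?thesis using j by simp
qed

text \<open>As the image of a generator has one-letter coefficients only, each generator consumes
  exactly one letter in the convolution, and a word acts by a tensor power on the initial
  letters.\<close>

lemma hv_word:
  assumes "set \<alpha> \<subseteq> {..<n}" "x \<in> Fock m"
  shows "hv b (\<Phi> (wword n a \<alpha>) x) \<delta> = (if length \<alpha> \<le> length \<delta> then tensor u (take (length \<alpha>) \<delta>) \<alpha> * hv b x (drop (length \<alpha>) \<delta>) else 0)"
  using assms(1)
proof (induction \<alpha> arbitrary: \<delta>)
  case Nil
  have "\<Phi> (wword n a []) x = x" unfolding wword_Nil cc_homD(5)[OF \<Phi>] using assms(2) by (simp add: idop_def)
  then show ?case by simp
next
  case (Cons j \<alpha>)
  then have j: "j < n" "set \<alpha> \<subseteq> {..<n}" by auto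
  have D: "\<Phi> (wword n a [j]) \<in> domalg m b" "\<Phi> (wword n a \<alpha>) \<in> domalg m b"
    using j by (auto intro!: cc_homD(1)[OF \<Phi>] wword_domalg[OF a])
  have y: "\<Phi> (wword n a \<alpha>) x \<in> Fock m" by (rule bounded_opD(1)[OF domalg_bounded[OF D(2)] assms(2)])
  have "hv b (\<Phi> (wword n a (j # \<alpha>)) x) \<delta> = (\<Sum>i\<le>length \<delta>. hat b (\<Phi> (wword n a [j])) (take i \<delta>) * hv b (\<Phi> (wword n a \<alpha>) x) (drop i \<delta>))"
    unfolding cc_hom_wword_Cons[OF a \<Phi> j] comp_def by (rule hv_conv[OF b D(1) y])
  also have "\<dots> = (\<Sum>i\<le>length \<delta>. if i = 1 then u (hd \<delta>) j * hv b (\<Phi> (wword n a \<alpha>) x) (tl \<delta>) else 0)"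
  proof (intro sum.cong refl)
    fix i assume i: "i \<in> {..length \<delta>}"
    show "hat b (\<Phi> (wword n a [j])) (take i \<delta>) * hv b (\<Phi> (wword n a \<alpha>) x) (drop i \<delta>) = (if i = 1 then u (hd \<delta>) j * hv b (\<Phi> (wword n a \<alpha>) x) (tl \<delta>) else 0)"
    proof (cases "i = 1")
      case True
      then obtain k \<gamma> where "\<delta> = k # \<gamma>" using i by (cases \<delta>) auto
      then show ?thesis using True by (simp add: ucoef_def)
    next
      case False
      then have "length (take i \<delta>) \<noteq> 1" using i by simp
      then show ?thesis using hat_linear[OF j(1)] False by simp
    qed
  qed
  also have "\<dots> = (if length \<delta> \<ge> 1 then u (hd \<delta>) j * hv b (\<Phi> (wword n a \<alpha>) x) (tl \<delta>) else 0)" by simp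
  also have "\<dots> = (if length (j # \<alpha>) \<le> length \<delta> then tensor u (take (length (j # \<alpha>)) \<delta>) (j # \<alpha>) * hv b x (drop (length (j # \<alpha>)) \<delta>) else 0)"
    by (cases \<delta>) (auto simp: Cons.IH[OF j(2)])
  finally show ?case .
qed

end

section \<open>Comparison of the coefficient forms degree by degree\<close>

lemma words_letters: "\<beta> \<in> words n k \<Longrightarrow> set \<beta> \<subseteq> {..<n}" "\<beta> \<in> words n k \<Longrightarrow> length \<beta> = k"
  by (auto simp: words_def)

lemma words_disjoint: "\<alpha> \<in> words n k \<Longrightarrow> \<alpha> \<in> words n l \<Longrightarrow> k = l"
  by (auto simp: words_def)

lemma sum_supp_by_length:
  fixes G :: "nat list \<Rightarrow> 'b::comm_monoid_add"
  assumes a: "symbol n a" and G: "\<And>\<alpha>. a \<alpha> = 0 \<Longrightarrow> G \<alpha> = 0"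
  shows "(\<Sum>\<alpha>\<in>supp a. if length \<alpha> \<le> k then G \<alpha> else 0) = (\<Sum>j=1..k. \<Sum>\<alpha>\<in>words n j. G \<alpha>)"
proof -
  have "(\<Sum>j=1..k. \<Sum>\<alpha>\<in>words n j. G \<alpha>) = sum G (\<Union>j\<in>{1..k}. words n j)"
    by (rule sum.UNION_disjoint[symmetric]) (auto simp: finite_words_eq dest: words_disjoint)
  also have "\<dots> = sum G ((\<Union>j\<in>{1..k}. words n j) \<inter> supp a)"
    by (rule sum.mono_neutral_right) (auto simp: finite_words_eq G)
  also have "(\<Union>j\<in>{1..k}. words n j) \<inter> supp a = {\<alpha>\<in>supp a. length \<alpha> \<le> k}"
    using symbolD(2)[OF a] symbol_Nil[OF a] by (auto simp: words_def Suc_le_eq)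
  also have "sum G {\<alpha>\<in>supp a. length \<alpha> \<le> k} = (\<Sum>\<alpha>\<in>supp a. if length \<alpha> \<le> k then G \<alpha> else 0)"
    by (rule sum.inter_filter[OF symbolD(1)[OF a]])
  finally show ?thesis by simp
qed

context cc_iso_fixed begin

text \<open>Up to weights, the component at \<open>\<gamma>\<close> of the adjoint of the image of
  the word \<open>\<alpha>\<close> applied to \<open>\<eta>\<close>.\<close>

definition slice :: "(nat list \<Rightarrow> complex) \<Rightarrow> nat list \<Rightarrow> nat list \<Rightarrow> complex" where
  "slice \<eta> \<alpha> \<gamma> = (\<Sum>\<beta>\<in>words m (length \<alpha>). cnj (tensor u \<beta> \<alpha>) * \<eta> (\<beta> @ \<gamma>))"

text \<open>\<open>row_contr_dual\<close> for a vector \<open>y\<close> of degree \<open>k\<close>.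
  The adjoint of a word lowers the degree by its length, so only words of length at most
  \<open>k\<close> contribute.\<close>

lemma level_row:
  "(\<Sum>\<alpha>\<in>supp a. if length \<alpha> \<le> k then a \<alpha> * (\<Sum>\<gamma>\<in>words m (k - length \<alpha>). bcoef b \<gamma> * (cmod (slice \<eta> \<alpha> \<gamma>))\<^sup>2) else 0)
    \<le> (\<Sum>\<delta>\<in>words m k. bcoef b \<delta> * (cmod (\<eta> \<delta>))\<^sup>2)"
proof -
  define y where "y \<delta> = (if \<delta> \<in> words m k then of_real (sqrt (bcoef b \<delta>)) * \<eta> \<delta> else 0)" for \<delta>
  define x where "x \<alpha> \<gamma> = (if length \<alpha> \<le> k \<and> \<gamma> \<in> words m (k - length \<alpha>) then of_real (sqrt (a \<alpha>) * sqrt (bcoef b \<gamma>)) * slice \<eta> \<alpha> \<gamma> else 0)" for \<alpha> \<gamma>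
  have yF: "y \<in> Fock m"
    by (rule Fock_finite_support[of "words m k"]) (auto simp: y_def finite_words_eq words_letters split: if_splits)
  have xF: "x \<alpha> \<in> Fock m" for \<alpha>
    by (rule Fock_finite_support[of "words m (k - length \<alpha>)"]) (auto simp: x_def finite_words_eq words_letters split: if_splits)
  have xn: "(fnorm (x \<alpha>))\<^sup>2 = (if length \<alpha> \<le> k then a \<alpha> * (\<Sum>\<gamma>\<in>words m (k - length \<alpha>). bcoef b \<gamma> * (cmod (slice \<eta> \<alpha> \<gamma>))\<^sup>2) else 0)" for \<alpha>
  proof -
    have "(fnorm (x \<alpha>))\<^sup>2 = (\<Sum>\<gamma>\<in>words m (k - length \<alpha>). (cmod (x \<alpha> \<gamma>))\<^sup>2)"
      by (rule fnorm_finite_support) (auto simp: x_def finite_words_eq)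
    also have "\<dots> = (if length \<alpha> \<le> k then a \<alpha> * (\<Sum>\<gamma>\<in>words m (k - length \<alpha>). bcoef b \<gamma> * (cmod (slice \<eta> \<alpha> \<gamma>))\<^sup>2) else 0)"
      by (auto simp: x_def norm_mult power_mult_distrib symbolD(4)[OF a] bcoef_nonneg[OF b] sum_distrib_left mult.assoc intro!: sum.cong)
    finally show ?thesis .
  qed
  have yn: "(fnorm y)\<^sup>2 = (\<Sum>\<delta>\<in>words m k. bcoef b \<delta> * (cmod (\<eta> \<delta>))\<^sup>2)"
  proof -
    have "(fnorm y)\<^sup>2 = (\<Sum>\<delta>\<in>words m k. (cmod (y \<delta>))\<^sup>2)"
      by (rule fnorm_finite_support) (auto simp: y_def finite_words_eq)
    also have "\<dots> = (\<Sum>\<delta>\<in>words m k. bcoef b \<delta> * (cmod (\<eta> \<delta>))\<^sup>2)"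
      by (intro sum.cong refl) (simp add: y_def norm_mult power_mult_distrib bcoef_nonneg[OF b])
    finally show ?thesis .
  qed
  let ?V = "\<lambda>\<beta>. \<Sum>\<alpha>\<in>supp a. of_real (sqrt (a \<alpha>)) * \<Phi> (wword n a \<alpha>) (x \<alpha>) \<beta>"
  have letters: "set \<alpha> \<subseteq> {..<n}" if "\<alpha> \<in> supp a" for \<alpha> using symbolD(2)[OF a] that by simp
  have DF: "\<Phi> (wword n a \<alpha>) (x \<alpha>) \<in> Fock m" if "\<alpha> \<in> supp a" for \<alpha>
    by (rule bounded_opD(1)[OF domalg_bounded[OF cc_homD(1)[OF \<Phi> wword_domalg[OF a letters[OF that]]]] xF])
  have VF: "?V \<in> Fock m" by (rule Fock_sum, rule Fock_scale, rule DF)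
  have ipa: "of_real (sqrt (a \<alpha>)) * ip (\<Phi> (wword n a \<alpha>) (x \<alpha>)) y = of_real ((fnorm (x \<alpha>))\<^sup>2)" if \<alpha>: "\<alpha> \<in> supp a" for \<alpha>
  proof (cases "length \<alpha> \<le> k")
    case len: True
    let ?l = "length \<alpha>"
    have "ip (\<Phi> (wword n a \<alpha>) (x \<alpha>)) y = (\<Sum>\<delta>\<in>words m k. \<Phi> (wword n a \<alpha>) (x \<alpha>) \<delta> * cnj (y \<delta>))"
      by (rule ip_finite_support) (auto simp: y_def finite_words_eq)
    also have "\<dots> = (\<Sum>\<delta>\<in>words m k. hv b (\<Phi> (wword n a \<alpha>) (x \<alpha>)) \<delta> * cnj (\<eta> \<delta>))"
      by (intro sum.cong refl) (simp add: y_def hv_def mult_ac)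
    also have "\<dots> = (\<Sum>\<delta>\<in>words m k. tensor u (take ?l \<delta>) \<alpha> * hv b (x \<alpha>) (drop ?l \<delta>) * cnj (\<eta> (take ?l \<delta> @ drop ?l \<delta>)))"
      by (intro sum.cong refl) (use len in \<open>simp add: hv_word[OF letters[OF \<alpha>] xF] words_letters\<close>)
    also have "\<dots> = (\<Sum>\<beta>\<in>words m ?l. \<Sum>\<gamma>\<in>words m (k - ?l). tensor u \<beta> \<alpha> * hv b (x \<alpha>) \<gamma> * cnj (\<eta> (\<beta> @ \<gamma>)))"
      by (rule words_append[OF len])
    also have "\<dots> = (\<Sum>\<gamma>\<in>words m (k - ?l). \<Sum>\<beta>\<in>words m ?l. tensor u \<beta> \<alpha> * hv b (x \<alpha>) \<gamma> * cnj (\<eta> (\<beta> @ \<gamma>)))"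
      by (rule sum.swap)
    also have "\<dots> = (\<Sum>\<gamma>\<in>words m (k - ?l). hv b (x \<alpha>) \<gamma> * cnj (slice \<eta> \<alpha> \<gamma>))"
      unfolding slice_def cnj_sum sum_distrib_left by (intro sum.cong refl) (simp add: mult_ac)
    finally have "of_real (sqrt (a \<alpha>)) * ip (\<Phi> (wword n a \<alpha>) (x \<alpha>)) y = (\<Sum>\<gamma>\<in>words m (k - ?l). of_real (sqrt (a \<alpha>)) * (hv b (x \<alpha>) \<gamma> * cnj (slice \<eta> \<alpha> \<gamma>)))"
      by (simp add: sum_distrib_left)
    also have "\<dots> = (\<Sum>\<gamma>\<in>words m (k - ?l). of_real ((cmod (x \<alpha> \<gamma>))\<^sup>2))"
    proof (intro sum.cong refl)
      fix \<gamma> assume \<gamma>: "\<gamma> \<in> words m (k - ?l)"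
      have "x \<alpha> \<gamma> = of_real (sqrt (a \<alpha>) * sqrt (bcoef b \<gamma>)) * slice \<eta> \<alpha> \<gamma>" using \<gamma> len by (simp add: x_def)
      then have "of_real (sqrt (a \<alpha>)) * (hv b (x \<alpha>) \<gamma> * cnj (slice \<eta> \<alpha> \<gamma>)) = x \<alpha> \<gamma> * cnj (x \<alpha> \<gamma>)" by (simp add: hv_def)
      then show "of_real (sqrt (a \<alpha>)) * (hv b (x \<alpha>) \<gamma> * cnj (slice \<eta> \<alpha> \<gamma>)) = of_real ((cmod (x \<alpha> \<gamma>))\<^sup>2)"
        by (simp only: complex_norm_square)
    qed
    also have "\<dots> = of_real ((fnorm (x \<alpha>))\<^sup>2)"
      unfolding of_real_sum[symmetric] by (subst fnorm_finite_support[of "words m (k - ?l)"]) (auto simp: x_def finite_words_eq)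
    finally show ?thesis .
  next
    case False
    then have x0: "x \<alpha> = (\<lambda>_. 0)" by (simp add: x_def fun_eq_iff)
    then show ?thesis
      using bounded_op_zero_vec[OF domalg_bounded[OF cc_homD(1)[OF \<Phi> wword_domalg[OF a letters[OF \<alpha>]]]]] by (simp add: ip_def)
  qed
  have "ip ?V y = (\<Sum>\<alpha>\<in>supp a. of_real (sqrt (a \<alpha>)) * ip (\<Phi> (wword n a \<alpha>) (x \<alpha>)) y)"
    by (subst ip_sum_left[where n = m, OF _ yF]) (auto simp: ip_scale_left intro!: Fock_scale DF)
  also have "\<dots> = of_real (\<Sum>\<alpha>\<in>supp a. (fnorm (x \<alpha>))\<^sup>2)" unfolding of_real_sum by (intro sum.cong refl ipa)
  finally have "(\<Sum>\<alpha>\<in>supp a. (fnorm (x \<alpha>))\<^sup>2) \<le> (fnorm y)\<^sup>2"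
    by (rule row_contr_dual[OF cc_homD(7)[OF \<Phi>] xF yF VF])
  then show ?thesis unfolding xn yn .
qed

text \<open>The diagonal form of the coefficients of \<open>a\<close> in degree \<open>k\<close>,
  pulled back by the adjoint of the tensor power of \<open>u\<close>. The goal is that it is the
  diagonal form of \<open>b\<close>.\<close>

definition form :: "nat \<Rightarrow> (nat list \<Rightarrow> complex) \<Rightarrow> real" where
  "form k \<eta> = (\<Sum>\<alpha>\<in>words n k. a \<alpha> * (cmod (\<Sum>\<beta>\<in>words m k. cnj (tensor u \<beta> \<alpha>) * \<eta> \<beta>))\<^sup>2)"

text \<open>In \<open>level_row\<close> the left side is sorted by the length j of the word of
  \<open>a\<close>, the right side by the length of the first factor in the recursion for the
  weights of \<open>b\<close>. For each remainder \<open>\<gamma>\<close> the parts with j < k agree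
  by induction and cancel. For j = k the remainder is empty and its weight is 1.\<close>

lemma form_le:
  assumes k: "k \<ge> 1" and IH: "\<And>j \<eta>. 1 \<le> j \<Longrightarrow> j < k \<Longrightarrow> form j \<eta> = (\<Sum>\<beta>\<in>words m j. b \<beta> * (cmod (\<eta> \<beta>))\<^sup>2)"
  shows "form k \<eta> \<le> (\<Sum>\<beta>\<in>words m k. b \<beta> * (cmod (\<eta> \<beta>))\<^sup>2)"
proof -
  define L where "L j = (\<Sum>\<gamma>\<in>words m (k - j). bcoef b \<gamma> * form j (\<lambda>\<beta>. \<eta> (\<beta> @ \<gamma>)))" for j
  define R where "R j = (\<Sum>\<gamma>\<in>words m (k - j). bcoef b \<gamma> * (\<Sum>\<beta>\<in>words m j. b \<beta> * (cmod (\<eta> (\<beta> @ \<gamma>)))\<^sup>2))" for j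
  have "(\<Sum>j=1..k. L j) = (\<Sum>j=1..k. \<Sum>\<alpha>\<in>words n j. a \<alpha> * (\<Sum>\<gamma>\<in>words m (k - length \<alpha>). bcoef b \<gamma> * (cmod (slice \<eta> \<alpha> \<gamma>))\<^sup>2))"
  proof (intro sum.cong refl)
    fix j
    have "L j = (\<Sum>\<gamma>\<in>words m (k - j). \<Sum>\<alpha>\<in>words n j. a \<alpha> * (bcoef b \<gamma> * (cmod (slice \<eta> \<alpha> \<gamma>))\<^sup>2))"
      unfolding L_def form_def sum_distrib_left by (intro sum.cong refl) (simp add: slice_def words_letters)
    also have "\<dots> = (\<Sum>\<alpha>\<in>words n j. \<Sum>\<gamma>\<in>words m (k - j). a \<alpha> * (bcoef b \<gamma> * (cmod (slice \<eta> \<alpha> \<gamma>))\<^sup>2))" by (rule sum.swap)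
    also have "\<dots> = (\<Sum>\<alpha>\<in>words n j. a \<alpha> * (\<Sum>\<gamma>\<in>words m (k - length \<alpha>). bcoef b \<gamma> * (cmod (slice \<eta> \<alpha> \<gamma>))\<^sup>2))"
      unfolding sum_distrib_left by (intro sum.cong) (simp_all add: words_letters)
    finally show "L j = \<dots>" .
  qed
  also have "\<dots> = (\<Sum>\<alpha>\<in>supp a. if length \<alpha> \<le> k then a \<alpha> * (\<Sum>\<gamma>\<in>words m (k - length \<alpha>). bcoef b \<gamma> * (cmod (slice \<eta> \<alpha> \<gamma>))\<^sup>2) else 0)"
    by (rule sum_supp_by_length[OF a, symmetric]) simp
  also have "\<dots> \<le> (\<Sum>\<delta>\<in>words m k. bcoef b \<delta> * (cmod (\<eta> \<delta>))\<^sup>2)" by (rule level_row)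
  also have "\<dots> = (\<Sum>\<delta>\<in>words m k. \<Sum>j=1..k. b (take j \<delta>) * bcoef b (drop j \<delta>) * (cmod (\<eta> (take j \<delta> @ drop j \<delta>)))\<^sup>2)"
  proof (intro sum.cong refl)
    fix \<delta> assume \<delta>: "\<delta> \<in> words m k"
    then have "\<delta> \<noteq> []" "length \<delta> = k" using k by (auto simp: words_def)
    then show "bcoef b \<delta> * (cmod (\<eta> \<delta>))\<^sup>2 = (\<Sum>j=1..k. b (take j \<delta>) * bcoef b (drop j \<delta>) * (cmod (\<eta> (take j \<delta> @ drop j \<delta>)))\<^sup>2)"
      by (simp add: bcoef_rec sum_distrib_right)
  qed
  also have "\<dots> = (\<Sum>j=1..k. \<Sum>\<delta>\<in>words m k. b (take j \<delta>) * bcoef b (drop j \<delta>) * (cmod (\<eta> (take j \<delta> @ drop j \<delta>)))\<^sup>2)"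
    by (rule sum.swap)
  also have "\<dots> = (\<Sum>j=1..k. R j)"
  proof (intro sum.cong refl)
    fix j assume "j \<in> {1..k}"
    then have "(\<Sum>\<delta>\<in>words m k. b (take j \<delta>) * bcoef b (drop j \<delta>) * (cmod (\<eta> (take j \<delta> @ drop j \<delta>)))\<^sup>2)
      = (\<Sum>\<beta>\<in>words m j. \<Sum>\<gamma>\<in>words m (k - j). b \<beta> * bcoef b \<gamma> * (cmod (\<eta> (\<beta> @ \<gamma>)))\<^sup>2)"
      by (intro words_append) simp
    also have "\<dots> = (\<Sum>\<gamma>\<in>words m (k - j). \<Sum>\<beta>\<in>words m j. b \<beta> * bcoef b \<gamma> * (cmod (\<eta> (\<beta> @ \<gamma>)))\<^sup>2)" by (rule sum.swap)
    also have "\<dots> = R j" unfolding R_def sum_distrib_left by (intro sum.cong refl) simp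
    finally show "(\<Sum>\<delta>\<in>words m k. b (take j \<delta>) * bcoef b (drop j \<delta>) * (cmod (\<eta> (take j \<delta> @ drop j \<delta>)))\<^sup>2) = R j" .
  qed
  finally have le: "(\<Sum>j=1..k. L j) \<le> (\<Sum>j=1..k. R j)" .
  \<comment> \<open>Separates the top length, the only one not covered by the induction
    hypothesis.\<close>
  have split: "(\<Sum>j=1..k. G j) = (\<Sum>j\<in>{1..<k}. G j) + G k" for G :: "nat \<Rightarrow> real"
  proof -
    have "{1..k} = insert k {1..<k}" using k by auto
    then show ?thesis by simp
  qed
  have "(\<Sum>j\<in>{1..<k}. L j) = (\<Sum>j\<in>{1..<k}. R j)"
    by (intro sum.cong refl) (simp add: L_def R_def IH)
  then have "L k \<le> R k" using le unfolding split by simp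
  then show ?thesis by (simp add: L_def R_def words_0)
qed

end

context cc_iso_fixed begin

abbreviation "form' \<equiv> cc_iso_fixed.form m b n a \<Psi>"

lemma vu: "j < n \<Longrightarrow> k < n \<Longrightarrow> (\<Sum>i<m. v j i * u i k) = (if j = k then 1 else 0)"
  using cc_iso_fixed.uv[OF swap_fixed] .

lemma tensor_cancel:
  assumes \<alpha>: "\<alpha> \<in> words n k"
  shows "(\<Sum>\<beta>\<in>words m k. cnj (tensor u \<beta> \<alpha>) * (\<Sum>\<alpha>'\<in>words n k. cnj (tensor v \<alpha>' \<beta>) * \<theta> \<alpha>')) = \<theta> \<alpha>"
proof -
  have "(\<Sum>\<beta>\<in>words m k. cnj (tensor u \<beta> \<alpha>) * (\<Sum>\<alpha>'\<in>words n k. cnj (tensor v \<alpha>' \<beta>) * \<theta> \<alpha>'))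
    = (\<Sum>\<alpha>'\<in>words n k. \<Sum>\<beta>\<in>words m k. cnj (tensor u \<beta> \<alpha>) * (cnj (tensor v \<alpha>' \<beta>) * \<theta> \<alpha>'))"
    unfolding sum_distrib_left by (rule sum.swap)
  also have "\<dots> = (\<Sum>\<alpha>'\<in>words n k. cnj (\<Sum>\<beta>\<in>words m k. tensor v \<alpha>' \<beta> * tensor u \<beta> \<alpha>) * \<theta> \<alpha>')"
    unfolding cnj_sum sum_distrib_right by (intro sum.cong refl) simp
  also have "\<dots> = (\<Sum>\<alpha>'\<in>words n k. if \<alpha>' = \<alpha> then \<theta> \<alpha> else 0)"
    by (intro sum.cong refl) (simp add: tensor_inverse[OF vu _ \<alpha>])
  also have "\<dots> = \<theta> \<alpha>" using \<alpha> finite_words_eq by simp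
  finally show ?thesis .
qed

lemma form_tensor:
  "form k (\<lambda>\<beta>. \<Sum>\<alpha>\<in>words n k. cnj (tensor v \<alpha> \<beta>) * \<theta> \<alpha>) = (\<Sum>\<alpha>\<in>words n k. a \<alpha> * (cmod (\<theta> \<alpha>))\<^sup>2)"
  unfolding form_def by (intro sum.cong refl) (simp add: tensor_cancel)

text \<open>The reverse inequality is \<open>form_le\<close> for the inverse, translated by the
  inverse tensor power.\<close>

lemma form_eq:
  assumes "k \<ge> 1"
  shows "form k \<eta> = (\<Sum>\<beta>\<in>words m k. b \<beta> * (cmod (\<eta> \<beta>))\<^sup>2)"
  using assms
proof (induction k arbitrary: \<eta> rule: less_induct)
  case (less k)
  have IH: "form j \<eta> = (\<Sum>\<beta>\<in>words m j. b \<beta> * (cmod (\<eta> \<beta>))\<^sup>2)" if "1 \<le> j" "j < k" for j \<eta>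
    using less.IH[OF that(2,1)] .
  \<comment> \<open>The induction hypothesis for the inverse is that for \<open>\<Phi>\<close> after
    substituting a vector in the image of the tensor power of \<open>v\<close>, so one induction
    serves both directions.\<close>
  have IH': "form' j \<theta> = (\<Sum>\<alpha>\<in>words n j. a \<alpha> * (cmod (\<theta> \<alpha>))\<^sup>2)" if "1 \<le> j" "j < k" for j \<theta>
    unfolding form_tensor[symmetric] IH[OF that] unfolding cc_iso_fixed.form_def[OF swap_fixed] ..
  show ?case
  proof (rule antisym)
    show "form k \<eta> \<le> (\<Sum>\<beta>\<in>words m k. b \<beta> * (cmod (\<eta> \<beta>))\<^sup>2)" by (rule form_le[OF less.prems IH])
    have "(\<Sum>\<beta>\<in>words m k. b \<beta> * (cmod (\<eta> \<beta>))\<^sup>2) = form' k (\<lambda>\<alpha>. \<Sum>\<beta>\<in>words m k. cnj (tensor u \<beta> \<alpha>) * \<eta> \<beta>)"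
      by (rule cc_iso_fixed.form_tensor[OF swap_fixed, symmetric])
    also have "\<dots> \<le> (\<Sum>\<alpha>\<in>words n k. a \<alpha> * (cmod (\<Sum>\<beta>\<in>words m k. cnj (tensor u \<beta> \<alpha>) * \<eta> \<beta>))\<^sup>2)"
      by (rule cc_iso_fixed.form_le[OF swap_fixed less.prems IH'])
    also have "\<dots> = form k \<eta>" unfolding form_def ..
    finally show "(\<Sum>\<beta>\<in>words m k. b \<beta> * (cmod (\<eta> \<beta>))\<^sup>2) \<le> form k \<eta>" .
  qed
qed

text \<open>Polarising \<open>form_eq\<close> gives a matrix identity with two factors of the tensor
  power of \<open>u\<close>; one of them is cancelled against that of \<open>v\<close>.\<close>

lemma intertwine:
  assumes k: "k \<ge> 1" and \<alpha>: "\<alpha> \<in> words n k" and \<beta>: "\<beta> \<in> words m k"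
  shows "of_real (a \<alpha>) * cnj (tensor u \<beta> \<alpha>) = of_real (b \<beta>) * tensor v \<alpha> \<beta>"
proof -
  have pol: "(\<Sum>\<alpha>'\<in>words n k. of_real (a \<alpha>') * (cnj (tensor u \<beta> \<alpha>') * cnj (cnj (tensor u \<beta>' \<alpha>')))) = (if \<beta> = \<beta>' then of_real (b \<beta>) else 0)"
    if "\<beta>' \<in> words m k" for \<beta>'
    by (rule polarization[OF finite_words_eq _ \<beta> that]) (use form_eq[OF k] in \<open>simp add: form_def\<close>)
  have "of_real (b \<beta>) * tensor v \<alpha> \<beta> = (\<Sum>\<beta>'\<in>words m k. if \<beta>' = \<beta> then of_real (b \<beta>) * tensor v \<alpha> \<beta> else 0)"
    using \<beta> finite_words_eq by simp
  also have "\<dots> = (\<Sum>\<beta>'\<in>words m k. tensor v \<alpha> \<beta>' * (\<Sum>\<alpha>'\<in>words n k. of_real (a \<alpha>') * (cnj (tensor u \<beta> \<alpha>') * cnj (cnj (tensor u \<beta>' \<alpha>')))))"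
    by (intro sum.cong refl) (auto simp only: pol split: if_splits, auto)
  also have "\<dots> = (\<Sum>\<alpha>'\<in>words n k. \<Sum>\<beta>'\<in>words m k. tensor v \<alpha> \<beta>' * (of_real (a \<alpha>') * (cnj (tensor u \<beta> \<alpha>') * cnj (cnj (tensor u \<beta>' \<alpha>')))))"
    unfolding sum_distrib_left by (rule sum.swap)
  also have "\<dots> = (\<Sum>\<alpha>'\<in>words n k. of_real (a \<alpha>') * cnj (tensor u \<beta> \<alpha>') * (\<Sum>\<beta>'\<in>words m k. tensor v \<alpha> \<beta>' * tensor u \<beta>' \<alpha>'))"
    unfolding sum_distrib_left by (intro sum.cong refl) simp
  also have "\<dots> = (\<Sum>\<alpha>'\<in>words n k. if \<alpha>' = \<alpha> then of_real (a \<alpha>) * cnj (tensor u \<beta> \<alpha>) else 0)"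
    by (intro sum.cong refl) (simp add: tensor_inverse[OF vu \<alpha>])
  also have "\<dots> = of_real (a \<alpha>) * cnj (tensor u \<beta> \<alpha>)" using \<alpha> finite_words_eq by simp
  finally show ?thesis by simp
qed

text \<open>A permutation occurring in the expansion of the determinant of \<open>u\<close> is the required one.\<close>

lemma scale_perm: "scale_perm_equiv n a b"
proof -
  have uv': "(\<Sum>j<n. u i j * v j k) = (if i = k then 1 else 0)" if "i < n" "k < n" for i k
    using uv that n_eq_m by simp
  obtain \<sigma> where \<sigma>: "bij_betw \<sigma> {..<n} {..<n}" and nz: "\<And>i. i < n \<Longrightarrow> u i (\<sigma> i) \<noteq> 0"
    using nonzero_permutation_entries[OF uv'] by blast
  \<comment> \<open>Forced by the words of length one.\<close>
  define lam where "lam i = a [\<sigma> i] / b [i]" for i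
  have \<sigma>n: "\<sigma> i < n" if "i < n" for i using \<sigma> that by (auto simp: bij_betw_def)
  \<comment> \<open>Degree one expresses \<open>v\<close> through the conjugate of \<open>u\<close>.
    Inserted in degree k, this turns both sides of \<open>intertwine\<close> into multiples of the
    same tensor entry, which is nonzero along \<open>\<sigma>\<close> and can be divided
    out.\<close>
  have v: "v j i = of_real (a [j]) * of_real (1 / b [i]) * cnj (u i j)" if "j < n" "i < m" for i j
  proof -
    have "of_real (a [j]) * cnj (tensor u [i] [j]) = of_real (b [i]) * tensor v [j] [i]"
      by (rule intertwine[of 1]) (use that in \<open>auto simp: words_def\<close>)
    then show ?thesis using symbolD(5)[OF b that(2)] by (simp add: field_simps)
  qed
  have "a (map \<sigma> \<beta>) = b \<beta> * (\<Prod>i\<leftarrow>\<beta>. lam i)" if \<beta>: "set \<beta> \<subseteq> {..<n}" for \<beta>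
  proof (cases "\<beta> = []")
    case True
    then show ?thesis using symbolD(3)[OF a] symbolD(3)[OF b] by simp
  next
    case False
    let ?\<alpha> = "map \<sigma> \<beta>"
    have \<alpha>: "set ?\<alpha> \<subseteq> {..<n}" using \<beta> \<sigma>n by auto
    have t0: "tensor u \<beta> ?\<alpha> \<noteq> 0" using \<beta> nz by (induction \<beta>) auto
    have "of_real (a ?\<alpha>) * cnj (tensor u \<beta> ?\<alpha>) = of_real (b \<beta>) * tensor v ?\<alpha> \<beta>"
      by (rule intertwine[of "length \<beta>"]) (use False \<beta> \<alpha> n_eq_m in \<open>auto simp: words_def Suc_le_eq\<close>)
    also have "tensor v ?\<alpha> \<beta> = wp (\<lambda>j. of_real (a [j])) ?\<alpha> * wp (\<lambda>i. of_real (1 / b [i])) \<beta> * cnj (tensor u \<beta> ?\<alpha>)"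
      by (rule tensor_scale) (use v \<alpha> \<beta> n_eq_m in auto)
    finally have "complex_of_real (a ?\<alpha>) = of_real (b \<beta>) * (wp (\<lambda>j. of_real (a [j])) ?\<alpha> * wp (\<lambda>i. of_real (1 / b [i])) \<beta>)"
      using t0 by simp
    also have "wp (\<lambda>j. complex_of_real (a [j])) ?\<alpha> * wp (\<lambda>i. of_real (1 / b [i])) \<beta> = of_real (\<Prod>i\<leftarrow>\<beta>. lam i)"
      by (induction \<beta>) (simp_all add: lam_def)
    finally have "complex_of_real (a ?\<alpha>) = of_real (b \<beta> * (\<Prod>i\<leftarrow>\<beta>. lam i))" by simp
    then show ?thesis by (simp only: of_real_eq_iff)
  qed
  then show ?thesis unfolding scale_perm_equiv_def using \<sigma> by blast
qed

end

section \<open>Conclusion of the forward implication\<close>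

lemma linear_symbols_equiv:
  assumes a: "symbol n a" and b: "symbol n b"
    and la: "\<And>\<alpha>. length \<alpha> \<ge> 2 \<Longrightarrow> a \<alpha> = 0" and lb: "\<And>\<alpha>. length \<alpha> \<ge> 2 \<Longrightarrow> b \<alpha> = 0"
  shows "scale_perm_equiv n a b"
  unfolding scale_perm_equiv_def
proof (intro exI conjI allI impI)
  show "bij_betw id {..<n} {..<n}" by simp
  fix \<beta> assume \<beta>: "set \<beta> \<subseteq> {..<n}"
  consider "\<beta> = []" | i where "\<beta> = [i]" | "length \<beta> \<ge> 2"
    by (cases \<beta>; cases "tl \<beta>") auto
  then show "a (map id \<beta>) = b \<beta> * (\<Prod>i\<leftarrow>\<beta>. a [i] / b [i])"
  proof cases
    case 1
    then show ?thesis using symbolD(3)[OF a] symbolD(3)[OF b] by simp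
  next
    case 2
    then show ?thesis using symbolD(5)[OF b, of i] \<beta> by simp
  next
    case 3
    then show ?thesis using la lb by simp
  qed
qed

theorem ci_isomorphic_imp_scale_perm:
  assumes "n > 0" "m > 0" and a: "symbol n a" and b: "symbol m b" and ci: "ci_isomorphic n a m b"
  shows "n = m \<and> scale_perm_equiv n a b"
proof -
  obtain \<Phi> \<Psi> where hom: "cc_hom n a m b \<Phi>" "cc_hom m b n a \<Psi>"
    "\<And>S. S \<in> domalg n a \<Longrightarrow> \<Psi> (\<Phi> S) = S" "\<And>T. T \<in> domalg m b \<Longrightarrow> \<Phi> (\<Psi> T) = T"
    using ci_isomorphic_cc_homs[OF assms] by blast
  interpret cc_iso n a m b \<Phi> \<Psi> by unfold_locales (fact assms hom)+
  have nm: "n = m" by (rule n_eq_m)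
  have "scale_perm_equiv n a b"
  proof (cases "\<exists>k<n. phi n a b \<Phi> (\<lambda>_. 0) k \<noteq> 0")
    case True
    then obtain k where k: "k < n" "phi n a b \<Phi> (\<lambda>_. 0) k \<noteq> 0" by (elim exE conjE)
    obtain i where i: "i < m" "phi m b a \<Psi> (\<lambda>_. 0) i \<noteq> 0" using psi_0_nonzero[OF k] by (elim exE conjE)
    have "symbol n b" using b nm by simp
    then show ?thesis
      using moved_origin_linear[OF k] cc_iso.moved_origin_linear[OF swap i] by (intro linear_symbols_equiv[OF a]) auto
  next
    case False
    then have "cc_iso_fixed n a m b \<Phi> \<Psi>" by unfold_locales simp
    then show ?thesis by (rule cc_iso_fixed.scale_perm)
  qed
  then show ?thesis using nm by simp
qed

subsection \<open>Relabelling the generators\<close>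

definition relabel :: "(nat \<Rightarrow> nat) \<Rightarrow> (nat list \<Rightarrow> complex) \<Rightarrow> nat list \<Rightarrow> complex" where
  "relabel \<pi> x \<beta> = x (map \<pi> \<beta>)"

definition conj_op :: "(nat \<Rightarrow> nat) \<Rightarrow> op \<Rightarrow> op" where
  "conj_op \<pi> T x = relabel \<pi> (T (relabel (inv_into UNIV \<pi>) x))"

lemma bij_map: "bij \<pi> \<Longrightarrow> bij (map \<pi>)"
  by (rule o_bij[of "map (inv_into UNIV \<pi>)"]) (auto simp: fun_eq_iff bij_is_inj bij_is_surj surj_iff o_def surj_f_inv_f list.map_comp)

lemma relabel_inverse:
  assumes "bij \<pi>"
  shows "relabel \<pi> (relabel (inv_into UNIV \<pi>) x) = x" "relabel (inv_into UNIV \<pi>) (relabel \<pi> x) = x"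
  using assms by (auto simp: relabel_def fun_eq_iff o_def bij_is_inj bij_is_surj surj_f_inv_f)

lemma relabel_fnorm:
  assumes "bij \<pi>"
  shows "fnorm (relabel \<pi> x) = fnorm x"
  unfolding fnorm_def relabel_def
  by (subst infsum_reindex_bij_betw[OF bij_map[OF assms], of "\<lambda>\<alpha>. (cmod (x \<alpha>))\<^sup>2"]) simp

lemma relabel_letters:
  assumes "bij \<pi>" "\<pi> ` {..<n} = {..<n}"
  shows "set (map \<pi> \<beta>) \<subseteq> {..<n} \<longleftrightarrow> set \<beta> \<subseteq> {..<n}"
  using assms by (metis bij_is_inj image_set inj_image_subset_iff)

lemma relabel_Fock:
  assumes "bij \<pi>" "\<pi> ` {..<n} = {..<n}" "x \<in> Fock n"
  shows "relabel \<pi> x \<in> Fock n"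
proof -
  have "(\<lambda>\<beta>. (cmod (x (map \<pi> \<beta>)))\<^sup>2) summable_on UNIV"
    using summable_on_reindex_bij_betw[OF bij_map[OF assms(1)], of "\<lambda>\<alpha>. (cmod (x \<alpha>))\<^sup>2"] Fock_summable[OF assms(3)] by simp
  moreover have "set \<beta> \<subseteq> {..<n}" if "x (map \<pi> \<beta>) \<noteq> 0" for \<beta>
    using Fock_letters[OF assms(3) that] relabel_letters[OF assms(1,2)] by blast
  ultimately show ?thesis by (simp add: Fock_def relabel_def)
qed

lemma inv_range:
  assumes "bij \<pi>" "\<pi> ` {..<n::nat} = {..<n}"
  shows "inv_into UNIV \<pi> ` {..<n} = {..<n}"
  using assms by (metis bij_is_inj image_inv_f_f)

lemma relabel_Fock_iff:
  assumes "bij \<pi>" "\<pi> ` {..<n} = {..<n}"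
  shows "relabel \<pi> x \<in> Fock n \<longleftrightarrow> x \<in> Fock n"
  using relabel_Fock[OF assms] relabel_Fock[OF bij_imp_bij_inv[OF assms(1)] inv_range[OF assms], of "relabel \<pi> x"]
  by (auto simp: relabel_inverse[OF assms(1)])

text \<open>\<open>\<pi>\<close> permutes all natural numbers and preserves the alphabet, so that
  relabelling is a bijection of the full index set of the sums that define norms.\<close>

locale relabelling =
  fixes n :: nat and \<pi> :: "nat \<Rightarrow> nat"
  assumes bij: "bij \<pi>" and range: "\<pi> ` {..<n} = {..<n}"
begin

abbreviation "\<tau> \<equiv> inv_into UNIV \<pi>"

lemma inverse: "relabelling n \<tau>"
  using bij_imp_bij_inv[OF bij] inv_range[OF bij range] by unfold_locales

lemmas Fock_\<pi> = relabel_Fock[OF bij range]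
lemmas Fock_\<tau> = relabel_Fock[OF bij_imp_bij_inv[OF bij] inv_range[OF bij range]]
lemmas Fock_\<tau>_iff = relabel_Fock_iff[OF bij_imp_bij_inv[OF bij] inv_range[OF bij range]]
lemmas fnorm_\<pi> = relabel_fnorm[OF bij]
lemmas fnorm_\<tau> = relabel_fnorm[OF bij_imp_bij_inv[OF bij]]
lemmas cancel = relabel_inverse[OF bij]

lemma conj_inverse: "conj_op \<tau> (conj_op \<pi> T) = T" "conj_op \<pi> (conj_op \<tau> T) = T"
  by (auto simp: conj_op_def fun_eq_iff inv_inv_eq[OF bij] cancel)

lemma conj_mult: "conj_op \<pi> (S \<circ> T) = conj_op \<pi> S \<circ> conj_op \<pi> T"
  by (auto simp: conj_op_def fun_eq_iff cancel)

lemma conj_bounded: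
  assumes T: "bounded_op n T"
  shows "bounded_op n (conj_op \<pi> T)"
proof -
  obtain K where K: "\<And>x. x \<in> Fock n \<Longrightarrow> fnorm (T x) \<le> K * fnorm x" using bounded_op_bound[OF T] by blast
  show ?thesis
  proof (rule bounded_opI[where K = K])
    fix x assume x: "x \<in> Fock n"
    note x' = Fock_\<tau>[OF x]
    show "conj_op \<pi> T x \<in> Fock n" unfolding conj_op_def by (intro Fock_\<pi> bounded_opD(1)[OF T] x')
    show "fnorm (conj_op \<pi> T x) \<le> K * fnorm x" unfolding conj_op_def fnorm_\<pi> using K[OF x'] by (simp add: fnorm_\<tau>)
    show "conj_op \<pi> T (\<lambda>\<beta>. c * x \<beta>) = (\<lambda>\<beta>. c * conj_op \<pi> T x \<beta>)" for c
      using bounded_opD(3)[OF T x', of c] by (simp add: conj_op_def relabel_def[abs_def])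
    fix y assume y: "y \<in> Fock n"
    show "conj_op \<pi> T (\<lambda>\<beta>. x \<beta> + y \<beta>) = (\<lambda>\<beta>. conj_op \<pi> T x \<beta> + conj_op \<pi> T y \<beta>)"
      using bounded_opD(2)[OF T x' Fock_\<tau>[OF y]] by (simp add: conj_op_def relabel_def[abs_def])
  next
    fix x assume "x \<notin> Fock n"
    then have "relabel \<tau> x \<notin> Fock n" by (simp add: Fock_\<tau>_iff)
    then show "conj_op \<pi> T x = (\<lambda>_. 0)" using bounded_opD(4)[OF T] by (simp add: conj_op_def relabel_def fun_eq_iff)
  qed
qed

lemma conj_opnorm:
  assumes "bounded_op n T"
  shows "opnorm n (conj_op \<pi> T) \<le> opnorm n T"
proof (rule opnorm_le[OF opnorm_nonneg[OF assms]])
  fix x assume x: "x \<in> Fock n"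
  show "fnorm (conj_op \<pi> T x) \<le> opnorm n T * fnorm x"
    unfolding conj_op_def fnorm_\<pi> using opnorm_bound[OF assms Fock_\<tau>[OF x]] by (simp add: fnorm_\<tau>)
qed

text \<open>Relabelling the columns is a bijection of the unit ball over which the supremum is
  taken, and it preserves all values.\<close>

lemma conj_mnorm: "mnorm n k (\<lambda>i j. conj_op \<pi> (M i j)) = mnorm n k M"
proof -
  have val: "fnorm (\<lambda>\<beta>. \<Sum>j<k. conj_op \<pi> (M i j) (x j) \<beta>) = fnorm (\<lambda>\<beta>. \<Sum>j<k. M i j (relabel \<tau> (x j)) \<beta>)" for i x
  proof -
    have "(\<lambda>\<beta>. \<Sum>j<k. conj_op \<pi> (M i j) (x j) \<beta>) = relabel \<pi> (\<lambda>\<beta>. \<Sum>j<k. M i j (relabel \<tau> (x j)) \<beta>)"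
      by (simp add: conj_op_def relabel_def fun_eq_iff)
    then show ?thesis by (simp add: fnorm_\<pi>)
  qed
  have "{sqrt (\<Sum>i<k. (fnorm (\<lambda>\<beta>. \<Sum>j<k. conj_op \<pi> (M i j) (x j) \<beta>))\<^sup>2) | x. (\<forall>j<k. x j \<in> Fock n) \<and> (\<Sum>j<k. (fnorm (x j))\<^sup>2) \<le> 1}
    = {sqrt (\<Sum>i<k. (fnorm (\<lambda>\<beta>. \<Sum>j<k. M i j (x j) \<beta>))\<^sup>2) | x. (\<forall>j<k. x j \<in> Fock n) \<and> (\<Sum>j<k. (fnorm (x j))\<^sup>2) \<le> 1}" (is "?A = ?B")
  proof (intro equalityI subsetI)
    fix r assume "r \<in> ?A"
    then obtain x where x: "r = sqrt (\<Sum>i<k. (fnorm (\<lambda>\<beta>. \<Sum>j<k. M i j (relabel \<tau> (x j)) \<beta>))\<^sup>2)" "\<forall>j<k. x j \<in> Fock n" "(\<Sum>j<k. (fnorm (x j))\<^sup>2) \<le> 1"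
      unfolding val by blast
    show "r \<in> ?B"
      by (intro CollectI exI[of _ "\<lambda>j. relabel \<tau> (x j)"]) (use x Fock_\<tau> in \<open>auto simp: fnorm_\<tau>\<close>)
  next
    fix r assume "r \<in> ?B"
    then obtain x where x: "r = sqrt (\<Sum>i<k. (fnorm (\<lambda>\<beta>. \<Sum>j<k. M i j (x j) \<beta>))\<^sup>2)" "\<forall>j<k. x j \<in> Fock n" "(\<Sum>j<k. (fnorm (x j))\<^sup>2) \<le> 1" by blast
    show "r \<in> ?A"
      unfolding val
      by (intro CollectI exI[of _ "\<lambda>j. relabel \<pi> (x j)"]) (use x Fock_\<pi> in \<open>auto simp: fnorm_\<pi> cancel\<close>)
  qed
  then show ?thesis unfolding mnorm_def by simp
qed

text \<open>The factor \<open>wp lam\<close> is multiplicative under concatenation, so it comes out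
  of every decomposition of the word.\<close>

lemma bcoef_relabel:
  assumes rel: "\<And>\<beta>. set \<beta> \<subseteq> {..<n} \<Longrightarrow> a (map \<pi> \<beta>) = b \<beta> * wp lam \<beta>" and "set \<gamma> \<subseteq> {..<n}"
  shows "bcoef a (map \<pi> \<gamma>) = bcoef b \<gamma> * wp lam \<gamma>"
  using assms(2)
proof (induction \<gamma> rule: length_induct)
  case (1 \<gamma>)
  show ?case
  proof (cases "\<gamma> = []")
    case False
    then have "bcoef a (map \<pi> \<gamma>) = (\<Sum>i=1..length \<gamma>. a (map \<pi> (take i \<gamma>)) * bcoef a (map \<pi> (drop i \<gamma>)))"
      using bcoef_rec[of "map \<pi> \<gamma>" a] by (simp add: take_map drop_map)
    also have "\<dots> = (\<Sum>i=1..length \<gamma>. b (take i \<gamma>) * bcoef b (drop i \<gamma>) * wp lam \<gamma>)"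
    proof (intro sum.cong refl)
      fix i assume i: "i \<in> {1..length \<gamma>}"
      have s: "set (take i \<gamma>) \<subseteq> {..<n}" "set (drop i \<gamma>) \<subseteq> {..<n}" using 1(2) by (auto dest: in_set_takeD in_set_dropD)
      have "bcoef a (map \<pi> (drop i \<gamma>)) = bcoef b (drop i \<gamma>) * wp lam (drop i \<gamma>)" using 1(1) s(2) i False by auto
      then show "a (map \<pi> (take i \<gamma>)) * bcoef a (map \<pi> (drop i \<gamma>)) = b (take i \<gamma>) * bcoef b (drop i \<gamma>) * wp lam \<gamma>"
        unfolding rel[OF s(1)] wp_take_drop[of lam i \<gamma>, symmetric] by simp
    qed
    also have "\<dots> = bcoef b \<gamma> * wp lam \<gamma>" using bcoef_rec[OF False, of b] by (simp add: sum_distrib_right)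
    finally show ?thesis .
  qed simp
qed

text \<open>The quotient of weights changes by \<open>1 / wp lam \<alpha>\<close>, independently of
  the remaining letters. Hence a unitary relabelling carries operator words to scalar multiples of
  operator words, and the isomorphism is spatial.\<close>

lemma conj_wword:
  assumes a: "symbol n a" and b: "symbol n b" and lam: "\<And>i. i < n \<Longrightarrow> lam i > 0"
    and rel: "\<And>\<beta>. set \<beta> \<subseteq> {..<n} \<Longrightarrow> a (map \<pi> \<beta>) = b \<beta> * wp lam \<beta>" and \<alpha>: "set \<alpha> \<subseteq> {..<n}"
  shows "conj_op \<pi> (wword n a (map \<pi> \<alpha>)) = (\<lambda>x \<beta>. of_real (sqrt (1 / wp lam \<alpha>)) * wword n b \<alpha> x \<beta>)"
proof (intro ext)
  fix x \<beta>
  have \<pi>\<alpha>: "set (map \<pi> \<alpha>) \<subseteq> {..<n}" using relabel_letters[OF bij range] \<alpha> by blast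
  have lp: "wp lam \<gamma> > 0" if "set \<gamma> \<subseteq> {..<n}" for \<gamma> using that lam by (induction \<gamma>) auto
  show "conj_op \<pi> (wword n a (map \<pi> \<alpha>)) x \<beta> = of_real (sqrt (1 / wp lam \<alpha>)) * wword n b \<alpha> x \<beta>"
  proof (cases "x \<in> Fock n")
    case False
    then have "relabel \<tau> x \<notin> Fock n" by (simp add: Fock_\<tau>_iff)
    then show ?thesis
      using bounded_opD(4)[OF bounded_op_wword[OF a \<pi>\<alpha>]] bounded_opD(4)[OF bounded_op_wword[OF b \<alpha>] False]
      by (simp add: conj_op_def relabel_def)
  next
    case x: True
    let ?\<gamma> = "drop (length \<alpha>) \<beta>"
    have inj: "map \<pi> \<gamma> = map \<pi> \<delta> \<longleftrightarrow> \<gamma> = \<delta>" for \<gamma> \<delta> by (rule inj_eq[OF bij_is_inj[OF bij_map[OF bij]]])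
    have "conj_op \<pi> (wword n a (map \<pi> \<alpha>)) x \<beta> = (if take (length \<alpha>) \<beta> = \<alpha>
      then of_real (sqrt (bcoef a (map \<pi> ?\<gamma>) / bcoef a (map \<pi> \<beta>))) * relabel \<pi> (relabel \<tau> x) ?\<gamma> else 0)"
      by (simp add: conj_op_def relabel_def[of \<pi>] wword_apply[OF a \<pi>\<alpha> Fock_\<tau>[OF x]] take_map drop_map inj)
    also have "\<dots> = of_real (sqrt (1 / wp lam \<alpha>)) * wword n b \<alpha> x \<beta>"
    proof (cases "take (length \<alpha>) \<beta> = \<alpha> \<and> x ?\<gamma> \<noteq> 0")
      case True
      then have \<gamma>: "set ?\<gamma> \<subseteq> {..<n}" using Fock_letters[OF x] by blast
      then have \<beta>: "set \<beta> \<subseteq> {..<n}" using True \<alpha> by (metis append_take_drop_id set_append le_sup_iff)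
      have "wp lam \<beta> = wp lam \<alpha> * wp lam ?\<gamma>" using True wp_take_drop by metis
      moreover have "bcoef a (map \<pi> ?\<gamma>) = bcoef b ?\<gamma> * wp lam ?\<gamma>" "bcoef a (map \<pi> \<beta>) = bcoef b \<beta> * wp lam \<beta>"
        using bcoef_relabel[of a b lam, OF rel] \<gamma> \<beta> by blast+
      ultimately have "bcoef a (map \<pi> ?\<gamma>) / bcoef a (map \<pi> \<beta>) = (1 / wp lam \<alpha>) * (bcoef b ?\<gamma> / bcoef b \<beta>)"
        using lp[OF \<gamma>] by simp
      then show ?thesis using True by (simp add: wword_apply[OF b \<alpha> x] cancel real_sqrt_mult real_sqrt_divide)
    next
      case False
      then show ?thesis by (auto simp: wword_apply[OF b \<alpha> x] cancel)
    qed
    finally show ?thesis .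
  qed
qed

lemma conj_polyops:
  assumes a: "symbol n a" and b: "symbol n b" and lam: "\<And>i. i < n \<Longrightarrow> lam i > 0"
    and rel: "\<And>\<beta>. set \<beta> \<subseteq> {..<n} \<Longrightarrow> a (map \<pi> \<beta>) = b \<beta> * wp lam \<beta>" and P: "P \<in> polyops n a"
  shows "conj_op \<pi> P \<in> polyops n b"
proof -
  obtain F c where F: "finite F" "\<And>\<alpha>. \<alpha> \<in> F \<Longrightarrow> set \<alpha> \<subseteq> {..<n}" "P = (\<lambda>x \<beta>. \<Sum>\<alpha>\<in>F. c \<alpha> * wword n a \<alpha> x \<beta>)"
    using polyopsE[OF P] by blast
  have "conj_op \<pi> P = (\<lambda>x \<beta>. \<Sum>\<alpha>\<in>F. c \<alpha> * conj_op \<pi> (wword n a \<alpha>) x \<beta>)"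
    unfolding F(3) by (simp add: conj_op_def relabel_def fun_eq_iff)
  moreover have "conj_op \<pi> (wword n a \<alpha>) \<in> polyops n b" if "\<alpha> \<in> F" for \<alpha>
  proof -
    have \<tau>\<alpha>: "set (map \<tau> \<alpha>) \<subseteq> {..<n}"
      using relabel_letters[OF bij_imp_bij_inv[OF bij] inv_range[OF bij range]] F(2)[OF that] by blast
    have "map \<pi> (map \<tau> \<alpha>) = \<alpha>" using bij by (simp add: o_def bij_is_surj surj_f_inv_f)
    then show ?thesis
      using conj_wword[OF a b lam rel \<tau>\<alpha>] polyops_scale[OF wword_polyops[OF \<tau>\<alpha>]] by simp
  qed
  ultimately show ?thesis using polyops_sum[of F "\<lambda>\<alpha> x \<beta>. c \<alpha> * conj_op \<pi> (wword n a \<alpha>) x \<beta>" n b] polyops_scale by simp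
qed

lemma conj_domalg:
  assumes a: "symbol n a" and b: "symbol n b" and lam: "\<And>i. i < n \<Longrightarrow> lam i > 0"
    and rel: "\<And>\<beta>. set \<beta> \<subseteq> {..<n} \<Longrightarrow> a (map \<pi> \<beta>) = b \<beta> * wp lam \<beta>" and T: "T \<in> domalg n a"
  shows "conj_op \<pi> T \<in> domalg n b"
  unfolding domalg_def
proof (intro CollectI conjI allI impI)
  show "bounded_op n (conj_op \<pi> T)" by (rule conj_bounded[OF domalg_bounded[OF T]])
  fix \<epsilon> :: real assume "\<epsilon> > 0"
  then obtain P where P: "P \<in> polyops n a" "opnorm n (\<lambda>x \<beta>. T x \<beta> - P x \<beta>) < \<epsilon>" using T unfolding domalg_def by blast
  have "(\<lambda>x \<beta>. conj_op \<pi> T x \<beta> - conj_op \<pi> P x \<beta>) = conj_op \<pi> (\<lambda>x \<beta>. T x \<beta> - P x \<beta>)"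
    by (simp add: conj_op_def relabel_def fun_eq_iff)
  then have "opnorm n (\<lambda>x \<beta>. conj_op \<pi> T x \<beta> - conj_op \<pi> P x \<beta>) \<le> opnorm n (\<lambda>x \<beta>. T x \<beta> - P x \<beta>)"
    using conj_opnorm[OF bounded_op_diff[OF domalg_bounded[OF T] bounded_op_polyops[OF a P(1)]]] by simp
  then show "\<exists>Q\<in>polyops n b. opnorm n (\<lambda>x \<beta>. conj_op \<pi> T x \<beta> - Q x \<beta>) < \<epsilon>"
    using conj_polyops[OF a b lam rel P(1)] P(2) by (intro bexI[of _ "conj_op \<pi> P"]) auto
qed

end

theorem scale_perm_imp_ci_isomorphic:
  assumes a: "symbol n a" and b: "symbol n b" and sp: "scale_perm_equiv n a b"
  shows "ci_isomorphic n a n b"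
proof -
  obtain \<sigma> lam where \<sigma>: "bij_betw \<sigma> {..<n} {..<n}"
    and rel\<sigma>: "\<And>\<beta>. set \<beta> \<subseteq> {..<n} \<Longrightarrow> a (map \<sigma> \<beta>) = b \<beta> * (\<Prod>i\<leftarrow>\<beta>. lam i)"
    using sp unfolding scale_perm_equiv_def by blast
  \<comment> \<open>\<open>\<sigma>\<close> is only constrained on the alphabet; the identity
    elsewhere makes it a bijection of all letters.\<close>
  define \<pi> where "\<pi> i = (if i < n then \<sigma> i else i)" for i
  have \<pi>1: "bij_betw \<pi> {..<n} {..<n}" using \<sigma> by (rule bij_betw_cong[THEN iffD1, rotated]) (simp add: \<pi>_def)
  moreover have "bij_betw \<pi> {n..} {n..}" by (rule bij_betw_cong[THEN iffD1, OF _ bij_betw_id]) (simp add: \<pi>_def)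
  ultimately have "bij_betw \<pi> ({..<n} \<union> {n..}) ({..<n} \<union> {n..})" by (rule bij_betw_combine) auto
  moreover have "{..<n} \<union> {n..} = UNIV" by auto
  ultimately have bij: "bij \<pi>" by simp
  have rng: "\<pi> ` {..<n} = {..<n}" using \<pi>1 by (simp add: bij_betw_def)
  have rel: "a (map \<pi> \<beta>) = b \<beta> * wp lam \<beta>" if "set \<beta> \<subseteq> {..<n}" for \<beta>
  proof -
    have eq: "map \<pi> \<beta> = map \<sigma> \<beta>" using that by (auto simp: \<pi>_def)
    show ?thesis unfolding eq wp_def by (rule rel\<sigma>[OF that])
  qed
  \<comment> \<open>The equivalence asks only for real scalars; comparing the positive one-letter
    coefficients forces them to be positive, as the square roots in \<open>conj_wword\<close>
    require.\<close>
  have lam: "lam i > 0" if "i < n" for i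
  proof -
    have "\<pi> i < n" using rng that by auto
    then have "a [\<pi> i] > 0" "b [i] > 0" using symbolD(5)[OF a] symbolD(5)[OF b] that by auto
    then show ?thesis using rel[of "[i]"] that by (simp add: zero_less_mult_iff)
  qed
  interpret relabelling n \<pi> using bij rng by unfold_locales
  interpret R: relabelling n "inv_into UNIV \<pi>" by (rule inverse)
  \<comment> \<open>The scalars of the inverse equivalence, reindexed by the inverse permutation, so
    that the relabelling can be run backwards.\<close>
  define lam' where "lam' i = 1 / lam (inv_into UNIV \<pi> i)" for i
  have \<tau>n: "inv_into UNIV \<pi> i < n" if "i < n" for i using inv_range[OF bij rng] that by auto
  have lam': "lam' i > 0" if "i < n" for i using lam \<tau>n that by (simp add: lam'_def)
  have rel': "b (map (inv_into UNIV \<pi>) \<beta>) = a \<beta> * wp lam' \<beta>" if \<beta>: "set \<beta> \<subseteq> {..<n}" for \<beta>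
  proof -
    have "set (map (inv_into UNIV \<pi>) \<beta>) \<subseteq> {..<n}" using \<beta> \<tau>n by auto
    then have "a (map \<pi> (map (inv_into UNIV \<pi>) \<beta>)) = b (map (inv_into UNIV \<pi>) \<beta>) * wp lam (map (inv_into UNIV \<pi>) \<beta>)" by (rule rel)
    moreover have "map \<pi> (map (inv_into UNIV \<pi>) \<beta>) = \<beta>" using bij by (simp add: o_def bij_is_surj surj_f_inv_f)
    moreover have "wp lam (map (inv_into UNIV \<pi>) \<beta>) * wp lam' \<beta> = 1"
      using \<beta> by (induction \<beta>) (use lam \<tau>n in \<open>auto simp: lam'_def less_imp_neq[symmetric]\<close>)
    ultimately show ?thesis by (simp add: mult.assoc)
  qed
  have "ci_map n a n b (conj_op \<pi>)"
    unfolding ci_map_def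
  proof (intro conjI ballI allI impI)
    show "bij_betw (conj_op \<pi>) (domalg n a) (domalg n b)"
      by (rule bij_betwI[where g = "conj_op (inv_into UNIV \<pi>)"])
         (use conj_domalg[OF a b lam rel] R.conj_domalg[OF b a lam' rel'] conj_inverse in auto)
    show "mnorm n k (\<lambda>i j. conj_op \<pi> (M i j)) = mnorm n k M" for k M by (rule conj_mnorm)
    show "conj_op \<pi> (S \<circ> T) = conj_op \<pi> S \<circ> conj_op \<pi> T" for S T by (rule conj_mult)
  qed (simp_all add: conj_op_def relabel_def fun_eq_iff)
  then show ?thesis unfolding ci_isomorphic_iff by blast
qed

theorem theorem2p2:
  fixes n m :: nat and f g :: "nat list \<Rightarrow> real"
  assumes "n > 0" and "m > 0" and "symbol n f" and "symbol m g"
  shows "ci_isomorphic n f m g \<longleftrightarrow> (n = m \<and> scale_perm_equiv n f g)"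
  using ci_isomorphic_imp_scale_perm[OF assms] scale_perm_imp_ci_isomorphic[OF assms(3)] assms(4) by blast

end
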